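(* Let $R$ be a ring which is a finite module over its noetherian centre $Z(R)$, with $R$ grade symmetric, $Z(R)$-Macaulay and with $\mathrm{Kdim}(R)=t<\infty$. Then $\delta:=t-j_R$ is an exact finitely partitive dimension function on the category of finitely generated $R$-modules.
   Context: Rings are associative with $1$; $\mathrm{Kdim}$ is Krull dimension. Let $R$ be a noetherian ring that is a finite module over its centre $Z(R)$. For a right $R$-module $M$, $j_R^r(M)=\min\{i:\mathrm{Ext}^i_R(M,R_R)\neq 0\}$, or $\infty$ if no such $i$ exists; $j_R^\ell$ is defined analogously for left modules; $j_R$ denotes either, according to the side. An $R$-bimodule $M$ is central if $zm=mz$ for all $m\in M$, $z\in Z(R)$. $R$ is grade symmetric if $j_R^\ell(M)=j_R^r(M)$ for all central $R$-bimodules $M$ finitely generated on both sides. A $Z(R)$-sequence on $R$ is a sequence $x_1,\dots,x_t$ in $Z(R)$ with $\sum_i x_iR\neq R$ such that $x_i$ is a non-zero-divisor on $R/\sum_{j<i}x_jR$ for each $i$. $R$ is $Z(R)$-Macaulay if it is a maximal Cohen-Macaulay $Z(R)$-module, i.e. for every maximal ideal $\mathfrak{m}$ of $Z(R)$ the length of a maximal $Z(R)$-sequence on $R$ contained in $\mathfrak{m}$ equals $\mathrm{Kdim}(R_{\mathfrak{m}})=\mathrm{Kdim}(Z(R)_{\mathfrak{m}})$. An exact dimension function $\delta$ assigns to each finitely generated $R$-module a value, with $\delta(0)=-\infty$, such that $\delta(M)=\max\{\delta(M'),\delta(M/M')\}$ for every submodule $M'$ of $M$, and such that if $M$ is annihilated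 by a prime ideal $P$ and is a torsion $R/P$-module, then $\delta(M)\leq\delta(R/P)-1$. It is finitely partitive if for every finitely generated $M$ there is an integer $n$ such that every chain $M=M_0\supsetneq M_1\supsetneq\cdots\supsetneq M_m$ of submodules with $\delta(M_i/M_{i+1})=\delta(M)$ for all $i$ satisfies $m\leq n$. *)

theory Defs
  imports "HOL-Algebra.Module" "HOL-Algebra.Ring_Divisibility" "HOL-Library.Extended_Real"
begin

section \<open>Rings and modules\<close>

definition centre :: "('a, 'b) ring_scheme \<Rightarrow> ('a, 'b) ring_scheme" where
  "centre R = R\<lparr>carrier := {z \<in> carrier R. \<forall>r\<in>carrier R. z \<otimes>\<^bsub>R\<^esub> r = r \<otimes>\<^bsub>R\<^esub> z}\<rparr>"

definition opposite :: "('a, 'b) ring_scheme \<Rightarrow> ('a, 'b) ring_scheme" where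
  "opposite R = R\<lparr>monoid.mult := \<lambda>x y. y \<otimes>\<^bsub>R\<^esub> x\<rparr>"

text \<open>The library locale \<open>module\<close> requires a commutative ring of scalars; the axioms below are the
  same over an arbitrary ring. The fields \<open>mult\<close> and \<open>one\<close> of a module record are irrelevant.
  Right modules are left modules over \<open>opposite R\<close>: \<open>r \<odot> x\<close> then stands for \<open>x r\<close>.\<close>

locale left_module = R?: ring R + M?: abelian_group M
  for R :: "('a, 'b) ring_scheme" (structure) and M :: "('a, 'm, 'c) module_scheme" (structure) +
  assumes smult_closed:
      "\<lbrakk>a \<in> carrier R; x \<in> carrier M\<rbrakk> \<Longrightarrow> a \<odot>\<^bsub>M\<^esub> x \<in> carrier M"
    and smult_l_distr:
      "\<lbrakk>a \<in> carrier R; b \<in> carrier R; x \<in> carrier M\<rbrakk> \<Longrightarrow>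
        (a \<oplus> b) \<odot>\<^bsub>M\<^esub> x = a \<odot>\<^bsub>M\<^esub> x \<oplus>\<^bsub>M\<^esub> b \<odot>\<^bsub>M\<^esub> x"
    and smult_r_distr:
      "\<lbrakk>a \<in> carrier R; x \<in> carrier M; y \<in> carrier M\<rbrakk> \<Longrightarrow>
        a \<odot>\<^bsub>M\<^esub> (x \<oplus>\<^bsub>M\<^esub> y) = a \<odot>\<^bsub>M\<^esub> x \<oplus>\<^bsub>M\<^esub> a \<odot>\<^bsub>M\<^esub> y"
    and smult_assoc:
      "\<lbrakk>a \<in> carrier R; b \<in> carrier R; x \<in> carrier M\<rbrakk> \<Longrightarrow>
        (a \<otimes> b) \<odot>\<^bsub>M\<^esub> x = a \<odot>\<^bsub>M\<^esub> (b \<odot>\<^bsub>M\<^esub> x)"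
    and smult_one: "x \<in> carrier M \<Longrightarrow> \<one> \<odot>\<^bsub>M\<^esub> x = x"

definition finitely_generated :: "('a, 'b) ring_scheme \<Rightarrow> ('a, 'm) module \<Rightarrow> bool" where
  "finitely_generated R M \<longleftrightarrow>
     (\<exists>S. finite S \<and> S \<subseteq> carrier M \<and> (\<forall>N. submodule N R M \<and> S \<subseteq> N \<longrightarrow> N = carrier M))"

definition fg_module :: "('a, 'b) ring_scheme \<Rightarrow> ('a, 'm) module \<Rightarrow> bool" where
  "fg_module R M \<longleftrightarrow> left_module R M \<and> finitely_generated R M"

text \<open>The regular left module. Over \<open>opposite R\<close> it is \<open>R\<^sub>R\<close>; the same record is also \<open>R\<close> regarded
  as a module over \<open>centre R\<close>.\<close>

definition regular_module :: "('a, 'b) ring_scheme \<Rightarrow> ('a, 'a) module" where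
  "regular_module R = \<lparr>carrier = carrier R, monoid.mult = monoid.mult R,
     monoid.one = monoid.one R, ring.zero = ring.zero R, ring.add = ring.add R,
     smult = monoid.mult R\<rparr>"

definition quotient_module :: "('a, 'm) module \<Rightarrow> 'm set \<Rightarrow> ('a, 'm set) module" where
  "quotient_module M N = \<lparr>carrier = a_rcosets\<^bsub>M\<^esub> N, monoid.mult = undefined,
     monoid.one = undefined, ring.zero = N, ring.add = set_add M,
     smult = \<lambda>r C. \<Union>x\<in>C. N +>\<^bsub>M\<^esub> (r \<odot>\<^bsub>M\<^esub> x)\<rparr>"

section \<open>Ext groups and grade\<close>

definition module_hom ::
    "('a, 'b) ring_scheme \<Rightarrow> ('a, 'm) module \<Rightarrow> ('a, 'n) module \<Rightarrow> ('m \<Rightarrow> 'n) set" where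
  "module_hom R M N = {f \<in> carrier M \<rightarrow>\<^sub>E carrier N.
     (\<forall>x\<in>carrier M. \<forall>y\<in>carrier M. f (x \<oplus>\<^bsub>M\<^esub> y) = f x \<oplus>\<^bsub>N\<^esub> f y) \<and>
     (\<forall>r\<in>carrier R. \<forall>x\<in>carrier M. f (r \<odot>\<^bsub>M\<^esub> x) = r \<odot>\<^bsub>N\<^esub> f x)}"

definition hom_group ::
    "('a, 'b) ring_scheme \<Rightarrow> ('a, 'm) module \<Rightarrow> ('a, 'n) module \<Rightarrow> ('m \<Rightarrow> 'n) monoid" where
  "hom_group R M N = \<lparr>carrier = module_hom R M N,
     monoid.mult = \<lambda>f g. \<lambda>x\<in>carrier M. f x \<oplus>\<^bsub>N\<^esub> g x,
     monoid.one = \<lambda>x\<in>carrier M. \<zero>\<^bsub>N\<^esub>\<rparr>"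

definition is_basis :: "('a, 'b) ring_scheme \<Rightarrow> ('a, 'm) module \<Rightarrow> 'm set \<Rightarrow> bool" where
  "is_basis R F B \<longleftrightarrow> B \<subseteq> carrier F \<and>
     (\<forall>x\<in>carrier F. \<exists>!c. (\<forall>b\<in>B. c b \<in> carrier R) \<and> (\<forall>b. b \<notin> B \<longrightarrow> c b = \<zero>\<^bsub>R\<^esub>) \<and>
        finite {b \<in> B. c b \<noteq> \<zero>\<^bsub>R\<^esub>} \<and>
        x = finsum F (\<lambda>b. c b \<odot>\<^bsub>F\<^esub> b) {b \<in> B. c b \<noteq> \<zero>\<^bsub>R\<^esub>})"

text \<open>\<open>\<dots> \<rightarrow> P 2 \<rightarrow> P 1 \<rightarrow> P 0 \<rightarrow> M \<rightarrow> 0\<close> is exact with every \<open>P i\<close> free, where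
  \<open>d i\<close> maps \<open>P (Suc i)\<close> to \<open>P i\<close>.\<close>

definition free_resolution :: "('a, 'b) ring_scheme \<Rightarrow> ('a, 'm) module \<Rightarrow>
    (nat \<Rightarrow> ('a, 'u) module) \<Rightarrow> (nat \<Rightarrow> 'u \<Rightarrow> 'u) \<Rightarrow> bool" where
  "free_resolution R M P d \<longleftrightarrow>
     (\<forall>i. left_module R (P i) \<and> (\<exists>B. is_basis R (P i) B)) \<and>
     (\<forall>i. d i \<in> module_hom R (P (Suc i)) (P i)) \<and>
     (\<forall>i. d (Suc i) ` carrier (P (Suc (Suc i))) =
        {x \<in> carrier (P (Suc i)). d i x = \<zero>\<^bsub>P i\<^esub>}) \<and>
     (\<exists>e \<in> module_hom R (P 0) M. e ` carrier (P 0) = carrier M \<and>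
        d 0 ` carrier (P 1) = {x \<in> carrier (P 0). e x = \<zero>\<^bsub>M\<^esub>})"

text \<open>The type \<open>('a + 'm) list\<close> has cardinality \<open>max |'a| |'m| \<aleph>\<^sub>0\<close>, so every left module with
  carrier in \<open>'m\<close> has a free resolution with carriers in that type.\<close>

definition some_resolution :: "('a, 'b) ring_scheme \<Rightarrow> ('a, 'm) module \<Rightarrow>
    (nat \<Rightarrow> ('a, ('a + 'm) list) module) \<times> (nat \<Rightarrow> ('a + 'm) list \<Rightarrow> ('a + 'm) list)" where
  "some_resolution R M = (SOME (P, d). free_resolution R M P d)"

definition cocycles :: "('a, 'b) ring_scheme \<Rightarrow> (nat \<Rightarrow> ('a, 'u) module) \<Rightarrow>
    (nat \<Rightarrow> 'u \<Rightarrow> 'u) \<Rightarrow> ('a, 'n) module \<Rightarrow> nat \<Rightarrow> ('u \<Rightarrow> 'n) set" where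
  "cocycles R P d N i =
     {f \<in> module_hom R (P i) N. \<forall>x\<in>carrier (P (Suc i)). f (d i x) = \<zero>\<^bsub>N\<^esub>}"

fun coboundaries :: "('a, 'b) ring_scheme \<Rightarrow> (nat \<Rightarrow> ('a, 'u) module) \<Rightarrow>
    (nat \<Rightarrow> 'u \<Rightarrow> 'u) \<Rightarrow> ('a, 'n) module \<Rightarrow> nat \<Rightarrow> ('u \<Rightarrow> 'n) set" where
  "coboundaries R P d N 0 = {\<lambda>x\<in>carrier (P 0). \<zero>\<^bsub>N\<^esub>}"
| "coboundaries R P d N (Suc i) =
     (\<lambda>g. compose (carrier (P (Suc i))) g (d i)) ` module_hom R (P i) N"

definition Ext :: "('a, 'b) ring_scheme \<Rightarrow> nat \<Rightarrow> ('a, 'm) module \<Rightarrow> ('a, 'n) module \<Rightarrow>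
    (('a + 'm) list \<Rightarrow> 'n) set monoid" where
  "Ext R i M N = (case some_resolution R M of (P, d) \<Rightarrow>
     (hom_group R (P i) N)\<lparr>carrier := cocycles R P d N i\<rparr> Mod coboundaries R P d N i)"

text \<open>The grade of a left module; \<open>grade (opposite R) M\<close> is the grade of a right module. The
  infimum of the empty set in \<open>enat\<close> is \<open>\<infinity>\<close>.\<close>

definition grade :: "('a, 'b) ring_scheme \<Rightarrow> ('a, 'm) module \<Rightarrow> enat" where
  "grade R M = Inf {enat i | i.
     carrier (Ext R i M (regular_module R)) \<noteq> {\<one>\<^bsub>Ext R i M (regular_module R)\<^esub>}}"

text \<open>A bimodule is a left module \<open>M\<close> together with a right action \<open>ra :: 'm \<Rightarrow> 'a \<Rightarrow> 'm\<close>.\<close>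

definition right_part :: "('a, 'm) module \<Rightarrow> ('m \<Rightarrow> 'a \<Rightarrow> 'm) \<Rightarrow> ('a, 'm) module" where
  "right_part M ra = M\<lparr>smult := \<lambda>r x. ra x r\<rparr>"

definition central_bimodule ::
    "('a, 'b) ring_scheme \<Rightarrow> ('a, 'm) module \<Rightarrow> ('m \<Rightarrow> 'a \<Rightarrow> 'm) \<Rightarrow> bool" where
  "central_bimodule R M ra \<longleftrightarrow>
     left_module R M \<and> left_module (opposite R) (right_part M ra) \<and>
     (\<forall>r\<in>carrier R. \<forall>s\<in>carrier R. \<forall>x\<in>carrier M. ra (r \<odot>\<^bsub>M\<^esub> x) s = r \<odot>\<^bsub>M\<^esub> ra x s) \<and>
     (\<forall>z\<in>carrier (centre R). \<forall>x\<in>carrier M. z \<odot>\<^bsub>M\<^esub> x = ra x z)"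

text \<open>A finitely generated module is isomorphic to some \<open>R\<^sup>n / K\<close>, whose elements are sets of lists
  over \<open>R\<close>. Hence, up to isomorphism, the carrier type \<open>'a list set\<close> accounts for all bimodules
  finitely generated on both sides.\<close>

definition grade_symmetric :: "('a, 'b) ring_scheme \<Rightarrow> bool" where
  "grade_symmetric R \<longleftrightarrow> (\<forall>(M :: ('a, 'a list set) module) ra.
     central_bimodule R M ra \<and> finitely_generated R M \<and>
     finitely_generated (opposite R) (right_part M ra) \<longrightarrow>
     grade R M = grade (opposite R) (right_part M ra))"

section \<open>Krull dimension\<close>

text \<open>Rentschler-Gabriel: \<open>deviation_less L n A B\<close> says that the interval \<open>[A, B]\<close> of \<open>L\<close>, ordered by
  inclusion, has deviation less than \<open>n\<close>, where the trivial interval has deviation \<open>-\<infinity>\<close>.\<close>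

fun deviation_less :: "'m set set \<Rightarrow> nat \<Rightarrow> 'm set \<Rightarrow> 'm set \<Rightarrow> bool" where
  "deviation_less L 0 A B \<longleftrightarrow> A = B"
| "deviation_less L (Suc n) A B \<longleftrightarrow>
     (\<forall>X :: nat \<Rightarrow> 'm set. (\<forall>i. X i \<in> L \<and> A \<subseteq> X i \<and> X i \<subseteq> B \<and> X (Suc i) \<subseteq> X i) \<longrightarrow>
        (\<exists>k. \<forall>i\<ge>k. deviation_less L n (X (Suc i)) (X i)))"

text \<open>Infinite ordinal values, and undefined dimension, are recorded as \<open>\<infinity>\<close>.\<close>

definition Kdim_module :: "('a, 'b) ring_scheme \<Rightarrow> ('a, 'm) module \<Rightarrow> ereal" where
  "Kdim_module R M = (if carrier M = {\<zero>\<^bsub>M\<^esub>} then -\<infinity> else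
     Inf {ereal (real n) | n. deviation_less {N. submodule N R M} (Suc n) {\<zero>\<^bsub>M\<^esub>} (carrier M)})"

text \<open>As is customary, the Krull dimension of a ring is that of its right regular module.\<close>

definition Kdim :: "('a, 'b) ring_scheme \<Rightarrow> ereal" where
  "Kdim R = Kdim_module (opposite R) (regular_module (opposite R))"

section \<open>The centrally Macaulay property\<close>

text \<open>Localization at a multiplicatively closed set \<open>S\<close> of central elements;
  \<open>fraction R S r s\<close> is the equivalence class \<open>r / s\<close>.\<close>

definition fraction :: "('a, 'b) ring_scheme \<Rightarrow> 'a set \<Rightarrow> 'a \<Rightarrow> 'a \<Rightarrow> ('a \<times> 'a) set" where
  "fraction R S r s = {(r', s'). r' \<in> carrier R \<and> s' \<in> S \<and>
     (\<exists>u\<in>S. u \<otimes>\<^bsub>R\<^esub> (s' \<otimes>\<^bsub>R\<^esub> r) = u \<otimes>\<^bsub>R\<^esub> (s \<otimes>\<^bsub>R\<^esub> r'))}"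

definition localization :: "('a, 'b) ring_scheme \<Rightarrow> 'a set \<Rightarrow> ('a \<times> 'a) set ring" where
  "localization R S = \<lparr>
     carrier = {fraction R S r s | r s. r \<in> carrier R \<and> s \<in> S},
     monoid.mult = \<lambda>A B. \<Union>(r, s)\<in>A. \<Union>(r', s')\<in>B. fraction R S (r \<otimes>\<^bsub>R\<^esub> r') (s \<otimes>\<^bsub>R\<^esub> s'),
     monoid.one = fraction R S \<one>\<^bsub>R\<^esub> \<one>\<^bsub>R\<^esub>,
     ring.zero = fraction R S \<zero>\<^bsub>R\<^esub> \<one>\<^bsub>R\<^esub>,
     ring.add = \<lambda>A B. \<Union>(r, s)\<in>A. \<Union>(r', s')\<in>B.
       fraction R S (s' \<otimes>\<^bsub>R\<^esub> r \<oplus>\<^bsub>R\<^esub> s \<otimes>\<^bsub>R\<^esub> r') (s \<otimes>\<^bsub>R\<^esub> s')\<rparr>"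

text \<open>\<open>x\<^sub>1 R + \<dots> + x\<^sub>n R\<close>\<close>

definition span_list :: "('a, 'b) ring_scheme \<Rightarrow> 'a list \<Rightarrow> 'a set" where
  "span_list R xs = {\<Oplus>\<^bsub>R\<^esub>i\<in>{..<length xs}. xs ! i \<otimes>\<^bsub>R\<^esub> r i | r.
     r \<in> {..<length xs} \<rightarrow> carrier R}"

definition central_sequence :: "('a, 'b) ring_scheme \<Rightarrow> 'a list \<Rightarrow> bool" where
  "central_sequence R xs \<longleftrightarrow> set xs \<subseteq> carrier (centre R) \<and> span_list R xs \<noteq> carrier R \<and>
     (\<forall>i<length xs. \<forall>r\<in>carrier R. xs ! i \<otimes>\<^bsub>R\<^esub> r \<in> span_list R (take i xs) \<longrightarrow>
        r \<in> span_list R (take i xs))"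

definition maximal_central_sequence_in :: "('a, 'b) ring_scheme \<Rightarrow> 'a set \<Rightarrow> 'a list \<Rightarrow> bool" where
  "maximal_central_sequence_in R I xs \<longleftrightarrow> central_sequence R xs \<and> set xs \<subseteq> I \<and>
     (\<forall>x\<in>I. \<not> central_sequence R (xs @ [x]))"

definition centrally_Macaulay :: "('a, 'b) ring_scheme \<Rightarrow> bool" where
  "centrally_Macaulay R \<longleftrightarrow> (\<forall>\<mm>. maximalideal \<mm> (centre R) \<longrightarrow>
     (\<forall>xs. maximal_central_sequence_in R \<mm> xs \<longrightarrow>
        ereal (real (length xs)) = Kdim (localization R (carrier (centre R) - \<mm>)) \<and>
        Kdim (localization R (carrier (centre R) - \<mm>)) =
          Kdim (localization (centre R) (carrier (centre R) - \<mm>))))"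

section \<open>Dimension functions\<close>

definition prime_ideal :: "('a, 'b) ring_scheme \<Rightarrow> 'a set \<Rightarrow> bool" where
  "prime_ideal R P \<longleftrightarrow> ideal P R \<and> P \<noteq> carrier R \<and>
     (\<forall>I J. ideal I R \<and> ideal J R \<and> (\<forall>i\<in>I. \<forall>j\<in>J. i \<otimes>\<^bsub>R\<^esub> j \<in> P) \<longrightarrow> I \<subseteq> P \<or> J \<subseteq> P)"

definition regular_elements :: "('a, 'b) ring_scheme \<Rightarrow> 'a set" where
  "regular_elements R = {c \<in> carrier R. \<forall>x\<in>carrier R.
     (c \<otimes>\<^bsub>R\<^esub> x = \<zero>\<^bsub>R\<^esub> \<longrightarrow> x = \<zero>\<^bsub>R\<^esub>) \<and> (x \<otimes>\<^bsub>R\<^esub> c = \<zero>\<^bsub>R\<^esub> \<longrightarrow> x = \<zero>\<^bsub>R\<^esub>)}"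

text \<open>\<open>M\<close> is annihilated by \<open>P\<close>, and every element of the \<open>R/P\<close>-module \<open>M\<close> is killed by a regular
  element of \<open>R/P\<close>.\<close>

definition torsion_over_quotient :: "('a, 'b) ring_scheme \<Rightarrow> 'a set \<Rightarrow> ('a, 'm) module \<Rightarrow> bool" where
  "torsion_over_quotient R P M \<longleftrightarrow>
     (\<forall>p\<in>P. \<forall>x\<in>carrier M. p \<odot>\<^bsub>M\<^esub> x = \<zero>\<^bsub>M\<^esub>) \<and>
     (\<forall>x\<in>carrier M. \<exists>c\<in>carrier R. P +>\<^bsub>R\<^esub> c \<in> regular_elements (R Quot P) \<and>
        c \<odot>\<^bsub>M\<^esub> x = \<zero>\<^bsub>M\<^esub>)"

text \<open>A dimension function is polymorphic in the carrier type of the module, which a bound variable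
  cannot be. The predicates therefore take its instances on modules (\<open>\<delta>\<close>), on quotient modules
  (\<open>\<delta>q\<close>) and on cyclic modules \<open>R/P\<close> (\<open>\<delta>c\<close>) separately; they are to be applied to instances of a
  single polymorphic constant.\<close>

definition exact_dimension_function :: "('a, 'b) ring_scheme \<Rightarrow> (('a, 'm) module \<Rightarrow> ereal) \<Rightarrow>
    (('a, 'm set) module \<Rightarrow> ereal) \<Rightarrow> (('a, 'a set) module \<Rightarrow> ereal) \<Rightarrow> bool" where
  "exact_dimension_function R \<delta> \<delta>q \<delta>c \<longleftrightarrow>
     (\<forall>M. fg_module R M \<and> carrier M = {\<zero>\<^bsub>M\<^esub>} \<longrightarrow> \<delta> M = -\<infinity>) \<and>
     (\<forall>M N. fg_module R M \<and> submodule N R M \<longrightarrow>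
        \<delta> M = max (\<delta> (M\<lparr>carrier := N\<rparr>)) (\<delta>q (quotient_module M N))) \<and>
     (\<forall>M P. fg_module R M \<and> prime_ideal R P \<and> torsion_over_quotient R P M \<longrightarrow>
        \<delta> M \<le> \<delta>c (quotient_module (regular_module R) P) - 1)"

definition finitely_partitive :: "('a, 'b) ring_scheme \<Rightarrow> (('a, 'm) module \<Rightarrow> ereal) \<Rightarrow>
    (('a, 'm set) module \<Rightarrow> ereal) \<Rightarrow> bool" where
  "finitely_partitive R \<delta> \<delta>q \<longleftrightarrow> (\<forall>M. fg_module R M \<longrightarrow>
     (\<exists>n::nat. \<forall>m (N :: nat \<Rightarrow> 'm set).
        N 0 = carrier M \<and> (\<forall>i\<le>m. submodule (N i) R M) \<and>
        (\<forall>i<m. N (Suc i) \<subset> N i \<and>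
           \<delta>q (quotient_module (M\<lparr>carrier := N i\<rparr>) (N (Suc i))) = \<delta> M) \<longrightarrow> m \<le> n))"

definition cograde :: "nat \<Rightarrow> ('a, 'b) ring_scheme \<Rightarrow> ('a, 'm) module \<Rightarrow> ereal" where
  "cograde t R M = ereal (real t) - ereal_of_enat (grade R M)"

end

theory Submission
  imports Defs
begin

text \<open>
  For a nonzero finitely generated left module \<open>M\<close>, let \<open>x\<^sub>1, \<dots>, x\<^sub>n\<close> be a maximal regular sequence in
  \<open>\<aa> = Ann\<^bsub>Z(R)\<^esub> M\<close> and \<open>J = x\<^sub>1 R + \<dots> + x\<^sub>n R\<close>. By Rees' change of rings \<open>j(M) \<ge> n\<close>, with equality
  exactly if \<open>Hom\<^sub>R(M, R/J) \<noteq> 0\<close>. By maximality \<open>\<aa>\<close> lies in an associated prime of the \<open>Z(R)\<close>-module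
  \<open>R/J\<close>, which gives a nonzero \<open>Z(R)\<close>-linear map \<open>M \<rightarrow> R/J\<close>. Out of it one builds a central bimodule
  \<open>B\<close>, generated as a left module by images of \<open>M\<close>, with a nonzero map of right modules \<open>B \<rightarrow> R/J\<close>. So
  \<open>j\<^sup>r(B) = n\<close>, grade symmetry turns this into a nonzero left linear map \<open>B \<rightarrow> R/J\<close>, and hence
  \<open>Hom\<^sub>R(M, R/J) \<noteq> 0\<close>. Thus \<open>j(M)\<close> is the length of a maximal regular sequence in \<open>\<aa>\<close>.

  Exactness is then immediate from left exactness of \<open>Hom\<^sub>R(-, R/J)\<close>. For the rest, the Macaulay property
  makes \<open>R/J\<close> unmixed: its associated primes are minimal over \<open>x\<^sub>1, \<dots>, x\<^sub>n\<close>. A torsion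
  \<open>R/P\<close>-module is killed by some \<open>z \<in> Z(R) - P\<close>, so a maximal regular sequence in \<open>P \<inter> Z(R)\<close> extends in
  its annihilator. Finally, \<open>M\<close> has finite length at each of the finitely many associated primes of \<open>R/J\<close>, and
  a subfactor of grade \<open>n\<close> does not vanish at one of them, which bounds the chains in question.
\<close>

section \<open>Modules over arbitrary rings\<close>

text \<open>The obstacle is that grade symmetry speaks of central bimodules, while \<open>M\<close>
  has an action on one side only. In place of the tensor product of \<open>M\<close> with
  \<open>R\<close> over the centre, its image in a module of functions from \<open>R\<close> to R/J
  is used: it is finitely generated on both sides, and the wanted right linear map to R/J is
  evaluation at \<open>\<one>\<close>.

  The change of rings rests on one fact: a central \<open>z\<close> that kills \<open>M\<close> acts
  null-homotopically on a free resolution and hence kills every Ext group. The long exact sequence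
  of 0 -> N -> N -> N/zN -> 0 then falls apart into short pieces, and one fixed resolution serves
  all coefficient modules.

  Localization at a prime of the centre is expressed by saturating submodules, and local lengths by
  counting the steps of a chain that survive localization. Krull dimension enters through a bound on
  the lengths of chains of primes. The properties used pass to the opposite ring, so right modules
  need no second argument.\<close>

lemma (in abelian_group) a_inv_zero [simp]: "\<ominus> \<zero> = \<zero>"
  by (rule minus_equality) simp_all

lemma (in abelian_group) diff_eq_iff:
  "\<lbrakk>x \<in> carrier G; y \<in> carrier G; z \<in> carrier G\<rbrakk> \<Longrightarrow> x \<ominus> y = z \<longleftrightarrow> x = z \<oplus> y"
  using add.inv_solve_right[of z x y] by (auto simp: minus_eq)

lemma (in abelian_group) diff_eq_zero_iff [simp]:
  "\<lbrakk>x \<in> carrier G; y \<in> carrier G\<rbrakk> \<Longrightarrow> x \<ominus> y = \<zero> \<longleftrightarrow> x = y"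
  using diff_eq_iff[of x y \<zero>] by simp

text \<open>AC normalisation may leave another summand between an element and its negative; these
  rules cancel across it, which makes \<open>abel_simps\<close> strong enough for the identities
  below.\<close>

lemma (in abelian_group) cancel_left:
  assumes "x \<in> carrier G" "y \<in> carrier G" "z \<in> carrier G"
  shows "x \<oplus> (y \<oplus> \<ominus> x) = y" "x \<oplus> (y \<oplus> (\<ominus> x \<oplus> z)) = y \<oplus> z"
    "\<ominus> x \<oplus> (y \<oplus> x) = y" "\<ominus> x \<oplus> (y \<oplus> (x \<oplus> z)) = y \<oplus> z"
  using assms by (simp_all add: a_lcomm[of _ y] r_neg l_neg r_neg1 r_neg2)

lemmas (in abelian_group) abel_simps =
  minus_eq a_ac minus_add minus_minus r_neg l_neg r_neg1 r_neg2 cancel_left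

lemma left_moduleI:
  fixes R (structure) and M (structure)
  assumes "ring R" "abelian_group M"
    and "\<And>a x. \<lbrakk>a \<in> carrier R; x \<in> carrier M\<rbrakk> \<Longrightarrow> a \<odot>\<^bsub>M\<^esub> x \<in> carrier M"
    and "\<And>a b x. \<lbrakk>a \<in> carrier R; b \<in> carrier R; x \<in> carrier M\<rbrakk> \<Longrightarrow>
      (a \<oplus> b) \<odot>\<^bsub>M\<^esub> x = a \<odot>\<^bsub>M\<^esub> x \<oplus>\<^bsub>M\<^esub> b \<odot>\<^bsub>M\<^esub> x"
    and "\<And>a x y. \<lbrakk>a \<in> carrier R; x \<in> carrier M; y \<in> carrier M\<rbrakk> \<Longrightarrow>
      a \<odot>\<^bsub>M\<^esub> (x \<oplus>\<^bsub>M\<^esub> y) = a \<odot>\<^bsub>M\<^esub> x \<oplus>\<^bsub>M\<^esub> a \<odot>\<^bsub>M\<^esub> y"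
    and "\<And>a b x. \<lbrakk>a \<in> carrier R; b \<in> carrier R; x \<in> carrier M\<rbrakk> \<Longrightarrow>
      (a \<otimes> b) \<odot>\<^bsub>M\<^esub> x = a \<odot>\<^bsub>M\<^esub> (b \<odot>\<^bsub>M\<^esub> x)"
    and "\<And>x. x \<in> carrier M \<Longrightarrow> \<one> \<odot>\<^bsub>M\<^esub> x = x"
  shows "left_module R M"
  using assms by (intro left_module.intro left_module_axioms.intro) auto

context left_module
begin

declare smult_closed [simp, intro] smult_one [simp]

lemma smult_l_null [simp]: "x \<in> carrier M \<Longrightarrow> \<zero> \<odot>\<^bsub>M\<^esub> x = \<zero>\<^bsub>M\<^esub>"
  using smult_l_distr[of \<zero> \<zero> x] by (metis M.add.r_cancel_one' R.r_zero R.zero_closed smult_closed)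

lemma smult_r_null [simp]: "a \<in> carrier R \<Longrightarrow> a \<odot>\<^bsub>M\<^esub> \<zero>\<^bsub>M\<^esub> = \<zero>\<^bsub>M\<^esub>"
  using smult_r_distr[of a "\<zero>\<^bsub>M\<^esub>" "\<zero>\<^bsub>M\<^esub>"]
  by (metis M.add.r_cancel_one' M.r_zero M.zero_closed smult_closed)

lemma smult_l_minus:
  "\<lbrakk>a \<in> carrier R; x \<in> carrier M\<rbrakk> \<Longrightarrow> (\<ominus> a) \<odot>\<^bsub>M\<^esub> x = \<ominus>\<^bsub>M\<^esub> (a \<odot>\<^bsub>M\<^esub> x)"
  using smult_l_distr[of "\<ominus> a" a x]
  by (metis M.minus_equality R.add.inv_closed R.l_neg smult_closed smult_l_null)

lemma smult_r_minus:
  "\<lbrakk>a \<in> carrier R; x \<in> carrier M\<rbrakk> \<Longrightarrow> a \<odot>\<^bsub>M\<^esub> (\<ominus>\<^bsub>M\<^esub> x) = \<ominus>\<^bsub>M\<^esub> (a \<odot>\<^bsub>M\<^esub> x)"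
  using smult_r_distr[of a "\<ominus>\<^bsub>M\<^esub> x" x]
  by (metis M.minus_equality M.add.inv_closed M.l_neg smult_closed smult_r_null)

lemma smult_r_diff:
  "\<lbrakk>a \<in> carrier R; x \<in> carrier M; y \<in> carrier M\<rbrakk> \<Longrightarrow>
    a \<odot>\<^bsub>M\<^esub> (x \<ominus>\<^bsub>M\<^esub> y) = a \<odot>\<^bsub>M\<^esub> x \<ominus>\<^bsub>M\<^esub> a \<odot>\<^bsub>M\<^esub> y"
  by (simp add: a_minus_def smult_r_distr smult_r_minus)

lemma smult_l_diff:
  "\<lbrakk>a \<in> carrier R; b \<in> carrier R; x \<in> carrier M\<rbrakk> \<Longrightarrow>
    (a \<ominus> b) \<odot>\<^bsub>M\<^esub> x = a \<odot>\<^bsub>M\<^esub> x \<ominus>\<^bsub>M\<^esub> b \<odot>\<^bsub>M\<^esub> x"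
  by (simp add: a_minus_def smult_l_distr smult_l_minus)

lemma submoduleI:
  assumes "H \<subseteq> carrier M" "\<zero>\<^bsub>M\<^esub> \<in> H"
    and "\<And>a b. \<lbrakk>a \<in> H; b \<in> H\<rbrakk> \<Longrightarrow> a \<oplus>\<^bsub>M\<^esub> b \<in> H"
    and "\<And>a x. \<lbrakk>a \<in> carrier R; x \<in> H\<rbrakk> \<Longrightarrow> a \<odot>\<^bsub>M\<^esub> x \<in> H"
  shows "submodule H R M"
proof -
  have "\<ominus>\<^bsub>M\<^esub> a \<in> H" if "a \<in> H" for a
    using assms(4)[of "\<ominus> \<one>" a] that assms(1) by (auto simp: smult_l_minus)
  then show ?thesis
    using assms by (intro submodule.intro subgroup.intro submodule_axioms.intro) (auto simp flip: a_inv_def)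
qed

lemma submoduleD:
  assumes "submodule H R M"
  shows "H \<subseteq> carrier M" "\<zero>\<^bsub>M\<^esub> \<in> H"
    and "\<And>a b. \<lbrakk>a \<in> H; b \<in> H\<rbrakk> \<Longrightarrow> a \<oplus>\<^bsub>M\<^esub> b \<in> H"
    and "\<And>a x. \<lbrakk>a \<in> carrier R; x \<in> H\<rbrakk> \<Longrightarrow> a \<odot>\<^bsub>M\<^esub> x \<in> H"
    and "\<And>a. a \<in> H \<Longrightarrow> \<ominus>\<^bsub>M\<^esub> a \<in> H"
    and "\<And>a b. \<lbrakk>a \<in> H; b \<in> H\<rbrakk> \<Longrightarrow> a \<ominus>\<^bsub>M\<^esub> b \<in> H"
    and "\<And>a. a \<in> H \<Longrightarrow> a \<in> carrier M"
proof -
  interpret submodule H R M by fact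
  show *: "H \<subseteq> carrier M" "\<zero>\<^bsub>M\<^esub> \<in> H"
    "\<And>a b. \<lbrakk>a \<in> H; b \<in> H\<rbrakk> \<Longrightarrow> a \<oplus>\<^bsub>M\<^esub> b \<in> H"
    "\<And>a x. \<lbrakk>a \<in> carrier R; x \<in> H\<rbrakk> \<Longrightarrow> a \<odot>\<^bsub>M\<^esub> x \<in> H"
    using subset one_closed m_closed by auto
  show **: "\<And>a. a \<in> H \<Longrightarrow> \<ominus>\<^bsub>M\<^esub> a \<in> H"
    using m_inv_closed by (simp add: a_inv_def)
  show "\<And>a b. \<lbrakk>a \<in> H; b \<in> H\<rbrakk> \<Longrightarrow> a \<ominus>\<^bsub>M\<^esub> b \<in> H"
    using * ** by (simp add: a_minus_def)
  show "\<And>a. a \<in> H \<Longrightarrow> a \<in> carrier M" using * by auto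
qed

lemma carrier_submodule: "submodule (carrier M) R M"
  by (rule submoduleI) auto

lemma zero_submodule: "submodule {\<zero>\<^bsub>M\<^esub>} R M"
  by (rule submoduleI) auto

lemma submodule_Int:
  "\<lbrakk>submodule H R M; submodule K R M\<rbrakk> \<Longrightarrow> submodule (H \<inter> K) R M"
  by (intro submoduleI) (auto dest: submoduleD)

lemma submodule_set_add:
  assumes H: "submodule H R M" and K: "submodule K R M"
  shows "submodule (H <+>\<^bsub>M\<^esub> K) R M"
proof (rule submoduleI)
  note h = submoduleD[OF H] and k = submoduleD[OF K]
  show "H <+>\<^bsub>M\<^esub> K \<subseteq> carrier M" using h(1) k(1) by (auto simp: set_add_def')
  show "\<zero>\<^bsub>M\<^esub> \<in> H <+>\<^bsub>M\<^esub> K" using h(2) k(2) M.r_zero by (force simp: set_add_def')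
  show "a \<oplus>\<^bsub>M\<^esub> b \<in> H <+>\<^bsub>M\<^esub> K" if "a \<in> H <+>\<^bsub>M\<^esub> K" "b \<in> H <+>\<^bsub>M\<^esub> K" for a b
  proof -
    from that obtain u v u' v' where uv: "u \<in> H" "v \<in> K" "u' \<in> H" "v' \<in> K" "a = u \<oplus>\<^bsub>M\<^esub> v" "b = u' \<oplus>\<^bsub>M\<^esub> v'"
      by (auto simp: set_add_def')
    then have "a \<oplus>\<^bsub>M\<^esub> b = (u \<oplus>\<^bsub>M\<^esub> u') \<oplus>\<^bsub>M\<^esub> (v \<oplus>\<^bsub>M\<^esub> v')"
      using h(7) k(7) by (simp add: M.a_ac)
    then show ?thesis using uv h(3)[of u u'] k(3)[of v v'] unfolding set_add_def' by blast
  qed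
  show "a \<odot>\<^bsub>M\<^esub> x \<in> H <+>\<^bsub>M\<^esub> K" if "a \<in> carrier R" "x \<in> H <+>\<^bsub>M\<^esub> K" for a x
  proof -
    from that obtain u v where uv: "u \<in> H" "v \<in> K" "x = u \<oplus>\<^bsub>M\<^esub> v" unfolding set_add_def' by blast
    then have "a \<odot>\<^bsub>M\<^esub> x = a \<odot>\<^bsub>M\<^esub> u \<oplus>\<^bsub>M\<^esub> a \<odot>\<^bsub>M\<^esub> v"
      using h(7) k(7) that by (simp add: smult_r_distr)
    then show ?thesis using uv h(4)[OF that(1), of u] k(4)[OF that(1), of v] unfolding set_add_def' by blast
  qed
qed

lemma submodule_le_set_add:
  assumes H: "submodule H R M" and K: "submodule K R M"
  shows "H \<subseteq> H <+>\<^bsub>M\<^esub> K" "K \<subseteq> H <+>\<^bsub>M\<^esub> K"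
proof
  fix x assume x: "x \<in> H"
  then have "x = x \<oplus>\<^bsub>M\<^esub> \<zero>\<^bsub>M\<^esub>" using submoduleD[OF H] by simp
  then show "x \<in> H <+>\<^bsub>M\<^esub> K" using x submoduleD(2)[OF K] by (auto simp: set_add_def')
next
  show "K \<subseteq> H <+>\<^bsub>M\<^esub> K"
  proof
    fix x assume x: "x \<in> K"
    then have "x = \<zero>\<^bsub>M\<^esub> \<oplus>\<^bsub>M\<^esub> x" using submoduleD[OF K] by simp
    then show "x \<in> H <+>\<^bsub>M\<^esub> K" using x submoduleD(2)[OF H] by (auto simp: set_add_def')
  qed
qed

lemma smult_image_submodule:
  assumes comm: "\<And>a b. \<lbrakk>a \<in> carrier R; b \<in> carrier R\<rbrakk> \<Longrightarrow> a \<otimes> b = b \<otimes> a" and v: "v \<in> carrier M"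
  shows "submodule ((\<lambda>a. a \<odot>\<^bsub>M\<^esub> v) ` carrier R) R M"
proof (rule submoduleI)
  show "(\<lambda>a. a \<odot>\<^bsub>M\<^esub> v) ` carrier R \<subseteq> carrier M" using v by auto
  show "\<zero>\<^bsub>M\<^esub> \<in> (\<lambda>a. a \<odot>\<^bsub>M\<^esub> v) ` carrier R" using v by (force intro: rev_image_eqI[of \<zero>])
  fix a b assume "a \<in> (\<lambda>a. a \<odot>\<^bsub>M\<^esub> v) ` carrier R" "b \<in> (\<lambda>a. a \<odot>\<^bsub>M\<^esub> v) ` carrier R"
  then show "a \<oplus>\<^bsub>M\<^esub> b \<in> (\<lambda>a. a \<odot>\<^bsub>M\<^esub> v) ` carrier R"
    using v by (auto simp flip: smult_l_distr)
next
  fix a x assume "a \<in> carrier R" "x \<in> (\<lambda>a. a \<odot>\<^bsub>M\<^esub> v) ` carrier R"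
  then show "a \<odot>\<^bsub>M\<^esub> x \<in> (\<lambda>a. a \<odot>\<^bsub>M\<^esub> v) ` carrier R"
    using v by (auto simp flip: smult_assoc)
qed

lemma submodule_left_module:
  assumes "submodule H R M"
  shows "left_module R (M\<lparr>carrier := H\<rparr>)"
proof (rule left_moduleI)
  note h = submoduleD[OF assms]
  show "ring R" ..
  show "abelian_group (M\<lparr>carrier := H\<rparr>)"
  proof (rule abelian_groupI)
    fix x assume "x \<in> carrier (M\<lparr>carrier := H\<rparr>)"
    then show "\<exists>y\<in>carrier (M\<lparr>carrier := H\<rparr>). y \<oplus>\<^bsub>M\<lparr>carrier := H\<rparr>\<^esub> x = \<zero>\<^bsub>M\<lparr>carrier := H\<rparr>\<^esub>"
      using h(5,7) M.l_neg by (auto intro: bexI[of _ "\<ominus>\<^bsub>M\<^esub> x"])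
  qed (use h in \<open>auto simp: M.a_ac\<close>)
qed (use submoduleD[OF assms] in \<open>auto simp: smult_l_distr smult_r_distr smult_assoc\<close>)

lemma submodule_restrict:
  assumes "submodule H R M" "K \<subseteq> H"
  shows "submodule K R (M\<lparr>carrier := H\<rparr>) \<longleftrightarrow> submodule K R M"
proof
  interpret H: left_module R "M\<lparr>carrier := H\<rparr>" using assms(1) by (rule submodule_left_module)
  note h = submoduleD[OF assms(1)]
  show "submodule K R M" if "submodule K R (M\<lparr>carrier := H\<rparr>)"
    using H.submoduleD[OF that] assms(2) h by (intro submoduleI) auto
  show "submodule K R (M\<lparr>carrier := H\<rparr>)" if "submodule K R M"
    using submoduleD[OF that] assms(2) h by (intro H.submoduleI) auto
qed

lemma submodule_is_abelian_subgroup: "submodule H R M \<Longrightarrow> abelian_subgroup H M"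
  by (intro abelian_subgroupI3 additive_subgroup.intro submodule.axioms(1)) (auto intro: M.abelian_group_axioms)

end

lemma (in ring) regular_left_module: "left_module R (regular_module R)"
  by (intro left_moduleI abelian_groupI)
     (auto simp: regular_module_def l_distr r_distr m_assoc a_ac ring_axioms intro: bexI[of _ "\<ominus> _"] l_neg)

lemma regular_simps [simp]:
  "carrier (regular_module R) = carrier R" "\<zero>\<^bsub>regular_module R\<^esub> = \<zero>\<^bsub>R\<^esub>"
  "add (regular_module R) = add R" "smult (regular_module R) = monoid.mult R"
  "(\<odot>\<^bsub>regular_module R\<^esub>) = (\<otimes>\<^bsub>R\<^esub>)"
  by (simp_all add: regular_module_def)

lemma (in ideal) submodule_regular: "submodule I R (regular_module R)"
proof -
  interpret left_module R "regular_module R" by (rule regular_left_module)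
  show ?thesis using a_subset by (intro submoduleI) (auto simp: I_l_closed)
qed

subsection \<open>Quotients\<close>

context
  fixes R :: "('a, 'b) ring_scheme" (structure) and M :: "('a, 'm) module" and H
  assumes M: "left_module R M" and H: "submodule H R M"
begin

interpretation left_module R M by (rule M)
interpretation abelian_subgroup H M using H by (rule submodule_is_abelian_subgroup)

lemma coset_eq_iff:
  assumes "x \<in> carrier M" "y \<in> carrier M"
  shows "H +>\<^bsub>M\<^esub> x = H +>\<^bsub>M\<^esub> y \<longleftrightarrow> x \<ominus>\<^bsub>M\<^esub> y \<in> H"
proof -
  have "H +>\<^bsub>M\<^esub> x = H +>\<^bsub>M\<^esub> y \<longleftrightarrow> x \<in> H +>\<^bsub>M\<^esub> y"
    using a_repr_independence'[of x y] a_rcos_self[of x] assms by auto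
  also have "\<dots> \<longleftrightarrow> x \<ominus>\<^bsub>M\<^esub> y \<in> H"
    using assms by (simp add: a_rcos_module a_minus_def)
  finally show ?thesis .
qed

lemma coset_eq_zero_iff: "x \<in> carrier M \<Longrightarrow> H +>\<^bsub>M\<^esub> x = H \<longleftrightarrow> x \<in> H"
  using coset_eq_iff[of x "\<zero>\<^bsub>M\<^esub>"] a_subset by (auto simp add: a_minus_def)

lemma coset_self: "x \<in> carrier M \<Longrightarrow> x \<in> H +>\<^bsub>M\<^esub> x"
  by (rule a_rcos_self)

lemma coset_memD: "\<lbrakk>x \<in> carrier M; y \<in> H +>\<^bsub>M\<^esub> x\<rbrakk> \<Longrightarrow> y \<in> carrier M \<and> H +>\<^bsub>M\<^esub> y = H +>\<^bsub>M\<^esub> x"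
  using a_repr_independence'[of y x] M.a_r_coset_subset_G[OF a_subset, of x] by auto

lemma coset_add:
  "\<lbrakk>x \<in> carrier M; y \<in> carrier M\<rbrakk> \<Longrightarrow> (H +>\<^bsub>M\<^esub> x) <+>\<^bsub>M\<^esub> (H +>\<^bsub>M\<^esub> y) = H +>\<^bsub>M\<^esub> (x \<oplus>\<^bsub>M\<^esub> y)"
  by (rule a_rcos_sum)

lemma quotient_simps:
  "carrier (quotient_module M H) = (\<lambda>x. H +>\<^bsub>M\<^esub> x) ` carrier M"
  "\<zero>\<^bsub>quotient_module M H\<^esub> = H"
  "C \<oplus>\<^bsub>quotient_module M H\<^esub> D = C <+>\<^bsub>M\<^esub> D"
  by (auto simp: quotient_module_def A_RCOSETS_def')

text \<open>The scalar action of \<open>quotient_module\<close> is a union over all representatives.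
  Every representative contributes the same coset, so the union collapses.\<close>

lemma quotient_smult:
  assumes "r \<in> carrier R" "x \<in> carrier M"
  shows "r \<odot>\<^bsub>quotient_module M H\<^esub> (H +>\<^bsub>M\<^esub> x) = H +>\<^bsub>M\<^esub> (r \<odot>\<^bsub>M\<^esub> x)"
proof -
  have "H +>\<^bsub>M\<^esub> (r \<odot>\<^bsub>M\<^esub> y) = H +>\<^bsub>M\<^esub> (r \<odot>\<^bsub>M\<^esub> x)" if "y \<in> H +>\<^bsub>M\<^esub> x" for y
  proof -
    have y: "y \<in> carrier M" "y \<ominus>\<^bsub>M\<^esub> x \<in> H"
      using coset_memD[OF assms(2) that] assms(2) by (auto simp: coset_eq_iff)
    then have "r \<odot>\<^bsub>M\<^esub> y \<ominus>\<^bsub>M\<^esub> r \<odot>\<^bsub>M\<^esub> x \<in> H"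
      using submoduleD(4)[OF H assms(1) y(2)] assms by (simp add: smult_r_diff)
    then show ?thesis using y assms by (simp add: coset_eq_iff)
  qed
  then have "(\<Union>y\<in>H +>\<^bsub>M\<^esub> x. H +>\<^bsub>M\<^esub> (r \<odot>\<^bsub>M\<^esub> y)) = (\<Union>y\<in>H +>\<^bsub>M\<^esub> x. H +>\<^bsub>M\<^esub> (r \<odot>\<^bsub>M\<^esub> x))"
    by (rule SUP_cong[OF refl])
  also have "\<dots> = H +>\<^bsub>M\<^esub> (r \<odot>\<^bsub>M\<^esub> x)"
    using coset_self[OF assms(2)] by (intro SUP_const) blast
  finally show ?thesis by (simp add: quotient_module_def)
qed

lemma quotient_left_module: "left_module R (quotient_module M H)"
proof (rule left_moduleI)
  show "ring R" ..
  show "abelian_group (quotient_module M H)"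
  proof (rule abelian_groupI)
    fix C assume "C \<in> carrier (quotient_module M H)"
    then obtain x where x: "x \<in> carrier M" "C = H +>\<^bsub>M\<^esub> x" by (auto simp: quotient_simps)
    have "(H +>\<^bsub>M\<^esub> \<ominus>\<^bsub>M\<^esub> x) <+>\<^bsub>M\<^esub> C = H"
      using x a_subset by (simp add: coset_add M.l_neg)
    then show "\<exists>D\<in>carrier (quotient_module M H). D \<oplus>\<^bsub>quotient_module M H\<^esub> C = \<zero>\<^bsub>quotient_module M H\<^esub>"
      using x by (auto simp: quotient_simps)
    have "H <+>\<^bsub>M\<^esub> C = C" using coset_add[of "\<zero>\<^bsub>M\<^esub>" x] x a_subset by simp
    then show "\<zero>\<^bsub>quotient_module M H\<^esub> \<oplus>\<^bsub>quotient_module M H\<^esub> C = C" by (simp add: quotient_simps)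
  next
    have "H = H +>\<^bsub>M\<^esub> \<zero>\<^bsub>M\<^esub>" using a_subset by simp
    then show "\<zero>\<^bsub>quotient_module M H\<^esub> \<in> carrier (quotient_module M H)"
      by (auto simp: quotient_simps)
  qed (auto simp: quotient_simps coset_add M.a_ac)
qed (auto simp: quotient_simps coset_add quotient_smult smult_l_distr smult_r_distr smult_assoc)

end

subsection \<open>Linear maps\<close>

text \<open>In contrast to \<open>module_hom\<close> no extensionality is required: composites, sums
  and multiples are plain lambda terms, and \<open>restrict\<close> leads back to
  \<open>module_hom\<close> where the definition of Ext asks for it.\<close>

definition linear_map :: "('a, 'b) ring_scheme \<Rightarrow> ('a, 'm, 'c) module_scheme \<Rightarrow>
    ('a, 'n, 'd) module_scheme \<Rightarrow> ('m \<Rightarrow> 'n) \<Rightarrow> bool" where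
  "linear_map R M N f \<longleftrightarrow> (\<forall>x\<in>carrier M. f x \<in> carrier N) \<and>
     (\<forall>x\<in>carrier M. \<forall>y\<in>carrier M. f (x \<oplus>\<^bsub>M\<^esub> y) = f x \<oplus>\<^bsub>N\<^esub> f y) \<and>
     (\<forall>r\<in>carrier R. \<forall>x\<in>carrier M. f (r \<odot>\<^bsub>M\<^esub> x) = r \<odot>\<^bsub>N\<^esub> f x)"

lemma linear_mapI:
  assumes "\<And>x. x \<in> carrier M \<Longrightarrow> f x \<in> carrier N"
    and "\<And>x y. \<lbrakk>x \<in> carrier M; y \<in> carrier M\<rbrakk> \<Longrightarrow> f (x \<oplus>\<^bsub>M\<^esub> y) = f x \<oplus>\<^bsub>N\<^esub> f y"
    and "\<And>r x. \<lbrakk>r \<in> carrier R; x \<in> carrier M\<rbrakk> \<Longrightarrow> f (r \<odot>\<^bsub>M\<^esub> x) = r \<odot>\<^bsub>N\<^esub> f x"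
  shows "linear_map R M N f"
  using assms by (auto simp: linear_map_def)

lemma linear_mapD:
  assumes "linear_map R M N f"
  shows "x \<in> carrier M \<Longrightarrow> f x \<in> carrier N"
    and "\<lbrakk>x \<in> carrier M; y \<in> carrier M\<rbrakk> \<Longrightarrow> f (x \<oplus>\<^bsub>M\<^esub> y) = f x \<oplus>\<^bsub>N\<^esub> f y"
    and "\<lbrakk>r \<in> carrier R; x \<in> carrier M\<rbrakk> \<Longrightarrow> f (r \<odot>\<^bsub>M\<^esub> x) = r \<odot>\<^bsub>N\<^esub> f x"
  using assms by (auto simp: linear_map_def)

lemma module_hom_iff:
  "f \<in> module_hom R M N \<longleftrightarrow> f \<in> extensional (carrier M) \<and> linear_map R M N f"
  by (auto simp: module_hom_def linear_map_def PiE_def)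

lemma linear_map_cong:
  assumes "left_module R M" "linear_map R M N f" "\<And>x. x \<in> carrier M \<Longrightarrow> f x = g x"
  shows "linear_map R M N g"
proof -
  interpret left_module R M by fact
  show ?thesis
    by (rule linear_mapI) (use assms(3) linear_mapD[OF assms(2)] in \<open>simp_all flip: assms(3)\<close>)
qed

lemma restrict_module_hom:
  assumes "left_module R M" "linear_map R M N f"
  shows "restrict f (carrier M) \<in> module_hom R M N"
  using linear_map_cong[OF assms, of "restrict f (carrier M)"] by (simp add: module_hom_iff)

lemma linear_map_comp:
  "\<lbrakk>linear_map R L M g; linear_map R M N f\<rbrakk> \<Longrightarrow> linear_map R L N (\<lambda>x. f (g x))"
  by (simp add: linear_map_def)

context
  fixes R :: "('a, 'b) ring_scheme" and M :: "('a, 'm, 'c) module_scheme"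
    and N :: "('a, 'n, 'd) module_scheme"
  assumes M: "left_module R M" and N: "left_module R N"
begin

interpretation R: ring R using M by (simp add: left_module_def)
interpretation M: left_module R M by (rule M)
interpretation N: left_module R N by (rule N)

lemma linear_map_zero: "linear_map R M N f \<Longrightarrow> f \<zero>\<^bsub>M\<^esub> = \<zero>\<^bsub>N\<^esub>"
  using linear_mapD(3)[of R M N f "\<zero>\<^bsub>R\<^esub>" "\<zero>\<^bsub>M\<^esub>"] linear_mapD(1)[of R M N f "\<zero>\<^bsub>M\<^esub>"] by simp

lemma linear_map_minus: "\<lbrakk>linear_map R M N f; x \<in> carrier M\<rbrakk> \<Longrightarrow> f (\<ominus>\<^bsub>M\<^esub> x) = \<ominus>\<^bsub>N\<^esub> f x"
  using linear_mapD(2)[of R M N f "\<ominus>\<^bsub>M\<^esub> x" x] linear_mapD(1)[of R M N f]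
  by (intro N.M.minus_equality[symmetric]) (auto simp: M.M.l_neg linear_map_zero)

lemma linear_map_diff:
  "\<lbrakk>linear_map R M N f; x \<in> carrier M; y \<in> carrier M\<rbrakk> \<Longrightarrow> f (x \<ominus>\<^bsub>M\<^esub> y) = f x \<ominus>\<^bsub>N\<^esub> f y"
  by (simp add: a_minus_def linear_mapD linear_map_minus)

lemma linear_map_const_zero: "linear_map R M N (\<lambda>x. \<zero>\<^bsub>N\<^esub>)"
  by (rule linear_mapI) auto

lemma linear_map_add_fun:
  "\<lbrakk>linear_map R M N f; linear_map R M N g\<rbrakk> \<Longrightarrow> linear_map R M N (\<lambda>x. f x \<oplus>\<^bsub>N\<^esub> g x)"
  by (rule linear_mapI) (simp_all add: linear_mapD N.smult_r_distr N.M.a_ac)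

lemma linear_map_diff_fun:
  "\<lbrakk>linear_map R M N f; linear_map R M N g\<rbrakk> \<Longrightarrow> linear_map R M N (\<lambda>x. f x \<ominus>\<^bsub>N\<^esub> g x)"
  by (rule linear_mapI)
     (simp_all add: linear_mapD N.smult_r_diff a_minus_def N.smult_r_distr N.smult_r_minus N.M.a_ac N.M.minus_add)

lemma linear_map_smult_fun:
  assumes "linear_map R M N f" "z \<in> carrier R" "\<And>r. r \<in> carrier R \<Longrightarrow> z \<otimes>\<^bsub>R\<^esub> r = r \<otimes>\<^bsub>R\<^esub> z"
  shows "linear_map R M N (\<lambda>x. z \<odot>\<^bsub>N\<^esub> f x)"
  by (rule linear_mapI)
     (use assms in \<open>simp_all add: linear_mapD N.smult_r_distr flip: N.smult_assoc\<close>)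

lemma linear_map_finsum:
  assumes f: "linear_map R M N f" and u: "\<And>i. i \<in> A \<Longrightarrow> u i \<in> carrier M"
  shows "f (finsum M u A) = finsum N (\<lambda>i. f (u i)) A"
  using u
proof (induction A rule: infinite_finite_induct)
  case (insert a A)
  then have "u \<in> A \<rightarrow> carrier M" "(\<lambda>i. f (u i)) \<in> A \<rightarrow> carrier N" using linear_mapD(1)[OF f] by auto
  with insert show ?case by (simp add: linear_mapD[OF f])
qed (simp_all add: linear_map_zero[OF f])

lemma submodule_vimage:
  assumes f: "linear_map R M N f" and H: "submodule H R N"
  shows "submodule {x \<in> carrier M. f x \<in> H} R M"
  by (rule M.submoduleI) (use N.submoduleD[OF H] linear_mapD[OF f] linear_map_zero[OF f] in auto)

lemma submodule_kernel:
  assumes f: "linear_map R M N f"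
  shows "submodule {x \<in> carrier M. f x = \<zero>\<^bsub>N\<^esub>} R M"
  using submodule_vimage[OF f N.zero_submodule] by simp

lemma submodule_image:
  assumes f: "linear_map R M N f" and H: "submodule H R M"
  shows "submodule (f ` H) R N"
proof (rule N.submoduleI)
  note h = M.submoduleD[OF H]
  show "f ` H \<subseteq> carrier N" using h linear_mapD[OF f] by auto
  show "\<zero>\<^bsub>N\<^esub> \<in> f ` H" using h linear_map_zero[OF f] by (metis imageI)
  show "a \<oplus>\<^bsub>N\<^esub> b \<in> f ` H" if "a \<in> f ` H" "b \<in> f ` H" for a b
    using that h(3,7) by (auto simp flip: linear_mapD(2)[OF f])
  show "a \<odot>\<^bsub>N\<^esub> b \<in> f ` H" if "a \<in> carrier R" "b \<in> f ` H" for a b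
    using that h(4,7) by (auto simp flip: linear_mapD(3)[OF f])
qed

end

lemma linear_map_quotient:
  assumes M: "left_module R M" and H: "submodule H R M"
  shows "linear_map R M (quotient_module M H) (\<lambda>x. H +>\<^bsub>M\<^esub> x)"
  by (rule linear_mapI) (auto simp: quotient_simps[OF M H] coset_add[OF M H] quotient_smult[OF M H])

subsection \<open>Free modules\<close>

text \<open>Projectivity of free modules: preimages under \<open>\<psi>\<close> are chosen on the
  basis and extended linearly, the coefficients being those that \<open>is_basis\<close> makes
  unique.\<close>

lemma free_lift:
  assumes P: "left_module R P" and D: "left_module R D" and C: "left_module R C"
    and basis: "is_basis R P B"
    and \<psi>: "linear_map R D C \<psi>" and f: "linear_map R P C f"
    and im: "\<And>x. x \<in> carrier P \<Longrightarrow> f x \<in> \<psi> ` carrier D"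
  shows "\<exists>g. linear_map R P D g \<and> (\<forall>x\<in>carrier P. \<psi> (g x) = f x)"
proof -
  interpret R: ring R using P by (simp add: left_module_def)
  interpret P: left_module R P by fact
  interpret D: left_module R D by fact
  interpret C: left_module R C by fact
  have B: "B \<subseteq> carrier P" using basis by (simp add: is_basis_def)
  have "\<exists>y. y \<in> carrier D \<and> \<psi> y = f b" if "b \<in> B" for b
    using im[of b] subsetD[OF B that] by (auto simp: image_iff)
  then obtain \<phi> where \<phi>: "\<And>b. b \<in> B \<Longrightarrow> \<phi> b \<in> carrier D" "\<And>b. b \<in> B \<Longrightarrow> \<psi> (\<phi> b) = f b" by metis
  define supp where "supp c = {b \<in> B. c b \<noteq> \<zero>\<^bsub>R\<^esub>}" for c
  define coef where "coef x c \<longleftrightarrow> (\<forall>b\<in>B. c b \<in> carrier R) \<and> (\<forall>b. b \<notin> B \<longrightarrow> c b = \<zero>\<^bsub>R\<^esub>) \<and>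
    finite (supp c) \<and> x = finsum P (\<lambda>b. c b \<odot>\<^bsub>P\<^esub> b) (supp c)" for x c
  have uniq: "\<exists>!c. coef x c" if "x \<in> carrier P" for x
    using basis that unfolding is_basis_def coef_def supp_def by blast
  define cf where "cf x = (THE c. coef x c)" for x
  have cf: "coef x (cf x)" if "x \<in> carrier P" for x
    unfolding cf_def by (rule theI'[OF uniq[OF that]])
  have cf_eq: "cf x = c" if "x \<in> carrier P" "coef x c" for x c
    using uniq[OF that(1)] cf[OF that(1)] that(2) by blast
  define g where "g x = finsum D (\<lambda>b. cf x b \<odot>\<^bsub>D\<^esub> \<phi> b) (supp (cf x))" for x
  \<comment> \<open>Supports vary with the element, so expansions are compared over a common finite
    set \<open>T\<close> on which some coefficients may vanish.\<close>
  have ext: "finsum X (\<lambda>b. c b \<odot>\<^bsub>X\<^esub> u b) (supp c) = finsum X (\<lambda>b. c b \<odot>\<^bsub>X\<^esub> u b) T"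
    if "left_module R X" "finite T" "supp c \<subseteq> T" "T \<subseteq> B" "\<And>b. b \<in> T \<Longrightarrow> c b \<in> carrier R"
      "\<And>b. b \<in> T \<Longrightarrow> u b \<in> carrier X" for c T u and X :: "('a, 'x, 'y) module_scheme"
  proof -
    interpret X: left_module R X by fact
    show ?thesis
      by (rule X.M.add.finprod_mono_neutral_cong_left) (use that in \<open>auto simp: supp_def\<close>)
  qed
  \<comment> \<open>The coefficient function in \<open>is_basis\<close> is zero off the basis;
    \<open>c'\<close> is \<open>c\<close> cut down to \<open>T\<close>, hence the function that
    \<open>cf\<close> returns.\<close>
  have g_eval: "g (finsum P (\<lambda>b. c b \<odot>\<^bsub>P\<^esub> b) T) = finsum D (\<lambda>b. c b \<odot>\<^bsub>D\<^esub> \<phi> b) T"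
    if T: "finite T" "T \<subseteq> B" and c: "\<And>b. b \<in> T \<Longrightarrow> c b \<in> carrier R" for c T
  proof -
    define c' where "c' b = (if b \<in> T then c b else \<zero>\<^bsub>R\<^esub>)" for b
    let ?x = "finsum P (\<lambda>b. c b \<odot>\<^bsub>P\<^esub> b) T"
    have s: "supp c' \<subseteq> T" by (auto simp: supp_def c'_def)
    have cP: "\<And>b. b \<in> T \<Longrightarrow> b \<in> carrier P" using T B by auto
    have x: "?x \<in> carrier P" using c cP by (auto intro!: P.M.finsum_closed)
    have "?x = finsum P (\<lambda>b. c' b \<odot>\<^bsub>P\<^esub> b) T"
      by (rule P.M.add.finprod_cong') (use c cP in \<open>auto simp: c'_def\<close>)
    also have "\<dots> = finsum P (\<lambda>b. c' b \<odot>\<^bsub>P\<^esub> b) (supp c')"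
      by (rule ext[OF P, symmetric]) (use T s c cP in \<open>auto simp: c'_def supp_def split: if_splits\<close>)
    finally have "coef ?x c'"
      using T s c by (auto simp: coef_def c'_def dest: finite_subset)
    then have "g ?x = finsum D (\<lambda>b. c' b \<odot>\<^bsub>D\<^esub> \<phi> b) (supp c')"
      using cf_eq[OF x] by (simp add: g_def)
    also have "\<dots> = finsum D (\<lambda>b. c' b \<odot>\<^bsub>D\<^esub> \<phi> b) T"
      by (rule ext[OF D]) (use T s c \<phi>(1) in \<open>auto simp: c'_def supp_def split: if_splits\<close>)
    also have "\<dots> = finsum D (\<lambda>b. c b \<odot>\<^bsub>D\<^esub> \<phi> b) T"
      by (rule D.M.add.finprod_cong') (use c T \<phi>(1) in \<open>auto simp: c'_def\<close>)
    finally show ?thesis .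
  qed
  have rep: "x = finsum P (\<lambda>b. cf x b \<odot>\<^bsub>P\<^esub> b) T"
    if "x \<in> carrier P" "finite T" "supp (cf x) \<subseteq> T" "T \<subseteq> B" for x T
    using cf[OF that(1)] ext[OF P that(2-4), of "\<lambda>b. b"] that(4) B unfolding coef_def by auto
  have cfR: "cf x b \<in> carrier R" if "x \<in> carrier P" "b \<in> B" for x b
    using cf[OF that(1)] that(2) by (auto simp: coef_def)
  have fin: "finite (supp (cf x))" if "x \<in> carrier P" for x using cf[OF that] by (auto simp: coef_def)
  have sB: "supp c \<subseteq> B" for c by (auto simp: supp_def)
  have g_closed: "g x \<in> carrier D" if "x \<in> carrier P" for x
    unfolding g_def using cfR[OF that] \<phi>(1) by (intro D.M.finsum_closed) (auto simp: supp_def)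
  have "linear_map R P D g"
  proof (rule linear_mapI)
    show "g x \<in> carrier D" if "x \<in> carrier P" for x using that by (rule g_closed)
    fix x y assume xy: "x \<in> carrier P" "y \<in> carrier P"
    define T where "T = supp (cf x) \<union> supp (cf y)"
    have T: "finite T" "T \<subseteq> B" "supp (cf x) \<subseteq> T" "supp (cf y) \<subseteq> T"
      using fin xy sB by (auto simp: T_def)
    note xr = rep[OF xy(1) T(1,3,2)] and yr = rep[OF xy(2) T(1,4,2)]
    have c: "b \<in> T \<Longrightarrow> cf x b \<in> carrier R" "b \<in> T \<Longrightarrow> cf y b \<in> carrier R"
      "b \<in> T \<Longrightarrow> b \<in> carrier P" "b \<in> T \<Longrightarrow> \<phi> b \<in> carrier D" for b
      using cfR xy T B \<phi> by auto
    have "x \<oplus>\<^bsub>P\<^esub> y = finsum P (\<lambda>b. cf x b \<odot>\<^bsub>P\<^esub> b \<oplus>\<^bsub>P\<^esub> cf y b \<odot>\<^bsub>P\<^esub> b) T"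
      using c by (subst P.M.finsum_addf) (auto simp flip: xr yr)
    also have "\<dots> = finsum P (\<lambda>b. (cf x b \<oplus>\<^bsub>R\<^esub> cf y b) \<odot>\<^bsub>P\<^esub> b) T"
      by (rule P.M.add.finprod_cong') (use c in \<open>auto simp: P.smult_l_distr\<close>)
    finally have "g (x \<oplus>\<^bsub>P\<^esub> y) = finsum D (\<lambda>b. (cf x b \<oplus>\<^bsub>R\<^esub> cf y b) \<odot>\<^bsub>D\<^esub> \<phi> b) T"
      using g_eval[OF T(1,2), of "\<lambda>b. cf x b \<oplus>\<^bsub>R\<^esub> cf y b"] c by simp
    also have "\<dots> = finsum D (\<lambda>b. cf x b \<odot>\<^bsub>D\<^esub> \<phi> b \<oplus>\<^bsub>D\<^esub> cf y b \<odot>\<^bsub>D\<^esub> \<phi> b) T"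
      by (rule D.M.add.finprod_cong') (use c in \<open>auto simp: D.smult_l_distr\<close>)
    also have "\<dots> = g x \<oplus>\<^bsub>D\<^esub> g y"
      using c g_eval[OF T(1,2), of "cf x"] g_eval[OF T(1,2), of "cf y"] xr yr
      by (subst D.M.finsum_addf) auto
    finally show "g (x \<oplus>\<^bsub>P\<^esub> y) = g x \<oplus>\<^bsub>D\<^esub> g y" .
  next
    fix r x assume rx: "r \<in> carrier R" "x \<in> carrier P"
    define T where "T = supp (cf x)"
    have T: "finite T" "T \<subseteq> B" "supp (cf x) \<subseteq> T" using fin rx sB by (auto simp: T_def)
    note xr = rep[OF rx(2) T(1,3,2)]
    have c: "b \<in> T \<Longrightarrow> cf x b \<in> carrier R"
      "b \<in> T \<Longrightarrow> b \<in> carrier P" "b \<in> T \<Longrightarrow> \<phi> b \<in> carrier D" for b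
      using cfR rx T B \<phi> by auto
    have smul: "r \<odot>\<^bsub>X\<^esub> finsum X (\<lambda>b. cf x b \<odot>\<^bsub>X\<^esub> u b) T = finsum X (\<lambda>b. (r \<otimes>\<^bsub>R\<^esub> cf x b) \<odot>\<^bsub>X\<^esub> u b) T"
      if X: "left_module R X" "\<And>b. b \<in> T \<Longrightarrow> u b \<in> carrier X" for u and X :: "('a, 'x, 'y) module_scheme"
    proof -
      interpret X: left_module R X by fact
      show ?thesis using T(1) c(1) X(2)
      proof (induction T rule: finite_induct)
        case empty then show ?case using rx by simp
      next
        case (insert b T)
        then show ?case using rx by (simp add: Pi_def X.smult_r_distr X.smult_assoc)
      qed
    qed
    have "r \<odot>\<^bsub>P\<^esub> x = finsum P (\<lambda>b. (r \<otimes>\<^bsub>R\<^esub> cf x b) \<odot>\<^bsub>P\<^esub> b) T"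
      using smul[OF P, of "\<lambda>b. b"] c(2) xr by simp
    then have "g (r \<odot>\<^bsub>P\<^esub> x) = finsum D (\<lambda>b. (r \<otimes>\<^bsub>R\<^esub> cf x b) \<odot>\<^bsub>D\<^esub> \<phi> b) T"
      using g_eval[OF T(1,2), of "\<lambda>b. r \<otimes>\<^bsub>R\<^esub> cf x b"] c rx by simp
    also have "\<dots> = r \<odot>\<^bsub>D\<^esub> g x"
      using smul[OF D, of \<phi>] c by (simp add: g_def T_def)
    finally show "g (r \<odot>\<^bsub>P\<^esub> x) = r \<odot>\<^bsub>D\<^esub> g x" .
  qed
  moreover have "\<psi> (g x) = f x" if x: "x \<in> carrier P" for x
  proof -
    define T where "T = supp (cf x)"
    have T: "finite T" "T \<subseteq> B" "supp (cf x) \<subseteq> T" using fin x sB by (auto simp: T_def)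
    note xr = rep[OF x T(1,3,2)]
    have c: "b \<in> T \<Longrightarrow> cf x b \<in> carrier R"
      "b \<in> T \<Longrightarrow> b \<in> carrier P" "b \<in> T \<Longrightarrow> \<phi> b \<in> carrier D" "b \<in> T \<Longrightarrow> \<psi> (\<phi> b) = f b" for b
      using cfR x T B \<phi> by auto
    have "\<psi> (g x) = finsum C (\<lambda>b. \<psi> (cf x b \<odot>\<^bsub>D\<^esub> \<phi> b)) T"
      unfolding g_def T_def[symmetric] using c by (intro linear_map_finsum[OF D C \<psi>]) auto
    also have "\<dots> = finsum C (\<lambda>b. f (cf x b \<odot>\<^bsub>P\<^esub> b)) T"
      by (rule C.M.add.finprod_cong') (use c linear_mapD[OF \<psi>] linear_mapD[OF f] in auto)
    also have "\<dots> = f x"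
      using c by (subst xr, intro linear_map_finsum[OF P C f, symmetric]) auto
    finally show ?thesis .
  qed
  ultimately show ?thesis by blast
qed

section \<open>Cohomology of a free resolution\<close>

text \<open>Only the values on \<open>P i\<close> matter here, whereas \<open>coboundaries\<close>
  consists of extensional functions.\<close>

fun is_coboundary :: "('a, 'b) ring_scheme \<Rightarrow> (nat \<Rightarrow> ('a, 'u) module) \<Rightarrow> (nat \<Rightarrow> 'u \<Rightarrow> 'u) \<Rightarrow>
    ('a, 'n) module \<Rightarrow> nat \<Rightarrow> ('u \<Rightarrow> 'n) \<Rightarrow> bool" where
  "is_coboundary R P d N 0 f \<longleftrightarrow> (\<forall>x\<in>carrier (P 0). f x = \<zero>\<^bsub>N\<^esub>)"
| "is_coboundary R P d N (Suc i) f \<longleftrightarrow>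
     (\<exists>g. linear_map R (P i) N g \<and> (\<forall>x\<in>carrier (P (Suc i)). f x = g (d i x)))"

definition cohomology_zero :: "('a, 'b) ring_scheme \<Rightarrow> (nat \<Rightarrow> ('a, 'u) module) \<Rightarrow>
    (nat \<Rightarrow> 'u \<Rightarrow> 'u) \<Rightarrow> ('a, 'n) module \<Rightarrow> nat \<Rightarrow> bool" where
  "cohomology_zero R P d N i \<longleftrightarrow> (\<forall>f. linear_map R (P i) N f \<and>
     (\<forall>x\<in>carrier (P (Suc i)). f (d i x) = \<zero>\<^bsub>N\<^esub>) \<longrightarrow> is_coboundary R P d N i f)"

text \<open>The sequence \<open>0 \<rightarrow> N \<rightarrow> N \<rightarrow> N' \<rightarrow> 0\<close>, whose maps are multiplication by \<open>z\<close> and \<open>\<pi>\<close>, is exact.\<close>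

definition mult_exact :: "('a, 'b) ring_scheme \<Rightarrow> 'a \<Rightarrow> ('a, 'n) module \<Rightarrow> ('a, 'p) module \<Rightarrow>
    ('n \<Rightarrow> 'p) \<Rightarrow> bool" where
  "mult_exact R z N N' \<pi> \<longleftrightarrow> linear_map R N N' \<pi> \<and> \<pi> ` carrier N = carrier N' \<and>
     (\<forall>x\<in>carrier N. \<pi> x = \<zero>\<^bsub>N'\<^esub> \<longleftrightarrow> (\<exists>y\<in>carrier N. x = z \<odot>\<^bsub>N\<^esub> y)) \<and>
     (\<forall>x\<in>carrier N. z \<odot>\<^bsub>N\<^esub> x = \<zero>\<^bsub>N\<^esub> \<longrightarrow> x = \<zero>\<^bsub>N\<^esub>)"

locale free_res =
  fixes R :: "('a, 'b) ring_scheme" and M :: "('a, 'm) module"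
    and P :: "nat \<Rightarrow> ('a, 'u) module" and d :: "nat \<Rightarrow> 'u \<Rightarrow> 'u"
  assumes M: "left_module R M" and res: "free_resolution R M P d"
begin

sublocale M: left_module R M by (rule M)

lemma P: "left_module R (P i)"
  using res by (simp add: free_resolution_def)

lemma P_lift:
  assumes "left_module R D" "left_module R C" "linear_map R D C \<psi>" "linear_map R (P i) C f"
    and "\<And>x. x \<in> carrier (P i) \<Longrightarrow> f x \<in> \<psi> ` carrier D"
  obtains g where "linear_map R (P i) D g" "\<And>x. x \<in> carrier (P i) \<Longrightarrow> \<psi> (g x) = f x"
proof -
  have "\<exists>B. is_basis R (P i) B" using res by (simp add: free_resolution_def)
  then obtain B where "is_basis R (P i) B" ..
  from free_lift[OF P assms(1,2) this assms(3-5)]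
  obtain g where "linear_map R (P i) D g" "\<forall>x\<in>carrier (P i). \<psi> (g x) = f x" by auto
  then show thesis by (intro that) auto
qed

lemma d: "linear_map R (P (Suc i)) (P i) (d i)"
  using res by (simp add: free_resolution_def module_hom_iff)

lemma d_closed: "x \<in> carrier (P (Suc i)) \<Longrightarrow> d i x \<in> carrier (P i)"
  using linear_mapD(1)[OF d] .

lemma d_image: "d (Suc i) ` carrier (P (Suc (Suc i))) = {x \<in> carrier (P (Suc i)). d i x = \<zero>\<^bsub>P i\<^esub>}"
  using res by (simp add: free_resolution_def)

lemma dd: "x \<in> carrier (P (Suc (Suc i))) \<Longrightarrow> d i (d (Suc i) x) = \<zero>\<^bsub>P i\<^esub>"
  using d_image[of i] by auto

lemma augmentation:
  obtains e where "linear_map R (P 0) M e" "e ` carrier (P 0) = carrier M"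
    "d 0 ` carrier (P (Suc 0)) = {x \<in> carrier (P 0). e x = \<zero>\<^bsub>M\<^esub>}"
  using res by (auto simp: free_resolution_def module_hom_iff)

lemma is_coboundary_cong:
  "\<lbrakk>is_coboundary R P d N i f; \<And>x. x \<in> carrier (P i) \<Longrightarrow> f x = g x\<rbrakk> \<Longrightarrow> is_coboundary R P d N i g"
  by (cases i) auto

lemma is_coboundary_d:
  assumes "left_module R N" "is_coboundary R P d N i f" "x \<in> carrier (P (Suc i))"
  shows "f (d i x) = \<zero>\<^bsub>N\<^esub>"
proof (cases i)
  case 0
  then show ?thesis using assms d_closed[of x 0] by auto
next
  case (Suc j)
  then show ?thesis
    using assms d_closed[of x i] dd[of x j] by (auto simp: linear_map_zero[OF P assms(1)])
qed

lemma is_coboundary_comp: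
  assumes "left_module R N" "left_module R N'" "linear_map R N N' \<pi>" "is_coboundary R P d N i f"
  shows "is_coboundary R P d N' i (\<lambda>x. \<pi> (f x))"
proof (cases i)
  case 0
  then show ?thesis using assms by (auto simp: linear_map_zero[OF assms(1,2)])
next
  case (Suc j)
  then obtain g where "linear_map R (P j) N g" "\<forall>x\<in>carrier (P (Suc j)). f x = g (d j x)"
    using assms(4) by auto
  then show ?thesis
    using Suc linear_map_comp[OF _ assms(3)] by (auto intro!: exI[of _ "\<lambda>x. \<pi> (g x)"])
qed

text \<open>The primitive of the coboundary lives on a free module and lifts along
  \<open>\<pi>\<close>. This allows a cochain to be changed by a coboundary so that its image under
  \<open>\<pi>\<close> becomes zero.\<close>

lemma is_coboundary_lift:
  assumes "left_module R N" "left_module R N'" "linear_map R N N' \<pi>" "\<pi> ` carrier N = carrier N'"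
    and "is_coboundary R P d N' i f"
  obtains g where "linear_map R (P i) N g" "is_coboundary R P d N i g"
    "\<And>x. x \<in> carrier (P i) \<Longrightarrow> \<pi> (g x) = f x"
proof (cases i)
  case 0
  show thesis
    by (rule that[of "\<lambda>x. \<zero>\<^bsub>N\<^esub>"])
       (use 0 assms linear_map_const_zero[OF P assms(1)] linear_map_zero[OF assms(1,2)] in auto)
next
  case (Suc j)
  then obtain h where h: "linear_map R (P j) N' h" "\<forall>x\<in>carrier (P (Suc j)). f x = h (d j x)"
    using assms(5) by auto
  have "h x \<in> \<pi> ` carrier N" if "x \<in> carrier (P j)" for x
    using linear_mapD(1)[OF h(1) that] assms(4) by simp
  then obtain g where g: "linear_map R (P j) N g" "\<And>x. x \<in> carrier (P j) \<Longrightarrow> \<pi> (g x) = h x"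
    using P_lift[OF assms(1-3) h(1)] by metis
  show thesis
    by (rule that[of "\<lambda>x. g (d j x)"])
       (use Suc g h linear_map_comp[OF d g(1)] d_closed in auto)
qed

lemma is_coboundary_diff:
  assumes N: "left_module R N" and "is_coboundary R P d N i f" "is_coboundary R P d N i g"
  shows "is_coboundary R P d N i (\<lambda>x. f x \<ominus>\<^bsub>N\<^esub> g x)"
proof -
  interpret N: left_module R N by (rule N)
  show ?thesis
  proof (cases i)
    case 0
    then show ?thesis using assms by auto
  next
    case (Suc j)
    then obtain u v where "linear_map R (P j) N u" "\<forall>x\<in>carrier (P (Suc j)). f x = u (d j x)"
      "linear_map R (P j) N v" "\<forall>x\<in>carrier (P (Suc j)). g x = v (d j x)"
      using assms by auto
    then show ?thesis
      using Suc linear_map_diff_fun[OF P N, of j u v]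
      by (auto intro!: exI[of _ "\<lambda>x. u x \<ominus>\<^bsub>N\<^esub> v x"])
  qed
qed

lemma is_coboundary_add:
  assumes N: "left_module R N" and "is_coboundary R P d N i f" "is_coboundary R P d N i g"
  shows "is_coboundary R P d N i (\<lambda>x. f x \<oplus>\<^bsub>N\<^esub> g x)"
proof -
  interpret N: left_module R N by (rule N)
  show ?thesis
  proof (cases i)
    case 0
    then show ?thesis using assms by auto
  next
    case (Suc j)
    then obtain u v where "linear_map R (P j) N u" "\<forall>x\<in>carrier (P (Suc j)). f x = u (d j x)"
      "linear_map R (P j) N v" "\<forall>x\<in>carrier (P (Suc j)). g x = v (d j x)"
      using assms by auto
    then show ?thesis
      using Suc linear_map_add_fun[OF P N, of j u v]
      by (auto intro!: exI[of _ "\<lambda>x. u x \<oplus>\<^bsub>N\<^esub> v x"])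
  qed
qed

lemma coboundaries_iff:
  assumes N: "left_module R N"
  shows "f \<in> coboundaries R P d N i \<longleftrightarrow>
    f \<in> extensional (carrier (P i)) \<and> is_coboundary R P d N i f"
proof (cases i)
  case 0
  then show ?thesis by (auto simp: fun_eq_iff extensional_def)
next
  case (Suc j)
  have "f \<in> coboundaries R P d N i" if "f \<in> extensional (carrier (P i))" "is_coboundary R P d N i f"
  proof -
    from that Suc obtain g where g: "linear_map R (P j) N g" "\<forall>x\<in>carrier (P (Suc j)). f x = g (d j x)"
      by auto
    let ?g = "restrict g (carrier (P j))"
    have "f = compose (carrier (P (Suc j))) ?g (d j)"
      using g that(1) Suc d_closed[of _ j] by (auto simp: fun_eq_iff compose_def extensional_def)
    then show ?thesis using restrict_module_hom[OF P g(1)] Suc by auto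
  qed
  moreover have "is_coboundary R P d N i f" if "f \<in> coboundaries R P d N i"
    using that Suc by (auto simp: module_hom_iff compose_def)
  moreover have "f \<in> extensional (carrier (P i))" if "f \<in> coboundaries R P d N i"
    using that Suc by (auto simp: compose_def)
  ultimately show ?thesis by blast
qed

lemma is_coboundary_linear:
  assumes N: "left_module R N" and f: "is_coboundary R P d N i f"
  shows "linear_map R (P i) N f"
proof (cases i)
  case 0
  then show ?thesis
    using f linear_map_cong[OF P linear_map_const_zero[OF P N], of i f] by auto
next
  case (Suc j)
  then obtain g where g: "linear_map R (P j) N g" "\<forall>x\<in>carrier (P (Suc j)). f x = g (d j x)"
    using f by auto
  then show ?thesis
    using Suc linear_map_cong[OF P linear_map_comp[OF d g(1)], of f] by auto
qed

lemma cohomology_zero_iff: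
  assumes N: "left_module R N"
  shows "cohomology_zero R P d N i \<longleftrightarrow> cocycles R P d N i \<subseteq> coboundaries R P d N i"
proof
  assume *: "cohomology_zero R P d N i"
  show "cocycles R P d N i \<subseteq> coboundaries R P d N i"
    using * by (auto simp: cocycles_def cohomology_zero_def coboundaries_iff[OF N] module_hom_iff)
next
  assume *: "cocycles R P d N i \<subseteq> coboundaries R P d N i"
  show "cohomology_zero R P d N i"
    unfolding cohomology_zero_def
  proof (intro allI impI, elim conjE)
    fix f assume f: "linear_map R (P i) N f" "\<forall>x\<in>carrier (P (Suc i)). f (d i x) = \<zero>\<^bsub>N\<^esub>"
    then have "restrict f (carrier (P i)) \<in> cocycles R P d N i"
      using restrict_module_hom[OF P f(1)] d_closed by (simp add: cocycles_def)
    with * have "is_coboundary R P d N i (restrict f (carrier (P i)))"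
      using coboundaries_iff[OF N] by blast
    then show "is_coboundary R P d N i f" by (rule is_coboundary_cong) simp
  qed
qed

text \<open>Degree 0 computes homomorphisms out of \<open>M\<close>: a cocycle on \<open>P 0\<close>
  is constant on the fibres of the augmentation \<open>e\<close>, so composing it with any
  set-theoretic section \<open>s\<close> of \<open>e\<close> gives a linear map on
  \<open>M\<close>.\<close>

lemma cohomology_zero_0_iff:
  assumes N: "left_module R N"
  shows "cohomology_zero R P d N 0 \<longleftrightarrow>
    (\<forall>h. linear_map R M N h \<longrightarrow> (\<forall>x\<in>carrier M. h x = \<zero>\<^bsub>N\<^esub>))"
proof -
  obtain e where e: "linear_map R (P 0) M e" "e ` carrier (P 0) = carrier M"
    "d 0 ` carrier (P (Suc 0)) = {x \<in> carrier (P 0). e x = \<zero>\<^bsub>M\<^esub>}"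
    by (rule augmentation)
  interpret P0: left_module R "P 0" by (rule P)
  interpret N: left_module R N by (rule N)
  show ?thesis
  proof (intro iffI allI impI ballI)
    fix h x assume *: "cohomology_zero R P d N 0" and h: "linear_map R M N h" and x: "x \<in> carrier M"
    have "\<forall>y\<in>carrier (P 0). h (e y) = \<zero>\<^bsub>N\<^esub>"
    proof -
      have "e (d 0 y) = \<zero>\<^bsub>M\<^esub>" if "y \<in> carrier (P (Suc 0))" for y using e(3) that by auto
      then have "\<forall>y\<in>carrier (P (Suc 0)). h (e (d 0 y)) = \<zero>\<^bsub>N\<^esub>" using linear_map_zero[OF M N h] by simp
      then show ?thesis
        using *[unfolded cohomology_zero_def, rule_format, of "\<lambda>x. h (e x)"] linear_map_comp[OF e(1) h] by simp
    qed
    then have "\<forall>y\<in>e ` carrier (P 0). h y = \<zero>\<^bsub>N\<^esub>" by simp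
    then show "h x = \<zero>\<^bsub>N\<^esub>" using x unfolding e(2) by blast
  next
    assume *: "\<forall>h. linear_map R M N h \<longrightarrow> (\<forall>x\<in>carrier M. h x = \<zero>\<^bsub>N\<^esub>)"
    show "cohomology_zero R P d N 0"
      unfolding cohomology_zero_def
    proof (intro allI impI, elim conjE)
      fix f assume f: "linear_map R (P 0) N f" "\<forall>x\<in>carrier (P (Suc 0)). f (d 0 x) = \<zero>\<^bsub>N\<^esub>"
      define s where "s x = (SOME y. y \<in> carrier (P 0) \<and> e y = x)" for x
      have s: "s x \<in> carrier (P 0) \<and> e (s x) = x" if "x \<in> carrier M" for x
      proof -
        have "\<exists>y. y \<in> carrier (P 0) \<and> e y = x" using that unfolding e(2)[symmetric] by blast
        then show ?thesis unfolding s_def by (rule someI_ex)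
      qed
      have fe: "f y = f y'" if "y \<in> carrier (P 0)" "y' \<in> carrier (P 0)" "e y = e y'" for y y'
      proof -
        have "e (y \<ominus>\<^bsub>P 0\<^esub> y') = \<zero>\<^bsub>M\<^esub>"
          using that linear_map_diff[OF P M e(1)] linear_mapD(1)[OF e(1)] by simp
        then have "y \<ominus>\<^bsub>P 0\<^esub> y' \<in> d 0 ` carrier (P (Suc 0))" using e(3) that by simp
        then have "f (y \<ominus>\<^bsub>P 0\<^esub> y') = \<zero>\<^bsub>N\<^esub>" using f(2) by auto
        then show ?thesis
          using that linear_map_diff[OF P N f(1)] linear_mapD(1)[OF f(1)] by simp
      qed
      have "linear_map R M N (\<lambda>x. f (s x))"
      proof (rule linear_mapI)
        show "f (s x) \<in> carrier N" if "x \<in> carrier M" for x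
          using s[OF that] linear_mapD(1)[OF f(1)] by auto
        show "f (s (x \<oplus>\<^bsub>M\<^esub> y)) = f (s x) \<oplus>\<^bsub>N\<^esub> f (s y)" if "x \<in> carrier M" "y \<in> carrier M" for x y
          using that s linear_mapD(2)[OF e(1)]
          by (subst linear_mapD(2)[OF f(1), symmetric]) (auto intro!: fe)
        show "f (s (r \<odot>\<^bsub>M\<^esub> x)) = r \<odot>\<^bsub>N\<^esub> f (s x)" if "r \<in> carrier R" "x \<in> carrier M" for r x
          using that s linear_mapD(3)[OF e(1)]
          by (subst linear_mapD(3)[OF f(1), symmetric]) (auto intro!: fe)
      qed
      with * have "\<forall>x\<in>carrier M. f (s x) = \<zero>\<^bsub>N\<^esub>" by blast
      then have "f y = \<zero>\<^bsub>N\<^esub>" if "y \<in> carrier (P 0)" for y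
        using fe[of y "s (e y)"] s[of "e y"] that linear_mapD(1)[OF e(1) that] by auto
      then show "is_coboundary R P d N 0 f" by simp
    qed
  qed
qed

text \<open>Multiplication by \<open>z\<close> and the zero map both lift the zero map of
  \<open>M\<close> to the resolution, so they are homotopic. The summand \<open>r\<close> is the
  term s d from the preceding degree; calling it a coboundary gives degree 0, where it is zero, the
  same shape.\<close>

lemma null_homotopy:
  assumes z: "z \<in> carrier R" "\<And>r. r \<in> carrier R \<Longrightarrow> z \<otimes>\<^bsub>R\<^esub> r = r \<otimes>\<^bsub>R\<^esub> z"
    and zM: "\<And>x. x \<in> carrier M \<Longrightarrow> z \<odot>\<^bsub>M\<^esub> x = \<zero>\<^bsub>M\<^esub>"
  shows "\<exists>s r. linear_map R (P i) (P (Suc i)) s \<and> linear_map R (P i) (P i) r \<and>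
    is_coboundary R P d (P i) i r \<and>
    (\<forall>x\<in>carrier (P i). z \<odot>\<^bsub>P i\<^esub> x = d i (s x) \<oplus>\<^bsub>P i\<^esub> r x)"
proof (induction i)
  case 0
  interpret P: left_module R "P 0" by (rule P)
  interpret P1: left_module R "P (Suc 0)" by (rule P)
  obtain e where e: "linear_map R (P 0) M e" "e ` carrier (P 0) = carrier M"
    "d 0 ` carrier (P (Suc 0)) = {x \<in> carrier (P 0). e x = \<zero>\<^bsub>M\<^esub>}"
    by (rule augmentation)
  have "linear_map R (P 0) (P 0) (\<lambda>x. x)" by (rule linear_mapI) auto
  then have zl: "linear_map R (P 0) (P 0) (\<lambda>x. z \<odot>\<^bsub>P 0\<^esub> x)"
    by (rule linear_map_smult_fun[OF P P _ z])
  have "z \<odot>\<^bsub>P 0\<^esub> x \<in> d 0 ` carrier (P (Suc 0))" if "x \<in> carrier (P 0)" for x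
    using that z(1) zM linear_mapD(1,3)[OF e(1)] unfolding e(3) by auto
  then obtain s where s: "linear_map R (P 0) (P (Suc 0)) s"
    "\<And>x. x \<in> carrier (P 0) \<Longrightarrow> d 0 (s x) = z \<odot>\<^bsub>P 0\<^esub> x"
    using P_lift[OF P P d zl] by metis
  show ?case
    by (rule exI[of _ s], rule exI[of _ "\<lambda>x. \<zero>\<^bsub>P 0\<^esub>"])
       (use s z linear_map_const_zero[OF P P] in auto)
next
  case (Suc i)
  interpret P: left_module R "P i" by (rule P)
  interpret P1: left_module R "P (Suc i)" by (rule P)
  from Suc obtain s r where s: "linear_map R (P i) (P (Suc i)) s" and r: "linear_map R (P i) (P i) r"
    "is_coboundary R P d (P i) i r"
    and sr: "\<And>x. x \<in> carrier (P i) \<Longrightarrow> z \<odot>\<^bsub>P i\<^esub> x = d i (s x) \<oplus>\<^bsub>P i\<^esub> r x" by metis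
  have "linear_map R (P (Suc i)) (P (Suc i)) (\<lambda>x. x)" by (rule linear_mapI) auto
  then have "linear_map R (P (Suc i)) (P (Suc i)) (\<lambda>x. z \<odot>\<^bsub>P (Suc i)\<^esub> x)"
    by (rule linear_map_smult_fun[OF P P _ z])
  then have zl: "linear_map R (P (Suc i)) (P (Suc i)) (\<lambda>x. z \<odot>\<^bsub>P (Suc i)\<^esub> x \<ominus>\<^bsub>P (Suc i)\<^esub> s (d i x))"
    by (rule linear_map_diff_fun[OF P P _ linear_map_comp[OF d s]])
  have "z \<odot>\<^bsub>P (Suc i)\<^esub> x \<ominus>\<^bsub>P (Suc i)\<^esub> s (d i x) \<in> d (Suc i) ` carrier (P (Suc (Suc i)))"
    if x: "x \<in> carrier (P (Suc i))" for x
  proof -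
    have dx: "d i x \<in> carrier (P i)" "s (d i x) \<in> carrier (P (Suc i))"
      using x d_closed linear_mapD(1)[OF s] by auto
    \<comment> \<open>Both terms agree after \<open>d i\<close> because the \<open>r\<close> of the
      induction hypothesis vanishes on boundaries; exactness then provides values for
      \<open>t\<close>.\<close>
    have "d i (z \<odot>\<^bsub>P (Suc i)\<^esub> x \<ominus>\<^bsub>P (Suc i)\<^esub> s (d i x)) = z \<odot>\<^bsub>P i\<^esub> d i x \<ominus>\<^bsub>P i\<^esub> d i (s (d i x))"
      using x dx z(1) by (simp add: linear_map_diff[OF P P d] linear_mapD(3)[OF d])
    also have "z \<odot>\<^bsub>P i\<^esub> d i x = d i (s (d i x))"
      using sr[OF dx(1)] is_coboundary_d[OF P r(2) x] dx d_closed by simp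
    finally show ?thesis using x dx z(1) d_closed unfolding d_image by simp
  qed
  then obtain t where t: "linear_map R (P (Suc i)) (P (Suc (Suc i))) t"
    "\<And>x. x \<in> carrier (P (Suc i)) \<Longrightarrow>
      d (Suc i) (t x) = z \<odot>\<^bsub>P (Suc i)\<^esub> x \<ominus>\<^bsub>P (Suc i)\<^esub> s (d i x)"
    using P_lift[OF P P d zl] by metis
  show ?case
  proof (rule exI[of _ t], rule exI[of _ "\<lambda>x. s (d i x)"], intro conjI ballI)
    show "linear_map R (P (Suc i)) (P (Suc (Suc i))) t" by (rule t)
    show "linear_map R (P (Suc i)) (P (Suc i)) (\<lambda>x. s (d i x))" by (rule linear_map_comp[OF d s])
    show "is_coboundary R P d (P (Suc i)) (Suc i) (\<lambda>x. s (d i x))" using s by auto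
    fix x assume x: "x \<in> carrier (P (Suc i))"
    then have "z \<odot>\<^bsub>P (Suc i)\<^esub> x \<in> carrier (P (Suc i))" "s (d i x) \<in> carrier (P (Suc i))"
      using z d_closed linear_mapD(1)[OF s] by auto
    then show "z \<odot>\<^bsub>P (Suc i)\<^esub> x = d (Suc i) (t x) \<oplus>\<^bsub>P (Suc i)\<^esub> s (d i x)"
      using t(2)[OF x] P1.M.diff_eq_iff by (metis P1.M.minus_closed)
  qed
qed

text \<open>Composing a cocycle \<open>f\<close> with z = d s + r kills the first summand, and
  \<open>f\<close> composed with the coboundary \<open>r\<close> is a coboundary. Thus
  \<open>z\<close> annihilates every Ext group of \<open>M\<close>.\<close>

lemma smult_is_coboundary:
  assumes z: "z \<in> carrier R" "\<And>r. r \<in> carrier R \<Longrightarrow> z \<otimes>\<^bsub>R\<^esub> r = r \<otimes>\<^bsub>R\<^esub> z"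
    and zM: "\<And>x. x \<in> carrier M \<Longrightarrow> z \<odot>\<^bsub>M\<^esub> x = \<zero>\<^bsub>M\<^esub>"
    and N: "left_module R N" and f: "linear_map R (P i) N f"
      "\<And>x. x \<in> carrier (P (Suc i)) \<Longrightarrow> f (d i x) = \<zero>\<^bsub>N\<^esub>"
  shows "is_coboundary R P d N i (\<lambda>x. z \<odot>\<^bsub>N\<^esub> f x)"
proof -
  interpret N: left_module R N by (rule N)
  obtain s r where s: "linear_map R (P i) (P (Suc i)) s" and r: "linear_map R (P i) (P i) r"
    "is_coboundary R P d (P i) i r"
    and sr: "\<And>x. x \<in> carrier (P i) \<Longrightarrow> z \<odot>\<^bsub>P i\<^esub> x = d i (s x) \<oplus>\<^bsub>P i\<^esub> r x"
    using null_homotopy[OF z zM, of i] by metis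
  have "is_coboundary R P d N i (\<lambda>x. f (r x))"
    by (rule is_coboundary_comp[OF P N f(1) r(2)])
  then show ?thesis
  proof (rule is_coboundary_cong)
    fix x assume x: "x \<in> carrier (P i)"
    have c: "s x \<in> carrier (P (Suc i))" "r x \<in> carrier (P i)" "d i (s x) \<in> carrier (P i)"
      using x linear_mapD(1)[OF s] linear_mapD(1)[OF r(1)] d_closed by auto
    have "z \<odot>\<^bsub>N\<^esub> f x = f (d i (s x) \<oplus>\<^bsub>P i\<^esub> r x)"
      using sr[OF x] linear_mapD(3)[OF f(1) z(1) x] by simp
    also have "\<dots> = f (r x)"
      using c f(2)[of "s x"] linear_mapD(1,2)[OF f(1)] by simp
    finally show "f (r x) = z \<odot>\<^bsub>N\<^esub> f x" by simp
  qed
qed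

text \<open>On the zero module even \<open>\<one>\<close> acts as zero, so \<open>\<one>\<close>
  times any cocycle is a coboundary.\<close>

lemma cohomology_zero_of_zero_module:
  assumes "carrier M = {\<zero>\<^bsub>M\<^esub>}" and N: "left_module R N"
  shows "cohomology_zero R P d N i"
  unfolding cohomology_zero_def
proof (intro allI impI, elim conjE)
  interpret N: left_module R N by (rule N)
  fix f assume f: "linear_map R (P i) N f" "\<forall>x\<in>carrier (P (Suc i)). f (d i x) = \<zero>\<^bsub>N\<^esub>"
  have "is_coboundary R P d N i (\<lambda>x. \<one>\<^bsub>R\<^esub> \<odot>\<^bsub>N\<^esub> f x)"
    by (rule smult_is_coboundary[OF _ _ _ N f(1)]) (use assms f(2) in auto)
  then show "is_coboundary R P d N i f"
    by (rule is_coboundary_cong) (use linear_mapD(1)[OF f(1)] in simp)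
qed

section \<open>Change of rings along a central element that kills M and is regular on N\<close>

context
  fixes z and N :: "('a, 'n) module" and N' :: "('a, 'p) module" and \<pi>
  assumes z: "z \<in> carrier R" "\<And>r. r \<in> carrier R \<Longrightarrow> z \<otimes>\<^bsub>R\<^esub> r = r \<otimes>\<^bsub>R\<^esub> z"
    and zM: "\<And>x. x \<in> carrier M \<Longrightarrow> z \<odot>\<^bsub>M\<^esub> x = \<zero>\<^bsub>M\<^esub>"
    and N: "left_module R N" and N': "left_module R N'" and ex: "mult_exact R z N N' \<pi>"
begin

interpretation N: left_module R N by (rule N)
interpretation N': left_module R N' by (rule N')

private lemma \<pi>: "linear_map R N N' \<pi>" "\<pi> ` carrier N = carrier N'"
  using ex by (auto simp: mult_exact_def)

private lemma \<pi>_z: "x \<in> carrier N \<Longrightarrow> \<pi> (z \<odot>\<^bsub>N\<^esub> x) = \<zero>\<^bsub>N'\<^esub>"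
  using ex z(1) unfolding mult_exact_def by blast

private lemma z_cancel: "\<lbrakk>x \<in> carrier N; y \<in> carrier N; z \<odot>\<^bsub>N\<^esub> x = z \<odot>\<^bsub>N\<^esub> y\<rbrakk> \<Longrightarrow> x = y"
proof -
  assume xy: "x \<in> carrier N" "y \<in> carrier N" "z \<odot>\<^bsub>N\<^esub> x = z \<odot>\<^bsub>N\<^esub> y"
  then have "z \<odot>\<^bsub>N\<^esub> (x \<ominus>\<^bsub>N\<^esub> y) = \<zero>\<^bsub>N\<^esub>" using z by (simp add: N.smult_r_diff)
  then have "x \<ominus>\<^bsub>N\<^esub> y = \<zero>\<^bsub>N\<^esub>" using ex xy by (simp add: mult_exact_def)
  then show "x = y" using xy by simp
qed

private lemma divide_by_z:
  assumes L: "left_module R L" and f: "linear_map R L N f" "\<And>x. x \<in> carrier L \<Longrightarrow> \<pi> (f x) = \<zero>\<^bsub>N'\<^esub>"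
  obtains g where "linear_map R L N g" "\<And>x. x \<in> carrier L \<Longrightarrow> f x = z \<odot>\<^bsub>N\<^esub> g x"
proof -
  interpret L: left_module R L by (rule L)
  have "\<exists>y. y \<in> carrier N \<and> f x = z \<odot>\<^bsub>N\<^esub> y" if "x \<in> carrier L" for x
    using ex f(2)[OF that] linear_mapD(1)[OF f(1) that] by (auto simp: mult_exact_def)
  then obtain g where g: "\<And>x. x \<in> carrier L \<Longrightarrow> g x \<in> carrier N"
    "\<And>x. x \<in> carrier L \<Longrightarrow> f x = z \<odot>\<^bsub>N\<^esub> g x" by metis
  have "linear_map R L N g"
  proof (rule linear_mapI)
    fix x y assume xy: "x \<in> carrier L" "y \<in> carrier L"
    show "g (x \<oplus>\<^bsub>L\<^esub> y) = g x \<oplus>\<^bsub>N\<^esub> g y"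
    proof (rule z_cancel)
      show "z \<odot>\<^bsub>N\<^esub> g (x \<oplus>\<^bsub>L\<^esub> y) = z \<odot>\<^bsub>N\<^esub> (g x \<oplus>\<^bsub>N\<^esub> g y)"
        using linear_mapD(2)[OF f(1) xy] xy g(1) z(1) by (simp add: N.smult_r_distr flip: g(2))
    qed (use xy g(1) in auto)
  next
    fix r x assume rx: "r \<in> carrier R" "x \<in> carrier L"
    have "z \<odot>\<^bsub>N\<^esub> (r \<odot>\<^bsub>N\<^esub> g x) = r \<odot>\<^bsub>N\<^esub> (z \<odot>\<^bsub>N\<^esub> g x)"
      using N.smult_assoc[OF z(1) rx(1) g(1)[OF rx(2)]] N.smult_assoc[OF rx(1) z(1) g(1)[OF rx(2)]]
        z(2)[OF rx(1)] by simp
    also have "\<dots> = f (r \<odot>\<^bsub>L\<^esub> x)" using linear_mapD(3)[OF f(1) rx] g(2)[OF rx(2)] by simp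
    also have "\<dots> = z \<odot>\<^bsub>N\<^esub> g (r \<odot>\<^bsub>L\<^esub> x)" using rx by (intro g(2)) simp
    finally show "g (r \<odot>\<^bsub>L\<^esub> x) = r \<odot>\<^bsub>N\<^esub> g x"
      by (rule z_cancel[symmetric, rotated 2]) (use rx g(1) in simp_all)
  qed (rule g)
  then show thesis using g that by blast
qed

text \<open>\<open>z\<close> acts injectively on \<open>N\<close>, yet it annihilates degree 0 by
  \<open>smult_is_coboundary\<close>.\<close>

lemma cohomology_zero_0: "cohomology_zero R P d N 0"
  unfolding cohomology_zero_def
proof (intro allI impI, elim conjE)
  fix f assume f: "linear_map R (P 0) N f" "\<forall>x\<in>carrier (P (Suc 0)). f (d 0 x) = \<zero>\<^bsub>N\<^esub>"
  have "is_coboundary R P d N 0 (\<lambda>x. z \<odot>\<^bsub>N\<^esub> f x)"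
    by (rule smult_is_coboundary[OF z zM N f(1)]) (use f(2) in auto)
  then show "is_coboundary R P d N 0 f"
    using z_cancel[of _ "\<zero>\<^bsub>N\<^esub>"] linear_mapD(1)[OF f(1)] z by simp
qed

text \<open>In the long exact sequence of 0 -> N -> N -> N' -> 0 the maps induced by
  \<open>z\<close> vanish, so the connecting map from degree \<open>i\<close> of \<open>N'\<close>
  to degree \<open>Suc i\<close> of \<open>N\<close> is onto. Concretely, a primitive of
  \<open>z\<close> times the cocycle is made divisible by \<open>z\<close>.\<close>

lemma cohomology_zero_Suc:
  assumes "cohomology_zero R P d N' i"
  shows "cohomology_zero R P d N (Suc i)"
  unfolding cohomology_zero_def
proof (intro allI impI, elim conjE)
  fix f assume f: "linear_map R (P (Suc i)) N f" "\<forall>x\<in>carrier (P (Suc (Suc i))). f (d (Suc i) x) = \<zero>\<^bsub>N\<^esub>"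
  have "is_coboundary R P d N (Suc i) (\<lambda>x. z \<odot>\<^bsub>N\<^esub> f x)"
    by (rule smult_is_coboundary[OF z zM N f(1)]) (use f(2) in auto)
  then obtain g where g: "linear_map R (P i) N g" "\<And>x. x \<in> carrier (P (Suc i)) \<Longrightarrow> z \<odot>\<^bsub>N\<^esub> f x = g (d i x)"
    by auto
  have "\<pi> (g (d i x)) = \<zero>\<^bsub>N'\<^esub>" if "x \<in> carrier (P (Suc i))" for x
    using \<pi>_z[OF linear_mapD(1)[OF f(1) that]] g(2)[OF that] by simp
  then have "is_coboundary R P d N' i (\<lambda>x. \<pi> (g x))"
    using assms linear_map_comp[OF g(1) \<pi>(1)] by (simp add: cohomology_zero_def)
  then obtain h where h: "linear_map R (P i) N h" "is_coboundary R P d N i h"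
    "\<And>x. x \<in> carrier (P i) \<Longrightarrow> \<pi> (h x) = \<pi> (g x)"
    by (rule is_coboundary_lift[OF N N' \<pi>]) blast
  \<comment> \<open>Subtracting the coboundary \<open>h\<close> does not change the composite of
    \<open>g\<close> with \<open>d i\<close>, but makes \<open>g\<close> divisible by
    \<open>z\<close>; the quotient \<open>k\<close> is the primitive of \<open>f\<close>.\<close>
  have "\<pi> (g x \<ominus>\<^bsub>N\<^esub> h x) = \<zero>\<^bsub>N'\<^esub>" if "x \<in> carrier (P i)" for x
    using that h(3) linear_mapD(1)[OF g(1) that] linear_mapD(1)[OF h(1) that] linear_mapD(1)[OF \<pi>(1)]
    by (simp add: linear_map_diff[OF N N' \<pi>(1)])
  then obtain k where k: "linear_map R (P i) N k" "\<And>x. x \<in> carrier (P i) \<Longrightarrow> g x \<ominus>\<^bsub>N\<^esub> h x = z \<odot>\<^bsub>N\<^esub> k x"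
    using divide_by_z[OF P linear_map_diff_fun[OF P N g(1) h(1)]] by metis
  have "f x = k (d i x)" if x: "x \<in> carrier (P (Suc i))" for x
  proof (rule z_cancel)
    have dx: "d i x \<in> carrier (P i)" using x by (rule d_closed)
    have "z \<odot>\<^bsub>N\<^esub> k (d i x) = g (d i x) \<ominus>\<^bsub>N\<^esub> h (d i x)" using k(2)[OF dx] by simp
    also have "\<dots> = g (d i x)"
      using is_coboundary_d[OF N h(2) x] linear_mapD(1)[OF g(1) dx] by (simp add: N.M.minus_eq)
    finally show "z \<odot>\<^bsub>N\<^esub> f x = z \<odot>\<^bsub>N\<^esub> k (d i x)" using g(2)[OF x] by simp
    show "f x \<in> carrier N" "k (d i x) \<in> carrier N"
      using x dx linear_mapD(1)[OF f(1)] linear_mapD(1)[OF k(1)] by auto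
  qed
  then show "is_coboundary R P d N (Suc i) f" using k(1) by auto
qed

text \<open>Degree \<open>i\<close> of \<open>N'\<close> sits between degrees \<open>i\<close> and
  \<open>Suc i\<close> of \<open>N\<close> in the same long exact sequence.\<close>

lemma cohomology_zero_quotient:
  assumes "cohomology_zero R P d N i" "cohomology_zero R P d N (Suc i)"
  shows "cohomology_zero R P d N' i"
  unfolding cohomology_zero_def
proof (intro allI impI, elim conjE)
  fix f' assume f': "linear_map R (P i) N' f'" "\<forall>x\<in>carrier (P (Suc i)). f' (d i x) = \<zero>\<^bsub>N'\<^esub>"
  have "f' x \<in> \<pi> ` carrier N" if "x \<in> carrier (P i)" for x
    using \<pi>(2) linear_mapD(1)[OF f'(1) that] by simp
  then obtain f where f: "linear_map R (P i) N f" "\<And>x. x \<in> carrier (P i) \<Longrightarrow> \<pi> (f x) = f' x"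
    using P_lift[OF N N' \<pi>(1) f'(1)] by metis
  have "\<pi> (f (d i x)) = \<zero>\<^bsub>N'\<^esub>" if "x \<in> carrier (P (Suc i))" for x
    using that f(2) f'(2) d_closed by simp
  then obtain g where g: "linear_map R (P (Suc i)) N g"
    "\<And>x. x \<in> carrier (P (Suc i)) \<Longrightarrow> f (d i x) = z \<odot>\<^bsub>N\<^esub> g x"
    using divide_by_z[OF P linear_map_comp[OF d f(1)]] by metis
  have "g (d (Suc i) x) = \<zero>\<^bsub>N\<^esub>" if x: "x \<in> carrier (P (Suc (Suc i)))" for x
  proof (rule z_cancel)
    show "z \<odot>\<^bsub>N\<^esub> g (d (Suc i) x) = z \<odot>\<^bsub>N\<^esub> \<zero>\<^bsub>N\<^esub>"
      using linear_map_zero[OF P N f(1)] z(1) by (simp add: dd[OF x] flip: g(2)[OF d_closed[OF x]])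
  qed (use linear_mapD(1)[OF g(1) d_closed[OF x]] in auto)
  then have "is_coboundary R P d N (Suc i) g"
    using assms(2) g(1) by (simp add: cohomology_zero_def)
  then obtain h where h: "linear_map R (P i) N h" "\<And>x. x \<in> carrier (P (Suc i)) \<Longrightarrow> g x = h (d i x)"
    by auto
  \<comment> \<open>With f d = z g and g = h d, the correction by z h turns the lift
    \<open>f\<close> into a cocycle, and \<open>\<pi>\<close> does not see it.\<close>
  define k where "k x = f x \<ominus>\<^bsub>N\<^esub> z \<odot>\<^bsub>N\<^esub> h x" for x
  have k: "linear_map R (P i) N k"
    unfolding k_def by (rule linear_map_diff_fun[OF P N f(1) linear_map_smult_fun[OF P N h(1) z]])
  have "k (d i x) = \<zero>\<^bsub>N\<^esub>" if "x \<in> carrier (P (Suc i))" for x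
    using g(2)[OF that] h(2)[OF that] linear_mapD(1)[OF h(1) d_closed[OF that]] z by (simp add: k_def)
  then have "is_coboundary R P d N i k" using assms(1) k by (simp add: cohomology_zero_def)
  then have "is_coboundary R P d N' i (\<lambda>x. \<pi> (k x))" by (rule is_coboundary_comp[OF N N' \<pi>(1)])
  then show "is_coboundary R P d N' i f'"
  proof (rule is_coboundary_cong)
    fix x assume x: "x \<in> carrier (P i)"
    have c: "f x \<in> carrier N" "h x \<in> carrier N" "f' x \<in> carrier N'"
      using x linear_mapD(1)[OF f(1)] linear_mapD(1)[OF h(1)] linear_mapD(1)[OF f'(1)] by auto
    then have "\<pi> (k x) = \<pi> (f x) \<ominus>\<^bsub>N'\<^esub> \<zero>\<^bsub>N'\<^esub>"
      using z by (simp add: k_def linear_map_diff[OF N N' \<pi>(1)] \<pi>_z)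
    then show "\<pi> (k x) = f' x" using f(2)[OF x] c by (simp add: N'.M.minus_eq)
  qed
qed

end

lemma cohomology_zero_iso:
  assumes N: "left_module R N" and N': "left_module R N'" and \<pi>: "linear_map R N N' \<pi>"
    and bij: "bij_betw \<pi> (carrier N) (carrier N')"
  shows "cohomology_zero R P d N i \<longleftrightarrow> cohomology_zero R P d N' i"
proof -
  interpret N: left_module R N by (rule N)
  interpret N': left_module R N' by (rule N')
  have aux: "cohomology_zero R P d A i"
    if A: "left_module R A" and B: "left_module R B" and p: "linear_map R A B p"
      and q: "linear_map R B A q" "\<And>x. x \<in> carrier A \<Longrightarrow> q (p x) = x"
      and *: "cohomology_zero R P d B i"
    for A :: "('a, 'x) module" and B :: "('a, 'y) module" and p q
    unfolding cohomology_zero_def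
  proof (intro allI impI, elim conjE)
    fix f assume f: "linear_map R (P i) A f" "\<forall>x\<in>carrier (P (Suc i)). f (d i x) = \<zero>\<^bsub>A\<^esub>"
    have "is_coboundary R P d B i (\<lambda>x. p (f x))"
      using * linear_map_comp[OF f(1) p] f(2) linear_map_zero[OF A B p] by (simp add: cohomology_zero_def)
    then have "is_coboundary R P d A i (\<lambda>x. q (p (f x)))" by (rule is_coboundary_comp[OF B A q(1)])
    then show "is_coboundary R P d A i f"
      by (rule is_coboundary_cong) (use q(2) linear_mapD(1)[OF f(1)] in simp)
  qed
  define q where "q = inv_into (carrier N) \<pi>"
  have q: "q y \<in> carrier N" "\<pi> (q y) = y" if "y \<in> carrier N'" for y
    using bij that by (auto simp: q_def bij_betw_def inv_into_into f_inv_into_f)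
  have q': "q (\<pi> x) = x" if "x \<in> carrier N" for x
    using bij that by (auto simp: q_def bij_betw_def)
  have "linear_map R N' N q"
  proof (rule linear_mapI)
    show "q (x \<oplus>\<^bsub>N'\<^esub> y) = q x \<oplus>\<^bsub>N\<^esub> q y" if "x \<in> carrier N'" "y \<in> carrier N'" for x y
      using q'[of "q x \<oplus>\<^bsub>N\<^esub> q y"] linear_mapD(2)[OF \<pi>, of "q x" "q y"] that q by simp
    show "q (r \<odot>\<^bsub>N'\<^esub> x) = r \<odot>\<^bsub>N\<^esub> q x" if "r \<in> carrier R" "x \<in> carrier N'" for r x
      using q'[of "r \<odot>\<^bsub>N\<^esub> q x"] linear_mapD(3)[OF \<pi>, of r "q x"] that q by simp
  qed (use q in auto)
  then show ?thesis
    using aux[OF N N' \<pi> _ q'] aux[OF N' N _ \<pi> q(2)] by blast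
qed

end

text \<open>The carrier of the factor group is examined coset by coset: each cocycle lies in its own
  coset, and the coset of a coboundary is the set of all coboundaries.\<close>

lemma Ext_nonzero_iff:
  assumes M: "left_module R M" and N: "left_module R N"
    and Pd: "some_resolution R M = (P, d)" and res: "free_resolution R M P d"
  shows "carrier (Ext R i M N) \<noteq> {\<one>\<^bsub>Ext R i M N\<^esub>} \<longleftrightarrow> \<not> cohomology_zero R P d N i"
proof -
  interpret N: left_module R N by (rule N)
  interpret free_res R M P d by (rule free_res.intro[OF M res])
  define G where "G = (hom_group R (P i) N)\<lparr>carrier := cocycles R P d N i\<rparr>"
  define H where "H = coboundaries R P d N i"
  have E: "Ext R i M N = G Mod H" using Pd by (simp add: Ext_def G_def H_def)
  have coset: "H #>\<^bsub>G\<^esub> a = (\<lambda>h. \<lambda>x\<in>carrier (P i). h x \<oplus>\<^bsub>N\<^esub> a x) ` H" for a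
    by (auto simp: r_coset_def G_def hom_group_def)
  have zero: "(\<lambda>x\<in>carrier (P i). \<zero>\<^bsub>N\<^esub>) \<in> H"
  proof -
    have "is_coboundary R P d N i (\<lambda>x. \<zero>\<^bsub>N\<^esub>)"
      using linear_map_const_zero[OF P N] by (cases i) auto
    then have "is_coboundary R P d N i (\<lambda>x\<in>carrier (P i). \<zero>\<^bsub>N\<^esub>)" by (rule is_coboundary_cong) simp
    then show ?thesis by (simp add: H_def coboundaries_iff[OF N])
  qed
  have HG: "H \<subseteq> cocycles R P d N i"
    using is_coboundary_linear[OF N] is_coboundary_d[OF N]
    by (auto simp: H_def coboundaries_iff[OF N] cocycles_def module_hom_iff)
  have carr: "carrier (Ext R i M N) = (\<lambda>a. H #>\<^bsub>G\<^esub> a) ` cocycles R P d N i" and one: "\<one>\<^bsub>Ext R i M N\<^esub> = H"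
    by (auto simp: E FactGroup_def RCOSETS_def G_def)
  have coset_H: "H #>\<^bsub>G\<^esub> a = H" if a: "a \<in> H" for a
  proof -
    have ext: "f \<in> extensional (carrier (P i))" and cob: "is_coboundary R P d N i f"
      and cl: "\<And>x. x \<in> carrier (P i) \<Longrightarrow> f x \<in> carrier N" if "f \<in> H" for f
    proof -
      show "f \<in> extensional (carrier (P i))" and *: "is_coboundary R P d N i f"
        using that by (auto simp: H_def coboundaries_iff[OF N])
      then show "\<And>x. x \<in> carrier (P i) \<Longrightarrow> f x \<in> carrier N"
        using linear_mapD(1)[OF is_coboundary_linear[OF N *]] by blast
    qed
    have "(\<lambda>x\<in>carrier (P i). h x \<oplus>\<^bsub>N\<^esub> a x) \<in> H" if "h \<in> H" for h
      using is_coboundary_cong[OF is_coboundary_add[OF N cob[OF that] cob[OF a]],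
          of "\<lambda>x\<in>carrier (P i). h x \<oplus>\<^bsub>N\<^esub> a x"]
      by (simp add: H_def coboundaries_iff[OF N])
    moreover have "h \<in> H #>\<^bsub>G\<^esub> a" if h: "h \<in> H" for h
    proof -
      let ?k = "\<lambda>x\<in>carrier (P i). h x \<ominus>\<^bsub>N\<^esub> a x"
      have "?k \<in> H"
        using is_coboundary_cong[OF is_coboundary_diff[OF N cob[OF h] cob[OF a]], of ?k]
        by (simp add: H_def coboundaries_iff[OF N])
      moreover have "h = (\<lambda>x\<in>carrier (P i). ?k x \<oplus>\<^bsub>N\<^esub> a x)"
      proof
        fix x
        show "h x = (\<lambda>x\<in>carrier (P i). ?k x \<oplus>\<^bsub>N\<^esub> a x) x"
        proof (cases "x \<in> carrier (P i)")
          case True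
          then show ?thesis using cl[OF h True] cl[OF a True]
              N.M.diff_eq_iff[of "h x" "a x" "h x \<ominus>\<^bsub>N\<^esub> a x"] by simp
        next
          case False
          then show ?thesis using ext[OF h] by (simp add: extensional_def)
        qed
      qed
      ultimately show ?thesis unfolding coset by blast
    qed
    ultimately show ?thesis unfolding coset by blast
  qed
  have coset_self: "a \<in> H #>\<^bsub>G\<^esub> a" if a: "a \<in> cocycles R P d N i" for a
  proof -
    have a': "a \<in> extensional (carrier (P i))" "linear_map R (P i) N a"
      using a by (auto simp: cocycles_def module_hom_iff)
    have "a = (\<lambda>x\<in>carrier (P i). (\<lambda>x\<in>carrier (P i). \<zero>\<^bsub>N\<^esub>) x \<oplus>\<^bsub>N\<^esub> a x)"
    proof
      fix x
      show "a x = (\<lambda>x\<in>carrier (P i). (\<lambda>x\<in>carrier (P i). \<zero>\<^bsub>N\<^esub>) x \<oplus>\<^bsub>N\<^esub> a x) x"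
        using a' linear_mapD(1)[OF a'(2)] by (cases "x \<in> carrier (P i)") (auto simp: extensional_def)
    qed
    then show ?thesis unfolding coset using zero by (rule rev_image_eqI[rotated])
  qed
  have "carrier (Ext R i M N) = {\<one>\<^bsub>Ext R i M N\<^esub>} \<longleftrightarrow> cocycles R P d N i \<subseteq> H"
  proof
    assume "carrier (Ext R i M N) = {\<one>\<^bsub>Ext R i M N\<^esub>}"
    then show "cocycles R P d N i \<subseteq> H" using coset_self unfolding carr one by blast
  next
    assume "cocycles R P d N i \<subseteq> H"
    then have "cocycles R P d N i = H" using HG by auto
    then show "carrier (Ext R i M N) = {\<one>\<^bsub>Ext R i M N\<^esub>}"
      using coset_H zero unfolding carr one by auto
  qed
  then show ?thesis by (simp add: cohomology_zero_iff[OF N] H_def)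
qed

section \<open>Noetherian modules\<close>

definition generated_submodule :: "('a, 'b) ring_scheme \<Rightarrow> ('a, 'm) module \<Rightarrow> 'm set \<Rightarrow> 'm set" where
  "generated_submodule R M S = \<Inter>{N. submodule N R M \<and> S \<subseteq> N}"

text \<open>The chain condition concerns submodules of \<open>M\<close> lying in the set
  \<open>K\<close>, so that \<open>K\<close> can grow generator by generator inside a fixed
  \<open>M\<close>.\<close>

definition noetherian_in :: "('a, 'b) ring_scheme \<Rightarrow> ('a, 'm) module \<Rightarrow> 'm set \<Rightarrow> bool" where
  "noetherian_in R M K \<longleftrightarrow> (\<forall>N :: nat \<Rightarrow> 'm set.
     (\<forall>i. submodule (N i) R M \<and> N i \<subseteq> K \<and> N i \<subseteq> N (Suc i)) \<longrightarrow> (\<exists>k. \<forall>i\<ge>k. N i = N k))"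

lemma noetherian_inD:
  assumes "noetherian_in R M K" "\<And>i. submodule (N i) R M" "\<And>i. N i \<subseteq> K" "\<And>i::nat. N i \<subseteq> N (Suc i)"
  obtains k where "\<And>i. i \<ge> k \<Longrightarrow> N i = N k"
  using assms unfolding noetherian_in_def by blast

text \<open>Dependent choice would otherwise build a strictly increasing chain above
  \<open>A\<close>.\<close>

lemma noetherian_in_maximal:
  assumes "noetherian_in R M K" and A: "A \<in> \<A>"
    and sub: "\<And>N. N \<in> \<A> \<Longrightarrow> submodule N R M \<and> N \<subseteq> K"
  obtains N where "N \<in> \<A>" "A \<subseteq> N" "\<And>N'. \<lbrakk>N' \<in> \<A>; N \<subseteq> N'\<rbrakk> \<Longrightarrow> N' = N"
proof (rule ccontr)
  note found = that
  assume *: "\<not> thesis"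
  have step: "\<exists>N'. (N' \<in> \<A> \<and> A \<subseteq> N') \<and> N \<subset> N'" if "N \<in> \<A> \<and> A \<subseteq> N" for N
  proof (rule ccontr)
    assume "\<not> ?thesis"
    then have "\<And>N'. \<lbrakk>N' \<in> \<A>; N \<subseteq> N'\<rbrakk> \<Longrightarrow> N' = N" using that by blast
    then show False using * found[of N] that by blast
  qed
  have "A \<in> \<A> \<and> A \<subseteq> A" using A by simp
  then have "\<exists>f. \<forall>n. (f n \<in> \<A> \<and> A \<subseteq> f n) \<and> f n \<subset> f (Suc n)"
    by (intro dependent_nat_choice[of "\<lambda>_ N. N \<in> \<A> \<and> A \<subseteq> N" "\<lambda>_ N N'. N \<subset> N'"] step) auto
  then obtain f where f: "\<And>n. f n \<in> \<A>" "\<And>n::nat. f n \<subset> f (Suc n)" by blast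
  have chain: "submodule (f n) R M" "f n \<subseteq> K" "f n \<subseteq> f (Suc n)" for n
    using sub[OF f(1)[of n]] f(2)[of n] by auto
  obtain k where k: "\<And>i. i \<ge> k \<Longrightarrow> f i = f k"
    by (rule noetherian_inD[where N = f, OF assms(1) chain]) (rule that)
  have "f (Suc k) = f k" by (rule k) simp
  then show False using f(2)[of k] by blast
qed

context left_module
begin

lemma submodule_finsum:
  assumes H: "submodule H R M" and u: "\<And>i. i \<in> A \<Longrightarrow> u i \<in> H"
  shows "finsum M u A \<in> H"
  using u
proof (induction A rule: infinite_finite_induct)
  case (insert a A)
  then have "u \<in> A \<rightarrow> carrier M" "u a \<in> carrier M" using submoduleD(7)[OF H] by auto
  with insert show ?case using submoduleD(3)[OF H] by simp
qed (use submoduleD(2)[OF H] in simp_all)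

end

context
  fixes R :: "('a, 'b) ring_scheme" and M :: "('a, 'm) module"
  assumes M: "left_module R M"
begin

interpretation left_module R M by (rule M)

lemma generated_submodule:
  assumes "S \<subseteq> carrier M"
  shows "submodule (generated_submodule R M S) R M" "S \<subseteq> generated_submodule R M S"
proof -
  show "submodule (generated_submodule R M S) R M"
  proof (rule submoduleI)
    show "generated_submodule R M S \<subseteq> carrier M"
      using carrier_submodule assms by (auto simp: generated_submodule_def)
  qed (auto simp: generated_submodule_def dest: submoduleD)
  show "S \<subseteq> generated_submodule R M S" by (auto simp: generated_submodule_def)
qed

lemma generated_submodule_least: "\<lbrakk>submodule N R M; S \<subseteq> N\<rbrakk> \<Longrightarrow> generated_submodule R M S \<subseteq> N"
  by (auto simp: generated_submodule_def)

text \<open>A maximal one among the finitely generated submodules of \<open>N\<close> absorbs every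
  further element of \<open>N\<close>.\<close>

lemma noetherian_submodule_generated:
  assumes noeth: "noetherian_in R M (carrier M)" and N: "submodule N R M"
  obtains S where "finite S" "S \<subseteq> N" "generated_submodule R M S = N"
proof -
  note n = submoduleD[OF N]
  define \<A> where "\<A> = {generated_submodule R M S |S. finite S \<and> S \<subseteq> N}"
  have gA: "generated_submodule R M S \<in> \<A>" if "finite S" "S \<subseteq> N" for S
    using that by (auto simp: \<A>_def)
  have sub: "submodule K R M \<and> K \<subseteq> carrier M" if "K \<in> \<A>" for K
    using that generated_submodule(1) submoduleD(1) n(1) unfolding \<A>_def by blast
  obtain K where K: "K \<in> \<A>" "\<And>N'. \<lbrakk>N' \<in> \<A>; K \<subseteq> N'\<rbrakk> \<Longrightarrow> N' = K"
    by (rule noetherian_in_maximal[where \<A> = \<A> and A = "generated_submodule R M {}", OF noeth _ sub])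
       (use gA[of "{}"] in auto)
  then obtain S where S: "finite S" "S \<subseteq> N" "K = generated_submodule R M S" by (auto simp: \<A>_def)
  have "N \<subseteq> K"
  proof
    fix x assume x: "x \<in> N"
    then have c: "insert x S \<subseteq> carrier M" "S \<subseteq> carrier M" using S n(1) by auto
    have "K \<subseteq> generated_submodule R M (insert x S)"
      unfolding S(3) using generated_submodule[OF c(1)] by (intro generated_submodule_least) auto
    then have "generated_submodule R M (insert x S) = K"
      using K(2) gA[of "insert x S"] S x by blast
    then show "x \<in> K" using generated_submodule(2)[OF c(1)] by blast
  qed
  moreover have "K \<subseteq> N" unfolding S(3) using N S(2) by (rule generated_submodule_least)
  ultimately show thesis using that S by blast
qed

lemma submodule_finitely_generated:
  assumes noeth: "noetherian_in R M (carrier M)" and N: "submodule N R M"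
  shows "finitely_generated R (M\<lparr>carrier := N\<rparr>)"
proof -
  interpret N: left_module R "M\<lparr>carrier := N\<rparr>" by (rule submodule_left_module[OF N])
  obtain S where S: "finite S" "S \<subseteq> N" "generated_submodule R M S = N"
    by (rule noetherian_submodule_generated[OF noeth N])
  have "K = N" if K: "submodule K R (M\<lparr>carrier := N\<rparr>)" "S \<subseteq> K" for K
  proof -
    have "K \<subseteq> N" using N.submoduleD(1)[OF K(1)] by simp
    then have "submodule K R M" using K(1) submodule_restrict[OF N] by blast
    then have "N \<subseteq> K" using generated_submodule_least[of K S] K(2) S(3) by simp
    then show ?thesis using \<open>K \<subseteq> N\<close> by blast
  qed
  then show ?thesis using S unfolding finitely_generated_def by auto
qed

lemma finitely_generated_image:
  assumes "finitely_generated R M" "left_module R N" "linear_map R M N f" "f ` carrier M = carrier N"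
  shows "finitely_generated R N"
proof -
  interpret N: left_module R N by fact
  obtain S where S: "finite S" "S \<subseteq> carrier M" "\<And>K. submodule K R M \<and> S \<subseteq> K \<Longrightarrow> K = carrier M"
    using assms(1) by (auto simp: finitely_generated_def)
  have "K = carrier N" if K: "submodule K R N" "f ` S \<subseteq> K" for K
  proof -
    have "{x \<in> carrier M. f x \<in> K} = carrier M"
      using S(2) K submodule_vimage[OF M assms(2,3) K(1)] by (intro S(3)) auto
    then have "carrier N \<subseteq> K" unfolding assms(4)[symmetric] by auto
    then show ?thesis using N.submoduleD(1)[OF K(1)] by blast
  qed
  then show ?thesis
    using S(1,2) assms(4) unfolding finitely_generated_def by (intro exI[of _ "f ` S"]) auto
qed

lemma quotient_finitely_generated:
  assumes "finitely_generated R M" "submodule N R M"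
  shows "finitely_generated R (quotient_module M N)"
  by (rule finitely_generated_image[OF assms(1) quotient_left_module[OF M assms(2)]
        linear_map_quotient[OF M assms(2)]]) (simp add: quotient_simps[OF M assms(2)])

end

subsection \<open>Finitely generated modules over a commutative noetherian ring\<close>

locale comm_left_module = left_module R M + cring R
  for R :: "('a, 'b) ring_scheme" (structure) and M :: "('a, 'm) module" (structure)
begin

lemma cyclic_submodule: "v \<in> carrier M \<Longrightarrow> submodule ((\<lambda>a. a \<odot>\<^bsub>M\<^esub> v) ` carrier R) R M"
  by (rule smult_image_submodule) (rule m_comm)

text \<open>A chain in K + R v is controlled by two others: its intersections with \<open>K\<close>,
  and the ideals \<open>I i\<close> of coefficients of \<open>v\<close> that occur in it. Both
  become stationary.\<close>

lemma noetherian_in_add_cyclic: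
  assumes Z: "noetherian_ring R" and K: "submodule K R M" "noetherian_in R M K"
    and v: "v \<in> carrier M"
  shows "noetherian_in R M (K <+>\<^bsub>M\<^esub> (\<lambda>a. a \<odot>\<^bsub>M\<^esub> v) ` carrier R)"
  unfolding noetherian_in_def
proof (intro allI impI)
  fix N :: "nat \<Rightarrow> 'm set"
  assume "\<forall>i. submodule (N i) R M \<and> N i \<subseteq> K <+>\<^bsub>M\<^esub> (\<lambda>a. a \<odot>\<^bsub>M\<^esub> v) ` carrier R \<and> N i \<subseteq> N (Suc i)"
  then have N: "\<And>i. submodule (N i) R M" "\<And>i. N i \<subseteq> K <+>\<^bsub>M\<^esub> (\<lambda>a. a \<odot>\<^bsub>M\<^esub> v) ` carrier R"
    "\<And>i. N i \<subseteq> N (Suc i)" by auto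
  have mono: "N i \<subseteq> N j" if "i \<le> j" for i j using N(3) that by (rule lift_Suc_mono_le)
  note k = submoduleD[OF K(1)]
  define I where "I i = {c \<in> carrier R. \<exists>u\<in>K. c \<odot>\<^bsub>M\<^esub> v \<oplus>\<^bsub>M\<^esub> u \<in> N i}" for i
  have "ideal (I i) R" for i
  proof (rule idealI)
    note n = submoduleD[OF N(1)[of i]]
    show "ring R" ..
    have add: "a \<oplus> b \<in> I i" if ab: "a \<in> I i" "b \<in> I i" for a b
    proof -
      obtain s t where st: "a \<in> carrier R" "b \<in> carrier R" "s \<in> K" "t \<in> K"
        "a \<odot>\<^bsub>M\<^esub> v \<oplus>\<^bsub>M\<^esub> s \<in> N i" "b \<odot>\<^bsub>M\<^esub> v \<oplus>\<^bsub>M\<^esub> t \<in> N i"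
        using ab by (auto simp: I_def)
      then have "(a \<oplus> b) \<odot>\<^bsub>M\<^esub> v \<oplus>\<^bsub>M\<^esub> (s \<oplus>\<^bsub>M\<^esub> t) = (a \<odot>\<^bsub>M\<^esub> v \<oplus>\<^bsub>M\<^esub> s) \<oplus>\<^bsub>M\<^esub> (b \<odot>\<^bsub>M\<^esub> v \<oplus>\<^bsub>M\<^esub> t)"
        using v k(7) by (simp add: smult_l_distr M.a_ac)
      then show ?thesis using st n(3) k(3) by (auto simp: I_def intro!: bexI[of _ "s \<oplus>\<^bsub>M\<^esub> t"])
    qed
    have mult: "x \<otimes> a \<in> I i" if ax: "a \<in> I i" "x \<in> carrier R" for a x
    proof -
      obtain s where s: "a \<in> carrier R" "s \<in> K" "a \<odot>\<^bsub>M\<^esub> v \<oplus>\<^bsub>M\<^esub> s \<in> N i"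
        using ax by (auto simp: I_def)
      then have "(x \<otimes> a) \<odot>\<^bsub>M\<^esub> v \<oplus>\<^bsub>M\<^esub> x \<odot>\<^bsub>M\<^esub> s = x \<odot>\<^bsub>M\<^esub> (a \<odot>\<^bsub>M\<^esub> v \<oplus>\<^bsub>M\<^esub> s)"
        using v k(7) ax by (simp add: smult_assoc smult_r_distr)
      then show ?thesis using s ax n(4) k(4) by (auto simp: I_def intro!: bexI[of _ "x \<odot>\<^bsub>M\<^esub> s"])
    qed
    have zero: "\<zero> \<in> I i" using k(2) n(2) v by (auto simp: I_def intro!: bexI[of _ "\<zero>\<^bsub>M\<^esub>"])
    show "subgroup (I i) (add_monoid R)"
    proof (rule R.add.subgroupI)
      show "I i \<subseteq> carrier R" by (auto simp: I_def)
      show "\<ominus> a \<in> I i" if "a \<in> I i" for a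
        using mult[OF that, of "\<ominus> \<one>"] that by (simp add: R.l_minus I_def)
    qed (use zero add in auto)
    show "x \<otimes> a \<in> I i" if "a \<in> I i" "x \<in> carrier R" for a x using that by (rule mult)
    show "a \<otimes> x \<in> I i" if "a \<in> I i" "x \<in> carrier R" for a x
      using mult[OF that] that m_comm[of a x] by (simp add: I_def)
  qed
  then have ideal: "ideal (I i) R" for i .
  have I_mono: "I i \<subseteq> I j" if "i \<le> j" for i j
    using mono[OF that] by (auto simp: I_def)
  have "subset.chain {I. ideal I R} (range I)"
    unfolding subset_chain_def
  proof (intro conjI ballI)
    fix X Y assume "X \<in> range I" "Y \<in> range I"
    then show "X \<subseteq> Y \<or> Y \<subseteq> X" using I_mono nat_le_linear by blast
  qed (use ideal in auto)
  then have "\<Union>(range I) \<in> range I" by (intro noetherian_ring.ideal_chain_is_trivial[OF Z]) auto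
  then obtain k1 where k1: "\<And>i. I i \<subseteq> I k1" by auto
  obtain k2 where k2: "\<And>i. i \<ge> k2 \<Longrightarrow> N i \<inter> K = N k2 \<inter> K"
    by (rule noetherian_inD[OF K(2), of "\<lambda>i. N i \<inter> K"]) (use submodule_Int[OF N(1) K(1)] N(3) in auto)
  define k where "k = max k1 k2"
  have "N i = N k" if ik: "i \<ge> k" for i
  proof
    show "N k \<subseteq> N i" using ik by (rule mono)
    show "N i \<subseteq> N k"
    proof
      fix x assume x: "x \<in> N i"
      note ni = submoduleD[OF N(1)[of i]] and nk = submoduleD[OF N(1)[of k]]
      obtain u c where uc: "u \<in> K" "c \<in> carrier R" "x = u \<oplus>\<^bsub>M\<^esub> c \<odot>\<^bsub>M\<^esub> v"
        using N(2)[of i] x unfolding set_add_def' by blast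
      have uM: "u \<in> carrier M" using uc(1) by (rule submoduleD(7)[OF K(1)])
      have "c \<in> I i" using uc x uM v by (auto simp: I_def M.a_comm intro!: bexI[of _ u])
      then have "c \<in> I k" using k1 I_mono[of k1 k] by (auto simp: k_def)
      then obtain u' where u': "u' \<in> K" "c \<odot>\<^bsub>M\<^esub> v \<oplus>\<^bsub>M\<^esub> u' \<in> N k" by (auto simp: I_def)
      have u'M: "u' \<in> carrier M" using u'(1) by (rule submoduleD(7)[OF K(1)])
      have cv: "c \<odot>\<^bsub>M\<^esub> v \<in> carrier M" using uc v by simp
      \<comment> \<open>\<open>x\<close> and the element found in \<open>N k\<close> have the same
        coefficient at \<open>v\<close>, so their difference lies in \<open>K\<close>, where the
        chain is already stationary.\<close>
      have "u \<ominus>\<^bsub>M\<^esub> u' = x \<ominus>\<^bsub>M\<^esub> (c \<odot>\<^bsub>M\<^esub> v \<oplus>\<^bsub>M\<^esub> u')"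
        using uM u'M cv unfolding uc(3) by (simp add: M.abel_simps)
      then have "u \<ominus>\<^bsub>M\<^esub> u' \<in> N i" using ni(6)[OF x] u'(2) mono[OF ik] by auto
      then have "u \<ominus>\<^bsub>M\<^esub> u' \<in> N i \<inter> K" using submoduleD(6)[OF K(1) uc(1) u'(1)] by simp
      then have "u \<ominus>\<^bsub>M\<^esub> u' \<in> N k" using k2[of i] k2[of k] ik by (auto simp: k_def)
      then have "(u \<ominus>\<^bsub>M\<^esub> u') \<oplus>\<^bsub>M\<^esub> (c \<odot>\<^bsub>M\<^esub> v \<oplus>\<^bsub>M\<^esub> u') \<in> N k" using u'(2) nk(3) by blast
      moreover have "(u \<ominus>\<^bsub>M\<^esub> u') \<oplus>\<^bsub>M\<^esub> (c \<odot>\<^bsub>M\<^esub> v \<oplus>\<^bsub>M\<^esub> u') = x"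
        using uM u'M cv unfolding uc(3) by (simp add: M.abel_simps)
      ultimately show "x \<in> N k" by simp
    qed
  qed
  then show "\<exists>k. \<forall>i\<ge>k. N i = N k" by blast
qed

lemma finitely_generated_noetherian:
  assumes Z: "noetherian_ring R" and fg: "finitely_generated R M"
  shows "noetherian_in R M (carrier M)"
proof -
  obtain S where S: "finite S" "S \<subseteq> carrier M" "\<And>K. submodule K R M \<and> S \<subseteq> K \<Longrightarrow> K = carrier M"
    using fg by (auto simp: finitely_generated_def)
  have "\<exists>K. submodule K R M \<and> S \<subseteq> K \<and> noetherian_in R M K"
    using S(1,2)
  proof (induction S rule: finite_induct)
    case empty
    have "noetherian_in R M {\<zero>\<^bsub>M\<^esub>}"
      unfolding noetherian_in_def
    proof (intro allI impI)
      fix N :: "nat \<Rightarrow> 'm set"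
      assume *: "\<forall>i. submodule (N i) R M \<and> N i \<subseteq> {\<zero>\<^bsub>M\<^esub>} \<and> N i \<subseteq> N (Suc i)"
      have "N i = {\<zero>\<^bsub>M\<^esub>}" for i using * submoduleD(2)[of "N i"] by blast
      then show "\<exists>k. \<forall>i\<ge>k. N i = N k" by simp
    qed
    then show ?case using zero_submodule by auto
  next
    case (insert v S)
    then obtain K where K: "submodule K R M" "S \<subseteq> K" "noetherian_in R M K" by auto
    have v: "v \<in> carrier M" using insert by simp
    let ?C = "(\<lambda>a. a \<odot>\<^bsub>M\<^esub> v) ` carrier R"
    note C = cyclic_submodule[OF v]
    have "v \<in> ?C" using v by (intro image_eqI[of _ _ \<one>]) auto
    then have "insert v S \<subseteq> K <+>\<^bsub>M\<^esub> ?C" using submodule_le_set_add[OF K(1) C] K(2) by auto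
    then show ?case
      using submodule_set_add[OF K(1) C] noetherian_in_add_cyclic[OF Z K(1,3) v] by blast
  qed
  then show ?thesis using S(3) by blast
qed

end

subsection \<open>The centre\<close>

lemma centre_simps [simp]:
  "add (centre R) = add R" "zero (centre R) = zero R" "monoid.mult (centre R) = monoid.mult R"
  "one (centre R) = one R"
  by (simp_all add: centre_def)

lemma centre_iff: "z \<in> carrier (centre R) \<longleftrightarrow>
    z \<in> carrier R \<and> (\<forall>r\<in>carrier R. z \<otimes>\<^bsub>R\<^esub> r = r \<otimes>\<^bsub>R\<^esub> z)"
  by (simp add: centre_def)

context ring
begin

lemma centre_closed [simp]: "z \<in> carrier (centre R) \<Longrightarrow> z \<in> carrier R"
  by (simp add: centre_iff)

lemma centre_comm: "\<lbrakk>z \<in> carrier (centre R); r \<in> carrier R\<rbrakk> \<Longrightarrow> z \<otimes> r = r \<otimes> z"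
  unfolding centre_iff by blast

lemma centreI: "\<lbrakk>z \<in> carrier R; \<And>r. r \<in> carrier R \<Longrightarrow> z \<otimes> r = r \<otimes> z\<rbrakk> \<Longrightarrow> z \<in> carrier (centre R)"
  unfolding centre_iff by blast

lemma centre_cring: "cring (centre R)"
proof (rule cringI)
  show "abelian_group (centre R)"
  proof (rule abelian_groupI)
    fix x assume x: "x \<in> carrier (centre R)"
    have "\<ominus> x \<in> carrier (centre R)"
      using x centre_comm[OF x] by (intro centreI) (simp_all add: l_minus r_minus)
    then show "\<exists>y\<in>carrier (centre R). y \<oplus>\<^bsub>centre R\<^esub> x = \<zero>\<^bsub>centre R\<^esub>"
      using x by (intro bexI[of _ "\<ominus> x"]) (simp_all add: l_neg)
  next
    fix x y assume xy: "x \<in> carrier (centre R)" "y \<in> carrier (centre R)"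
    show "x \<oplus>\<^bsub>centre R\<^esub> y \<in> carrier (centre R)"
      using xy centre_comm[OF xy(1)] centre_comm[OF xy(2)] by (intro centreI) (simp_all add: l_distr r_distr)
  next
    show "\<zero>\<^bsub>centre R\<^esub> \<in> carrier (centre R)" by (rule centreI) auto
  qed (auto simp: a_ac)
  show "comm_monoid (centre R)"
  proof (rule comm_monoidI)
    fix x y assume xy: "x \<in> carrier (centre R)" "y \<in> carrier (centre R)"
    have "(x \<otimes> y) \<otimes> r = r \<otimes> (x \<otimes> y)" if r: "r \<in> carrier R" for r
    proof -
      have "(x \<otimes> y) \<otimes> r = x \<otimes> (r \<otimes> y)" using xy r by (simp add: m_assoc centre_comm[OF xy(2) r])
      also have "\<dots> = (r \<otimes> x) \<otimes> y" using xy r by (simp flip: m_assoc add: centre_comm[OF xy(1) r])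
      finally show ?thesis using xy r by (simp add: m_assoc)
    qed
    then show "x \<otimes>\<^bsub>centre R\<^esub> y \<in> carrier (centre R)" using xy by (intro centreI) simp_all
    show "x \<otimes>\<^bsub>centre R\<^esub> y = y \<otimes>\<^bsub>centre R\<^esub> x" using centre_comm[OF xy(1), of y] xy(2) by simp
  next
    show "\<one>\<^bsub>centre R\<^esub> \<in> carrier (centre R)" by (rule centreI) auto
  qed (auto simp: m_assoc)
qed (auto simp: l_distr)

lemma centre_left_module:
  assumes "left_module R M"
  shows "left_module (centre R) M"
proof -
  interpret M: left_module R M by fact
  interpret Z: cring "centre R" by (rule centre_cring)
  show ?thesis
    by (rule left_moduleI)
       (auto simp: M.smult_l_distr M.smult_r_distr M.smult_assoc intro: Z.ring_axioms M.M.abelian_group_axioms)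
qed

lemma centre_submodule: "submodule N R M \<Longrightarrow> submodule N (centre R) M"
  by (auto simp: submodule_def submodule_axioms_def)

lemma centre_comm_left_module: "left_module R M \<Longrightarrow> comm_left_module (centre R) M"
  by (intro comm_left_module.intro centre_left_module centre_cring)

text \<open>Products of generators of \<open>R\<close> over the centre with generators of
  \<open>M\<close> over \<open>R\<close> suffice: the scalars that take a fixed generator of
  \<open>M\<close> into a given submodule over the centre form such a submodule of
  \<open>R\<close>.\<close>

lemma centre_finitely_generated:
  assumes fin: "finitely_generated (centre R) (regular_module R)"
    and M: "left_module R M" and fg: "finitely_generated R M"
  shows "finitely_generated (centre R) M"
proof -
  interpret M: left_module R M by fact
  interpret MZ: left_module "centre R" M by (rule centre_left_module[OF M])
  interpret RZ: left_module "centre R" "regular_module R"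
    by (rule centre_left_module[OF regular_left_module])
  obtain T where T: "finite T" "T \<subseteq> carrier R"
    "\<And>K. submodule K (centre R) (regular_module R) \<and> T \<subseteq> K \<Longrightarrow> K = carrier R"
    using fin by (auto simp: finitely_generated_def)
  obtain S where S: "finite S" "S \<subseteq> carrier M" "\<And>K. submodule K R M \<and> S \<subseteq> K \<Longrightarrow> K = carrier M"
    using fg by (auto simp: finitely_generated_def)
  let ?U = "(\<lambda>(r, x). r \<odot>\<^bsub>M\<^esub> x) ` (T \<times> S)"
  have "N = carrier M" if N: "submodule N (centre R) M" "?U \<subseteq> N" for N
  proof -
    note n = MZ.submoduleD[OF N(1)]
    have rx: "r \<odot>\<^bsub>M\<^esub> x \<in> N" if "r \<in> carrier R" "x \<in> S" for r x
    proof -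
      have x: "x \<in> carrier M" using that S by auto
      have "submodule {r \<in> carrier R. r \<odot>\<^bsub>M\<^esub> x \<in> N} (centre R) (regular_module R)"
        by (rule RZ.submoduleI) (use x n in \<open>auto simp: M.smult_l_distr M.smult_assoc\<close>)
      moreover have "T \<subseteq> {r \<in> carrier R. r \<odot>\<^bsub>M\<^esub> x \<in> N}" using T(2) N(2) that by auto
      ultimately have "{r \<in> carrier R. r \<odot>\<^bsub>M\<^esub> x \<in> N} = carrier R" using T(3) by blast
      then show ?thesis using that by blast
    qed
    have "{x \<in> carrier M. \<forall>r\<in>carrier R. r \<odot>\<^bsub>M\<^esub> x \<in> N} = carrier M"
    proof (rule S(3), intro conjI)
      show "submodule {x \<in> carrier M. \<forall>r\<in>carrier R. r \<odot>\<^bsub>M\<^esub> x \<in> N} R M"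
        by (rule M.submoduleI) (use n in \<open>auto simp: M.smult_r_distr simp flip: M.smult_assoc\<close>)
      show "S \<subseteq> {x \<in> carrier M. \<forall>r\<in>carrier R. r \<odot>\<^bsub>M\<^esub> x \<in> N}" using rx S(2) by auto
    qed
    then have "\<one> \<odot>\<^bsub>M\<^esub> x \<in> N" if "x \<in> carrier M" for x using that by blast
    then show ?thesis using n(1) by auto
  qed
  moreover have "finite ?U" "?U \<subseteq> carrier M" using S T by auto
  ultimately show ?thesis unfolding finitely_generated_def by blast
qed

end

text \<open>The assumption \<open>one_neq_zero\<close> keeps the unit vectors of a free module
  distinct, on which the proof that they form a basis relies.\<close>

locale centrally_finite_ring = ring R for R :: "('a, 'b) ring_scheme" (structure) +
  assumes noetherian_centre: "noetherian_ring (centre R)"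
    and finite_over_centre: "finitely_generated (centre R) (regular_module R)"
    and one_neq_zero: "\<one> \<noteq> \<zero>"
begin

lemma fg_noetherian_over_centre:
  assumes "fg_module R M"
  shows "noetherian_in (centre R) M (carrier M)"
  using assms centre_finitely_generated[OF finite_over_centre, of M]
  by (intro comm_left_module.finitely_generated_noetherian centre_comm_left_module noetherian_centre)
     (auto simp: fg_module_def)

lemma fg_noetherian: "fg_module R M \<Longrightarrow> noetherian_in R M (carrier M)"
  using fg_noetherian_over_centre[of M] centre_submodule
  unfolding noetherian_in_def by blast

lemma fg_submodule:
  assumes "fg_module R M" "submodule N R M"
  shows "fg_module R (M\<lparr>carrier := N\<rparr>)"
proof -
  interpret left_module R M using assms by (simp add: fg_module_def)
  show ?thesis
    using submodule_left_module[OF assms(2)] submodule_finitely_generated[OF left_module_axioms fg_noetherian assms(2)] assms(1)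
    by (simp add: fg_module_def)
qed

lemma fg_quotient: "\<lbrakk>fg_module R M; submodule N R M\<rbrakk> \<Longrightarrow> fg_module R (quotient_module M N)"
  using quotient_left_module quotient_finitely_generated by (auto simp: fg_module_def)

lemma fg_regular: "fg_module R (regular_module R)"
proof -
  interpret left_module R "regular_module R" by (rule regular_left_module)
  have "N = carrier R" if N: "submodule N R (regular_module R)" "\<one> \<in> N" for N
  proof -
    have "x \<in> N" if "x \<in> carrier R" for x using submoduleD(4)[OF N(1), of x \<one>] N(2) that by simp
    then show ?thesis using submoduleD(1)[OF N(1)] by auto
  qed
  then have "finitely_generated R (regular_module R)"
    unfolding finitely_generated_def by (intro exI[of _ "{\<one>}"]) auto
  then show ?thesis using left_module_axioms by (simp add: fg_module_def)
qed

end

section \<open>Existence of free resolutions\<close>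

text \<open>The free module \<open>R\<^sup>n\<close> on the carrier type that \<open>some_resolution\<close> prescribes.\<close>

definition free_module :: "('a, 'b) ring_scheme \<Rightarrow> nat \<Rightarrow> ('a, ('a + 'm) list) module" where
  "free_module R n = \<lparr>carrier = {xs. length xs = n \<and> set xs \<subseteq> Inl ` carrier R},
     monoid.mult = undefined, monoid.one = undefined,
     ring.zero = map (\<lambda>i. Inl \<zero>\<^bsub>R\<^esub>) [0..<n],
     ring.add = \<lambda>xs ys. map (\<lambda>i. Inl (projl (xs ! i) \<oplus>\<^bsub>R\<^esub> projl (ys ! i))) [0..<n],
     smult = \<lambda>r xs. map (\<lambda>i. Inl (r \<otimes>\<^bsub>R\<^esub> projl (xs ! i))) [0..<n]\<rparr>"

definition linear_comb :: "('a, 'm) module \<Rightarrow> 'm list \<Rightarrow> ('a + 'u) list \<Rightarrow> 'm" where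
  "linear_comb M ms xs = finsum M (\<lambda>i. projl (xs ! i) \<odot>\<^bsub>M\<^esub> ms ! i) {..<length ms}"

context ring
begin

context
  fixes n :: nat and F :: "('a, ('a + 'm) list) module"
  defines "F \<equiv> free_module R n"
begin

lemma free_module_mk:
  "(\<And>i. i < n \<Longrightarrow> f i \<in> carrier R) \<Longrightarrow> map (\<lambda>i. Inl (f i)) [0..<n] \<in> carrier F"
  by (auto simp: F_def free_module_def)

lemma free_module_coord: "\<lbrakk>xs \<in> carrier F; i < n\<rbrakk> \<Longrightarrow> projl (xs ! i) \<in> carrier R"
  using subsetD[of "set xs" "Inl ` carrier R" "xs ! i"] by (auto simp: F_def free_module_def)

lemma free_module_eqI:
  assumes "xs \<in> carrier F" "ys \<in> carrier F" "\<And>i. i < n \<Longrightarrow> projl (xs ! i) = projl (ys ! i)"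
  shows "xs = ys"
proof (rule nth_equalityI)
  show "length xs = length ys" using assms(1,2) by (simp add: F_def free_module_def)
  fix i assume "i < length xs"
  then have i: "i < n" "xs ! i \<in> set xs" "ys ! i \<in> set ys" using assms(1,2) by (auto simp: F_def free_module_def)
  then have "xs ! i \<in> Inl ` carrier R" "ys ! i \<in> Inl ` carrier R"
    using assms(1,2) by (auto simp: F_def free_module_def)
  then show "xs ! i = ys ! i" using assms(3)[OF i(1)] by auto
qed

lemma free_module_ops [simp]:
  "i < n \<Longrightarrow> projl ((xs \<oplus>\<^bsub>F\<^esub> ys) ! i) = projl (xs ! i) \<oplus> projl (ys ! i)"
  "i < n \<Longrightarrow> projl ((r \<odot>\<^bsub>F\<^esub> xs) ! i) = r \<otimes> projl (xs ! i)"
  "i < n \<Longrightarrow> projl (\<zero>\<^bsub>F\<^esub> ! i) = \<zero>"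
  by (simp_all add: F_def free_module_def)

lemma free_module_closed:
  "\<lbrakk>xs \<in> carrier F; ys \<in> carrier F\<rbrakk> \<Longrightarrow> xs \<oplus>\<^bsub>F\<^esub> ys \<in> carrier F"
  "\<lbrakk>r \<in> carrier R; xs \<in> carrier F\<rbrakk> \<Longrightarrow> r \<odot>\<^bsub>F\<^esub> xs \<in> carrier F"
  "\<zero>\<^bsub>F\<^esub> \<in> carrier F"
proof -
  show "xs \<oplus>\<^bsub>F\<^esub> ys \<in> carrier F" if "xs \<in> carrier F" "ys \<in> carrier F"
  proof -
    have "xs \<oplus>\<^bsub>F\<^esub> ys = map (\<lambda>i. Inl (projl (xs ! i) \<oplus> projl (ys ! i))) [0..<n]"
      by (simp add: F_def free_module_def)
    then show ?thesis using free_module_coord that by (simp only:) (intro free_module_mk, simp)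
  qed
  show "r \<odot>\<^bsub>F\<^esub> xs \<in> carrier F" if "r \<in> carrier R" "xs \<in> carrier F"
  proof -
    have "r \<odot>\<^bsub>F\<^esub> xs = map (\<lambda>i. Inl (r \<otimes> projl (xs ! i))) [0..<n]"
      by (simp add: F_def free_module_def)
    then show ?thesis using free_module_coord that by (simp only:) (intro free_module_mk, simp)
  qed
  show "\<zero>\<^bsub>F\<^esub> \<in> carrier F"
    using free_module_mk[of "\<lambda>_. \<zero>"] by (simp add: F_def free_module_def)
qed

lemma free_module: "left_module R F"
proof (rule left_moduleI)
  show "ring R" by (rule ring_axioms)
  show "abelian_group F"
  proof (rule abelian_groupI)
    fix xs assume xs: "xs \<in> carrier F"
    let ?ys = "(\<ominus> \<one>) \<odot>\<^bsub>F\<^esub> xs"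
    have "?ys \<oplus>\<^bsub>F\<^esub> xs = \<zero>\<^bsub>F\<^esub>"
      by (rule free_module_eqI)
         (use xs free_module_coord in \<open>auto simp: free_module_closed l_minus l_neg\<close>)
    then show "\<exists>ys\<in>carrier F. ys \<oplus>\<^bsub>F\<^esub> xs = \<zero>\<^bsub>F\<^esub>" using xs free_module_closed(2) by blast
  qed (auto intro!: free_module_eqI simp: free_module_closed free_module_coord a_ac)
qed (auto intro!: free_module_eqI simp: free_module_closed free_module_coord l_distr r_distr m_assoc)

lemma coord_linear: "i < n \<Longrightarrow> linear_map R F (regular_module R) (\<lambda>xs. projl (xs ! i))"
  by (rule linear_mapI) (auto simp: free_module_coord)

definition unit_vec :: "nat \<Rightarrow> ('a + 'm) list" where
  "unit_vec i = map (\<lambda>j. Inl (if j = i then \<one> else \<zero>)) [0..<n]"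

lemma unit_vec: "unit_vec i \<in> carrier F"
  unfolding unit_vec_def by (rule free_module_mk) simp

lemma unit_vec_coord: "j < n \<Longrightarrow> projl (unit_vec i ! j) = (if j = i then \<one> else \<zero>)"
  by (simp add: unit_vec_def)

text \<open>Coordinate \<open>k\<close> is linear and recovers the coefficient of
  \<open>unit_vec k\<close>; this gives uniqueness and, by comparing coordinates, the expansion
  itself.\<close>

lemma free_module_basis:
  assumes one: "\<one> \<noteq> \<zero>"
  shows "is_basis R F (unit_vec ` {..<n})"
proof -
  interpret F: left_module R F by (rule free_module)
  interpret RR: left_module R "regular_module R" by (rule regular_left_module)
  define B where "B = unit_vec ` {..<n}"
  have unit_eq: "unit_vec i = unit_vec j \<longleftrightarrow> i = j" if "i < n" "j < n" for i j
    using unit_vec_coord[OF that(1), of i] unit_vec_coord[OF that(1), of j] one by (auto split: if_splits)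
  have B: "finite B" "B \<subseteq> carrier F" using unit_vec by (auto simp: B_def)
  have coord: "projl (finsum F (\<lambda>b. c b \<odot>\<^bsub>F\<^esub> b) A ! k) = c (unit_vec k)"
    if c: "\<And>b. b \<in> B \<Longrightarrow> c b \<in> carrier R" "A = {b \<in> B. c b \<noteq> \<zero>}" and k: "k < n" for c A k
  proof -
    have A: "finite A" "A \<subseteq> B" using B by (auto simp: c(2))
    have bk: "unit_vec k \<in> B" using k by (auto simp: B_def)
    have "projl (finsum F (\<lambda>b. c b \<odot>\<^bsub>F\<^esub> b) A ! k) =
        finsum (regular_module R) (\<lambda>b. projl ((c b \<odot>\<^bsub>F\<^esub> b) ! k)) A"
      by (rule linear_map_finsum[OF free_module regular_left_module coord_linear[OF k]])
         (use A B c(1) in auto)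
    also have "\<dots> = finsum (regular_module R) (\<lambda>b. if b = unit_vec k then c b else \<zero>) B"
    proof (rule RR.M.add.finprod_mono_neutral_cong_left)
      fix b assume "b \<in> A"
      then obtain i where "i < n" "b = unit_vec i" "b \<in> B" using A by (auto simp: B_def)
      then show "projl ((c b \<odot>\<^bsub>F\<^esub> b) ! k) = (if b = unit_vec k then c b else \<zero>)"
        using k c(1) unit_eq by (auto simp: unit_vec_coord)
    qed (use A B c in auto)
    also have "\<dots> = c (unit_vec k)"
      using RR.M.add.finprod_singleton_swap[OF bk B(1), of c, unfolded regular_simps] c(1) by auto
    finally show ?thesis .
  qed
  have "\<exists>!c. (\<forall>b\<in>B. c b \<in> carrier R) \<and> (\<forall>b. b \<notin> B \<longrightarrow> c b = \<zero>) \<and>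
      finite {b \<in> B. c b \<noteq> \<zero>} \<and> x = finsum F (\<lambda>b. c b \<odot>\<^bsub>F\<^esub> b) {b \<in> B. c b \<noteq> \<zero>}"
    if x: "x \<in> carrier F" for x
  proof (rule ex1I)
    define c where "c b = (if b \<in> B then projl (x ! inv_into {..<n} unit_vec b) else \<zero>)" for b
    have cR: "\<And>b. b \<in> B \<Longrightarrow> c b \<in> carrier R"
      using free_module_coord[OF x] inv_into_into[of _ unit_vec "{..<n}"] by (auto simp: c_def B_def)
    have ck: "c (unit_vec k) = projl (x ! k)" if "k < n" for k
    proof -
      have "inj_on unit_vec {..<n}" using unit_eq by (auto simp: inj_on_def)
      then have "inv_into {..<n} unit_vec (unit_vec k) = k" using that by simp
      then show ?thesis using that by (simp add: c_def B_def)
    qed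
    have "x = finsum F (\<lambda>b. c b \<odot>\<^bsub>F\<^esub> b) {b \<in> B. c b \<noteq> \<zero>}"
      by (rule free_module_eqI[OF x])
         (use B cR coord[of c, OF cR refl] ck in \<open>auto intro!: F.M.finsum_closed\<close>)
    then show "(\<forall>b\<in>B. c b \<in> carrier R) \<and> (\<forall>b. b \<notin> B \<longrightarrow> c b = \<zero>) \<and>
      finite {b \<in> B. c b \<noteq> \<zero>} \<and> x = finsum F (\<lambda>b. c b \<odot>\<^bsub>F\<^esub> b) {b \<in> B. c b \<noteq> \<zero>}"
      using cR B(1) by (auto simp: c_def)
    fix c' assume c': "(\<forall>b\<in>B. c' b \<in> carrier R) \<and> (\<forall>b. b \<notin> B \<longrightarrow> c' b = \<zero>) \<and>
      finite {b \<in> B. c' b \<noteq> \<zero>} \<and> x = finsum F (\<lambda>b. c' b \<odot>\<^bsub>F\<^esub> b) {b \<in> B. c' b \<noteq> \<zero>}"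
    show "c' = c"
    proof
      fix b
      show "c' b = c b"
      proof (cases "b \<in> B")
        case True
        then obtain k where "k < n" "b = unit_vec k" by (auto simp: B_def)
        then show ?thesis using coord[of c', OF _ refl] c' ck by metis
      next
        case False
        then show ?thesis using c' by (simp add: c_def)
      qed
    qed
  qed
  then show ?thesis using B(2) by (simp add: is_basis_def B_def)
qed

lemma free_module_fg:
  assumes one: "\<one> \<noteq> \<zero>"
  shows "fg_module R F"
proof -
  interpret F: left_module R F by (rule free_module)
  have "N = carrier F" if N: "submodule N R F" "unit_vec ` {..<n} \<subseteq> N" for N
  proof
    show "N \<subseteq> carrier F" using F.submoduleD(1)[OF N(1)] .
    show "carrier F \<subseteq> N"
    proof
      fix x assume "x \<in> carrier F"
      then have "\<exists>!c. (\<forall>b\<in>unit_vec ` {..<n}. c b \<in> carrier R) \<and>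
          (\<forall>b. b \<notin> unit_vec ` {..<n} \<longrightarrow> c b = \<zero>) \<and> finite {b \<in> unit_vec ` {..<n}. c b \<noteq> \<zero>} \<and>
          x = finsum F (\<lambda>b. c b \<odot>\<^bsub>F\<^esub> b) {b \<in> unit_vec ` {..<n}. c b \<noteq> \<zero>}"
        using free_module_basis[OF one] unfolding is_basis_def by (elim conjE) (rule bspec)
      then obtain c where c: "\<forall>b\<in>unit_vec ` {..<n}. c b \<in> carrier R"
        "x = finsum F (\<lambda>b. c b \<odot>\<^bsub>F\<^esub> b) {b \<in> unit_vec ` {..<n}. c b \<noteq> \<zero>}"
        by (elim ex1E conjE) (rule that)
      show "x \<in> N"
        unfolding c(2) by (rule F.submodule_finsum[OF N(1)]) (use c(1) N(2) F.submoduleD(4)[OF N(1)] in auto)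
    qed
  qed
  moreover have "unit_vec ` {..<n} \<subseteq> carrier F" using unit_vec by auto
  ultimately show ?thesis
    using free_module unfolding fg_module_def finitely_generated_def by blast
qed

end

lemma linear_comb_linear:
  fixes M :: "('a, 'm) module"
  assumes M: "left_module R M" and ms: "set ms \<subseteq> carrier M"
  shows "linear_map R (free_module R (length ms) :: ('a, ('a + 'x) list) module) M (linear_comb M ms)"
proof -
  interpret M: left_module R M by (rule M)
  have m: "i < length ms \<Longrightarrow> ms ! i \<in> carrier M" for i using ms nth_mem[of i ms] by blast
  have c: "\<lbrakk>xs \<in> carrier (free_module R (length ms)); i < length ms\<rbrakk> \<Longrightarrow> projl (xs ! i) \<in> carrier R"
    for xs :: "('a + 'x) list" and i by (rule free_module_coord)
  have smul: "r \<odot>\<^bsub>M\<^esub> finsum M u A = finsum M (\<lambda>i. r \<odot>\<^bsub>M\<^esub> u i) A"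
    if "r \<in> carrier R" "\<And>i. i \<in> A \<Longrightarrow> u i \<in> carrier M" "finite A" for r u and A :: "nat set"
    using that(3,2)
  proof (induction A rule: finite_induct)
    case empty then show ?case using that(1) by simp
  next
    case (insert b T)
    then show ?case using that(1) by (simp add: Pi_def M.smult_r_distr)
  qed
  show ?thesis
  proof (rule linear_mapI)
    fix x :: "('a + 'x) list" assume x: "x \<in> carrier (free_module R (length ms))"
    then show "linear_comb M ms x \<in> carrier M"
      unfolding linear_comb_def using m c by (intro M.M.finsum_closed) auto
    fix r assume r: "r \<in> carrier R"
    have "linear_comb M ms (r \<odot>\<^bsub>free_module R (length ms)\<^esub> x) =
        finsum M (\<lambda>i. r \<odot>\<^bsub>M\<^esub> (projl (x ! i) \<odot>\<^bsub>M\<^esub> ms ! i)) {..<length ms}"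
      unfolding linear_comb_def
      by (rule M.M.add.finprod_cong') (use x r m c in \<open>auto simp: M.smult_assoc\<close>)
    then show "linear_comb M ms (r \<odot>\<^bsub>free_module R (length ms)\<^esub> x) = r \<odot>\<^bsub>M\<^esub> linear_comb M ms x"
      using smul[OF r, of "{..<length ms}" "\<lambda>i. projl (x ! i) \<odot>\<^bsub>M\<^esub> ms ! i"] x m c
      by (simp add: linear_comb_def)
  next
    fix x y :: "('a + 'x) list"
    assume xy: "x \<in> carrier (free_module R (length ms))" "y \<in> carrier (free_module R (length ms))"
    have "linear_comb M ms (x \<oplus>\<^bsub>free_module R (length ms)\<^esub> y) =
        finsum M (\<lambda>i. projl (x ! i) \<odot>\<^bsub>M\<^esub> ms ! i \<oplus>\<^bsub>M\<^esub> projl (y ! i) \<odot>\<^bsub>M\<^esub> ms ! i) {..<length ms}"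
      unfolding linear_comb_def
      by (rule M.M.add.finprod_cong') (use xy m c in \<open>auto simp: M.smult_l_distr\<close>)
    then show "linear_comb M ms (x \<oplus>\<^bsub>free_module R (length ms)\<^esub> y) = linear_comb M ms x \<oplus>\<^bsub>M\<^esub> linear_comb M ms y"
      unfolding linear_comb_def using xy m c by (subst M.M.finsum_addf[symmetric]) auto
  qed
qed

lemma linear_comb_image:
  fixes M :: "('a, 'm) module"
  assumes M: "left_module R M" and ms: "set ms \<subseteq> carrier M"
  shows "linear_comb M ms ` carrier (free_module R (length ms) :: ('a, ('a + 'x) list) module) =
    generated_submodule R M (set ms)"
proof
  interpret M: left_module R M by (rule M)
  have m: "i < length ms \<Longrightarrow> ms ! i \<in> carrier M" for i using ms nth_mem[of i ms] by blast
  let ?F = "free_module R (length ms) :: ('a, ('a + 'x) list) module"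
  interpret F: left_module R ?F by (rule free_module)
  note gen = generated_submodule[OF M ms]
  show "linear_comb M ms ` carrier ?F \<subseteq> generated_submodule R M (set ms)"
  proof (rule image_subsetI)
    fix x assume x: "x \<in> carrier ?F"
    have "ms ! i \<in> generated_submodule R M (set ms)" if "i < length ms" for i
      using gen(2) that nth_mem by blast
    then show "linear_comb M ms x \<in> generated_submodule R M (set ms)"
      unfolding linear_comb_def using free_module_coord[OF x] M.submoduleD(4)[OF gen(1)]
      by (intro M.submodule_finsum[OF gen(1)]) auto
  qed
  show "generated_submodule R M (set ms) \<subseteq> linear_comb M ms ` carrier ?F"
  proof (rule generated_submodule_least[OF M])
    show "submodule (linear_comb M ms ` carrier ?F) R M"
      by (rule submodule_image[OF free_module M linear_comb_linear[OF M ms] F.carrier_submodule])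
    show "set ms \<subseteq> linear_comb M ms ` carrier ?F"
    proof
      fix v assume "v \<in> set ms"
      then obtain i where i: "i < length ms" "v = ms ! i" by (auto simp: in_set_conv_nth)
      let ?e = "unit_vec (length ms) i :: ('a + 'x) list"
      have "linear_comb M ms ?e = finsum M (\<lambda>j. if j = i then ms ! j else \<zero>\<^bsub>M\<^esub>) {..<length ms}"
        unfolding linear_comb_def
        by (rule M.M.add.finprod_cong') (use m in \<open>auto simp: unit_vec_coord\<close>)
      also have "\<dots> = ms ! i"
        by (rule M.M.add.finprod_singleton_swap) (use i m in auto)
      finally show "v \<in> linear_comb M ms ` carrier ?F" using i(2) unit_vec by (metis image_eqI)
    qed
  qed
qed

end

context centrally_finite_ring
begin

lemma linear_comb_cover:
  fixes M :: "('a, 'm) module"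
  assumes M: "fg_module R M" and N: "submodule N R M"
  obtains ms where "set ms \<subseteq> carrier M"
    "linear_comb M ms ` carrier (free_module R (length ms) :: ('a, ('a + 'x) list) module) = N"
proof -
  have M': "left_module R M" using M by (simp add: fg_module_def)
  interpret M: left_module R M by (rule M')
  obtain S where S: "finite S" "S \<subseteq> N" "generated_submodule R M S = N"
    by (rule noetherian_submodule_generated[OF M' fg_noetherian[OF M] N])
  obtain ms where ms: "set ms = S" using finite_list[OF S(1)] by blast
  have "set ms \<subseteq> carrier M" using ms S(2) M.submoduleD(1)[OF N] by auto
  then show thesis using that linear_comb_image[OF M'] ms S(3) by blast
qed

text \<open>Kernels of maps between free modules of finite rank are finitely generated, so the maps
  can be chosen one after the other. Dependent choice carries ranks and lists rather than
  modules.\<close>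

lemma free_resolution_exists:
  fixes M :: "('a, 'm) module"
  assumes M: "fg_module R M"
  shows "\<exists>(P :: nat \<Rightarrow> ('a, ('a + 'm) list) module) d. free_resolution R M P d"
proof -
  have M': "left_module R M" using M by (simp add: fg_module_def)
  interpret M: left_module R M by (rule M')
  let ?F = "\<lambda>n. free_module R n :: ('a, ('a + 'm) list) module"
  obtain gs where gs: "set gs \<subseteq> carrier M" "linear_comb M gs ` carrier (?F (length gs)) = carrier M"
    by (rule linear_comb_cover[OF M M.carrier_submodule])
  \<comment> \<open>\<open>(n, ms)\<close> encodes the map \<open>R\<^sup>m \<rightarrow> R\<^sup>n\<close> sending the standard basis to the list \<open>ms\<close>, \<open>m = length ms\<close>.\<close>
  define ker where "ker n ms = {x \<in> carrier (?F (length ms)). linear_comb (?F n) ms x = \<zero>\<^bsub>?F n\<^esub>}" for n ms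
  \<comment> \<open>\<open>Inv\<close> ties the first map to the kernel of the augmentation given by
    \<open>gs\<close>; \<open>Next\<close> expresses exactness and makes the source rank of one map
    the target rank of the following one.\<close>
  define Inv where "Inv i p = (set (snd p) \<subseteq> carrier (?F (fst p)) \<and>
    (i = 0 \<longrightarrow> fst p = length gs \<and> linear_comb (?F (fst p)) (snd p) ` carrier (?F (length (snd p))) =
      {x \<in> carrier (?F (length gs)). linear_comb M gs x = \<zero>\<^bsub>M\<^esub>}))" for i :: nat and p
  define Next where "Next p q = (fst q = length (snd p) \<and>
    linear_comb (?F (fst q)) (snd q) ` carrier (?F (length (snd q))) = ker (fst p) (snd p))" for p q
  have "\<exists>f. \<forall>i. Inv i (f i) \<and> Next (f i) (f (Suc i))"
  proof (rule dependent_nat_choice)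
    have "submodule {x \<in> carrier (?F (length gs)). linear_comb M gs x = \<zero>\<^bsub>M\<^esub>} R (?F (length gs))"
      by (rule submodule_kernel[OF free_module M' linear_comb_linear[OF M' gs(1)]])
    then obtain ms where "set ms \<subseteq> carrier (?F (length gs))"
      "linear_comb (?F (length gs)) ms ` carrier (?F (length ms)) =
        {x \<in> carrier (?F (length gs)). linear_comb M gs x = \<zero>\<^bsub>M\<^esub>}"
      by (rule linear_comb_cover[OF free_module_fg[OF one_neq_zero]])
    then show "\<exists>p. Inv 0 p" by (intro exI[of _ "(length gs, ms)"]) (simp add: Inv_def)
  next
    fix p i assume "Inv i p"
    then have p: "set (snd p) \<subseteq> carrier (?F (fst p))" by (simp add: Inv_def)
    have "submodule (ker (fst p) (snd p)) R (?F (length (snd p)))"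
      unfolding ker_def by (rule submodule_kernel[OF free_module free_module linear_comb_linear[OF free_module p]])
    then obtain ms where "set ms \<subseteq> carrier (?F (length (snd p)))"
      "linear_comb (?F (length (snd p))) ms ` carrier (?F (length ms)) = ker (fst p) (snd p)"
      by (rule linear_comb_cover[OF free_module_fg[OF one_neq_zero]])
    then show "\<exists>q. Inv (Suc i) q \<and> Next p q"
      by (intro exI[of _ "(length (snd p), ms)"]) (simp add: Inv_def Next_def)
  qed
  then obtain f where f: "\<And>i. Inv i (f i)" "\<And>i. Next (f i) (f (Suc i))" by blast
  define P where "P i = ?F (fst (f i))" for i
  define d where "d i = restrict (linear_comb (P i) (snd (f i))) (carrier (P (Suc i)))" for i
  have P_Suc: "P (Suc i) = ?F (length (snd (f i)))" for i using f(2)[of i] by (simp add: P_def Next_def)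
  have P: "left_module R (P i)" for i unfolding P_def by (rule free_module)
  have "free_resolution R M P d"
    unfolding free_resolution_def
  proof (intro conjI allI)
    fix i
    show "left_module R (P i)" by (rule P)
    show "\<exists>B. is_basis R (P i) B" unfolding P_def using free_module_basis[OF one_neq_zero] by blast
    have ms: "set (snd (f i)) \<subseteq> carrier (P i)" using f(1)[of i] by (simp add: P_def Inv_def)
    show "d i \<in> module_hom R (P (Suc i)) (P i)"
      unfolding d_def
      by (rule restrict_module_hom[OF P]) (unfold P_Suc, rule linear_comb_linear[OF P ms])
    show "d (Suc i) ` carrier (P (Suc (Suc i))) = {x \<in> carrier (P (Suc i)). d i x = \<zero>\<^bsub>P i\<^esub>}"
    proof -
      have "d (Suc i) ` carrier (P (Suc (Suc i))) = ker (fst (f i)) (snd (f i))"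
        using f(2)[of i] f(2)[of "Suc i"] unfolding d_def P_def Next_def by auto
      also have "\<dots> = {x \<in> carrier (P (Suc i)). linear_comb (P i) (snd (f i)) x = \<zero>\<^bsub>P i\<^esub>}"
        by (simp add: ker_def P_Suc) (simp add: P_def)
      also have "\<dots> = {x \<in> carrier (P (Suc i)). d i x = \<zero>\<^bsub>P i\<^esub>}" by (auto simp: d_def)
      finally show ?thesis .
    qed
  next
    have P0: "P 0 = ?F (length gs)" using f(1)[of 0] by (simp add: P_def Inv_def)
    define e where "e = restrict (linear_comb M gs) (carrier (P 0))"
    have "d 0 ` carrier (P 1) = linear_comb (P 0) (snd (f 0)) ` carrier (P 1)" by (simp add: d_def)
    also have "\<dots> = {x \<in> carrier (P 0). linear_comb M gs x = \<zero>\<^bsub>M\<^esub>}"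
      using f(1)[of 0] P_Suc[of 0] P0 by (auto simp: Inv_def)
    also have "\<dots> = {x \<in> carrier (P 0). e x = \<zero>\<^bsub>M\<^esub>}" by (auto simp: e_def)
    finally have "d 0 ` carrier (P 1) = {x \<in> carrier (P 0). e x = \<zero>\<^bsub>M\<^esub>}" .
    moreover have "e \<in> module_hom R (P 0) M"
      unfolding e_def by (rule restrict_module_hom[OF P]) (unfold P0, rule linear_comb_linear[OF M' gs(1)])
    moreover have "e ` carrier (P 0) = carrier M" using gs(2) by (simp add: e_def P0)
    ultimately show "\<exists>e\<in>module_hom R (P 0) M. e ` carrier (P 0) = carrier M \<and>
        d 0 ` carrier (P 1) = {x \<in> carrier (P 0). e x = \<zero>\<^bsub>M\<^esub>}" by blast
  qed
  then show ?thesis by blast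
qed

lemma some_resolution:
  fixes M :: "('a, 'm) module"
  assumes "fg_module R M"
  obtains P d where "some_resolution R M = (P, d)" "free_resolution R M P d"
proof -
  have "\<exists>Pd. case Pd of (P :: nat \<Rightarrow> ('a, ('a + 'm) list) module, d) \<Rightarrow> free_resolution R M P d"
    using free_resolution_exists[OF assms] by auto
  from someI_ex[OF this] show thesis
    using that unfolding some_resolution_def by (metis (no_types, lifting) case_prodE)
qed

lemma grade_eq:
  fixes M :: "('a, 'm) module"
  assumes "fg_module R M" "some_resolution R M = (P, d)" "free_resolution R M P d"
  shows "grade R M = Inf {enat i |i. \<not> cohomology_zero R P d (regular_module R) i}"
  using Ext_nonzero_iff[OF _ regular_left_module assms(2,3)] assms(1)
  by (simp add: grade_def fg_module_def)

end

section \<open>Grade and central regular sequences\<close>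

lemma regular_module_ops [simp]:
  "set_add (regular_module R) = set_add R" "a_inv (regular_module R) = a_inv R"
  "a_minus (regular_module R) = a_minus R" "a_r_coset (regular_module R) = a_r_coset R"
proof -
  show inv: "a_inv (regular_module R) = a_inv R" by (simp add: a_inv_def m_inv_def fun_eq_iff)
  show "a_minus (regular_module R) = a_minus R" by (simp add: a_minus_def inv fun_eq_iff)
  show "set_add (regular_module R) = set_add R" by (simp add: set_add_def' fun_eq_iff)
  show "a_r_coset (regular_module R) = a_r_coset R" by (simp add: a_r_coset_def' fun_eq_iff)
qed

text \<open>A central sequence without properness of its span. Properness follows whenever the
  entries annihilate a nonzero module, and leaving it out admits zero modules, such as a zero
  submodule or quotient of \<open>M\<close>.\<close>

definition regular_sequence :: "('a, 'b) ring_scheme \<Rightarrow> 'a list \<Rightarrow> bool" where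
  "regular_sequence R xs \<longleftrightarrow> set xs \<subseteq> carrier (centre R) \<and>
     (\<forall>i<length xs. \<forall>r\<in>carrier R. xs ! i \<otimes>\<^bsub>R\<^esub> r \<in> span_list R (take i xs) \<longrightarrow>
        r \<in> span_list R (take i xs))"

lemma central_sequence_iff:
  "central_sequence R xs \<longleftrightarrow> regular_sequence R xs \<and> span_list R xs \<noteq> carrier R"
  by (auto simp: central_sequence_def regular_sequence_def)

lemma regular_sequence_Nil: "regular_sequence R []"
  by (simp add: regular_sequence_def)

lemma regular_sequence_snoc:
  "regular_sequence R (xs @ [y]) \<longleftrightarrow> regular_sequence R xs \<and> y \<in> carrier (centre R) \<and>
     (\<forall>r\<in>carrier R. y \<otimes>\<^bsub>R\<^esub> r \<in> span_list R xs \<longrightarrow> r \<in> span_list R xs)"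
  unfolding regular_sequence_def by (auto simp: nth_append less_Suc_eq)

lemma regular_sequence_centre: "regular_sequence R xs \<Longrightarrow> set xs \<subseteq> carrier (centre R)"
  by (simp add: regular_sequence_def)

lemma regular_sequence_take: "regular_sequence R xs \<Longrightarrow> regular_sequence R (take n xs)"
  using set_take_subset[of n xs] by (auto simp: regular_sequence_def)

context ring
begin

lemma span_list_Nil: "span_list R [] = {\<zero>}"
  by (auto simp: span_list_def)

text \<open>Turns the indexed sum into a recursion on the last entry, on which the inductions over
  sequences rest.\<close>

lemma span_list_snoc:
  assumes "set xs \<subseteq> carrier R" "y \<in> carrier R"
  shows "span_list R (xs @ [y]) = span_list R xs <+>\<^bsub>R\<^esub> (\<lambda>r. y \<otimes> r) ` carrier R"
proof -
  let ?n = "length xs"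
  have xs: "xs ! i \<in> carrier R" if "i < ?n" for i using assms(1) nth_mem[OF that] by blast
  have sum: "(\<Oplus>i\<in>{..<length (xs @ [y])}. (xs @ [y]) ! i \<otimes> r i) =
      (\<Oplus>i\<in>{..<?n}. xs ! i \<otimes> r i) \<oplus> y \<otimes> r ?n"
    if r: "r \<in> {..<Suc ?n} \<rightarrow> carrier R" for r
  proof -
    have "(\<Oplus>i\<in>insert ?n {..<?n}. (xs @ [y]) ! i \<otimes> r i) =
        (xs @ [y]) ! ?n \<otimes> r ?n \<oplus> (\<Oplus>i\<in>{..<?n}. (xs @ [y]) ! i \<otimes> r i)"
      by (rule finsum_insert) (use r xs assms(2) in \<open>auto simp: nth_append Pi_def\<close>)
    also have "(\<Oplus>i\<in>{..<?n}. (xs @ [y]) ! i \<otimes> r i) = (\<Oplus>i\<in>{..<?n}. xs ! i \<otimes> r i)"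
      by (rule add.finprod_cong') (use r xs in \<open>auto simp: nth_append Pi_def\<close>)
    finally show ?thesis
      using r xs assms(2) by (simp add: lessThan_Suc a_comm Pi_def)
  qed
  show ?thesis
  proof (intro equalityI subsetI)
    fix v assume "v \<in> span_list R (xs @ [y])"
    then obtain r where r: "r \<in> {..<Suc ?n} \<rightarrow> carrier R"
      "v = (\<Oplus>i\<in>{..<length (xs @ [y])}. (xs @ [y]) ! i \<otimes> r i)" by (auto simp: span_list_def)
    then have "v = (\<Oplus>i\<in>{..<?n}. xs ! i \<otimes> r i) \<oplus> y \<otimes> r ?n" using sum by simp
    moreover have "(\<Oplus>i\<in>{..<?n}. xs ! i \<otimes> r i) \<in> span_list R xs" "r ?n \<in> carrier R"
      using r(1) by (auto simp: span_list_def Pi_def)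
    ultimately show "v \<in> span_list R xs <+>\<^bsub>R\<^esub> (\<lambda>r. y \<otimes> r) ` carrier R" unfolding set_add_def' by blast
  next
    fix v assume "v \<in> span_list R xs <+>\<^bsub>R\<^esub> (\<lambda>r. y \<otimes> r) ` carrier R"
    then obtain r s where rs: "r \<in> {..<?n} \<rightarrow> carrier R" "s \<in> carrier R"
      "v = (\<Oplus>i\<in>{..<?n}. xs ! i \<otimes> r i) \<oplus> y \<otimes> s"
      unfolding set_add_def' span_list_def by blast
    define r' where "r' i = (if i < ?n then r i else s)" for i
    have r': "r' \<in> {..<Suc ?n} \<rightarrow> carrier R" using rs by (auto simp: r'_def Pi_def)
    have "(\<Oplus>i\<in>{..<?n}. xs ! i \<otimes> r i) = (\<Oplus>i\<in>{..<?n}. xs ! i \<otimes> r' i)"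
      by (rule add.finprod_cong') (use rs xs in \<open>auto simp: r'_def Pi_def\<close>)
    then have "v = (\<Oplus>i\<in>{..<length (xs @ [y])}. (xs @ [y]) ! i \<otimes> r' i)"
      using sum[OF r'] rs(3) by (simp add: r'_def)
    then show "v \<in> span_list R (xs @ [y])" using r' unfolding span_list_def by auto
  qed
qed

lemma central_cgenideal:
  assumes "y \<in> carrier (centre R)"
  shows "ideal ((\<lambda>r. y \<otimes> r) ` carrier R) R"
proof (rule idealI)
  note y = centre_comm[OF assms]
  have yR: "y \<in> carrier R" using assms by simp
  show "ring R" by (rule ring_axioms)
  show "subgroup ((\<lambda>r. y \<otimes> r) ` carrier R) (add_monoid R)"
  proof (rule add.subgroupI)
    fix a b assume "a \<in> (\<lambda>r. y \<otimes> r) ` carrier R" "b \<in> (\<lambda>r. y \<otimes> r) ` carrier R"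
    then show "a \<oplus> b \<in> (\<lambda>r. y \<otimes> r) ` carrier R" "\<ominus> a \<in> (\<lambda>r. y \<otimes> r) ` carrier R"
      using yR by (auto simp flip: r_distr r_minus)
  qed (use yR in auto)
  fix a x assume ax: "a \<in> (\<lambda>r. y \<otimes> r) ` carrier R" "x \<in> carrier R"
  then obtain r where r: "a = y \<otimes> r" "r \<in> carrier R" by auto
  have "x \<otimes> a = y \<otimes> (x \<otimes> r)" using ax r yR y[OF ax(2)] by (simp flip: m_assoc)
  then show "x \<otimes> a \<in> (\<lambda>r. y \<otimes> r) ` carrier R" using r ax by auto
  have "a \<otimes> x = y \<otimes> (r \<otimes> x)" using ax r yR by (simp add: m_assoc)
  then show "a \<otimes> x \<in> (\<lambda>r. y \<otimes> r) ` carrier R" using r ax by auto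
qed

lemma span_list_ideal: "set xs \<subseteq> carrier (centre R) \<Longrightarrow> ideal (span_list R xs) R"
proof (induction xs rule: rev_induct)
  case Nil
  then show ?case by (simp add: span_list_Nil zeroideal)
next
  case (snoc y xs)
  then have "set xs \<subseteq> carrier R" "y \<in> carrier R" by auto
  then show ?case
    using snoc by (simp add: span_list_snoc add_ideals central_cgenideal)
qed

lemma span_list_submodule:
  "set xs \<subseteq> carrier (centre R) \<Longrightarrow> submodule (span_list R xs) R (regular_module R)"
  using ideal.submodule_regular[OF span_list_ideal] .

lemma span_list_memI:
  "set xs \<subseteq> carrier (centre R) \<Longrightarrow> x \<in> set xs \<Longrightarrow> x \<in> span_list R xs"
proof (induction xs rule: rev_induct)
  case (snoc y xs)
  then have c: "set xs \<subseteq> carrier R" "y \<in> carrier R" "set xs \<subseteq> carrier (centre R)"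
    "y \<in> carrier (centre R)" by auto
  interpret I: ideal "span_list R xs" R by (rule span_list_ideal[OF c(3)])
  interpret J: ideal "(\<lambda>r. y \<otimes> r) ` carrier R" R by (rule central_cgenideal[OF c(4)])
  have "y \<in> (\<lambda>r. y \<otimes> r) ` carrier R" using c(2) by (intro image_eqI[of _ _ \<one>]) auto
  then have "\<zero> \<oplus> y \<in> span_list R (xs @ [y])"
    unfolding span_list_snoc[OF c(1,2)] set_add_def' using I.zero_closed by blast
  moreover have "x \<oplus> \<zero> \<in> span_list R (xs @ [y])" if "x \<in> span_list R xs"
    unfolding span_list_snoc[OF c(1,2)] set_add_def' using that J.zero_closed by blast
  ultimately show ?case using snoc c by auto
qed simp

end

text \<open>The projection \<open>M / H \<rightarrow> M / K\<close> is \<open>C \<mapsto> K + C\<close>.\<close>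

context
  fixes R :: "('a, 'b) ring_scheme" (structure) and M :: "('a, 'm) module" and H K
  assumes M: "left_module R M" and H: "submodule H R M" and K: "submodule K R M" and HK: "H \<subseteq> K"
begin

interpretation left_module R M by (rule M)

lemma set_add_coset:
  assumes x: "x \<in> carrier M"
  shows "K <+>\<^bsub>M\<^esub> (H +>\<^bsub>M\<^esub> x) = K +>\<^bsub>M\<^esub> x"
proof (intro equalityI subsetI)
  fix v assume "v \<in> K <+>\<^bsub>M\<^esub> (H +>\<^bsub>M\<^esub> x)"
  then obtain k h where kh: "k \<in> K" "h \<in> H" "v = k \<oplus>\<^bsub>M\<^esub> (h \<oplus>\<^bsub>M\<^esub> x)"
    unfolding set_add_def' a_r_coset_def' by blast
  moreover have "h \<in> K" using kh HK by auto
  ultimately have "v = (k \<oplus>\<^bsub>M\<^esub> h) \<oplus>\<^bsub>M\<^esub> x" "k \<oplus>\<^bsub>M\<^esub> h \<in> K"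
    using submoduleD(3,7)[OF K] x by (auto simp: M.a_assoc)
  then show "v \<in> K +>\<^bsub>M\<^esub> x" unfolding a_r_coset_def' by blast
next
  fix v assume "v \<in> K +>\<^bsub>M\<^esub> x"
  then obtain k where k: "k \<in> K" "v = k \<oplus>\<^bsub>M\<^esub> x" unfolding a_r_coset_def' by blast
  then have "v = k \<oplus>\<^bsub>M\<^esub> (\<zero>\<^bsub>M\<^esub> \<oplus>\<^bsub>M\<^esub> x)" using x by simp
  then show "v \<in> K <+>\<^bsub>M\<^esub> (H +>\<^bsub>M\<^esub> x)"
    using k(1) submoduleD(2)[OF H] unfolding set_add_def' a_r_coset_def' by blast
qed

lemma linear_map_quotient_quotient:
  "linear_map R (quotient_module M H) (quotient_module M K) (\<lambda>C. K <+>\<^bsub>M\<^esub> C)"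
  by (rule linear_mapI)
     (auto simp: quotient_simps[OF M H] quotient_simps[OF M K] set_add_coset coset_add[OF M H]
       coset_add[OF M K] quotient_smult[OF M H] quotient_smult[OF M K])

text \<open>Injectivity of \<open>z\<close> on M/H is the regularity assumption, and
  \<open>x\<close> lies in H + z M exactly if it is congruent to a multiple of \<open>z\<close>
  modulo \<open>H\<close>.\<close>

lemma mult_exact_quotient:
  assumes z: "z \<in> carrier R" "K = H <+>\<^bsub>M\<^esub> (\<lambda>x. z \<odot>\<^bsub>M\<^esub> x) ` carrier M"
    and reg: "\<And>x. \<lbrakk>x \<in> carrier M; z \<odot>\<^bsub>M\<^esub> x \<in> H\<rbrakk> \<Longrightarrow> x \<in> H"
  shows "mult_exact R z (quotient_module M H) (quotient_module M K) (\<lambda>C. K <+>\<^bsub>M\<^esub> C)"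
  unfolding mult_exact_def
proof (intro conjI ballI impI)
  show "linear_map R (quotient_module M H) (quotient_module M K) (\<lambda>C. K <+>\<^bsub>M\<^esub> C)"
    by (rule linear_map_quotient_quotient)
  show "(\<lambda>C. K <+>\<^bsub>M\<^esub> C) ` carrier (quotient_module M H) = carrier (quotient_module M K)"
    by (auto simp: quotient_simps[OF M H] quotient_simps[OF M K] set_add_coset image_image)
  fix C assume "C \<in> carrier (quotient_module M H)"
  then obtain x where x: "x \<in> carrier M" "C = H +>\<^bsub>M\<^esub> x" by (auto simp: quotient_simps[OF M H])
  show "C = \<zero>\<^bsub>quotient_module M H\<^esub>" if "z \<odot>\<^bsub>quotient_module M H\<^esub> C = \<zero>\<^bsub>quotient_module M H\<^esub>"
    using that x z(1) reg[OF x(1)]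
    by (simp add: quotient_smult[OF M H] quotient_simps[OF M H] coset_eq_zero_iff[OF M H])
  have "x \<in> K \<longleftrightarrow> (\<exists>y\<in>carrier M. x \<ominus>\<^bsub>M\<^esub> z \<odot>\<^bsub>M\<^esub> y \<in> H)"
  proof
    assume "x \<in> K"
    then obtain h y where hy: "h \<in> H" "y \<in> carrier M" "x = h \<oplus>\<^bsub>M\<^esub> z \<odot>\<^bsub>M\<^esub> y"
      unfolding z(2) set_add_def' by blast
    then have "x \<ominus>\<^bsub>M\<^esub> z \<odot>\<^bsub>M\<^esub> y = h"
      using submoduleD(7)[OF H] z(1) by (simp add: M.diff_eq_iff)
    then have "x \<ominus>\<^bsub>M\<^esub> z \<odot>\<^bsub>M\<^esub> y \<in> H" using hy(1) by simp
    then show "\<exists>y\<in>carrier M. x \<ominus>\<^bsub>M\<^esub> z \<odot>\<^bsub>M\<^esub> y \<in> H" using hy(2) by blast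
  next
    assume "\<exists>y\<in>carrier M. x \<ominus>\<^bsub>M\<^esub> z \<odot>\<^bsub>M\<^esub> y \<in> H"
    then obtain y where y: "y \<in> carrier M" "x \<ominus>\<^bsub>M\<^esub> z \<odot>\<^bsub>M\<^esub> y \<in> H" by auto
    then have "x = (x \<ominus>\<^bsub>M\<^esub> z \<odot>\<^bsub>M\<^esub> y) \<oplus>\<^bsub>M\<^esub> z \<odot>\<^bsub>M\<^esub> y"
      using x z(1) M.diff_eq_iff[of x "z \<odot>\<^bsub>M\<^esub> y" "x \<ominus>\<^bsub>M\<^esub> z \<odot>\<^bsub>M\<^esub> y"] by simp
    then show "x \<in> K" using y unfolding z(2) set_add_def' by blast
  qed
  then show "K <+>\<^bsub>M\<^esub> C = \<zero>\<^bsub>quotient_module M K\<^esub> \<longleftrightarrow>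
      (\<exists>y\<in>carrier (quotient_module M H). C = z \<odot>\<^bsub>quotient_module M H\<^esub> y)"
    using x z(1)
    by (simp add: quotient_simps[OF M H] quotient_simps[OF M K] set_add_coset
        coset_eq_zero_iff[OF M K] quotient_smult[OF M H] coset_eq_iff[OF M H])
qed

end

abbreviation cyclic_quotient :: "('a, 'b) ring_scheme \<Rightarrow> 'a set \<Rightarrow> ('a, 'a set) module" where
  "cyclic_quotient R J \<equiv> quotient_module (regular_module R) J"

definition has_nonzero_map :: "('a, 'b) ring_scheme \<Rightarrow> ('a, 'm) module \<Rightarrow> ('a, 'n) module \<Rightarrow> bool" where
  "has_nonzero_map R M N \<longleftrightarrow> (\<exists>h. linear_map R M N h \<and> (\<exists>x\<in>carrier M. h x \<noteq> \<zero>\<^bsub>N\<^esub>))"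

definition central_annihilator :: "('a, 'b) ring_scheme \<Rightarrow> ('a, 'm) module \<Rightarrow> 'a set" where
  "central_annihilator R M = {z \<in> carrier (centre R). \<forall>x\<in>carrier M. z \<odot>\<^bsub>M\<^esub> x = \<zero>\<^bsub>M\<^esub>}"

lemma Inf_enat_ge:
  assumes "\<And>i. i < n \<Longrightarrow> \<not> Q i"
  shows "enat n \<le> Inf {enat i |i. Q i}"
proof (rule Inf_greatest)
  fix x assume "x \<in> {enat i |i. Q i}"
  then obtain i where i: "x = enat i" "Q i" by blast
  then have "n \<le> i" using assms[of i] by (cases "i < n") auto
  then show "enat n \<le> x" using i by simp
qed

lemma Inf_enat_eq_iff:
  assumes "\<And>i. i < n \<Longrightarrow> \<not> Q i"
  shows "Inf {enat i |i. Q i} = enat n \<longleftrightarrow> Q n"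
proof
  assume "Q n"
  then have "Inf {enat i |i. Q i} \<le> enat n" by (intro Inf_lower) blast
  then show "Inf {enat i |i. Q i} = enat n" using Inf_enat_ge[of n Q, OF assms] by (rule antisym)
next
  assume *: "Inf {enat i |i. Q i} = enat n"
  show "Q n"
  proof (rule ccontr)
    assume "\<not> Q n"
    then have "\<not> Q i" if "i < Suc n" for i using that assms[of i] by (cases "i = n") auto
    then have "enat (Suc n) \<le> Inf {enat i |i. Q i}" by (rule Inf_enat_ge)
    then show False using * by simp
  qed
qed

context centrally_finite_ring
begin

text \<open>Write N_j for \<open>R\<close> modulo the first \<open>j\<close> entries. Each exact
  sequence 0 -> N_j -> N_j -> N_{j+1} -> 0 trades one entry for one degree.\<close>

lemma grade_regular_sequence:
  fixes M :: "('a, 'm) module"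
  assumes fg: "fg_module R M" and xs: "regular_sequence R xs" "set xs \<subseteq> central_annihilator R M"
  shows "enat (length xs) \<le> grade R M"
    and "grade R M = enat (length xs) \<longleftrightarrow> has_nonzero_map R M (cyclic_quotient R (span_list R xs))"
proof -
  have M': "left_module R M" using fg by (simp add: fg_module_def)
  interpret M: left_module R M by (rule M')
  interpret RR: left_module R "regular_module R" by (rule regular_left_module)
  obtain P d where Pd: "some_resolution R M = (P, d)" "free_resolution R M P d"
    by (rule some_resolution[OF fg])
  interpret free_res R M P d by (rule free_res.intro[OF M' Pd(2)])
  let ?N = "\<lambda>j. cyclic_quotient R (span_list R (take j xs))"
  let ?V = "\<lambda>j i. cohomology_zero R P d (?N j) i"
  let ?g = "length xs"
  have sub: "submodule (span_list R (take j xs)) R (regular_module R)" for j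
    using span_list_submodule regular_sequence_centre[OF regular_sequence_take[OF xs(1)]] .
  have N: "left_module R (?N j)" for j by (rule quotient_left_module[OF regular_left_module sub])
  have exact: "mult_exact R (xs ! j) (?N j) (?N (Suc j)) (\<lambda>C. span_list R (take (Suc j) xs) <+>\<^bsub>R\<^esub> C)"
    and kill: "xs ! j \<in> carrier R" "\<And>r. r \<in> carrier R \<Longrightarrow> xs ! j \<otimes> r = r \<otimes> xs ! j"
      "\<And>x. x \<in> carrier M \<Longrightarrow> xs ! j \<odot>\<^bsub>M\<^esub> x = \<zero>\<^bsub>M\<^esub>" if j: "j < ?g" for j
  proof -
    have mem: "xs ! j \<in> set xs" using j by simp
    then have z: "xs ! j \<in> carrier (centre R)" using xs(2) by (auto simp: central_annihilator_def)
    then show "xs ! j \<in> carrier R" "\<And>r. r \<in> carrier R \<Longrightarrow> xs ! j \<otimes> r = r \<otimes> xs ! j"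
      using centre_comm by auto
    show "\<And>x. x \<in> carrier M \<Longrightarrow> xs ! j \<odot>\<^bsub>M\<^esub> x = \<zero>\<^bsub>M\<^esub>"
      using mem xs(2) by (auto simp: central_annihilator_def)
    have T: "take (Suc j) xs = take j xs @ [xs ! j]" using j by (rule take_Suc_conv_app_nth)
    have c: "set (take j xs) \<subseteq> carrier R"
      using set_take_subset[of j xs] regular_sequence_centre[OF xs(1)] by auto
    have eq: "span_list R (take (Suc j) xs) = span_list R (take j xs) <+>\<^bsub>regular_module R\<^esub>
        (\<lambda>x. xs ! j \<odot>\<^bsub>regular_module R\<^esub> x) ` carrier (regular_module R)"
      using span_list_snoc[OF c] z by (simp add: T)
    have "span_list R (take j xs) \<subseteq> span_list R (take (Suc j) xs)"
      unfolding eq by (rule RR.submodule_le_set_add(1)[OF sub])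
        (use ideal.submodule_regular[OF central_cgenideal[OF z]] in simp)
    then show "mult_exact R (xs ! j) (?N j) (?N (Suc j)) (\<lambda>C. span_list R (take (Suc j) xs) <+>\<^bsub>R\<^esub> C)"
      using mult_exact_quotient[OF regular_left_module sub sub _ _ eq] xs(1) j z
      by (simp add: regular_sequence_def)
  qed
  have V0: "?V j 0" if "j < ?g" for j
    by (rule cohomology_zero_0[OF kill[OF that] N N exact[OF that]])
  have V_Suc: "?V j (Suc i)" if "j < ?g" "?V (Suc j) i" for i j
    by (rule cohomology_zero_Suc[OF kill[OF that(1)] N N exact[OF that(1)] that(2)])
  have V_quot: "?V (Suc j) i" if "j < ?g" "?V j i" "?V j (Suc i)" for i j
    by (rule cohomology_zero_quotient[OF kill[OF that(1)] N N exact[OF that(1)] that(2,3)])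
  \<comment> \<open>\<open>k\<close> counts the entries put back: on the way from the full quotient
    to stage \<open>?g - k\<close> the first degree that can be nonzero moves up from 0 to
    \<open>k\<close>, and vanishing there is still decided by homomorphisms into the full
    quotient.\<close>
  have main: "(\<forall>i<k. ?V (?g - k) i) \<and> (?V (?g - k) k \<longleftrightarrow> ?V ?g 0)" if "k \<le> ?g" for k
    using that
  proof (induction k)
    case 0
    then show ?case by simp
  next
    case (Suc k)
    define j where "j = ?g - Suc k"
    have j: "j < ?g" "?g - k = Suc j" using Suc.prems by (auto simp: j_def)
    have IH: "\<forall>i<k. ?V (Suc j) i" "?V (Suc j) k \<longleftrightarrow> ?V ?g 0" using Suc j by auto
    have low: "?V j i" if "i < Suc k" for i
      using V0[OF j(1)] V_Suc[OF j(1)] IH(1) that by (cases i) auto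
    then have "?V j (Suc k) \<longleftrightarrow> ?V (Suc j) k"
      using V_Suc[OF j(1)] V_quot[OF j(1)] by blast
    then show ?case using low IH(2) by (simp add: j_def[symmetric])
  qed
  \<comment> \<open>\<open>?N 0\<close> is \<open>R\<close> modulo the zero ideal, with singletons
    as elements, while the grade refers to \<open>R\<close> itself.\<close>
  have "linear_map R (regular_module R) (?N 0) (\<lambda>x. span_list R (take 0 xs) +>\<^bsub>regular_module R\<^esub> x)"
    by (rule linear_map_quotient[OF regular_left_module sub])
  moreover have "bij_betw (\<lambda>x. span_list R (take 0 xs) +>\<^bsub>regular_module R\<^esub> x)
      (carrier (regular_module R)) (carrier (?N 0))"
    unfolding bij_betw_def
  proof
    show "inj_on (\<lambda>x. span_list R (take 0 xs) +>\<^bsub>regular_module R\<^esub> x) (carrier (regular_module R))"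
      using coset_eq_iff[OF regular_left_module sub[of 0]] by (auto simp: inj_on_def span_list_Nil)
    show "(\<lambda>x. span_list R (take 0 xs) +>\<^bsub>regular_module R\<^esub> x) ` carrier (regular_module R) = carrier (?N 0)"
      by (simp only: quotient_simps[OF regular_left_module sub])
  qed
  ultimately have V_reg: "cohomology_zero R P d (regular_module R) i \<longleftrightarrow> ?V 0 i" for i
    by (rule cohomology_zero_iso[OF regular_left_module N])
  have low: "\<not> \<not> cohomology_zero R P d (regular_module R) i" if "i < ?g" for i
    using main[of ?g] that V_reg by simp
  have top: "\<not> cohomology_zero R P d (regular_module R) ?g \<longleftrightarrow> has_nonzero_map R M (?N ?g)"
  proof -
    have "?V ?g 0 \<longleftrightarrow> \<not> has_nonzero_map R M (?N ?g)"
      unfolding cohomology_zero_0_iff[OF N] has_nonzero_map_def by blast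
    then show ?thesis using main[of ?g] V_reg by simp
  qed
  show "enat (length xs) \<le> grade R M"
    unfolding grade_eq[OF fg Pd] by (rule Inf_enat_ge[OF low])
  show "grade R M = enat (length xs) \<longleftrightarrow> has_nonzero_map R M (cyclic_quotient R (span_list R xs))"
    unfolding grade_eq[OF fg Pd] using Inf_enat_eq_iff[OF low] top by simp
qed

lemma grade_zero_module:
  fixes M :: "('a, 'm) module"
  assumes fg: "fg_module R M" and zero: "carrier M = {\<zero>\<^bsub>M\<^esub>}"
  shows "grade R M = \<infinity>"
proof -
  have M': "left_module R M" using fg by (simp add: fg_module_def)
  obtain P d where Pd: "some_resolution R M = (P, d)" "free_resolution R M P d"
    by (rule some_resolution[OF fg])
  interpret free_res R M P d by (rule free_res.intro[OF M' Pd(2)])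
  show ?thesis
    unfolding grade_eq[OF fg Pd]
    using cohomology_zero_of_zero_module[OF zero regular_left_module] by (simp add: top_enat_def)
qed

end

section \<open>Associated primes and prime avoidance\<close>

definition module_colon :: "('a, 'b) ring_scheme \<Rightarrow> ('a, 'm) module \<Rightarrow> 'm set \<Rightarrow> 'm \<Rightarrow> 'a set" where
  "module_colon R M J u = {z \<in> carrier R. z \<odot>\<^bsub>M\<^esub> u \<in> J}"

text \<open>The maximal annihilators of nonzero elements of M/J, hence associated primes. In the
  noetherian case they are finitely many and cover all zero divisors on M/J; being maximal they are
  pairwise incomparable, which is what prime avoidance below asks for.\<close>

definition maximal_colons :: "('a, 'b) ring_scheme \<Rightarrow> ('a, 'm) module \<Rightarrow> 'm set \<Rightarrow> 'a set set" where
  "maximal_colons R M J = {module_colon R M J v |v. v \<in> carrier M - J \<and>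
     (\<forall>w \<in> carrier M - J. module_colon R M J v \<subseteq> module_colon R M J w \<longrightarrow>
        module_colon R M J w = module_colon R M J v)}"

text \<open>The kernel of the map from \<open>M\<close> to the localization of M/J at
  \<open>S\<close>, expressed without fractions.\<close>

definition saturate :: "('a, 'm) module \<Rightarrow> 'a set \<Rightarrow> 'm set \<Rightarrow> 'm set" where
  "saturate M S J = {u \<in> carrier M. \<exists>s\<in>S. s \<odot>\<^bsub>M\<^esub> u \<in> J}"

definition multiplicative :: "('a, 'b) ring_scheme \<Rightarrow> 'a set \<Rightarrow> bool" where
  "multiplicative R S \<longleftrightarrow> S \<subseteq> carrier R \<and> \<one>\<^bsub>R\<^esub> \<in> S \<and> (\<forall>s\<in>S. \<forall>t\<in>S. s \<otimes>\<^bsub>R\<^esub> t \<in> S)"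

lemma (in cring) regular_comm_left_module: "comm_left_module R (regular_module R)"
  by (intro comm_left_module.intro regular_left_module cring_axioms)

lemma (in ring) regular_finitely_generated: "finitely_generated R (regular_module R)"
proof -
  interpret left_module R "regular_module R" by (rule regular_left_module)
  have "N = carrier R" if N: "submodule N R (regular_module R)" "\<one> \<in> N" for N
  proof -
    have "x \<in> N" if "x \<in> carrier R" for x using submoduleD(4)[OF N(1), of x \<one>] N(2) that by simp
    then show ?thesis using submoduleD(1)[OF N(1)] by auto
  qed
  then show ?thesis unfolding finitely_generated_def by (intro exI[of _ "{\<one>}"]) auto
qed

lemma (in cring) noetherian_regular:
  "noetherian_ring R \<Longrightarrow> noetherian_in R (regular_module R) (carrier R)"
  using comm_left_module.finitely_generated_noetherian[OF regular_comm_left_module _ regular_finitely_generated]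
  by simp

lemma (in primeideal) prime_one: "\<one> \<notin> I"
  using I_notcarr one_imp_carrier by auto

lemma (in primeideal) prime_mult_notin:
  "\<lbrakk>a \<in> carrier R; b \<in> carrier R; a \<notin> I; b \<notin> I\<rbrakk> \<Longrightarrow> a \<otimes> b \<notin> I"
  using I_prime by blast

lemma (in primeideal) multiplicative_complement: "multiplicative R (carrier R - I)"
  using prime_one prime_mult_notin by (auto simp: multiplicative_def)

text \<open>An element of \<open>a\<close> outside \<open>b\<close> is picked for each
  \<open>a\<close>, and primeness keeps the product of these elements outside
  \<open>b\<close>.\<close>

lemma (in cring) exists_in_primes_notin_prime:
  assumes "finite F" "primeideal b R" "\<And>a. a \<in> F \<Longrightarrow> ideal a R" "\<And>a. a \<in> F \<Longrightarrow> \<not> a \<subseteq> b"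
  shows "\<exists>z\<in>carrier R - b. \<forall>a\<in>F. z \<in> a"
  using assms(1,3,4)
proof (induction F rule: finite_induct)
  interpret b: primeideal b R by fact
  case empty
  then show ?case using b.prime_one by blast
next
  interpret b: primeideal b R by fact
  case (insert a F)
  then obtain z where z: "z \<in> carrier R" "z \<notin> b" "\<forall>a\<in>F. z \<in> a" by auto
  from insert.prems have a: "ideal a R" and F: "\<And>c. c \<in> F \<Longrightarrow> ideal c R" by auto
  interpret a: ideal a R by (rule a)
  obtain y where y: "y \<in> a" "y \<notin> b" using insert.prems(2)[of a] by auto
  then have yR: "y \<in> carrier R" using a.a_subset by auto
  have "y \<otimes> z \<in> c" if "c \<in> insert a F" for c
  proof (cases "c = a")
    case True
    then show ?thesis using a.I_r_closed[OF y(1) z(1)] by simp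
  next
    case False
    then have "c \<in> F" using that by simp
    then show ?thesis using ideal.I_l_closed[OF F, of c z y] z(3) yR by blast
  qed
  moreover have "y \<otimes> z \<notin> b" using b.prime_mult_notin yR z y by blast
  ultimately show ?case using yR z(1) by blast
qed

text \<open>If \<open>x\<close> avoids the primes in \<open>F\<close> but lies in the new prime
  \<open>p\<close>, it is corrected by an element of \<open>I\<close> that lies in all primes of
  \<open>F\<close> but not in \<open>p\<close>; incomparability provides such an element.\<close>

lemma (in cring) prime_avoidance:
  assumes "finite F" "\<And>p. p \<in> F \<Longrightarrow> primeideal p R" "\<And>p q. \<lbrakk>p \<in> F; q \<in> F; p \<subseteq> q\<rbrakk> \<Longrightarrow> p = q"
    and I: "ideal I R" and "\<And>p. p \<in> F \<Longrightarrow> \<not> I \<subseteq> p"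
  shows "\<exists>x\<in>I. \<forall>p\<in>F. x \<notin> p"
  using assms(1-3,5)
proof (induction F rule: finite_induct)
  interpret I: ideal I R by (rule I)
  case empty
  then show ?case using I.zero_closed by blast
next
  interpret I: ideal I R by (rule I)
  case (insert p F)
  have "\<exists>x\<in>I. \<forall>q\<in>F. x \<notin> q"
    by (rule insert.IH) (use insert.prems in \<open>blast+\<close>)
  then obtain x where x: "x \<in> I" "\<forall>q\<in>F. x \<notin> q" by auto
  interpret p: primeideal p R using insert.prems(1) by simp
  show ?case
  proof (cases "x \<in> p")
    case False
    then show ?thesis using x by auto
  next
    case True
    have xR: "x \<in> carrier R" using x I.a_subset by auto
    obtain y where y: "y \<in> I" "y \<notin> p" using insert.prems(3)[of p] by auto
    then have yR: "y \<in> carrier R" using I.a_subset by auto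
    have ideals: "ideal q R" if "q \<in> F" for q
      using insert.prems(1)[of q] that by (simp add: primeideal.axioms(1))
    have "\<not> q \<subseteq> p" if "q \<in> F" for q
      using insert.prems(2)[of q p] insert.hyps(2) that by blast
    then obtain z where z: "z \<in> carrier R" "z \<notin> p" "\<forall>q\<in>F. z \<in> q"
      using exists_in_primes_notin_prime[OF insert.hyps(1) p.primeideal ideals] by auto
    have w: "y \<otimes> z \<in> I" "y \<otimes> z \<notin> p" "y \<otimes> z \<in> carrier R"
      using I.I_r_closed[OF y(1) z(1)] p.prime_mult_notin[OF yR z(1) y(2) z(2)] yR z(1) by auto
    have "x \<oplus> y \<otimes> z \<in> I" using x(1) w(1) by simp
    moreover have "x \<oplus> y \<otimes> z \<notin> p"
    proof
      assume "x \<oplus> y \<otimes> z \<in> p"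
      then have "\<ominus> x \<oplus> (x \<oplus> y \<otimes> z) \<in> p" using True by simp
      then show False using w xR by (simp add: r_neg1)
    qed
    moreover have "x \<oplus> y \<otimes> z \<notin> q" if q: "q \<in> F" for q
    proof
      interpret q: ideal q R by (rule ideals[OF q])
      assume *: "x \<oplus> y \<otimes> z \<in> q"
      have "y \<otimes> z \<in> q" using q z(3) yR q.I_l_closed by blast
      then have "(x \<oplus> y \<otimes> z) \<oplus> \<ominus> (y \<otimes> z) \<in> q" using * by simp
      then show False using x(2) q w xR by (simp add: a_assoc r_neg)
    qed
    ultimately show ?thesis by blast
  qed
qed

context comm_left_module
begin

context
  fixes J assumes J: "submodule J R M"
begin

private lemma Jc: "j \<in> J \<Longrightarrow> j \<in> carrier M" using submoduleD(7)[OF J] .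

lemma module_colon_ideal:
  assumes u: "u \<in> carrier M"
  shows "ideal (module_colon R M J u) R"
proof (rule idealI)
  note j = submoduleD[OF J]
  show "ring R" by (rule ring_axioms)
  show "subgroup (module_colon R M J u) (add_monoid R)"
  proof (rule R.add.subgroupI)
    show "module_colon R M J u \<noteq> {}"
      using u j(2) by (auto simp: module_colon_def intro!: exI[of _ \<zero>])
  qed (use u j in \<open>auto simp: module_colon_def smult_l_distr smult_l_minus\<close>)
  show mult: "x \<otimes> a \<in> module_colon R M J u" if "a \<in> module_colon R M J u" "x \<in> carrier R" for a x
    using that u j(4) by (auto simp: module_colon_def smult_assoc)
  show "a \<otimes> x \<in> module_colon R M J u" if "a \<in> module_colon R M J u" "x \<in> carrier R" for a x
    using mult[OF that] m_comm[of a x] that by (auto simp: module_colon_def)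
qed

lemma module_colon_notin: "\<lbrakk>u \<in> carrier M; u \<notin> J\<rbrakk> \<Longrightarrow> \<one> \<notin> module_colon R M J u"
  by (simp add: module_colon_def)

text \<open>If x y takes \<open>v\<close> into \<open>J\<close> but \<open>y\<close> does not, then
  the colon of y v contains \<open>a\<close>, hence equals it by maximality, and it contains
  \<open>x\<close>.\<close>

lemma maximal_colon_prime:
  assumes "a \<in> maximal_colons R M J"
  shows "primeideal a R"
proof -
  obtain v where v: "v \<in> carrier M" "v \<notin> J" "a = module_colon R M J v"
    and max: "\<And>w. \<lbrakk>w \<in> carrier M; w \<notin> J; a \<subseteq> module_colon R M J w\<rbrakk> \<Longrightarrow> module_colon R M J w = a"
    using assms by (auto simp: maximal_colons_def)
  interpret a: ideal a R unfolding v(3) by (rule module_colon_ideal[OF v(1)])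
  show ?thesis
  proof (rule primeidealI)
    show "ideal a R" by (rule a.ideal_axioms)
    show "cring R" by (rule cring_axioms)
    show "carrier R \<noteq> a" using module_colon_notin[OF v(1,2)] v(3) by auto
    fix x y assume xy: "x \<in> carrier R" "y \<in> carrier R" "x \<otimes> y \<in> a"
    show "x \<in> a \<or> y \<in> a"
    proof (rule disjCI)
      assume y: "y \<notin> a"
      have mem: "z \<in> a \<longleftrightarrow> z \<in> carrier R \<and> z \<odot>\<^bsub>M\<^esub> v \<in> J" for z
        unfolding v(3) by (simp add: module_colon_def)
      have "y \<odot>\<^bsub>M\<^esub> v \<notin> J" "y \<odot>\<^bsub>M\<^esub> v \<in> carrier M" using y xy(2) v(1) unfolding mem by auto
      moreover have "a \<subseteq> module_colon R M J (y \<odot>\<^bsub>M\<^esub> v)"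
      proof
        fix z assume z: "z \<in> a"
        then have zR: "z \<in> carrier R" using a.a_subset by auto
        have "y \<otimes> z \<in> a" using z xy(2) by (rule a.I_l_closed)
        then show "z \<in> module_colon R M J (y \<odot>\<^bsub>M\<^esub> v)"
          using v(1) zR xy(2) m_comm[OF xy(2) zR] unfolding mem by (simp add: module_colon_def flip: smult_assoc)
      qed
      ultimately have "module_colon R M J (y \<odot>\<^bsub>M\<^esub> v) = a" by (intro max)
      moreover have "x \<in> module_colon R M J (y \<odot>\<^bsub>M\<^esub> v)"
        using xy v(1) unfolding mem by (simp add: module_colon_def flip: smult_assoc)
      ultimately show "x \<in> a" by simp
    qed
  qed
qed

lemma maximal_colon_exists:
  assumes Z: "noetherian_ring R" and u: "u \<in> carrier M" "u \<notin> J"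
  obtains a where "a \<in> maximal_colons R M J" "module_colon R M J u \<subseteq> a"
proof -
  have noeth: "noetherian_in R (regular_module R) (carrier R)" by (rule noetherian_regular[OF Z])
  let ?A = "{module_colon R M J v |v. v \<in> carrier M - J}"
  have mem: "module_colon R M J u \<in> ?A" using u by blast
  have sub: "submodule N R (regular_module R) \<and> N \<subseteq> carrier R" if N: "N \<in> ?A" for N
  proof -
    obtain v where "v \<in> carrier M" "N = module_colon R M J v" using N by auto
    then show ?thesis using ideal.submodule_regular[OF module_colon_ideal] by (auto simp: module_colon_def)
  qed
  obtain a where a: "a \<in> ?A" "module_colon R M J u \<subseteq> a" "\<And>N'. \<lbrakk>N' \<in> ?A; a \<subseteq> N'\<rbrakk> \<Longrightarrow> N' = a"
    by (rule noetherian_in_maximal[OF noeth mem sub]) (assumption, rule that)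
  from a(1) obtain v where v: "v \<in> carrier M - J" "a = module_colon R M J v" by auto
  have "module_colon R M J w = module_colon R M J v"
    if "w \<in> carrier M - J" "module_colon R M J v \<subseteq> module_colon R M J w" for w
    using a(3)[of "module_colon R M J w"] that v(2) by blast
  then have "a \<in> maximal_colons R M J" unfolding maximal_colons_def using v by blast
  then show thesis using a(2) that by blast
qed

lemma maximal_colons_incomparable:
  "\<lbrakk>a \<in> maximal_colons R M J; b \<in> maximal_colons R M J; a \<subseteq> b\<rbrakk> \<Longrightarrow> a = b"
  unfolding maximal_colons_def by clarify (metis Diff_iff)

text \<open>Let \<open>v a\<close> be an element whose colon is \<open>a\<close>. Once the submodule
  generated by the \<open>v a\<close> for \<open>a\<close> in a finite set \<open>F\<close> is
  maximal, any further \<open>v b\<close> lies in it; an element in all members of \<open>F\<close>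
  but outside \<open>b\<close> then takes \<open>v b\<close> into \<open>J\<close>, which is
  absurd.\<close>

lemma finite_maximal_colons:
  assumes noeth: "noetherian_in R M (carrier M)"
  shows "finite (maximal_colons R M J)"
proof (rule ccontr)
  assume inf: "infinite (maximal_colons R M J)"
  let ?A = "maximal_colons R M J"
  have "\<exists>v. v \<in> carrier M \<and> v \<notin> J \<and> a = module_colon R M J v" if "a \<in> ?A" for a
    using that by (auto simp: maximal_colons_def)
  then obtain v where v: "\<And>a. a \<in> ?A \<Longrightarrow> v a \<in> carrier M \<and> v a \<notin> J \<and> a = module_colon R M J (v a)"
    by metis
  define K where "K F = generated_submodule R M (v ` F)" for F
  have vc: "v ` F \<subseteq> carrier M" if "F \<subseteq> ?A" for F using v that by blast
  note gen = generated_submodule[OF left_module_axioms vc]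
  let ?K = "{K F |F. finite F \<and> F \<subseteq> ?A}"
  have sub: "submodule N R M \<and> N \<subseteq> carrier M" if N: "N \<in> ?K" for N
  proof -
    obtain F where "F \<subseteq> ?A" "N = K F" using N by blast
    then show ?thesis using gen(1) submoduleD(1) by (simp add: K_def)
  qed
  have mem: "K {} \<in> ?K" by blast
  obtain N where N: "N \<in> ?K" "K {} \<subseteq> N" "\<And>N'. \<lbrakk>N' \<in> ?K; N \<subseteq> N'\<rbrakk> \<Longrightarrow> N' = N"
    by (rule noetherian_in_maximal[OF noeth mem sub]) (assumption, rule that)
  then obtain F where F: "finite F" "F \<subseteq> ?A" "N = K F" by auto
  obtain b where b: "b \<in> ?A" "b \<notin> F" using inf F(1) F(2) finite_subset[of ?A F] by blast
  have bF: "insert b F \<subseteq> ?A" using b F by auto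
  have "K F \<subseteq> K (insert b F)"
    unfolding K_def by (rule generated_submodule_least[OF left_module_axioms gen(1)[OF bF]])
      (use gen(2)[OF bF] in auto)
  then have "K (insert b F) = K F" using N(3)[of "K (insert b F)"] F bF by blast
  then have vb: "v b \<in> K F" using gen(2)[OF bF] by (auto simp: K_def)
  have id: "ideal a R" if "a \<in> F" for a
    using maximal_colon_prime[of a] F(2) that by (auto intro: primeideal.axioms(1))
  have "\<not> a \<subseteq> b" if "a \<in> F" for a
    using maximal_colons_incomparable[of a b] that F(2) b by auto
  then obtain z where z: "z \<in> carrier R" "z \<notin> b" "\<forall>a\<in>F. z \<in> a"
    using exists_in_primes_notin_prime[OF F(1) maximal_colon_prime[OF b(1)] id] by auto
  have "submodule {x \<in> carrier M. z \<odot>\<^bsub>M\<^esub> x \<in> J} R M"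
  proof (rule submoduleI)
    fix a x assume "a \<in> carrier R" "x \<in> {x \<in> carrier M. z \<odot>\<^bsub>M\<^esub> x \<in> J}"
    moreover have "z \<odot>\<^bsub>M\<^esub> (a \<odot>\<^bsub>M\<^esub> x) = a \<odot>\<^bsub>M\<^esub> (z \<odot>\<^bsub>M\<^esub> x)" if "a \<in> carrier R" "x \<in> carrier M"
      using that z(1) m_comm[of a z] by (simp flip: smult_assoc)
    ultimately show "a \<odot>\<^bsub>M\<^esub> x \<in> {x \<in> carrier M. z \<odot>\<^bsub>M\<^esub> x \<in> J}" using submoduleD(4)[OF J] by auto
  qed (use z(1) submoduleD[OF J] in \<open>auto simp: smult_r_distr\<close>)
  then have "K F \<subseteq> {x \<in> carrier M. z \<odot>\<^bsub>M\<^esub> x \<in> J}"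
    unfolding K_def
  proof (rule generated_submodule_least[OF left_module_axioms], intro image_subsetI)
    fix a assume a: "a \<in> F"
    then have "z \<in> module_colon R M J (v a)" using z(3) v F(2) by blast
    then show "v a \<in> {x \<in> carrier M. z \<odot>\<^bsub>M\<^esub> x \<in> J}"
      using v F(2) a by (auto simp: module_colon_def)
  qed
  then have "z \<in> module_colon R M J (v b)" using vb z(1) by (auto simp: module_colon_def)
  then show False using z(2) v[OF b(1)] by simp
qed

text \<open>Otherwise prime avoidance finds an element of \<open>I\<close> outside all maximal
  colons, yet this element is a zero divisor and belongs to a colon that one of them
  contains.\<close>

lemma zero_divisors_in_maximal_colon:
  assumes Z: "noetherian_ring R" and noeth: "noetherian_in R M (carrier M)" and I: "ideal I R"
    and zd: "\<And>z. z \<in> I \<Longrightarrow> \<exists>u\<in>carrier M - J. z \<odot>\<^bsub>M\<^esub> u \<in> J"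
  obtains a where "a \<in> maximal_colons R M J" "I \<subseteq> a"
proof (rule ccontr)
  assume "\<not> thesis"
  then have "\<And>a. a \<in> maximal_colons R M J \<Longrightarrow> \<not> I \<subseteq> a" using that by blast
  then obtain x where x: "x \<in> I" "\<forall>a\<in>maximal_colons R M J. x \<notin> a"
    using prime_avoidance[OF finite_maximal_colons[OF noeth] maximal_colon_prime maximal_colons_incomparable I]
    by blast
  then obtain u where u: "u \<in> carrier M" "u \<notin> J" "x \<odot>\<^bsub>M\<^esub> u \<in> J" using zd by blast
  obtain a where "a \<in> maximal_colons R M J" "module_colon R M J u \<subseteq> a"
    by (rule maximal_colon_exists[OF Z u(1,2)])
  moreover have "x \<in> carrier R" using x(1) ideal.Icarr[OF I] by blast
  ultimately show False using u(3) x(2) by (auto simp: module_colon_def)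
qed

lemma saturate_submodule:
  assumes S: "multiplicative R S"
  shows "submodule (saturate M S J) R M" "J \<subseteq> saturate M S J"
    "\<lbrakk>s \<in> S; u \<in> carrier M; s \<odot>\<^bsub>M\<^esub> u \<in> saturate M S J\<rbrakk> \<Longrightarrow> u \<in> saturate M S J"
proof -
  note j = submoduleD[OF J]
  have SR: "s \<in> carrier R" if "s \<in> S" for s using S that by (auto simp: multiplicative_def)
  have mul: "s \<otimes> t \<in> S" if "s \<in> S" "t \<in> S" for s t using S that by (auto simp: multiplicative_def)
  show J_sub: "J \<subseteq> saturate M S J"
    using S j(7) by (auto simp: saturate_def multiplicative_def intro!: bexI[of _ \<one>])
  show "submodule (saturate M S J) R M"
  proof (rule submoduleI)
    show "saturate M S J \<subseteq> carrier M" by (auto simp: saturate_def)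
    show "\<zero>\<^bsub>M\<^esub> \<in> saturate M S J" using J_sub j(2) by auto
    show "x \<oplus>\<^bsub>M\<^esub> y \<in> saturate M S J" if xy: "x \<in> saturate M S J" "y \<in> saturate M S J" for x y
    proof -
      obtain s t where st: "s \<in> S" "t \<in> S" "s \<odot>\<^bsub>M\<^esub> x \<in> J" "t \<odot>\<^bsub>M\<^esub> y \<in> J" "x \<in> carrier M" "y \<in> carrier M"
        using xy by (auto simp: saturate_def)
      have "(s \<otimes> t) \<odot>\<^bsub>M\<^esub> (x \<oplus>\<^bsub>M\<^esub> y) = t \<odot>\<^bsub>M\<^esub> (s \<odot>\<^bsub>M\<^esub> x) \<oplus>\<^bsub>M\<^esub> s \<odot>\<^bsub>M\<^esub> (t \<odot>\<^bsub>M\<^esub> y)"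
        using st SR m_comm[of s t] by (simp add: smult_r_distr flip: smult_assoc)
      then show ?thesis
        using st SR mul[of s t] j(3,4) by (auto simp: saturate_def intro!: bexI[of _ "s \<otimes> t"])
    qed
    show "a \<odot>\<^bsub>M\<^esub> x \<in> saturate M S J" if ax: "a \<in> carrier R" "x \<in> saturate M S J" for a x
    proof -
      obtain s where s: "s \<in> S" "s \<odot>\<^bsub>M\<^esub> x \<in> J" "x \<in> carrier M" using ax by (auto simp: saturate_def)
      have "s \<odot>\<^bsub>M\<^esub> (a \<odot>\<^bsub>M\<^esub> x) = a \<odot>\<^bsub>M\<^esub> (s \<odot>\<^bsub>M\<^esub> x)"
        using s SR ax m_comm[of s a] by (simp flip: smult_assoc)
      then show ?thesis using s SR ax j(4) by (auto simp: saturate_def intro!: bexI[of _ s])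
    qed
  qed
  show "u \<in> saturate M S J" if u: "s \<in> S" "u \<in> carrier M" "s \<odot>\<^bsub>M\<^esub> u \<in> saturate M S J"
  proof -
    obtain t where t: "t \<in> S" "t \<odot>\<^bsub>M\<^esub> (s \<odot>\<^bsub>M\<^esub> u) \<in> J" using u by (auto simp: saturate_def)
    then have "(t \<otimes> s) \<odot>\<^bsub>M\<^esub> u \<in> J" using u SR by (simp add: smult_assoc)
    then show ?thesis using u(2) mul[OF t(1) u(1)] by (auto simp: saturate_def)
  qed
qed

text \<open>A local form of Nakayama's lemma: \<open>U\<close> vanishes in \<open>M / J\<close> localized at \<open>\<mm>\<close>. Choose a
  counterexample \<open>r\<close> for which the localization of \<open>R r\<close> is maximal.\<close>

lemma local_nakayama:
  assumes noeth: "noetherian_in R M (carrier M)" and m: "primeideal \<mm> R" and y: "y \<in> \<mm>"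
    and U: "U \<subseteq> carrier M"
    and step: "\<And>r. r \<in> U \<Longrightarrow> \<exists>s\<in>carrier R - \<mm>. \<exists>r'\<in>U. s \<odot>\<^bsub>M\<^esub> r \<ominus>\<^bsub>M\<^esub> y \<odot>\<^bsub>M\<^esub> r' \<in> J"
  shows "U \<subseteq> saturate M (carrier R - \<mm>) J"
proof (rule ccontr)
  interpret m: primeideal \<mm> R by (rule m)
  let ?S = "carrier R - \<mm>"
  note j = submoduleD[OF J]
  have S: "multiplicative R ?S" by (rule m.multiplicative_complement)
  have yR: "y \<in> carrier R" using y by simp
  assume "\<not> U \<subseteq> saturate M ?S J"
  then obtain r0 where r0: "r0 \<in> U" "r0 \<notin> saturate M ?S J" by auto
  define C where "C r = J <+>\<^bsub>M\<^esub> (\<lambda>a. a \<odot>\<^bsub>M\<^esub> r) ` carrier R" for r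
  define T where "T r = saturate M ?S (C r)" for r
  have C: "submodule (C r) R M" if "r \<in> carrier M" for r
    unfolding C_def by (rule submodule_set_add[OF J cyclic_submodule[OF that]])
  have T: "submodule (T r) R M" if "r \<in> carrier M" for r
    unfolding T_def by (rule comm_left_module.saturate_submodule(1)[OF comm_left_module_axioms C[OF that] S])
  let ?K = "{T r |r. r \<in> U \<and> r \<notin> saturate M ?S J}"
  have sub: "submodule N R M \<and> N \<subseteq> carrier M" if N: "N \<in> ?K" for N
  proof -
    obtain r where "r \<in> U" "N = T r" using N by blast
    then show ?thesis using T[of r] submoduleD(1)[of "T r"] U by blast
  qed
  have mem: "T r0 \<in> ?K" using r0 by blast
  obtain N where N: "N \<in> ?K" "T r0 \<subseteq> N" "\<And>N'. \<lbrakk>N' \<in> ?K; N \<subseteq> N'\<rbrakk> \<Longrightarrow> N' = N"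
    by (rule noetherian_in_maximal[OF noeth mem sub]) (assumption, rule that)
  then obtain r where r: "r \<in> U" "r \<notin> saturate M ?S J" "N = T r" by auto
  obtain s r' where s: "s \<in> ?S" "r' \<in> U" "s \<odot>\<^bsub>M\<^esub> r \<ominus>\<^bsub>M\<^esub> y \<odot>\<^bsub>M\<^esub> r' \<in> J" using step[OF r(1)] by auto
  define k where "k = s \<odot>\<^bsub>M\<^esub> r \<ominus>\<^bsub>M\<^esub> y \<odot>\<^bsub>M\<^esub> r'"
  have c: "r \<in> carrier M" "r' \<in> carrier M" "s \<in> carrier R" "k \<in> carrier M" "k \<in> J"
    using U r s j(7) by (auto simp: k_def)
  have sr: "s \<odot>\<^bsub>M\<^esub> r = k \<oplus>\<^bsub>M\<^esub> y \<odot>\<^bsub>M\<^esub> r'"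
    using c yR M.diff_eq_iff[of "s \<odot>\<^bsub>M\<^esub> r" "y \<odot>\<^bsub>M\<^esub> r'" k] by (simp add: k_def)
  have memC: "\<lbrakk>k \<in> J; a \<in> carrier R\<rbrakk> \<Longrightarrow> k \<oplus>\<^bsub>M\<^esub> a \<odot>\<^bsub>M\<^esub> r \<in> C r" for k a r
    unfolding C_def set_add_def' by blast
  have self: "w \<in> T w" if "w \<in> carrier M" for w
  proof -
    have "w \<in> C w" using memC[OF j(2) R.one_closed, of w] that by simp
    then show ?thesis
      unfolding T_def using comm_left_module.saturate_submodule(2)[OF comm_left_module_axioms C[OF that] S] by blast
  qed
  have "r \<in> T r'"
  proof -
    have "s \<odot>\<^bsub>M\<^esub> r \<in> C r'" unfolding sr by (rule memC[OF c(5) yR])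
    then show ?thesis unfolding T_def using s(1) c(1) by (auto simp: saturate_def)
  qed
  moreover have "J \<subseteq> T r'"
  proof -
    have "J \<subseteq> C r'" unfolding C_def by (rule submodule_le_set_add(1)[OF J cyclic_submodule[OF c(2)]])
    then show ?thesis
      unfolding T_def using comm_left_module.saturate_submodule(2)[OF comm_left_module_axioms C[OF c(2)] S] by blast
  qed
  ultimately have Cr: "C r \<subseteq> T r'"
    using submoduleD(3,4)[OF T[OF c(2)]] unfolding C_def set_add_def' by blast
  have "T r \<subseteq> T r'"
  proof
    fix w assume "w \<in> T r"
    then obtain s where "s \<in> ?S" "w \<in> carrier M" "s \<odot>\<^bsub>M\<^esub> w \<in> C r"
      unfolding T_def saturate_def by blast
    then have "s \<in> ?S" "w \<in> carrier M" "s \<odot>\<^bsub>M\<^esub> w \<in> T r'" using Cr by blast+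
    then show "w \<in> T r'"
      using comm_left_module.saturate_submodule(3)[OF comm_left_module_axioms C[OF c(2)] S] by (simp add: T_def)
  qed
  have "r' \<notin> saturate M ?S J"
  proof
    assume r': "r' \<in> saturate M ?S J"
    note sat = saturate_submodule[OF S]
    have "k \<oplus>\<^bsub>M\<^esub> y \<odot>\<^bsub>M\<^esub> r' \<in> saturate M ?S J"
      using submoduleD(3)[OF sat(1)] submoduleD(4)[OF sat(1) yR r'] c(5) sat(2) by blast
    then show False using sat(3)[OF s(1) c(1)] r(2) sr by simp
  qed
  then have "T r' = T r" using N(3)[of "T r'"] s(2) r(3) \<open>T r \<subseteq> T r'\<close> by blast
  \<comment> \<open>Maximality puts \<open>r'\<close> into the local closure of \<open>C r\<close>,
    so t r' equals a r up to \<open>J\<close>. Combined with s r = k + y r' this shows that t s - y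
    a takes \<open>r\<close> into \<open>J\<close>, and this factor is outside \<open>\<mm>\<close>
    because \<open>y\<close> is inside.\<close>
  then have "r' \<in> T r" using self[OF c(2)] by simp
  then obtain t where t: "t \<in> ?S" "t \<odot>\<^bsub>M\<^esub> r' \<in> C r" by (auto simp: T_def saturate_def)
  then obtain l a where l: "l \<in> J" "a \<in> carrier R" "t \<odot>\<^bsub>M\<^esub> r' = l \<oplus>\<^bsub>M\<^esub> a \<odot>\<^bsub>M\<^esub> r"
    unfolding C_def set_add_def' by blast
  have lc: "l \<in> carrier M" "t \<in> carrier R" using l(1) j(7) t by auto
  have "(t \<otimes> s \<ominus> y \<otimes> a) \<odot>\<^bsub>M\<^esub> r = t \<odot>\<^bsub>M\<^esub> k \<oplus>\<^bsub>M\<^esub> y \<odot>\<^bsub>M\<^esub> l"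
  proof -
    have "(t \<otimes> s) \<odot>\<^bsub>M\<^esub> r = t \<odot>\<^bsub>M\<^esub> k \<oplus>\<^bsub>M\<^esub> (t \<otimes> y) \<odot>\<^bsub>M\<^esub> r'"
      using c lc yR by (simp add: smult_assoc sr smult_r_distr)
    also have "(t \<otimes> y) \<odot>\<^bsub>M\<^esub> r' = y \<odot>\<^bsub>M\<^esub> (t \<odot>\<^bsub>M\<^esub> r')"
      using c lc yR m_comm[of t y] by (simp add: smult_assoc)
    also have "\<dots> = y \<odot>\<^bsub>M\<^esub> l \<oplus>\<^bsub>M\<^esub> (y \<otimes> a) \<odot>\<^bsub>M\<^esub> r"
      using c lc yR l by (simp add: smult_assoc smult_r_distr)
    finally have "(t \<otimes> s) \<odot>\<^bsub>M\<^esub> r = (t \<odot>\<^bsub>M\<^esub> k \<oplus>\<^bsub>M\<^esub> y \<odot>\<^bsub>M\<^esub> l) \<oplus>\<^bsub>M\<^esub> (y \<otimes> a) \<odot>\<^bsub>M\<^esub> r"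
      using c lc yR l by (simp add: M.a_assoc)
    then show ?thesis using c lc yR l by (simp add: smult_l_diff M.diff_eq_iff)
  qed
  then have "(t \<otimes> s \<ominus> y \<otimes> a) \<odot>\<^bsub>M\<^esub> r \<in> J" using j(3,4) c lc yR l by auto
  moreover have "t \<otimes> s \<ominus> y \<otimes> a \<in> ?S"
  proof -
    have ya: "y \<otimes> a \<in> \<mm>" using y l(2) by (rule m.I_r_closed)
    have "t \<otimes> s \<in> \<mm>" if *: "t \<otimes> s \<ominus> y \<otimes> a \<in> \<mm>"
    proof -
      have "t \<otimes> s = (t \<otimes> s \<ominus> y \<otimes> a) \<oplus> y \<otimes> a"
        using c lc yR l by (simp add: a_minus_def R.a_assoc R.l_neg)
      then show ?thesis using * ya by (metis m.a_closed)
    qed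
    then show ?thesis using m.prime_mult_notin[of t s] s(1) t(1) lc c yR l by auto
  qed
  ultimately show False using r(2) c(1) by (auto simp: saturate_def)
qed

end

end

section \<open>Krull dimension and chains of primes\<close>

lemma deviation_less_mono:
  "\<lbrakk>deviation_less L n A B; A \<subseteq> A'; A' \<subseteq> B'; B' \<subseteq> B\<rbrakk> \<Longrightarrow> deviation_less L n A' B'"
proof (cases n)
  case (Suc k)
  assume *: "deviation_less L n A B" "A \<subseteq> A'" "A' \<subseteq> B'" "B' \<subseteq> B"
  show ?thesis
    unfolding Suc deviation_less.simps
  proof (intro allI impI)
    fix X :: "nat \<Rightarrow> 'a set"
    assume X: "\<forall>i. X i \<in> L \<and> A' \<subseteq> X i \<and> X i \<subseteq> B' \<and> X (Suc i) \<subseteq> X i"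
    have "\<forall>i. X i \<in> L \<and> A \<subseteq> X i \<and> X i \<subseteq> B \<and> X (Suc i) \<subseteq> X i"
    proof
      fix i show "X i \<in> L \<and> A \<subseteq> X i \<and> X i \<subseteq> B \<and> X (Suc i) \<subseteq> X i"
        using X[rule_format, of i] *(2,4) by blast
    qed
    then show "\<exists>k'. \<forall>i\<ge>k'. deviation_less L k (X (Suc i)) (X i)"
      using *(1) unfolding Suc deviation_less.simps by blast
  qed
qed auto

text \<open>Chains are pushed forward along \<open>f\<close>. Injectivity on comparable pairs is
  what the base case asks for, where \<open>deviation_less\<close> means that the interval is a
  point.\<close>

lemma deviation_less_transport:
  fixes L :: "'x set set" and L' :: "'y set set"
  assumes "deviation_less L' n (f A) (f B)" "A \<in> L" "B \<in> L" "A \<subseteq> B"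
    and "\<And>X. \<lbrakk>X \<in> L; A \<subseteq> X; X \<subseteq> B\<rbrakk> \<Longrightarrow> f X \<in> L'"
    and "\<And>X Y. \<lbrakk>X \<in> L; Y \<in> L; A \<subseteq> X; X \<subseteq> Y; Y \<subseteq> B\<rbrakk> \<Longrightarrow> f X \<subseteq> f Y"
    and "\<And>X Y. \<lbrakk>X \<in> L; Y \<in> L; A \<subseteq> X; X \<subseteq> Y; Y \<subseteq> B; f X = f Y\<rbrakk> \<Longrightarrow> X = Y"
  shows "deviation_less L n A B"
  using assms
proof (induction n arbitrary: A B)
  case 0
  then show ?case by simp
next
  case (Suc n)
  note mem = Suc.prems(5) and mono = Suc.prems(6) and inj = Suc.prems(7)
  show ?case
    unfolding deviation_less.simps
  proof (intro allI impI)
    fix X :: "nat \<Rightarrow> 'x set"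
    assume X: "\<forall>i. X i \<in> L \<and> A \<subseteq> X i \<and> X i \<subseteq> B \<and> X (Suc i) \<subseteq> X i"
    then have X': "X i \<in> L" "A \<subseteq> X i" "X i \<subseteq> B" "X (Suc i) \<subseteq> X i" for i by auto
    have "\<forall>i. f (X i) \<in> L' \<and> f A \<subseteq> f (X i) \<and> f (X i) \<subseteq> f B \<and> f (X (Suc i)) \<subseteq> f (X i)"
      using mem mono X' Suc.prems(2-4) by simp
    then have "\<exists>k. \<forall>i\<ge>k. deviation_less L' n (f (X (Suc i))) (f (X i))"
      using Suc.prems(1)[unfolded deviation_less.simps, rule_format, of "\<lambda>i. f (X i)"] by blast
    then obtain k where k: "\<And>i. i \<ge> k \<Longrightarrow> deviation_less L' n (f (X (Suc i))) (f (X i))" by blast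
    have "deviation_less L n (X (Suc i)) (X i)" if "i \<ge> k" for i
    proof (rule Suc.IH[OF k[OF that]])
      have sub: "A \<subseteq> Y" if "X (Suc i) \<subseteq> Y" for Y using X'(2)[of "Suc i"] that by blast
      have sub': "Y \<subseteq> B" if "Y \<subseteq> X i" for Y using X'(3)[of i] that by blast
      show "f Y \<in> L'" if "Y \<in> L" "X (Suc i) \<subseteq> Y" "Y \<subseteq> X i" for Y
        using mem that sub sub' by simp
      show "f Y \<subseteq> f Y'" if "Y \<in> L" "Y' \<in> L" "X (Suc i) \<subseteq> Y" "Y \<subseteq> Y'" "Y' \<subseteq> X i" for Y Y'
        using mono that sub sub' by simp
      show "Y = Y'" if "Y \<in> L" "Y' \<in> L" "X (Suc i) \<subseteq> Y" "Y \<subseteq> Y'" "Y' \<subseteq> X i" "f Y = f Y'" for Y Y'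
        by (rule inj) (use that sub sub' in simp_all)
    qed (use X' in auto)
    then show "\<exists>k. \<forall>i\<ge>k. deviation_less L n (X (Suc i)) (X i)" by blast
  qed
qed

fun height_ge :: "('a, 'b) ring_scheme \<Rightarrow> nat \<Rightarrow> 'a set \<Rightarrow> bool" where
  "height_ge R 0 p \<longleftrightarrow> primeideal p R"
| "height_ge R (Suc n) p \<longleftrightarrow> primeideal p R \<and> (\<exists>q. height_ge R n q \<and> q \<subset> p)"

lemma height_ge_prime: "height_ge R n p \<Longrightarrow> primeideal p R"
  by (cases n) auto

lemma height_ge_Suc: "height_ge R (Suc n) p \<Longrightarrow> height_ge R n p"
  by (induction n arbitrary: p) auto

lemma height_ge_mono: "\<lbrakk>height_ge R n p; k \<le> n\<rbrakk> \<Longrightarrow> height_ge R k p"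
  by (induction n) (auto simp: le_Suc_eq simp del: height_ge.simps dest: height_ge_Suc)

text \<open>These correspond to the ideals of the localization at \<open>S\<close>, so that
  deviations can be studied inside \<open>R\<close>.\<close>

definition saturated_ideals :: "('a, 'b) ring_scheme \<Rightarrow> 'a set \<Rightarrow> 'a set set" where
  "saturated_ideals R S = {I. submodule I R (regular_module R) \<and>
     (\<forall>s\<in>S. \<forall>z\<in>carrier R. s \<otimes>\<^bsub>R\<^esub> z \<in> I \<longrightarrow> z \<in> I)}"

context cring
begin

lemma prime_saturated:
  assumes "primeideal p R" "p \<subseteq> \<mm>"
  shows "p \<in> saturated_ideals R (carrier R - \<mm>)"
proof -
  interpret p: primeideal p R by fact
  show ?thesis
    using p.submodule_regular p.I_prime assms(2) unfolding saturated_ideals_def by blast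
qed

lemma carrier_saturated: "carrier R \<in> saturated_ideals R S"
  using left_module.carrier_submodule[OF regular_left_module] by (simp add: saturated_ideals_def)

text \<open>If \<open>q \<subset> p\<close> and \<open>z \<in> p - q\<close>, then the lattice above \<open>p\<close> embeds into each factor
  \<open>[q + z\<^sup>i\<^sup>+\<^sup>1 R, q + z\<^sup>i R]\<close>.\<close>

lemma deviation_prime_step:
  assumes m: "primeideal \<mm> R" and q: "primeideal q R" and p: "primeideal p R"
    and sub: "q \<subset> p" "p \<subseteq> \<mm>"
    and dev: "deviation_less (saturated_ideals R (carrier R - \<mm>)) (Suc k) q (carrier R)"
  shows "deviation_less (saturated_ideals R (carrier R - \<mm>)) k p (carrier R)"
proof -
  interpret m: primeideal \<mm> R by (rule m)
  interpret q: primeideal q R by (rule q)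
  interpret p: primeideal p R by (rule p)
  interpret RR: comm_left_module R "regular_module R" by (rule regular_comm_left_module)
  let ?S = "carrier R - \<mm>" let ?L = "saturated_ideals R ?S"
  have S: "multiplicative R ?S" by (rule m.multiplicative_complement)
  obtain z where z: "z \<in> p" "z \<notin> q" "z \<in> carrier R" using sub p.a_subset by blast
  define pre where "pre w I = q <+>\<^bsub>R\<^esub> (\<lambda>a. w \<otimes> a) ` I" for w I
  define \<phi> where "\<phi> w I = saturate (regular_module R) ?S (pre w I)" for w I
  have pre: "submodule (pre w I) R (regular_module R)"
    if "w \<in> carrier R" "submodule I R (regular_module R)" for w I
  proof -
    have "linear_map R (regular_module R) (regular_module R) (\<lambda>a. w \<otimes> a)"
      by (rule linear_mapI) (use that(1) in \<open>auto simp: r_distr m_lcomm\<close>)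
    then have "submodule ((\<lambda>a. w \<otimes> a) ` I) R (regular_module R)"
      by (rule submodule_image[OF regular_left_module regular_left_module _ that(2)])
    then show ?thesis
      using RR.submodule_set_add[OF q.submodule_regular] by (simp add: pre_def)
  qed
  note sat = RR.saturate_submodule[OF pre S]
  have preI: "c \<oplus> w \<otimes> a \<in> pre w I" if "c \<in> q" "a \<in> I" for c w a I
    using that unfolding pre_def set_add_def' by blast
  have preE: "\<exists>c\<in>q. \<exists>a\<in>I. x = c \<oplus> w \<otimes> a" if "x \<in> pre w I" for x w I
    using that unfolding pre_def set_add_def' by blast
  have L_sub: "submodule I R (regular_module R)" if "I \<in> ?L" for I using that by (simp add: saturated_ideals_def)
  have \<phi>_L: "\<phi> w I \<in> ?L" if "w \<in> carrier R" "I \<in> ?L" for w I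
    using sat(1)[OF that(1) L_sub[OF that(2)]] sat(3)[OF that(1) L_sub[OF that(2)]]
    unfolding saturated_ideals_def \<phi>_def by auto
  have \<phi>_mono: "\<phi> w I \<subseteq> \<phi> w' I'" if "pre w I \<subseteq> pre w' I'" for w w' I I'
    using that unfolding \<phi>_def saturate_def by blast
  have pre_mono: "pre w I \<subseteq> pre w I'" if "I \<subseteq> I'" for w I I'
    using that unfolding pre_def set_add_def' by blast
  \<comment> \<open>Since z R lies in \<open>p\<close>, the image of the lattice above
    \<open>p\<close> fits between two consecutive terms of the chain \<open>?X\<close>.\<close>
  have pre_z: "pre (w \<otimes> z) (carrier R) \<subseteq> pre w p" if w: "w \<in> carrier R" for w
  proof
    fix x assume "x \<in> pre (w \<otimes> z) (carrier R)"
    then obtain c a where ca: "c \<in> q" "a \<in> carrier R" "x = c \<oplus> (w \<otimes> z) \<otimes> a" using preE by blast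
    then have "x = c \<oplus> w \<otimes> (z \<otimes> a)" using w z by (simp add: m_assoc)
    then show "x \<in> pre w p" using preI ca(1) p.I_r_closed[OF z(1) ca(2)] by simp
  qed
  let ?X = "\<lambda>i::nat. \<phi> (z [^] i) (carrier R)"
  have zi: "z [^] i \<in> carrier R" "z [^] i \<notin> q" for i :: nat
  proof -
    show zc: "z [^] i \<in> carrier R" for i :: nat using z(3) by simp
    show "z [^] i \<notin> q"
    proof (induction i)
      case 0
      then show ?case using q.prime_one by simp
    next
      case (Suc i)
      then show ?case using q.prime_mult_notin[OF zc z(3) Suc z(2)] by simp
    qed
  qed
  have q_sub: "q \<subseteq> \<phi> w I" if w: "w \<in> carrier R" "I \<in> ?L" for w I
  proof -
    have "q \<subseteq> pre w I"
    proof
      fix x assume x: "x \<in> q"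
      have "\<zero> \<in> I" using RR.submoduleD(2)[OF L_sub[OF w(2)]] by simp
      then have "x \<oplus> w \<otimes> \<zero> \<in> pre w I" by (rule preI[OF x])
      then show "x \<in> pre w I" using x w by simp
    qed
    then show ?thesis using sat(2)[OF w(1) L_sub[OF w(2)]] unfolding \<phi>_def by blast
  qed
  have "\<forall>i. ?X i \<in> ?L \<and> q \<subseteq> ?X i \<and> ?X i \<subseteq> carrier R \<and> ?X (Suc i) \<subseteq> ?X i"
  proof
    fix i
    have "?X (Suc i) \<subseteq> ?X i"
      using pre_z[OF zi(1)[of i]] pre_mono[OF p.a_subset] by (intro \<phi>_mono) auto
    then show "?X i \<in> ?L \<and> q \<subseteq> ?X i \<and> ?X i \<subseteq> carrier R \<and> ?X (Suc i) \<subseteq> ?X i"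
      using \<phi>_L[OF zi(1) carrier_saturated] q_sub[OF zi(1) carrier_saturated]
      by (auto simp: \<phi>_def saturate_def)
  qed
  then obtain k0 where "\<forall>i\<ge>k0. deviation_less ?L k (?X (Suc i)) (?X i)"
    using dev[unfolded deviation_less.simps, rule_format, of ?X] by blast
  then have "deviation_less ?L k (?X (Suc k0)) (?X k0)" by simp
  \<comment> \<open>A single factor of small deviation is enough; \<open>w\<close> is the power of
    \<open>z\<close> at which it starts.\<close>
  define w where "w = z [^] k0"
  have w: "w \<in> carrier R" "w \<notin> q" using zi by (simp_all add: w_def)
  have dw: "deviation_less ?L k (\<phi> (w \<otimes> z) (carrier R)) (\<phi> w (carrier R))"
    using \<open>deviation_less ?L k (?X (Suc k0)) (?X k0)\<close> by (simp add: w_def)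
  have "deviation_less ?L k (\<phi> w p) (\<phi> w (carrier R))"
    by (rule deviation_less_mono[OF dw \<phi>_mono[OF pre_z[OF w(1)]] \<phi>_mono[OF pre_mono[OF p.a_subset]] order_refl])
  then show ?thesis
  proof (rule deviation_less_transport)
    show "p \<in> ?L" by (rule prime_saturated[OF p sub(2)])
    show "carrier R \<in> ?L" by (rule carrier_saturated)
    show "p \<subseteq> carrier R" by (rule p.a_subset)
    show "\<phi> w X \<in> ?L" if "X \<in> ?L" for X using \<phi>_L[OF w(1) that] .
    show "\<phi> w X \<subseteq> \<phi> w Y" if "X \<subseteq> Y" for X Y using \<phi>_mono[OF pre_mono[OF that]] .
    fix X Y assume X: "X \<in> ?L" and Y: "Y \<in> ?L" and XY: "p \<subseteq> X" "X \<subseteq> Y" "\<phi> w X = \<phi> w Y"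
    have "Y \<subseteq> X"
    proof
      fix a assume a: "a \<in> Y"
      have aR: "a \<in> carrier R" using RR.submoduleD(7)[OF L_sub[OF Y] a] by simp
      have "\<zero> \<oplus> w \<otimes> a \<in> pre w Y" by (rule preI) (use a in auto)
      then have "w \<otimes> a \<in> \<phi> w X"
        using sat(2)[OF w(1) L_sub[OF Y]] aR w XY(3) by (auto simp: \<phi>_def)
      then obtain s where s: "s \<in> ?S" "s \<otimes> (w \<otimes> a) \<in> pre w X" by (auto simp: \<phi>_def saturate_def)
      then obtain c a' where c: "c \<in> q" "a' \<in> X" "s \<otimes> (w \<otimes> a) = c \<oplus> w \<otimes> a'" using preE by blast
      have cR: "c \<in> carrier R" "a' \<in> carrier R" "s \<in> carrier R"
        using c(1) q.a_subset RR.submoduleD(7)[OF L_sub[OF X] c(2)] s(1) by auto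
      \<comment> \<open>Cancelling \<open>w\<close> modulo the prime \<open>q\<close> is the reason
        why multiplication by \<open>w\<close> loses nothing above \<open>p\<close>.\<close>
      have "w \<otimes> (s \<otimes> a \<ominus> a') = c"
      proof -
        have "w \<otimes> (s \<otimes> a \<ominus> a') = s \<otimes> (w \<otimes> a) \<ominus> w \<otimes> a'"
          using w aR cR by (simp add: a_minus_def r_distr r_minus m_lcomm)
        then show ?thesis using c(3) cR w by (simp add: diff_eq_iff)
      qed
      then have "s \<otimes> a \<ominus> a' \<in> q" using q.I_prime[of w "s \<otimes> a \<ominus> a'"] w c(1) cR aR by auto
      then have "s \<otimes> a \<ominus> a' \<in> X" using sub(1) XY(1) by blast
      then have "(s \<otimes> a \<ominus> a') \<oplus> a' \<in> X" using RR.submoduleD(3)[OF L_sub[OF X]] c(2) by simp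
      then have "s \<otimes> a \<in> X" using cR aR by (simp add: a_minus_def a_assoc l_neg)
      then show "a \<in> X" using X s(1) aR by (auto simp: saturated_ideals_def)
    qed
    then show "X = Y" using XY(2) by blast
  qed
qed

text \<open>Each step down the chain of primes raises the deviation by one; \<open>k\<close>
  accumulates the steps already made.\<close>

lemma deviation_height:
  assumes m: "primeideal \<mm> R" and "height_ge R n p" "p \<subseteq> \<mm>"
    and "\<not> deviation_less (saturated_ideals R (carrier R - \<mm>)) k p (carrier R)"
  shows "\<exists>q. primeideal q R \<and> q \<subseteq> \<mm> \<and>
    \<not> deviation_less (saturated_ideals R (carrier R - \<mm>)) (n + k) q (carrier R)"
  using assms(2-)
proof (induction n arbitrary: p k)
  case 0
  then show ?case by auto
next
  case (Suc n)
  then obtain q where q: "height_ge R n q" "q \<subset> p" "primeideal p R" by auto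
  have "\<not> deviation_less (saturated_ideals R (carrier R - \<mm>)) (Suc k) q (carrier R)"
    using deviation_prime_step[OF m height_ge_prime[OF q(1)] q(3,2) Suc.prems(2)] Suc.prems(3) by blast
  then show ?case using Suc.IH[OF q(1), of "Suc k"] q(2) Suc.prems(2) by auto
qed

subsection \<open>Localization\<close>

context
  fixes S assumes S: "multiplicative R S"
begin

private lemma S_closed: "s \<in> S \<Longrightarrow> s \<in> carrier R" "\<one> \<in> S" "\<lbrakk>s \<in> S; t \<in> S\<rbrakk> \<Longrightarrow> s \<otimes> t \<in> S"
  using S by (auto simp: multiplicative_def)

lemma fraction_mem: "(a, b) \<in> fraction R S r s \<longleftrightarrow>
    a \<in> carrier R \<and> b \<in> S \<and> (\<exists>u\<in>S. u \<otimes> (b \<otimes> r) = u \<otimes> (s \<otimes> a))"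
  by (simp add: fraction_def)

lemma fraction_self: "\<lbrakk>r \<in> carrier R; s \<in> S\<rbrakk> \<Longrightarrow> (r, s) \<in> fraction R S r s"
  unfolding fraction_mem using S_closed(2) by blast

lemma fraction_subset:
  assumes rs: "r \<in> carrier R" "s \<in> S" and ab: "(a, b) \<in> fraction R S r s"
  shows "fraction R S a b \<subseteq> fraction R S r s"
proof
  fix x assume x: "x \<in> fraction R S a b"
  obtain c d where cd: "x = (c, d)" by (cases x)
  from ab obtain u where u: "a \<in> carrier R" "b \<in> S" "u \<in> S" "u \<otimes> (b \<otimes> r) = u \<otimes> (s \<otimes> a)"
    unfolding fraction_mem by blast
  from x[unfolded cd] obtain v where v: "c \<in> carrier R" "d \<in> S" "v \<in> S" "v \<otimes> (d \<otimes> a) = v \<otimes> (b \<otimes> c)"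
    unfolding fraction_mem by blast
  note cl = rs(1) u(1) v(1) S_closed(1)[OF rs(2)] S_closed(1)[OF u(2)] S_closed(1)[OF u(3)]
    S_closed(1)[OF v(2)] S_closed(1)[OF v(3)]
  have "(u \<otimes> (v \<otimes> b)) \<otimes> (d \<otimes> r) = (v \<otimes> d) \<otimes> (u \<otimes> (b \<otimes> r))" using cl by (simp add: m_ac)
  also have "\<dots> = (v \<otimes> d) \<otimes> (u \<otimes> (s \<otimes> a))" by (simp only: u(4))
  also have "\<dots> = (u \<otimes> s) \<otimes> (v \<otimes> (d \<otimes> a))" using cl by (simp add: m_ac)
  also have "\<dots> = (u \<otimes> s) \<otimes> (v \<otimes> (b \<otimes> c))" by (simp only: v(4))
  also have "\<dots> = (u \<otimes> (v \<otimes> b)) \<otimes> (s \<otimes> c)" using cl by (simp add: m_ac)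
  finally show "x \<in> fraction R S r s"
    unfolding cd fraction_mem using v(1,2) S_closed(3) u v by blast
qed

lemma fraction_eqI:
  assumes rs: "r \<in> carrier R" "s \<in> S" and ab: "(a, b) \<in> fraction R S r s"
  shows "fraction R S a b = fraction R S r s"
proof
  show "fraction R S a b \<subseteq> fraction R S r s" by (rule fraction_subset[OF assms])
  from ab have c: "a \<in> carrier R" "b \<in> S" "(r, s) \<in> fraction R S a b"
    unfolding fraction_mem using rs by (blast, blast, metis)
  show "fraction R S r s \<subseteq> fraction R S a b" by (rule fraction_subset[OF c])
qed

text \<open>Sum and product in \<open>localization\<close> are unions over all representatives of
  both arguments; well-definedness makes all members of the union equal.\<close>

lemma fraction_op:
  assumes rs: "r \<in> carrier R" "s \<in> S" "r' \<in> carrier R" "s' \<in> S"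
    and wd: "\<And>a b a' b'. \<lbrakk>(a, b) \<in> fraction R S r s; (a', b') \<in> fraction R S r' s'\<rbrakk> \<Longrightarrow>
      F a b a' b' = F r s r' s'"
  shows "(\<Union>(a, b)\<in>fraction R S r s. \<Union>(a', b')\<in>fraction R S r' s'. F a b a' b') = F r s r' s'"
proof (intro equalityI subsetI)
  fix x assume "x \<in> (\<Union>(a, b)\<in>fraction R S r s. \<Union>(a', b')\<in>fraction R S r' s'. F a b a' b')"
  then obtain a b a' b' where "(a, b) \<in> fraction R S r s" "(a', b') \<in> fraction R S r' s'" "x \<in> F a b a' b'"
    by blast
  then show "x \<in> F r s r' s'" using wd by simp
next
  fix x assume "x \<in> F r s r' s'"
  then show "x \<in> (\<Union>(a, b)\<in>fraction R S r s. \<Union>(a', b')\<in>fraction R S r' s'. F a b a' b')"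
    using fraction_self[OF rs(1,2)] fraction_self[OF rs(3,4)] by blast
qed

lemma localization_mult:
  assumes rs: "r \<in> carrier R" "s \<in> S" "r' \<in> carrier R" "s' \<in> S"
  shows "fraction R S r s \<otimes>\<^bsub>localization R S\<^esub> fraction R S r' s' = fraction R S (r \<otimes> r') (s \<otimes> s')"
proof -
  have "fraction R S (a \<otimes> a') (b \<otimes> b') = fraction R S (r \<otimes> r') (s \<otimes> s')"
    if ab: "(a, b) \<in> fraction R S r s" "(a', b') \<in> fraction R S r' s'" for a b a' b'
  proof (rule fraction_eqI)
    from ab(1) obtain u where u: "a \<in> carrier R" "b \<in> S" "u \<in> S" "u \<otimes> (b \<otimes> r) = u \<otimes> (s \<otimes> a)"
      unfolding fraction_mem by blast
    from ab(2) obtain v where v: "a' \<in> carrier R" "b' \<in> S" "v \<in> S" "v \<otimes> (b' \<otimes> r') = v \<otimes> (s' \<otimes> a')"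
      unfolding fraction_mem by blast
    note cl = rs(1,3) u(1) v(1) S_closed(1)[OF rs(2)] S_closed(1)[OF rs(4)] S_closed(1)[OF u(2)]
      S_closed(1)[OF u(3)] S_closed(1)[OF v(2)] S_closed(1)[OF v(3)]
    have "(u \<otimes> v) \<otimes> ((b \<otimes> b') \<otimes> (r \<otimes> r')) = (u \<otimes> (b \<otimes> r)) \<otimes> (v \<otimes> (b' \<otimes> r'))"
      using cl by (simp add: m_ac)
    also have "\<dots> = (u \<otimes> v) \<otimes> ((s \<otimes> s') \<otimes> (a \<otimes> a'))"
      using cl by (simp add: u(4) v(4) m_ac)
    finally show "(a \<otimes> a', b \<otimes> b') \<in> fraction R S (r \<otimes> r') (s \<otimes> s')"
      unfolding fraction_mem using cl S_closed(3)[OF u(2) v(2)] S_closed(3)[OF u(3) v(3)] by auto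
  qed (use rs S_closed(3) in auto)
  then show ?thesis
    unfolding localization_def monoid.simps ring.simps
    using fraction_op[OF rs, of "\<lambda>a b a' b'. fraction R S (a \<otimes> a') (b \<otimes> b')"] by simp
qed

lemma localization_add:
  assumes rs: "r \<in> carrier R" "s \<in> S" "r' \<in> carrier R" "s' \<in> S"
  shows "fraction R S r s \<oplus>\<^bsub>localization R S\<^esub> fraction R S r' s' =
    fraction R S (s' \<otimes> r \<oplus> s \<otimes> r') (s \<otimes> s')"
proof -
  have "fraction R S (b' \<otimes> a \<oplus> b \<otimes> a') (b \<otimes> b') = fraction R S (s' \<otimes> r \<oplus> s \<otimes> r') (s \<otimes> s')"
    if ab: "(a, b) \<in> fraction R S r s" "(a', b') \<in> fraction R S r' s'" for a b a' b'
  proof (rule fraction_eqI)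
    from ab(1) obtain u where u: "a \<in> carrier R" "b \<in> S" "u \<in> S" "u \<otimes> (b \<otimes> r) = u \<otimes> (s \<otimes> a)"
      unfolding fraction_mem by blast
    from ab(2) obtain v where v: "a' \<in> carrier R" "b' \<in> S" "v \<in> S" "v \<otimes> (b' \<otimes> r') = v \<otimes> (s' \<otimes> a')"
      unfolding fraction_mem by blast
    note cl = rs(1,3) u(1) v(1) S_closed(1)[OF rs(2)] S_closed(1)[OF rs(4)] S_closed(1)[OF u(2)]
      S_closed(1)[OF u(3)] S_closed(1)[OF v(2)] S_closed(1)[OF v(3)]
    have "(u \<otimes> v) \<otimes> ((b \<otimes> b') \<otimes> (s' \<otimes> r \<oplus> s \<otimes> r')) =
        (v \<otimes> (b' \<otimes> s')) \<otimes> (u \<otimes> (b \<otimes> r)) \<oplus> (u \<otimes> (b \<otimes> s)) \<otimes> (v \<otimes> (b' \<otimes> r'))"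
      using cl by (simp add: r_distr m_ac)
    also have "\<dots> = (u \<otimes> v) \<otimes> ((s \<otimes> s') \<otimes> (b' \<otimes> a \<oplus> b \<otimes> a'))"
      using cl by (simp add: u(4) v(4) r_distr m_ac)
    finally show "(b' \<otimes> a \<oplus> b \<otimes> a', b \<otimes> b') \<in> fraction R S (s' \<otimes> r \<oplus> s \<otimes> r') (s \<otimes> s')"
      unfolding fraction_mem using cl S_closed(3)[OF u(2) v(2)] S_closed(3)[OF u(3) v(3)] by auto
  qed (use rs S_closed in auto)
  then show ?thesis
    unfolding localization_def monoid.simps ring.simps
    using fraction_op[OF rs, of "\<lambda>a b a' b'. fraction R S (b' \<otimes> a \<oplus> b \<otimes> a') (b \<otimes> b')"] by simp
qed

definition extended_ideal :: "'a set \<Rightarrow> ('a \<times> 'a) set set" where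
  "extended_ideal I = {fraction R S r s |r s. r \<in> I \<and> s \<in> S}"

lemma localization_simps:
  "carrier (localization R S) = extended_ideal (carrier R)"
  "\<zero>\<^bsub>localization R S\<^esub> = fraction R S \<zero> \<one>"
  by (auto simp: localization_def extended_ideal_def)

lemma fraction_eq_zeroI:
  assumes "r \<in> carrier R" "s \<in> S" "u \<in> S" "u \<otimes> r = \<zero>"
  shows "fraction R S r s = fraction R S \<zero> \<one>"
  by (rule fraction_eqI)
     (use assms S_closed in \<open>auto simp: fraction_mem intro!: bexI[of _ u]\<close>)

text \<open>\<open>Kdim\<close> is taken on the right, hence the opposite ring. Closure under
  negatives concerns \<open>m_inv\<close>, a definite description, which \<open>neg\<close>
  evaluates directly from the rule for sums of fractions.\<close>

lemma extended_ideal_submodule: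
  assumes I: "submodule I R (regular_module R)"
  shows "submodule (extended_ideal I) (opposite (localization R S)) (regular_module (opposite (localization R S)))"
proof -
  interpret RR: comm_left_module R "regular_module R" by (rule regular_comm_left_module)
  note i = RR.submoduleD[OF I, simplified]
  let ?\<Lambda> = "localization R S"
  have iR: "x \<in> carrier R" if "x \<in> I" for x using i(1) that by auto
  have neg: "(THE y. y \<in> extended_ideal (carrier R) \<and> fraction R S r s \<oplus>\<^bsub>?\<Lambda>\<^esub> y = fraction R S \<zero> \<one> \<and>
      y \<oplus>\<^bsub>?\<Lambda>\<^esub> fraction R S r s = fraction R S \<zero> \<one>) = fraction R S (\<ominus> r) s"
    if rs: "r \<in> carrier R" "s \<in> S" for r s
  proof (rule the_equality)
    note c = rs S_closed(1)[OF rs(2)]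
    have "s \<otimes> r \<oplus> s \<otimes> \<ominus> r = \<zero>" "s \<otimes> \<ominus> r \<oplus> s \<otimes> r = \<zero>" using c by (simp_all add: r_minus r_neg l_neg)
    then show "fraction R S (\<ominus> r) s \<in> extended_ideal (carrier R) \<and>
        fraction R S r s \<oplus>\<^bsub>?\<Lambda>\<^esub> fraction R S (\<ominus> r) s = fraction R S \<zero> \<one> \<and>
        fraction R S (\<ominus> r) s \<oplus>\<^bsub>?\<Lambda>\<^esub> fraction R S r s = fraction R S \<zero> \<one>"
      using c fraction_eq_zeroI[of \<zero> "s \<otimes> s" \<one>] S_closed
      by (auto simp: localization_add extended_ideal_def)
    fix y assume y: "y \<in> extended_ideal (carrier R) \<and> fraction R S r s \<oplus>\<^bsub>?\<Lambda>\<^esub> y = fraction R S \<zero> \<one> \<and>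
      y \<oplus>\<^bsub>?\<Lambda>\<^esub> fraction R S r s = fraction R S \<zero> \<one>"
    then obtain a b where ab: "y = fraction R S a b" "a \<in> carrier R" "b \<in> S" by (auto simp: extended_ideal_def)
    have bR: "b \<in> carrier R" using S_closed(1)[OF ab(3)] .
    have "fraction R S (b \<otimes> r \<oplus> s \<otimes> a) (s \<otimes> b) = fraction R S \<zero> \<one>"
      using y c ab by (simp add: localization_add)
    then have "(b \<otimes> r \<oplus> s \<otimes> a, s \<otimes> b) \<in> fraction R S \<zero> \<one>"
      using fraction_self[of "b \<otimes> r \<oplus> s \<otimes> a" "s \<otimes> b"] c ab bR S_closed(3) by simp
    then obtain u where u: "u \<in> S" "u \<otimes> ((s \<otimes> b) \<otimes> \<zero>) = u \<otimes> (\<one> \<otimes> (b \<otimes> r \<oplus> s \<otimes> a))"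
      unfolding fraction_mem by blast
    have uR: "u \<in> carrier R" using S_closed(1)[OF u(1)] .
    have 0: "u \<otimes> (b \<otimes> r) \<oplus> u \<otimes> (s \<otimes> a) = \<zero>" using u(2) c ab bR uR by (simp add: r_distr)
    have "u \<otimes> (b \<otimes> \<ominus> r) = \<ominus> (u \<otimes> (b \<otimes> r))" using c bR uR by (simp add: r_minus)
    also have "\<dots> = u \<otimes> (s \<otimes> a)"
      using minus_equality[of "u \<otimes> (s \<otimes> a)" "u \<otimes> (b \<otimes> r)"] 0 c ab bR uR by (simp add: a_comm)
    finally have "(a, b) \<in> fraction R S (\<ominus> r) s" unfolding fraction_mem using ab u(1) by blast
    then show "y = fraction R S (\<ominus> r) s" unfolding ab(1) using c by (intro fraction_eqI) auto
  qed
  show ?thesis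
  proof (intro submodule.intro subgroup.intro submodule_axioms.intro, goal_cases)
    case 1
    then show ?case using iR by (auto simp: opposite_def localization_simps extended_ideal_def)
  next
    case (2 x y)
    then obtain r s r' s' where rs: "x = fraction R S r s" "r \<in> I" "s \<in> S"
      "y = fraction R S r' s'" "r' \<in> I" "s' \<in> S" by (auto simp: extended_ideal_def)
    have "s' \<otimes> r \<oplus> s \<otimes> r' \<in> I" using i(3,4) rs S_closed(1) by simp
    then have "fraction R S (s' \<otimes> r \<oplus> s \<otimes> r') (s \<otimes> s') \<in> extended_ideal I"
      unfolding extended_ideal_def using S_closed(3) rs(3,6) by blast
    then show ?case using rs iR by (simp add: opposite_def localization_add)
  next
    case 3
    then show ?case using i(2) S_closed(2) by (auto simp: opposite_def localization_simps extended_ideal_def)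
  next
    case (4 x)
    then obtain r s where rs: "x = fraction R S r s" "r \<in> I" "s \<in> S" by (auto simp: extended_ideal_def)
    then show ?case
      using neg[of r s] iR i(5)[of r] by (auto simp: m_inv_def opposite_def localization_simps extended_ideal_def)
  next
    case (5 x y)
    then obtain r s r' s' where rs: "x = fraction R S r s" "r \<in> carrier R" "s \<in> S"
      "y = fraction R S r' s'" "r' \<in> I" "s' \<in> S"
      by (auto simp: opposite_def localization_simps extended_ideal_def)
    have "r' \<otimes> r \<in> I" using i(4)[OF rs(2,5)] m_comm[OF rs(2) iR[OF rs(5)]] by simp
    then have "fraction R S (r' \<otimes> r) (s' \<otimes> s) \<in> extended_ideal I"
      unfolding extended_ideal_def using S_closed(3) rs(3,6) by blast
    then show ?case using rs iR by (simp add: opposite_def localization_mult)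
  qed
qed

text \<open>From r/1 = a/s with \<open>a\<close> in \<open>X\<close> some multiple (u s) r lies in
  \<open>X\<close>, and saturation cancels u s.\<close>

lemma extended_ideal_inj:
  assumes X: "X \<in> saturated_ideals R S" and Y: "Y \<subseteq> carrier R"
    and eq: "extended_ideal Y \<subseteq> extended_ideal X"
  shows "Y \<subseteq> X"
proof
  interpret RR: comm_left_module R "regular_module R" by (rule regular_comm_left_module)
  have sub: "submodule X R (regular_module R)" using X by (simp add: saturated_ideals_def)
  note x = RR.submoduleD[OF sub, simplified]
  fix r assume r: "r \<in> Y"
  then have rR: "r \<in> carrier R" using Y by auto
  have "fraction R S r \<one> \<in> extended_ideal X" using eq r S_closed(2) by (auto simp: extended_ideal_def)
  then obtain a s where a: "a \<in> X" "s \<in> S" "fraction R S r \<one> = fraction R S a s"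
    by (auto simp: extended_ideal_def)
  have aR: "a \<in> carrier R" "s \<in> carrier R" using a x(1) S_closed(1) by auto
  have "(r, \<one>) \<in> fraction R S a s" using fraction_self[OF rR S_closed(2)] a(3) by simp
  then obtain u where u: "u \<in> S" "u \<otimes> (\<one> \<otimes> a) = u \<otimes> (s \<otimes> r)" unfolding fraction_mem by blast
  have uR: "u \<in> carrier R" using S_closed(1)[OF u(1)] .
  have "(u \<otimes> s) \<otimes> r = u \<otimes> a" using u(2) uR aR rR by (simp add: m_assoc)
  also have "\<dots> \<in> X" using x(4) uR a(1) by blast
  finally show "r \<in> X" using X S_closed(3)[OF u(1) a(2)] rR unfolding saturated_ideals_def by blast
qed

end

lemma Inf_ereal_nat_attained:
  assumes "Inf {ereal (real n) |n. Q n} = ereal (real d)"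
  shows "\<exists>n\<le>d. Q n"
proof (rule ccontr)
  assume *: "\<not> ?thesis"
  have "ereal (real (Suc d)) \<le> Inf {ereal (real n) |n. Q n}"
  proof (rule Inf_greatest)
    fix x assume "x \<in> {ereal (real n) |n. Q n}"
    then obtain n where n: "x = ereal (real n)" "Q n" by blast
    then have "Suc d \<le> n" using * by (metis not_less_eq_eq)
    then show "ereal (real (Suc d)) \<le> x" using n(1) by simp
  qed
  then show False using assms by simp
qed

text \<open>A long chain of primes forces a large deviation on the saturated ideals, and these embed
  into the ideals of the localization by extension.\<close>

lemma height_le_Kdim_localization:
  assumes m: "primeideal \<mm> R" and h: "height_ge R n p" "p \<subseteq> \<mm>"
    and K: "Kdim (localization R (carrier R - \<mm>)) = ereal (real d)"
  shows "n \<le> d"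
proof (rule ccontr)
  assume n: "\<not> n \<le> d"
  let ?S = "carrier R - \<mm>" let ?\<Lambda> = "opposite (localization R ?S)"
  let ?L = "saturated_ideals R ?S" let ?L' = "{N. submodule N ?\<Lambda> (regular_module ?\<Lambda>)}"
  interpret m: primeideal \<mm> R by (rule m)
  have S: "multiplicative R ?S" by (rule m.multiplicative_complement)
  have carr: "carrier (regular_module ?\<Lambda>) = extended_ideal ?S (carrier R)"
    "\<zero>\<^bsub>regular_module ?\<Lambda>\<^esub> = fraction R ?S \<zero> \<one>"
    by (simp_all add: opposite_def localization_simps[OF S])
  have "Kdim_module ?\<Lambda> (regular_module ?\<Lambda>) = ereal (real d)" using K by (simp add: Kdim_def)
  then have "\<exists>k\<le>d. deviation_less ?L' (Suc k) {\<zero>\<^bsub>regular_module ?\<Lambda>\<^esub>} (carrier (regular_module ?\<Lambda>))"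
    unfolding Kdim_module_def by (intro Inf_ereal_nat_attained) (simp split: if_splits)
  then obtain k where k: "k \<le> d"
    "deviation_less ?L' (Suc k) {fraction R ?S \<zero> \<one>} (extended_ideal ?S (carrier R))"
    unfolding carr by blast
  have p: "primeideal p R" by (rule height_ge_prime[OF h(1)])
  \<comment> \<open>\<open>deviation_less\<close> with index \<open>Suc k\<close> means deviation at
    most \<open>k\<close>. The interval from \<open>p\<close> to \<open>R\<close> is not a point,
    and since k \<le> d < n there are \<open>Suc k\<close> steps down from \<open>p\<close>, enough
    to exceed this bound.\<close>
  have "\<not> deviation_less ?L 0 p (carrier R)" using primeideal.I_notcarr[OF p] by auto
  moreover have "height_ge R (Suc k) p" using height_ge_mono[OF h(1), of "Suc k"] k(1) n by linarith
  ultimately have "\<exists>q. primeideal q R \<and> q \<subseteq> \<mm> \<and> \<not> deviation_less ?L (Suc k + 0) q (carrier R)"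
    by (intro deviation_height[OF m _ h(2)])
  then obtain q where q: "primeideal q R" "q \<subseteq> \<mm>" "\<not> deviation_less ?L (Suc k) q (carrier R)"
    unfolding add_0_right by (elim exE conjE) (rule that)
  have qL: "q \<in> ?L" by (rule prime_saturated[OF q(1,2)])
  have qR: "q \<subseteq> carrier R" using ideal.Icarr[OF primeideal.axioms(1)[OF q(1)]] by (rule subsetI)
  have zq: "\<zero> \<in> q" using additive_subgroup.zero_closed[OF ideal.axioms(1)[OF primeideal.axioms(1)[OF q(1)]]] .
  have ext_mono: "extended_ideal ?S X \<subseteq> extended_ideal ?S Y" if "X \<subseteq> Y" for X Y
    using that unfolding extended_ideal_def[OF S] by blast
  have "{fraction R ?S \<zero> \<one>} \<subseteq> extended_ideal ?S q"
    using zq m.prime_one unfolding extended_ideal_def[OF S] by blast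
  then have "deviation_less ?L' (Suc k) (extended_ideal ?S q) (extended_ideal ?S (carrier R))"
    by (rule deviation_less_mono[OF k(2) _ ext_mono[OF qR] order_refl])
  then have "deviation_less ?L (Suc k) q (carrier R)"
  proof (rule deviation_less_transport[OF _ qL carrier_saturated qR])
    show "extended_ideal ?S X \<in> ?L'" if "X \<in> ?L" for X
      using extended_ideal_submodule[OF S] that by (simp add: saturated_ideals_def)
    show "X = Y" if "X \<in> ?L" "X \<subseteq> Y" "Y \<subseteq> carrier R" "extended_ideal ?S X = extended_ideal ?S Y" for X Y
      using extended_ideal_inj[OF S that(1,3)] that(2,4) by blast
  qed (rule ext_mono)
  then show False using q(3) by blast
qed

end

section \<open>Consequences of the Macaulay property\<close>

abbreviation central_colon :: "('a, 'b) ring_scheme \<Rightarrow> 'a set \<Rightarrow> 'a \<Rightarrow> 'a set" where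
  "central_colon R \<equiv> module_colon (centre R) (regular_module R)"

abbreviation local_closure :: "('a, 'b) ring_scheme \<Rightarrow> 'a set \<Rightarrow> 'a set \<Rightarrow> 'a set" where
  "local_closure R p \<equiv> saturate (regular_module R) (carrier (centre R) - p)"

text \<open>The associated primes of \<open>R / (x\<^sub>1 R + \<dots> + x\<^sub>n R)\<close> are minimal over \<open>x\<^sub>1, \<dots>, x\<^sub>n\<close>.\<close>

definition unmixed :: "('a, 'b) ring_scheme \<Rightarrow> bool" where
  "unmixed R \<longleftrightarrow> (\<forall>xs p r. regular_sequence R xs \<longrightarrow> primeideal p (centre R) \<longrightarrow> set xs \<subseteq> p \<longrightarrow>
     r \<in> carrier R \<longrightarrow> r \<notin> span_list R xs \<longrightarrow> primeideal (central_colon R (span_list R xs) r) (centre R) \<longrightarrow>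
     p \<subseteq> central_colon R (span_list R xs) r \<longrightarrow> p = central_colon R (span_list R xs) r)"

context centrally_finite_ring
begin

lemma regular_over_centre: "comm_left_module (centre R) (regular_module R)"
  by (rule centre_comm_left_module[OF regular_left_module])

lemma regular_noetherian: "noetherian_in (centre R) (regular_module R) (carrier R)"
  using fg_noetherian_over_centre[OF fg_regular] by simp

lemma span_submodule_centre:
  "set xs \<subseteq> carrier (centre R) \<Longrightarrow> submodule (span_list R xs) (centre R) (regular_module R)"
  by (rule centre_submodule[OF span_list_submodule])

lemma prime_centre_subset: "primeideal p (centre R) \<Longrightarrow> p \<subseteq> carrier (centre R)"
  by (rule subsetI) (rule ideal.Icarr[OF primeideal.axioms(1)])

section \<open>Localization of R at a prime of the centre\<close>

context
  fixes p assumes p: "primeideal p (centre R)"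
begin

interpretation p: primeideal p "centre R" by (rule p)
interpretation RZ: comm_left_module "centre R" "regular_module R" by (rule regular_over_centre)

lemma complement_multiplicative: "multiplicative (centre R) (carrier (centre R) - p)"
  by (rule p.multiplicative_complement)

lemma local_closure_submodule:
  assumes "submodule J (centre R) (regular_module R)"
  shows "submodule (local_closure R p J) (centre R) (regular_module R)" "J \<subseteq> local_closure R p J"
    "\<lbrakk>s \<in> carrier (centre R) - p; u \<in> carrier R; s \<otimes> u \<in> local_closure R p J\<rbrakk> \<Longrightarrow> u \<in> local_closure R p J"
  using RZ.saturate_submodule[OF assms complement_multiplicative] by simp_all

text \<open>An element outside \<open>p\<close> acts injectively modulo the local closure, so the
  colons occurring there lie in \<open>p\<close>. The maximal ones are associated primes of the
  quotient localized at \<open>p\<close>.\<close>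

lemma local_maximal_colon:
  assumes J: "submodule J (centre R) (regular_module R)" and r: "r \<in> carrier R" "r \<notin> local_closure R p J"
  obtains v where "v \<in> carrier R" "v \<notin> local_closure R p J"
    "primeideal (central_colon R (local_closure R p J) v) (centre R)"
    "central_colon R (local_closure R p J) v \<subseteq> p"
    "central_colon R (local_closure R p J) r \<subseteq> central_colon R (local_closure R p J) v"
proof -
  note L = local_closure_submodule[OF J]
  obtain a where a: "a \<in> maximal_colons (centre R) (regular_module R) (local_closure R p J)"
    "central_colon R (local_closure R p J) r \<subseteq> a"
    by (rule RZ.maximal_colon_exists[OF L(1) noetherian_centre, of r]) (use r in auto)
  then obtain v where v: "v \<in> carrier R" "v \<notin> local_closure R p J" "a = central_colon R (local_closure R p J) v"
    by (auto simp: maximal_colons_def)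
  have "a \<subseteq> p"
  proof
    fix z assume "z \<in> a"
    then have z: "z \<in> carrier (centre R)" "z \<otimes> v \<in> local_closure R p J"
      unfolding v(3) by (auto simp: module_colon_def)
    then show "z \<in> p" using L(3)[of z v] v(1,2) by blast
  qed
  then show thesis using that v a(2) RZ.maximal_colon_prime[OF L(1) a(1)] by blast
qed

lemma local_closure_regular:
  assumes y: "y \<in> carrier (centre R)" "\<And>r. \<lbrakk>r \<in> carrier R; y \<otimes> r \<in> J\<rbrakk> \<Longrightarrow> r \<in> J"
    and r: "r \<in> carrier R" "y \<otimes> r \<in> local_closure R p J"
  shows "r \<in> local_closure R p J"
proof -
  obtain s where s: "s \<in> carrier (centre R) - p" "s \<otimes> (y \<otimes> r) \<in> J" using r(2) by (auto simp: saturate_def)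
  have "s \<otimes> (y \<otimes> r) = y \<otimes> (s \<otimes> r)"
    using s(1) y(1) r(1) centre_comm[OF y(1), of s] by (simp flip: m_assoc)
  then have "s \<otimes> r \<in> J" using y(2)[of "s \<otimes> r"] s r(1) by simp
  then show ?thesis using s(1) r(1) by (auto simp: saturate_def)
qed

text \<open>An equation s = j + y c with \<open>s\<close> outside \<open>p\<close> lets Nakayama's
  lemma drop \<open>y\<close> from the sequence; for the empty sequence it reads s = 0, which lies
  in \<open>p\<close>.\<close>

lemma one_notin_local_span:
  "set xs \<subseteq> p \<Longrightarrow> \<one> \<notin> local_closure R p (span_list R xs)"
proof (induction xs rule: rev_induct)
  case Nil
  show ?case
  proof
    assume "\<one> \<in> local_closure R p (span_list R [])"
    then obtain s where s: "s \<in> carrier (centre R)" "s \<notin> p" "s \<otimes> \<one> \<in> {\<zero>}"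
      by (auto simp: saturate_def span_list_Nil)
    then show False using additive_subgroup.zero_closed[OF p.is_additive_subgroup] by simp
  qed
next
  case (snoc y xs)
  have Z: "set xs \<subseteq> carrier (centre R)" "y \<in> carrier (centre R)" "y \<in> p"
    using snoc.prems prime_centre_subset[OF p] by auto
  then have R: "set xs \<subseteq> carrier R" "y \<in> carrier R" by auto
  interpret J: ideal "span_list R xs" R by (rule span_list_ideal[OF Z(1)])
  note sub = span_submodule_centre[OF Z(1)]
  show ?case
  proof
    assume "\<one> \<in> local_closure R p (span_list R (xs @ [y]))"
    then obtain s where s: "s \<in> carrier (centre R) - p" "s \<otimes> \<one> \<in> span_list R (xs @ [y])"
      by (auto simp: saturate_def)
    then obtain j c where jc: "j \<in> span_list R xs" "c \<in> carrier R" "s = j \<oplus> y \<otimes> c"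
      unfolding span_list_snoc[OF R] set_add_def' by auto
    have "carrier R \<subseteq> local_closure R p (span_list R xs)"
    proof (rule RZ.local_nakayama[OF sub _ p Z(3)])
      show "noetherian_in (centre R) (regular_module R) (carrier (regular_module R))"
        using regular_noetherian by simp
      fix r assume r: "r \<in> carrier R"
      have "s \<otimes> r \<ominus> y \<otimes> (c \<otimes> r) = j \<otimes> r"
        using r jc R(2) J.Icarr[OF jc(1)] by (simp add: diff_eq_iff l_distr m_assoc)
      then have "s \<otimes> r \<ominus> y \<otimes> (c \<otimes> r) \<in> span_list R xs" using J.I_r_closed[OF jc(1) r] by simp
      then show "\<exists>s\<in>carrier (centre R) - p. \<exists>r'\<in>carrier R.
          s \<odot>\<^bsub>regular_module R\<^esub> r \<ominus>\<^bsub>regular_module R\<^esub> y \<odot>\<^bsub>regular_module R\<^esub> r' \<in> span_list R xs"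
        using s(1) jc(2) r by (intro bexI[of _ s] bexI[of _ "c \<otimes> r"]) auto
    qed simp
    then show False using snoc.IH snoc.prems by auto
  qed
qed

end

text \<open>An associated prime \<open>b\<close> of the quotient by the earlier entries, taken
  inside \<open>p\<close>, contains these entries but not the regular element \<open>y\<close>; so
  it lies strictly below \<open>p\<close>.\<close>

lemma regular_sequence_height:
  "\<lbrakk>regular_sequence R xs; primeideal p (centre R); set xs \<subseteq> p\<rbrakk> \<Longrightarrow> height_ge (centre R) (length xs) p"
proof (induction xs arbitrary: p rule: rev_induct)
  case Nil
  then show ?case by simp
next
  case (snoc y xs)
  note p = snoc.prems(2)
  have reg: "regular_sequence R xs" "y \<in> carrier (centre R)"
    "\<And>r. \<lbrakk>r \<in> carrier R; y \<otimes> r \<in> span_list R xs\<rbrakk> \<Longrightarrow> r \<in> span_list R xs"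
    using snoc.prems(1) by (auto simp: regular_sequence_snoc)
  note Z = regular_sequence_centre[OF reg(1)]
  interpret J: ideal "span_list R xs" R by (rule span_list_ideal[OF Z])
  note sub = span_submodule_centre[OF Z]
  have "\<one> \<notin> local_closure R p (span_list R xs)"
    using one_notin_local_span[OF p] snoc.prems(3) by simp
  then obtain v where v: "v \<in> carrier R" "v \<notin> local_closure R p (span_list R xs)"
    "primeideal (central_colon R (local_closure R p (span_list R xs)) v) (centre R)"
    "central_colon R (local_closure R p (span_list R xs)) v \<subseteq> p"
    by (rule local_maximal_colon[OF p sub one_closed])
  define b where "b = central_colon R (local_closure R p (span_list R xs)) v"
  have "set xs \<subseteq> b"
  proof
    fix x assume x: "x \<in> set xs"
    have "x \<otimes> v \<in> span_list R xs" by (rule J.I_r_closed[OF span_list_memI[OF Z x] v(1)])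
    then show "x \<in> b"
      using local_closure_submodule(2)[OF p sub] x Z by (auto simp: b_def module_colon_def)
  qed
  then have h: "height_ge (centre R) (length xs) b" using snoc.IH[OF reg(1)] v(3) by (simp add: b_def)
  have "y \<notin> b"
    using local_closure_regular[OF p reg(2,3) v(1)] v(2) by (auto simp: b_def module_colon_def)
  then have "b \<subset> p" using v(4) snoc.prems(3) by (auto simp: b_def)
  then show ?case using h p by auto
qed

text \<open>Each further regular element \<open>y\<close> leads from an associated prime
  \<open>b\<close> of one quotient to a strictly larger one of the next: the latter contains both
  \<open>b\<close> and \<open>y\<close>, and \<open>y\<close> is not in \<open>b\<close>. In effect,
  depth is bounded by the dimension of the centre modulo any associated prime.\<close>

lemma regular_sequence_prime_above:
  assumes m: "primeideal \<mm> (centre R)"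
  shows "\<lbrakk>regular_sequence R (xs @ ys); set (xs @ ys) \<subseteq> \<mm>; u \<in> carrier R;
     u \<notin> local_closure R \<mm> (span_list R xs);
     height_ge (centre R) n (central_colon R (local_closure R \<mm> (span_list R xs)) u);
     central_colon R (local_closure R \<mm> (span_list R xs)) u \<subseteq> \<mm>\<rbrakk> \<Longrightarrow>
    \<exists>b. height_ge (centre R) (n + length ys) b \<and> b \<subseteq> \<mm>"
proof (induction ys arbitrary: xs u n)
  case Nil
  then show ?case by auto
next
  case (Cons y ys)
  interpret RZ: comm_left_module "centre R" "regular_module R" by (rule regular_over_centre)
  have "regular_sequence R (take (Suc (length xs)) (xs @ y # ys))"
    by (rule regular_sequence_take[OF Cons.prems(1)])
  then have reg: "regular_sequence R xs" "y \<in> carrier (centre R)"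
    "\<And>r. \<lbrakk>r \<in> carrier R; y \<otimes> r \<in> span_list R xs\<rbrakk> \<Longrightarrow> r \<in> span_list R xs"
    by (auto simp: regular_sequence_snoc)
  note Z = regular_sequence_centre[OF reg(1)]
  have Z1: "set (xs @ [y]) \<subseteq> carrier (centre R)" using Z reg(2) by auto
  have R: "set xs \<subseteq> carrier R" "y \<in> carrier R" using Z reg(2) by auto
  define J where "J = span_list R xs"
  define J1 where "J1 = span_list R (xs @ [y])"
  interpret J: ideal J R unfolding J_def by (rule span_list_ideal[OF Z])
  have sub: "submodule J (centre R) (regular_module R)" "submodule J1 (centre R) (regular_module R)"
    unfolding J_def J1_def by (rule span_submodule_centre[OF Z], rule span_submodule_centre[OF Z1])
  note L = local_closure_submodule[OF m sub(1)] and L1 = local_closure_submodule[OF m sub(2)]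
  have J1: "j \<oplus> y \<otimes> c \<in> J1" if "j \<in> J" "c \<in> carrier R" for j c
    using that unfolding J1_def span_list_snoc[OF R] set_add_def' J_def by blast
  have JJ1: "J \<subseteq> J1"
  proof
    fix j assume "j \<in> J"
    then show "j \<in> J1" using J1[of j \<zero>] R(2) J.Icarr by simp
  qed
  have LL1: "local_closure R \<mm> J \<subseteq> local_closure R \<mm> J1" using JJ1 by (auto simp: saturate_def)
  define b where "b = central_colon R (local_closure R \<mm> J) u"
  have bZ: "b \<subseteq> carrier (centre R)" by (auto simp: b_def module_colon_def)
  \<comment> \<open>\<open>U\<close> is the part annihilated by \<open>b\<close> locally. If it
    vanished locally modulo \<open>J1\<close>, every r in \<open>U\<close> would be y c up to
    \<open>J\<close> and a factor outside \<open>\<mm>\<close>, with c again in \<open>U\<close>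
    because \<open>y\<close> is regular; Nakayama would then make \<open>U\<close>, and with it
    \<open>u\<close>, vanish locally.\<close>
  define U where "U = {r \<in> carrier R. \<forall>z\<in>b. z \<otimes> r \<in> local_closure R \<mm> J}"
  have uU: "u \<in> U" using Cons.prems(3) by (auto simp: U_def b_def module_colon_def)
  have "\<not> U \<subseteq> local_closure R \<mm> J1"
  proof
    assume *: "U \<subseteq> local_closure R \<mm> J1"
    have "U \<subseteq> local_closure R \<mm> J"
    proof (rule RZ.local_nakayama[OF sub(1) _ m])
      show "noetherian_in (centre R) (regular_module R) (carrier (regular_module R))"
        using regular_noetherian by simp
      show "y \<in> \<mm>" using Cons.prems(2) by simp
      show "U \<subseteq> carrier (regular_module R)" by (auto simp: U_def)
      fix r assume r: "r \<in> U"
      then have rR: "r \<in> carrier R" by (simp add: U_def)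
      obtain s where s: "s \<in> carrier (centre R) - \<mm>" "s \<otimes> r \<in> J1" using * r by (auto simp: saturate_def)
      then obtain j c where jc: "j \<in> J" "c \<in> carrier R" "s \<otimes> r = j \<oplus> y \<otimes> c"
        unfolding J1_def span_list_snoc[OF R] set_add_def' J_def by auto
      have sR: "s \<in> carrier R" using s(1) by simp
      have jR: "j \<in> carrier R" using jc(1) by (rule J.Icarr)
      have eq: "s \<otimes> r \<ominus> y \<otimes> c = j" using jc rR sR R(2) jR by (simp add: diff_eq_iff)
      have "z \<otimes> c \<in> local_closure R \<mm> J" if z: "z \<in> b" for z
      proof (rule local_closure_regular[OF m reg(2)])
        show "r \<in> J" if "r \<in> carrier R" "y \<otimes> r \<in> J" for r using reg(3) that by (simp add: J_def)
        have zZ: "z \<in> carrier (centre R)" using z bZ by auto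
        then show "z \<otimes> c \<in> carrier R" using jc(2) by simp
        have "z \<otimes> r \<in> local_closure R \<mm> J" using r z by (simp add: U_def)
        then have 1: "s \<otimes> (z \<otimes> r) \<in> local_closure R \<mm> J" using RZ.submoduleD(4)[OF L(1), of s] s(1) by simp
        have 2: "z \<otimes> j \<in> local_closure R \<mm> J" using J.I_l_closed[OF jc(1), of z] zZ L(2) by auto
        have "y \<otimes> (z \<otimes> c) = z \<otimes> (y \<otimes> c)"
          using centre_comm[OF reg(2), of z] zZ jc(2) R(2) by (simp flip: m_assoc)
        also have "\<dots> = z \<otimes> (s \<otimes> r) \<ominus> z \<otimes> j"
          using zZ jc sR rR R(2) jR by (simp add: r_distr abel_simps)
        also have "z \<otimes> (s \<otimes> r) = s \<otimes> (z \<otimes> r)"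
          using centre_comm[OF zZ sR] zZ sR rR by (simp flip: m_assoc)
        finally show "y \<otimes> (z \<otimes> c) \<in> local_closure R \<mm> J"
          using RZ.submoduleD(6)[OF L(1) 1 2] by simp
      qed
      then have "c \<in> U" using jc(2) by (simp add: U_def)
      then show "\<exists>s\<in>carrier (centre R) - \<mm>. \<exists>r'\<in>U.
          s \<odot>\<^bsub>regular_module R\<^esub> r \<ominus>\<^bsub>regular_module R\<^esub> y \<odot>\<^bsub>regular_module R\<^esub> r' \<in> J"
        using s(1) eq jc(1) by (intro bexI[of _ s] bexI[of _ c]) auto
    qed
    then show False using uU Cons.prems(4) by (auto simp: J_def)
  qed
  then obtain r where r: "r \<in> U" "r \<notin> local_closure R \<mm> J1" by auto
  have rR: "r \<in> carrier R" using r(1) by (simp add: U_def)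
  obtain v where v: "v \<in> carrier R" "v \<notin> local_closure R \<mm> J1"
    "primeideal (central_colon R (local_closure R \<mm> J1) v) (centre R)"
    "central_colon R (local_closure R \<mm> J1) v \<subseteq> \<mm>"
    "central_colon R (local_closure R \<mm> J1) r \<subseteq> central_colon R (local_closure R \<mm> J1) v"
    by (rule local_maximal_colon[OF m sub(2) rR r(2)])
  have "b \<subseteq> central_colon R (local_closure R \<mm> J1) r"
    using r(1) LL1 bZ by (auto simp: U_def module_colon_def)
  moreover have "y \<in> central_colon R (local_closure R \<mm> J1) r"
  proof -
    have "\<zero> \<oplus> y \<otimes> r \<in> J1" by (rule J1[OF J.zero_closed rR])
    then show ?thesis using L1(2) reg(2) rR R(2) by (auto simp: module_colon_def)
  qed
  moreover have "y \<notin> b"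
    using local_closure_regular[OF m reg(2) reg(3) Cons.prems(3)] Cons.prems(4)
    by (auto simp: b_def module_colon_def J_def)
  ultimately have "b \<subset> central_colon R (local_closure R \<mm> J1) v" using v(5) by blast
  moreover have "height_ge (centre R) n b" using Cons.prems(5) by (simp add: b_def J_def)
  ultimately have "height_ge (centre R) (Suc n) (central_colon R (local_closure R \<mm> J1) v)"
    using v(3) by auto
  then show ?case
    using Cons.IH[of "xs @ [y]" v "Suc n"] Cons.prems(1,2) v unfolding J1_def by simp
qed

text \<open>The spans of longer and longer sequences satisfy the ascending chain condition. An entry
  \<open>x\<close> that does not enlarge the span lies in it, and regularity of \<open>x\<close>
  would then put \<open>\<one>\<close> there.\<close>

lemma maximal_central_sequence_exists:
  assumes xs: "central_sequence R xs" "set xs \<subseteq> \<mm>" and m: "\<mm> \<subseteq> carrier (centre R)"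
  obtains ys where "maximal_central_sequence_in R \<mm> (xs @ ys)"
proof -
  let ?A = "{span_list R (xs @ ys) |ys. central_sequence R (xs @ ys) \<and> set (xs @ ys) \<subseteq> \<mm>}"
  have sub: "submodule N (centre R) (regular_module R) \<and> N \<subseteq> carrier R" if N: "N \<in> ?A" for N
  proof -
    obtain ys where "N = span_list R (xs @ ys)" "central_sequence R (xs @ ys)" using N by blast
    then have ys: "N = span_list R (xs @ ys)" "set (xs @ ys) \<subseteq> carrier (centre R)"
      using regular_sequence_centre[of R "xs @ ys"] by (auto simp: central_sequence_iff)
    then show ?thesis using span_submodule_centre[OF ys(2)] ideal.Icarr[OF span_list_ideal[OF ys(2)]] by auto
  qed
  have mem: "span_list R xs \<in> ?A" using xs by (intro CollectI exI[of _ "[]"]) simp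
  obtain N where N: "N \<in> ?A" "span_list R xs \<subseteq> N" "\<And>N'. \<lbrakk>N' \<in> ?A; N \<subseteq> N'\<rbrakk> \<Longrightarrow> N' = N"
    by (rule noetherian_in_maximal[OF regular_noetherian mem sub]) (assumption, rule that)
  then obtain ys where ys: "N = span_list R (xs @ ys)" "central_sequence R (xs @ ys)" "set (xs @ ys) \<subseteq> \<mm>"
    by blast
  have "\<not> central_sequence R ((xs @ ys) @ [x])" if x: "x \<in> \<mm>" for x
  proof
    assume *: "central_sequence R ((xs @ ys) @ [x])"
    have Z: "set (xs @ ys) \<subseteq> carrier (centre R)" "x \<in> carrier (centre R)" using ys(3) x m by auto
    then have R: "set (xs @ ys) \<subseteq> carrier R" "x \<in> carrier R" by auto
    interpret J: ideal "span_list R (xs @ ys)" R by (rule span_list_ideal[OF Z(1)])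
    have mem': "j \<oplus> x \<otimes> c \<in> span_list R ((xs @ ys) @ [x])" if "j \<in> span_list R (xs @ ys)" "c \<in> carrier R" for j c
      using that unfolding span_list_snoc[OF R] set_add_def' by blast
    have "N \<subseteq> span_list R ((xs @ ys) @ [x])"
    proof
      fix j assume "j \<in> N"
      then show "j \<in> span_list R ((xs @ ys) @ [x])" using mem'[of j \<zero>] R J.Icarr by (simp add: ys(1))
    qed
    then have "span_list R ((xs @ ys) @ [x]) = N"
      using * ys(3) x by (intro N(3)) (auto intro!: exI[of _ "ys @ [x]"])
    then have xJ: "x \<in> span_list R (xs @ ys)" using mem'[OF J.zero_closed one_closed] R by (simp add: ys(1))
    have "\<forall>r\<in>carrier R. x \<otimes> r \<in> span_list R (xs @ ys) \<longrightarrow> r \<in> span_list R (xs @ ys)"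
      using *[unfolded central_sequence_iff regular_sequence_snoc] by (elim conjE)
    from bspec[OF this one_closed] have "\<one> \<in> span_list R (xs @ ys)" using xJ R(2) by simp
    then have "span_list R (xs @ ys) = carrier R" by (rule J.one_imp_carrier)
    then show False using ys(2) by (simp add: central_sequence_iff)
  qed
  then have "maximal_central_sequence_in R \<mm> (xs @ ys)"
    using ys by (simp add: maximal_central_sequence_in_def)
  then show thesis by (rule that)
qed

lemma maximalideal_above:
  assumes b: "primeideal b (centre R)"
  obtains \<mm> where "maximalideal \<mm> (centre R)" "b \<subseteq> \<mm>"
proof -
  interpret Z: cring "centre R" by (rule centre_cring)
  let ?A = "{I. ideal I (centre R) \<and> I \<noteq> carrier (centre R)}"
  have sub: "submodule N (centre R) (regular_module (centre R)) \<and> N \<subseteq> carrier (centre R)" if "N \<in> ?A" for N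
  proof -
    have "ideal N (centre R)" using that by simp
    then show ?thesis using ideal.submodule_regular[of N "centre R"] ideal.Icarr[of N "centre R"] by blast
  qed
  have mem: "b \<in> ?A" using primeideal.axioms(1)[OF b] primeideal.I_notcarr[OF b] by auto
  obtain N where N: "N \<in> ?A" "b \<subseteq> N" "\<And>N'. \<lbrakk>N' \<in> ?A; N \<subseteq> N'\<rbrakk> \<Longrightarrow> N' = N"
    by (rule noetherian_in_maximal[OF Z.noetherian_regular[OF noetherian_centre] mem sub]) (assumption, rule that)
  have "maximalideal N (centre R)"
    by (rule maximalidealI) (use N in auto)
  then show thesis using N(2) that by blast
qed

text \<open>If \<open>p\<close> were strictly below the colon ideal, the latter would have height
  above \<open>length xs\<close>. Completing \<open>xs\<close> to a maximal sequence in
  \<open>\<mm>\<close> and climbing with the added entries gives a chain of primes longer than the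
  Krull dimension of the localized centre, which by the Macaulay property is the length of the
  completed sequence.\<close>

lemma centrally_Macaulay_unmixed:
  assumes "centrally_Macaulay R"
  shows "unmixed R"
  unfolding unmixed_def
proof (intro allI impI)
  fix xs p r
  assume reg: "regular_sequence R xs" and p: "primeideal p (centre R)" and xsp: "set xs \<subseteq> p"
    and r: "r \<in> carrier R" "r \<notin> span_list R xs"
    and b: "primeideal (central_colon R (span_list R xs) r) (centre R)"
    and pb: "p \<subseteq> central_colon R (span_list R xs) r"
  let ?b = "central_colon R (span_list R xs) r"
  show "p = ?b"
  proof (rule ccontr)
    assume "p \<noteq> ?b"
    then have "p \<subset> ?b" using pb by blast
    then have h: "height_ge (centre R) (Suc (length xs)) ?b"
      using regular_sequence_height[OF reg p xsp] b by auto
    obtain \<mm> where mm: "maximalideal \<mm> (centre R)" "?b \<subseteq> \<mm>" by (rule maximalideal_above[OF b])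
    interpret Z: cring "centre R" by (rule centre_cring)
    have m: "primeideal \<mm> (centre R)" by (rule Z.maximalideal_prime[OF mm(1)])
    have "central_sequence R xs" using reg r by (auto simp: central_sequence_iff)
    moreover have xm: "set xs \<subseteq> \<mm>" using xsp pb mm(2) by blast
    ultimately obtain ys where ys: "maximal_central_sequence_in R \<mm> (xs @ ys)"
      by (rule maximal_central_sequence_exists[OF _ _ prime_centre_subset[OF m]])
    then have seq: "regular_sequence R (xs @ ys)" "set (xs @ ys) \<subseteq> \<mm>"
      by (auto simp: maximal_central_sequence_in_def central_sequence_iff)
    have K: "Kdim (localization (centre R) (carrier (centre R) - \<mm>)) = ereal (real (length (xs @ ys)))"
      using assms mm(1) ys unfolding centrally_Macaulay_def by metis
    note sub = span_submodule_centre[OF regular_sequence_centre[OF reg]]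
    have notb: "r \<notin> local_closure R \<mm> (span_list R xs)"
      using mm(2) by (auto simp: saturate_def module_colon_def)
    \<comment> \<open>The colon is a prime inside \<open>\<mm>\<close>, so passing to the local
      closure at \<open>\<mm>\<close> does not enlarge it.\<close>
    have "central_colon R (local_closure R \<mm> (span_list R xs)) r \<subseteq> ?b"
    proof
      fix z assume "z \<in> central_colon R (local_closure R \<mm> (span_list R xs)) r"
      then obtain s where s: "z \<in> carrier (centre R)" "s \<in> carrier (centre R)" "s \<notin> \<mm>" "s \<otimes> (z \<otimes> r) \<in> span_list R xs"
        by (auto simp: module_colon_def saturate_def)
      have "(s \<otimes>\<^bsub>centre R\<^esub> z) \<in> carrier (centre R)" using s(1,2) by (rule Z.m_closed[rotated])
      then have "s \<otimes>\<^bsub>centre R\<^esub> z \<in> ?b" using s r(1) by (simp add: module_colon_def m_assoc)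
      then show "z \<in> ?b" using primeideal.I_prime[OF b s(2,1)] s(3) mm(2) by blast
    qed
    moreover have "?b \<subseteq> central_colon R (local_closure R \<mm> (span_list R xs)) r"
      using local_closure_submodule(2)[OF m sub] by (auto simp: module_colon_def)
    ultimately have eq: "central_colon R (local_closure R \<mm> (span_list R xs)) r = ?b" by blast
    obtain q where q: "height_ge (centre R) (Suc (length xs) + length ys) q" "q \<subseteq> \<mm>"
      using regular_sequence_prime_above[OF m seq r(1) notb, unfolded eq, OF h mm(2)] by blast
    have "Suc (length xs) + length ys \<le> length (xs @ ys)"
      by (rule Z.height_le_Kdim_localization[OF m q K])
    then show False by simp
  qed
qed

end

section \<open>The opposite ring\<close>

lemma opposite_simps [simp]:
  "carrier (opposite R) = carrier R" "add (opposite R) = add R" "zero (opposite R) = zero R"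
  "one (opposite R) = one R" "x \<otimes>\<^bsub>opposite R\<^esub> y = y \<otimes>\<^bsub>R\<^esub> x"
  by (simp_all add: opposite_def)

lemma opposite_opposite [simp]: "opposite (opposite R) = R"
  by (simp add: opposite_def)

lemma opposite_ops [simp]:
  "a_inv (opposite R) = a_inv R" "a_minus (opposite R) = a_minus R"
  "set_add (opposite R) = set_add R" "a_r_coset (opposite R) = a_r_coset R"
proof -
  show inv: "a_inv (opposite R) = a_inv R" by (simp add: a_inv_def m_inv_def fun_eq_iff)
  show "a_minus (opposite R) = a_minus R" by (simp add: a_minus_def inv fun_eq_iff)
  show "set_add (opposite R) = set_add R" by (simp add: set_add_def' fun_eq_iff)
  show "a_r_coset (opposite R) = a_r_coset R" by (simp add: a_r_coset_def' fun_eq_iff)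
qed

lemma carrier_centre_opposite [simp]: "carrier (centre (opposite R)) = carrier (centre R)"
  by (auto simp: centre_def)

lemma right_part_simps [simp]:
  "carrier (right_part M ra) = carrier M" "add (right_part M ra) = add M"
  "zero (right_part M ra) = zero M" "r \<odot>\<^bsub>right_part M ra\<^esub> x = ra x r"
  by (simp_all add: right_part_def)

text \<open>The centres of \<open>R\<close> and \<open>opposite R\<close> are records whose products
  agree on the carrier only, so properties are carried over under a pointwise assumption on
  products.\<close>

lemma ideal_transfer:
  assumes "ring R'" "carrier R' = carrier R" "add R' = add R" "zero R' = zero R"
    and mult: "\<And>x y. \<lbrakk>x \<in> carrier R; y \<in> carrier R\<rbrakk> \<Longrightarrow> x \<otimes>\<^bsub>R'\<^esub> y = x \<otimes>\<^bsub>R\<^esub> y"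
    and I: "ideal I R"
  shows "ideal I R'"
proof -
  interpret I: ideal I R by (rule I)
  have "subgroup I (add_monoid R')"
  proof -
    have "m_inv (add_monoid R') = m_inv (add_monoid R)"
      using assms(2-4) by (simp add: m_inv_def fun_eq_iff)
    then show ?thesis using I.a_subgroup assms(2-4) by (simp add: subgroup_def)
  qed
  then show ?thesis
    using I.I_l_closed I.I_r_closed I.Icarr by (intro idealI assms(1)) (auto simp: mult assms(2))
qed

lemma primeideal_transfer:
  assumes "cring R'" "carrier R' = carrier R" "add R' = add R" "zero R' = zero R"
    and mult: "\<And>x y. \<lbrakk>x \<in> carrier R; y \<in> carrier R\<rbrakk> \<Longrightarrow> x \<otimes>\<^bsub>R'\<^esub> y = x \<otimes>\<^bsub>R\<^esub> y"
    and I: "primeideal I R"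
  shows "primeideal I R'"
proof -
  interpret I: primeideal I R by (rule I)
  show ?thesis
    using I.I_notcarr I.I_prime
    by (intro primeidealI assms(1) ideal_transfer[OF _ assms(2-4) mult I.ideal_axioms] cring.axioms(1))
       (auto simp: mult assms(2))
qed

lemma noetherian_ring_transfer:
  assumes R': "ring R'" and R: "noetherian_ring R"
    and eq: "carrier R' = carrier R" "add R' = add R" "zero R' = zero R"
    and mult: "\<And>x y. \<lbrakk>x \<in> carrier R; y \<in> carrier R\<rbrakk> \<Longrightarrow> x \<otimes>\<^bsub>R'\<^esub> y = x \<otimes>\<^bsub>R\<^esub> y"
  shows "noetherian_ring R'"
proof -
  interpret R: noetherian_ring R by (rule R)
  interpret R': ring R' by (rule R')
  have iff: "ideal I R' \<longleftrightarrow> ideal I R" for I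
    using ideal_transfer[OF R' eq mult] ideal_transfer[OF R.ring_axioms, of R' I] eq mult by auto
  then have "genideal R' A = genideal R A" for A by (simp add: genideal_def)
  then show ?thesis using R.finetely_gen iff eq(1) by (intro R'.noetherian_ringI) simp
qed

lemma (in ring) opposite_ring: "ring (opposite R)"
proof (rule ringI)
  show "abelian_group (opposite R)"
    by (rule abelian_groupI) (auto simp: a_ac intro: bexI[of _ "\<ominus> _"] l_neg)
  show "monoid (opposite R)" by (rule monoidI) (auto simp: m_assoc)
qed (auto simp: l_distr r_distr)

context centrally_finite_ring
begin

lemma centre_opposite_mult:
  "\<lbrakk>x \<in> carrier (centre R); y \<in> carrier R\<rbrakk> \<Longrightarrow> x \<otimes>\<^bsub>opposite R\<^esub> y = x \<otimes> y"
  using centre_comm[of x y] by simp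

lemma centre_opposite_cring: "cring (centre (opposite R))"
  by (rule ring.centre_cring[OF opposite_ring])

lemma primeideal_centre_opposite: "primeideal p (centre (opposite R)) \<longleftrightarrow> primeideal p (centre R)"
proof
  show "primeideal p (centre (opposite R))" if "primeideal p (centre R)"
    by (rule primeideal_transfer[OF centre_opposite_cring _ _ _ _ that]) (simp_all add: centre_comm)
  show "primeideal p (centre R)" if "primeideal p (centre (opposite R))"
    by (rule primeideal_transfer[OF centre_cring _ _ _ _ that]) (simp_all add: centre_comm)
qed

lemma submodule_centre_opposite:
  assumes "submodule N (centre (opposite R)) (regular_module (opposite R))"
  shows "submodule N (centre R) (regular_module R)"
proof -
  interpret L: left_module "centre (opposite R)" "regular_module (opposite R)"
    using ring.centre_left_module[OF opposite_ring ring.regular_left_module[OF opposite_ring]] .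
  interpret RZ: left_module "centre R" "regular_module R" by (rule centre_left_module[OF regular_left_module])
  note n = L.submoduleD[OF assms, simplified]
  show ?thesis
  proof (rule RZ.submoduleI)
    show "a \<odot>\<^bsub>regular_module R\<^esub> x \<in> N" if "a \<in> carrier (centre R)" "x \<in> N" for a x
      using n(4)[OF that] n(1) that centre_comm[OF that(1), of x] by auto
  qed (use n in auto)
qed

lemma opposite_centrally_finite: "centrally_finite_ring (opposite R)"
proof (intro centrally_finite_ring.intro centrally_finite_ring_axioms.intro)
  show "ring (opposite R)" by (rule opposite_ring)
  show "noetherian_ring (centre (opposite R))"
    by (rule noetherian_ring_transfer[OF _ noetherian_centre])
       (use centre_opposite_cring in \<open>simp_all add: cring.axioms(1) centre_comm\<close>)
  obtain T where "finite T" "T \<subseteq> carrier R"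
    "\<And>K. submodule K (centre R) (regular_module R) \<and> T \<subseteq> K \<Longrightarrow> K = carrier R"
    using finite_over_centre by (auto simp: finitely_generated_def)
  then show "finitely_generated (centre (opposite R)) (regular_module (opposite R))"
    unfolding finitely_generated_def using submodule_centre_opposite by (intro exI[of _ T]) auto
  show "\<one>\<^bsub>opposite R\<^esub> \<noteq> \<zero>\<^bsub>opposite R\<^esub>" using one_neq_zero by simp
qed

lemma span_list_opposite:
  "set xs \<subseteq> carrier (centre R) \<Longrightarrow> span_list (opposite R) xs = span_list R xs"
proof (induction xs rule: rev_induct)
  case Nil
  then show ?case by (simp add: span_list_Nil ring.span_list_Nil[OF opposite_ring])
next
  case (snoc y xs)
  then have R: "set xs \<subseteq> carrier R" "y \<in> carrier R" "y \<in> carrier (centre R)" by auto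
  have "(\<lambda>r. r \<otimes> y) ` carrier R = (\<lambda>r. y \<otimes> r) ` carrier R"
    by (rule image_cong) (simp_all add: centre_comm[OF R(3)])
  then show ?case
    using snoc span_list_snoc[OF R(1,2)] ring.span_list_snoc[OF opposite_ring, of xs y] R by simp
qed

lemma regular_sequence_opposite: "regular_sequence (opposite R) xs \<longleftrightarrow> regular_sequence R xs"
proof (cases "set xs \<subseteq> carrier (centre R)")
  case True
  have sp: "span_list (opposite R) (take i xs) = span_list R (take i xs)" for i
    using span_list_opposite[of "take i xs"] True set_take_subset[of i xs] by auto
  have "xs ! i \<otimes>\<^bsub>opposite R\<^esub> r = xs ! i \<otimes> r" if "i < length xs" "r \<in> carrier R" for i r
    using centre_opposite_mult[of "xs ! i" r] True that nth_mem[of i xs] by blast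
  then show ?thesis using True unfolding regular_sequence_def sp by auto
next
  case False
  then show ?thesis by (simp add: regular_sequence_def)
qed

lemma central_colon_opposite:
  "u \<in> carrier R \<Longrightarrow> central_colon (opposite R) J u = central_colon R J u"
  unfolding module_colon_def by (rule Collect_cong) (use centre_comm[of _ u] in force)

lemma unmixed_opposite:
  assumes "unmixed R"
  shows "unmixed (opposite R)"
  unfolding unmixed_def
proof (intro allI impI)
  fix xs p r
  assume "regular_sequence (opposite R) xs" "primeideal p (centre (opposite R))" "set xs \<subseteq> p"
    and r: "r \<in> carrier (opposite R)" "r \<notin> span_list (opposite R) xs"
    and c: "primeideal (central_colon (opposite R) (span_list (opposite R) xs) r) (centre (opposite R))"
      "p \<subseteq> central_colon (opposite R) (span_list (opposite R) xs) r"
  then have reg: "regular_sequence R xs" "primeideal p (centre R)" "set xs \<subseteq> p"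
    by (auto simp: regular_sequence_opposite primeideal_centre_opposite)
  note sp = span_list_opposite[OF regular_sequence_centre[OF reg(1)]]
  have rR: "r \<in> carrier R" using r by simp
  note col = central_colon_opposite[OF rR]
  show "p = central_colon (opposite R) (span_list (opposite R) xs) r"
    using assms[unfolded unmixed_def, rule_format, OF reg rR] r c
    by (simp add: sp col primeideal_centre_opposite)
qed

text \<open>Exchanging the two actions of a bimodule exchanges its two grades.\<close>

lemma grade_symmetric_opposite:
  assumes "grade_symmetric R"
  shows "grade_symmetric (opposite R)"
  unfolding grade_symmetric_def
proof (intro allI impI)
  fix M :: "('a, 'a list set) module" and ra
  assume *: "central_bimodule (opposite R) M ra \<and> finitely_generated (opposite R) M \<and>
    finitely_generated (opposite (opposite R)) (right_part M ra)"
  let ?M = "right_part M ra"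
  let ?ra = "\<lambda>x r. r \<odot>\<^bsub>M\<^esub> x"
  have MM: "right_part ?M ?ra = M" by (simp add: right_part_def)
  have "central_bimodule R ?M ?ra"
    using * unfolding central_bimodule_def MM by simp
  then have "grade R ?M = grade (opposite R) (right_part ?M ?ra)"
    using assms[unfolded grade_symmetric_def, rule_format, of ?M ?ra] * by (simp add: MM)
  then show "grade (opposite R) M = grade (opposite (opposite R)) (right_part M ra)"
    by (simp add: MM)
qed

end

section \<open>Transport of modules along injections\<close>

text \<open>Grade symmetry is stated for carriers of type \<open>'a list set\<close>; this moves a
  module to such a carrier.\<close>

definition transport_module :: "('m \<Rightarrow> 'n) \<Rightarrow> ('a, 'm) module \<Rightarrow> ('a, 'n) module" where
  "transport_module \<iota> M = \<lparr>carrier = \<iota> ` carrier M, monoid.mult = undefined, monoid.one = undefined,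
     ring.zero = \<iota> \<zero>\<^bsub>M\<^esub>,
     ring.add = \<lambda>x y. \<iota> (inv_into (carrier M) \<iota> x \<oplus>\<^bsub>M\<^esub> inv_into (carrier M) \<iota> y),
     smult = \<lambda>r x. \<iota> (r \<odot>\<^bsub>M\<^esub> inv_into (carrier M) \<iota> x)\<rparr>"

context
  fixes R :: "('a, 'b) ring_scheme" and M :: "('a, 'm) module" and \<iota> :: "'m \<Rightarrow> 'n"
  assumes M: "left_module R M" and inj: "inj_on \<iota> (carrier M)"
begin

interpretation left_module R M by (rule M)

lemma transport_simps:
  "carrier (transport_module \<iota> M) = \<iota> ` carrier M" "\<zero>\<^bsub>transport_module \<iota> M\<^esub> = \<iota> \<zero>\<^bsub>M\<^esub>"
  "\<lbrakk>x \<in> carrier M; y \<in> carrier M\<rbrakk> \<Longrightarrow> \<iota> x \<oplus>\<^bsub>transport_module \<iota> M\<^esub> \<iota> y = \<iota> (x \<oplus>\<^bsub>M\<^esub> y)"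
  "x \<in> carrier M \<Longrightarrow> r \<odot>\<^bsub>transport_module \<iota> M\<^esub> \<iota> x = \<iota> (r \<odot>\<^bsub>M\<^esub> x)"
  using inj by (simp_all add: transport_module_def)

lemma transport_left_module: "left_module R (transport_module \<iota> M)"
proof (rule left_moduleI)
  show "ring R" by (rule R.ring_axioms)
  show "abelian_group (transport_module \<iota> M)"
  proof (rule abelian_groupI)
    fix x assume "x \<in> carrier (transport_module \<iota> M)"
    then obtain y where "x = \<iota> y" "y \<in> carrier M" by (auto simp: transport_simps)
    then show "\<exists>y\<in>carrier (transport_module \<iota> M). y \<oplus>\<^bsub>transport_module \<iota> M\<^esub> x = \<zero>\<^bsub>transport_module \<iota> M\<^esub>"
      by (intro bexI[of _ "\<iota> (\<ominus>\<^bsub>M\<^esub> y)"]) (auto simp: transport_simps M.l_neg)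
  qed (auto simp: transport_simps M.a_ac)
qed (auto simp: transport_simps smult_l_distr smult_r_distr smult_assoc)

lemma transport_linear: "linear_map R M (transport_module \<iota> M) \<iota>"
  by (rule linear_mapI) (simp_all add: transport_simps)

lemma transport_inv_linear: "linear_map R (transport_module \<iota> M) M (inv_into (carrier M) \<iota>)"
  by (rule linear_mapI) (use inj in \<open>auto simp: transport_simps\<close>)

lemma transport_finitely_generated:
  "finitely_generated R M \<Longrightarrow> finitely_generated R (transport_module \<iota> M)"
  by (rule finitely_generated_image[OF M _ transport_left_module transport_linear])
     (simp_all add: transport_simps)

end

lemma has_nonzero_map_comp:
  assumes "linear_map R A B f" "f ` carrier A = carrier B" "has_nonzero_map R B N"
  shows "has_nonzero_map R A N"
proof -
  obtain h y where h: "linear_map R B N h" "y \<in> carrier B" "h y \<noteq> \<zero>\<^bsub>N\<^esub>"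
    using assms(3) by (auto simp: has_nonzero_map_def)
  then obtain x where "x \<in> carrier A" "y = f x" using assms(2) by auto
  then show ?thesis
    using h linear_map_comp[OF assms(1) h(1)] by (auto simp: has_nonzero_map_def)
qed

section \<open>A central bimodule detecting the grade\<close>

text \<open>Given a \<open>Z(R)\<close>-linear map \<open>\<phi> : M \<rightarrow> R/J\<close>, the bimodule is the image of \<open>M \<otimes>\<^bsub>Z(R)\<^esub> R\<close> in
  \<open>Hom\<^bsub>Z(R)\<^esub>(R, R/J)\<close> under \<open>m \<otimes> r \<mapsto> (u \<mapsto> \<phi>(u m) r)\<close>. It is generated by images of \<open>M\<close> as a left
  module, and evaluation at \<open>1\<close> maps it to \<open>R/J\<close> as a right module.\<close>

locale bimodule_of_map = centrally_finite_ring R for R :: "('a, 'b) ring_scheme" (structure) +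
  fixes M :: "('a, 'm) module" and J :: "'a set" and \<phi> :: "'m \<Rightarrow> 'a set"
  assumes fg: "fg_module R M" and J: "ideal J R"
    and \<phi>: "linear_map (centre R) M (cyclic_quotient R J) \<phi>"
begin

sublocale M: left_module R M using fg by (simp add: fg_module_def)
sublocale J: ideal J R by (rule J)
sublocale op: ring "opposite R" by (rule opposite_ring)

lemma ideal_op: "ideal J (opposite R)"
proof -
  have "subgroup J (add_monoid (opposite R))"
    using J.a_subgroup by (simp add: subgroup_def m_inv_def)
  then show ?thesis using J.I_l_closed J.I_r_closed by (intro idealI opposite_ring) auto
qed

text \<open>R/J is a bimodule as \<open>J\<close> is two-sided; \<open>Q\<close> carries the left
  action and \<open>Q'\<close> the right one on the same cosets.\<close>

abbreviation "Q \<equiv> cyclic_quotient R J"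
abbreviation "Q' \<equiv> cyclic_quotient (opposite R) J"

lemma Q: "left_module R Q"
  by (rule quotient_left_module[OF regular_left_module J.submodule_regular])

lemma Q': "left_module (opposite R) Q'"
  by (rule quotient_left_module[OF op.regular_left_module ideal.submodule_regular[OF ideal_op]])

sublocale Q: left_module R Q by (rule Q)
sublocale Q': left_module "opposite R" Q' by (rule Q')

lemma QE:
  assumes "C \<in> carrier Q"
  obtains c where "c \<in> carrier R" "C = J +> c"
  using assms by (auto simp: quotient_simps[OF regular_left_module J.submodule_regular])

lemma Q_smult: "\<lbrakk>r \<in> carrier R; c \<in> carrier R\<rbrakk> \<Longrightarrow> r \<odot>\<^bsub>Q\<^esub> (J +> c) = J +> (r \<otimes> c)"
  using quotient_smult[OF regular_left_module J.submodule_regular, of r c] by simp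

lemma Q'_smult: "\<lbrakk>r \<in> carrier R; c \<in> carrier R\<rbrakk> \<Longrightarrow> r \<odot>\<^bsub>Q'\<^esub> (J +> c) = J +> (c \<otimes> r)"
  using quotient_smult[OF op.regular_left_module ideal.submodule_regular[OF ideal_op], of r c] by simp

lemma Q'_eq [simp]: "carrier Q' = carrier Q" "\<zero>\<^bsub>Q'\<^esub> = \<zero>\<^bsub>Q\<^esub>" "add Q' = add Q"
proof -
  show "carrier Q' = carrier Q"
    by (simp add: quotient_simps[OF regular_left_module J.submodule_regular]
        quotient_simps[OF op.regular_left_module ideal.submodule_regular[OF ideal_op]])
  show "\<zero>\<^bsub>Q'\<^esub> = \<zero>\<^bsub>Q\<^esub>" "add Q' = add Q" by (simp_all add: quotient_module_def)
qed

lemma Q_assoc: "\<lbrakk>r \<in> carrier R; s \<in> carrier R; C \<in> carrier Q\<rbrakk> \<Longrightarrow> s \<odot>\<^bsub>Q'\<^esub> (r \<odot>\<^bsub>Q\<^esub> C) = r \<odot>\<^bsub>Q\<^esub> (s \<odot>\<^bsub>Q'\<^esub> C)"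
  by (erule QE) (simp add: Q_smult Q'_smult m_assoc)

lemma Q_central: "\<lbrakk>z \<in> carrier (centre R); C \<in> carrier Q\<rbrakk> \<Longrightarrow> z \<odot>\<^bsub>Q'\<^esub> C = z \<odot>\<^bsub>Q\<^esub> C"
  by (erule QE) (simp add: Q_smult Q'_smult centre_comm)

lemma QZ: "left_module (centre R) Q" by (rule centre_left_module[OF Q])

text \<open>The left action multiplies the argument on the right, and the right action
  \<open>ract\<close> multiplies the value. They agree on central elements because the members of
  \<open>H\<close> are linear over the centre.\<close>

definition H :: "('a, 'a \<Rightarrow> 'a set) module" where
  "H = \<lparr>carrier = {f \<in> extensional (carrier R). linear_map (centre R) (regular_module R) Q f},
     monoid.mult = undefined, monoid.one = undefined,
     ring.zero = \<lambda>u\<in>carrier R. \<zero>\<^bsub>Q\<^esub>, ring.add = \<lambda>f g. \<lambda>u\<in>carrier R. f u \<oplus>\<^bsub>Q\<^esub> g u,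
     smult = \<lambda>r f. \<lambda>u\<in>carrier R. f (u \<otimes> r)\<rparr>"

definition ract :: "('a \<Rightarrow> 'a set) \<Rightarrow> 'a \<Rightarrow> 'a \<Rightarrow> 'a set" where
  "ract f r = (\<lambda>u\<in>carrier R. r \<odot>\<^bsub>Q'\<^esub> f u)"

lemma H_mem: "f \<in> carrier H \<longleftrightarrow> f \<in> extensional (carrier R) \<and> linear_map (centre R) (regular_module R) Q f"
  by (simp add: H_def)

lemma H_apply:
  "u \<in> carrier R \<Longrightarrow> \<zero>\<^bsub>H\<^esub> u = \<zero>\<^bsub>Q\<^esub>" "u \<in> carrier R \<Longrightarrow> (f \<oplus>\<^bsub>H\<^esub> g) u = f u \<oplus>\<^bsub>Q\<^esub> g u"
  "u \<in> carrier R \<Longrightarrow> (r \<odot>\<^bsub>H\<^esub> f) u = f (u \<otimes> r)" "u \<in> carrier R \<Longrightarrow> ract f r u = r \<odot>\<^bsub>Q'\<^esub> f u"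
  by (simp_all add: H_def ract_def)

lemma H_ext: "\<lbrakk>f \<in> carrier H; g \<in> carrier H; \<And>u. u \<in> carrier R \<Longrightarrow> f u = g u\<rbrakk> \<Longrightarrow> f = g"
  unfolding H_mem by (blast intro: extensionalityI)

lemma H_D:
  assumes "f \<in> carrier H"
  shows "u \<in> carrier R \<Longrightarrow> f u \<in> carrier Q"
    and "\<lbrakk>u \<in> carrier R; v \<in> carrier R\<rbrakk> \<Longrightarrow> f (u \<oplus> v) = f u \<oplus>\<^bsub>Q\<^esub> f v"
    and "\<lbrakk>z \<in> carrier (centre R); u \<in> carrier R\<rbrakk> \<Longrightarrow> f (z \<otimes> u) = z \<odot>\<^bsub>Q\<^esub> f u"
  using assms linear_mapD[of "centre R" "regular_module R" Q f] by (simp_all add: H_mem)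

lemma H_I:
  assumes "f \<in> extensional (carrier R)" "\<And>u. u \<in> carrier R \<Longrightarrow> f u \<in> carrier Q"
    and "\<And>u v. \<lbrakk>u \<in> carrier R; v \<in> carrier R\<rbrakk> \<Longrightarrow> f (u \<oplus> v) = f u \<oplus>\<^bsub>Q\<^esub> f v"
    and "\<And>z u. \<lbrakk>z \<in> carrier (centre R); u \<in> carrier R\<rbrakk> \<Longrightarrow> f (z \<otimes> u) = z \<odot>\<^bsub>Q\<^esub> f u"
  shows "f \<in> carrier H"
  unfolding H_mem using assms by (auto intro!: linear_mapI)

lemma H_closed:
  "\<zero>\<^bsub>H\<^esub> \<in> carrier H" "\<lbrakk>f \<in> carrier H; g \<in> carrier H\<rbrakk> \<Longrightarrow> f \<oplus>\<^bsub>H\<^esub> g \<in> carrier H"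
  "\<lbrakk>r \<in> carrier R; f \<in> carrier H\<rbrakk> \<Longrightarrow> r \<odot>\<^bsub>H\<^esub> f \<in> carrier H"
  "\<lbrakk>r \<in> carrier R; f \<in> carrier H\<rbrakk> \<Longrightarrow> ract f r \<in> carrier H"
proof -
  show "\<zero>\<^bsub>H\<^esub> \<in> carrier H" by (rule H_I) (simp_all add: H_apply, simp add: H_def)
  show "f \<oplus>\<^bsub>H\<^esub> g \<in> carrier H" if f: "f \<in> carrier H" and g: "g \<in> carrier H"
  proof (rule H_I)
    show "f \<oplus>\<^bsub>H\<^esub> g \<in> extensional (carrier R)" by (simp add: H_def)
  qed (simp_all add: H_apply H_D[OF f] H_D[OF g] Q.M.a_ac Q.smult_r_distr)
  show "r \<odot>\<^bsub>H\<^esub> f \<in> carrier H" if r: "r \<in> carrier R" and f: "f \<in> carrier H"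
  proof (rule H_I)
    show "r \<odot>\<^bsub>H\<^esub> f \<in> extensional (carrier R)" by (simp add: H_def)
  qed (use r in \<open>simp_all add: H_apply H_D[OF f] l_distr m_assoc\<close>)
  show "ract f r \<in> carrier H" if r: "r \<in> carrier R" and f: "f \<in> carrier H"
  proof (rule H_I)
    show "ract f r \<in> extensional (carrier R)" by (simp add: ract_def)
    fix u assume u: "u \<in> carrier R"
    show "ract f r u \<in> carrier Q" using Q'.smult_closed[of r "f u"] r u H_D(1)[OF f u] by (simp add: H_apply)
    show "ract f r (u \<oplus> v) = ract f r u \<oplus>\<^bsub>Q\<^esub> ract f r v" if v: "v \<in> carrier R" for v
      using Q'.smult_r_distr[of r "f u" "f v"] r u v H_D[OF f] by (simp add: H_apply)
    show "ract f r (z \<otimes> u) = z \<odot>\<^bsub>Q\<^esub> ract f r u" if z: "z \<in> carrier (centre R)" for z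
      using Q_assoc[of z r "f u"] r u z H_D[OF f] by (simp add: H_apply)
  qed
qed

lemma H_left: "left_module R H"
proof (rule left_moduleI)
  show "ring R" by (rule ring_axioms)
  show "abelian_group H"
  proof (rule abelian_groupI)
    fix f assume f: "f \<in> carrier H"
    have "(\<ominus> \<one>) \<odot>\<^bsub>H\<^esub> f \<oplus>\<^bsub>H\<^esub> f = \<zero>\<^bsub>H\<^esub>"
    proof (rule H_ext)
      fix u assume u: "u \<in> carrier R"
      have "f (u \<otimes> \<ominus> \<one> \<oplus> u) = f \<zero>" using u by (simp add: r_minus l_neg)
      also have "\<dots> = \<zero>\<^bsub>Q\<^esub>"
        using linear_map_zero[OF centre_left_module[OF regular_left_module] QZ, of f] f by (simp add: H_mem)
      finally show "((\<ominus> \<one>) \<odot>\<^bsub>H\<^esub> f \<oplus>\<^bsub>H\<^esub> f) u = \<zero>\<^bsub>H\<^esub> u"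
        using u by (simp add: H_apply H_D(2)[OF f])
    qed (use f in \<open>simp_all add: H_closed\<close>)
    then show "\<exists>g\<in>carrier H. g \<oplus>\<^bsub>H\<^esub> f = \<zero>\<^bsub>H\<^esub>" using f H_closed(3)[of "\<ominus> \<one>" f] by blast
  qed (auto intro!: H_ext simp: H_closed H_apply H_D Q.M.a_ac)
qed (auto intro!: H_ext simp: H_closed H_apply H_D r_distr m_assoc)

lemma H_right: "left_module (opposite R) (right_part H ract)"
proof (rule left_moduleI)
  show "ring (opposite R)" by (rule opposite_ring)
  interpret H: left_module R H by (rule H_left)
  show "abelian_group (right_part H ract)"
    by (rule abelian_groupI) (auto simp: H.M.a_ac intro!: bexI[of _ "\<ominus>\<^bsub>H\<^esub> _"] H.M.l_neg)
  fix a b f g assume a: "a \<in> carrier (opposite R)" and f: "f \<in> carrier (right_part H ract)"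
  then have aR: "a \<in> carrier R" and fH: "f \<in> carrier H" by simp_all
  show "a \<odot>\<^bsub>right_part H ract\<^esub> f \<in> carrier (right_part H ract)" using aR fH by (simp add: H_closed)
  show "(a \<oplus>\<^bsub>opposite R\<^esub> b) \<odot>\<^bsub>right_part H ract\<^esub> f =
      a \<odot>\<^bsub>right_part H ract\<^esub> f \<oplus>\<^bsub>right_part H ract\<^esub> b \<odot>\<^bsub>right_part H ract\<^esub> f"
    if "b \<in> carrier (opposite R)"
    using that aR fH Q'.smult_l_distr[of a b]
    by (auto intro!: H_ext simp: H_closed H_apply H_D(1))
  show "a \<odot>\<^bsub>right_part H ract\<^esub> (f \<oplus>\<^bsub>right_part H ract\<^esub> g) =
      a \<odot>\<^bsub>right_part H ract\<^esub> f \<oplus>\<^bsub>right_part H ract\<^esub> a \<odot>\<^bsub>right_part H ract\<^esub> g"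
    if "g \<in> carrier (right_part H ract)"
    using that aR fH Q'.smult_r_distr[of a]
    by (auto intro!: H_ext simp: H_closed H_apply H_D(1))
  show "(a \<otimes>\<^bsub>opposite R\<^esub> b) \<odot>\<^bsub>right_part H ract\<^esub> f =
      a \<odot>\<^bsub>right_part H ract\<^esub> (b \<odot>\<^bsub>right_part H ract\<^esub> f)"
    if "b \<in> carrier (opposite R)"
    using that aR fH Q'.smult_assoc[of a b]
    by (auto intro!: H_ext simp: H_closed H_apply H_D(1))
next
  fix f assume "f \<in> carrier (right_part H ract)"
  then have fH: "f \<in> carrier H" by simp
  show "\<one>\<^bsub>opposite R\<^esub> \<odot>\<^bsub>right_part H ract\<^esub> f = f"
    using fH Q'.smult_one by (auto intro!: H_ext simp: H_closed H_apply H_D(1))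
qed

sublocale H: left_module R H by (rule H_left)
sublocale Hr: left_module "opposite R" "right_part H ract" by (rule H_right)

lemma ract_smult: "\<lbrakk>r \<in> carrier R; s \<in> carrier R; f \<in> carrier H\<rbrakk> \<Longrightarrow> ract (r \<odot>\<^bsub>H\<^esub> f) s = r \<odot>\<^bsub>H\<^esub> ract f s"
  by (auto intro!: H_ext simp: H_closed H_apply)

lemma ract_central: "\<lbrakk>z \<in> carrier (centre R); f \<in> carrier H\<rbrakk> \<Longrightarrow> z \<odot>\<^bsub>H\<^esub> f = ract f z"
proof (rule H_ext)
  fix u assume "z \<in> carrier (centre R)" "f \<in> carrier H" "u \<in> carrier R"
  then show "(z \<odot>\<^bsub>H\<^esub> f) u = ract f z u"
    using centre_comm[of z u] by (simp add: H_apply Q_central H_D flip: H_D(3))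
qed (simp_all add: H_closed)

definition gen :: "'m \<Rightarrow> 'a \<Rightarrow> 'a \<Rightarrow> 'a set" where
  "gen m r = (\<lambda>u\<in>carrier R. r \<odot>\<^bsub>Q'\<^esub> \<phi> (u \<odot>\<^bsub>M\<^esub> m))"

lemma \<phi>D:
  "m \<in> carrier M \<Longrightarrow> \<phi> m \<in> carrier Q"
  "\<lbrakk>m \<in> carrier M; m' \<in> carrier M\<rbrakk> \<Longrightarrow> \<phi> (m \<oplus>\<^bsub>M\<^esub> m') = \<phi> m \<oplus>\<^bsub>Q\<^esub> \<phi> m'"
  "\<lbrakk>z \<in> carrier (centre R); m \<in> carrier M\<rbrakk> \<Longrightarrow> \<phi> (z \<odot>\<^bsub>M\<^esub> m) = z \<odot>\<^bsub>Q\<^esub> \<phi> m"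
  using linear_mapD[OF \<phi>] by auto

lemma rQ_closed: "\<lbrakk>r \<in> carrier R; C \<in> carrier Q\<rbrakk> \<Longrightarrow> r \<odot>\<^bsub>Q'\<^esub> C \<in> carrier Q"
  using Q'.smult_closed[of r C] by simp

lemma rQ_add: "\<lbrakk>r \<in> carrier R; C \<in> carrier Q; D \<in> carrier Q\<rbrakk> \<Longrightarrow>
    r \<odot>\<^bsub>Q'\<^esub> (C \<oplus>\<^bsub>Q\<^esub> D) = r \<odot>\<^bsub>Q'\<^esub> C \<oplus>\<^bsub>Q\<^esub> r \<odot>\<^bsub>Q'\<^esub> D"
  using Q'.smult_r_distr[of r C D] by simp

lemma gen_apply: "u \<in> carrier R \<Longrightarrow> gen m r u = r \<odot>\<^bsub>Q'\<^esub> \<phi> (u \<odot>\<^bsub>M\<^esub> m)"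
  by (simp add: gen_def)

lemma gen_closed: "\<lbrakk>m \<in> carrier M; r \<in> carrier R\<rbrakk> \<Longrightarrow> gen m r \<in> carrier H"
proof (rule H_I)
  assume m: "m \<in> carrier M" and r: "r \<in> carrier R"
  show "gen m r \<in> extensional (carrier R)" by (simp add: gen_def)
  fix u assume u: "u \<in> carrier R"
  show "gen m r u \<in> carrier Q" using m r u by (simp add: gen_apply rQ_closed \<phi>D)
  show "gen m r (u \<oplus> v) = gen m r u \<oplus>\<^bsub>Q\<^esub> gen m r v" if "v \<in> carrier R" for v
    using that m r u by (simp add: gen_apply M.smult_l_distr \<phi>D rQ_add)
  show "gen m r (z \<otimes> u) = z \<odot>\<^bsub>Q\<^esub> gen m r u" if "z \<in> carrier (centre R)" for z
    using that m r u by (simp add: gen_apply M.smult_assoc \<phi>D Q_assoc)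
qed

lemma gen_add: "\<lbrakk>m \<in> carrier M; m' \<in> carrier M; r \<in> carrier R\<rbrakk> \<Longrightarrow> gen (m \<oplus>\<^bsub>M\<^esub> m') r = gen m r \<oplus>\<^bsub>H\<^esub> gen m' r"
  by (rule H_ext) (simp_all add: gen_closed H_closed H_apply gen_apply M.smult_r_distr \<phi>D rQ_add)

lemma gen_smult: "\<lbrakk>m \<in> carrier M; s \<in> carrier R; r \<in> carrier R\<rbrakk> \<Longrightarrow> gen (s \<odot>\<^bsub>M\<^esub> m) r = s \<odot>\<^bsub>H\<^esub> gen m r"
  by (rule H_ext) (simp_all add: gen_closed H_closed H_apply gen_apply M.smult_assoc)

lemma gen_ract: "\<lbrakk>m \<in> carrier M; s \<in> carrier R; r \<in> carrier R\<rbrakk> \<Longrightarrow> gen m (r \<otimes> s) = ract (gen m r) s"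
  using Q'.smult_assoc[of s r]
  by (intro H_ext) (simp_all add: gen_closed H_closed H_apply gen_apply \<phi>D)

lemma gen_add_right: "\<lbrakk>m \<in> carrier M; r \<in> carrier R; s \<in> carrier R\<rbrakk> \<Longrightarrow> gen m (r \<oplus> s) = gen m r \<oplus>\<^bsub>H\<^esub> gen m s"
  using Q'.smult_l_distr[of r s]
  by (intro H_ext) (simp_all add: gen_closed H_closed H_apply gen_apply \<phi>D)

lemma gen_zero_right: "m \<in> carrier M \<Longrightarrow> gen m \<zero> = \<zero>\<^bsub>H\<^esub>"
  using Q'.smult_l_null
  by (intro H_ext) (simp_all add: gen_closed H_closed H_apply gen_apply \<phi>D)

lemma gen_linear: "r \<in> carrier R \<Longrightarrow> linear_map R M H (\<lambda>m. gen m r)"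
  by (rule linear_mapI) (simp_all add: gen_closed gen_add gen_smult)

section \<open>The finitely generated central bimodule inside H\<close>

definition "gens = (\<lambda>(m, r). gen m r) ` (carrier M \<times> carrier R)"
definition "B = generated_submodule R H gens"

lemma gens_closed: "gens \<subseteq> carrier H" using gen_closed by (auto simp: gens_def)

lemma B_submodule: "submodule B R H" and gens_B: "gens \<subseteq> B"
  unfolding B_def using generated_submodule[OF H_left gens_closed] by auto

lemma B_least: "\<lbrakk>submodule N R H; gens \<subseteq> N\<rbrakk> \<Longrightarrow> B \<subseteq> N"
  unfolding B_def by (rule generated_submodule_least[OF H_left])

lemma gen_B: "\<lbrakk>m \<in> carrier M; r \<in> carrier R\<rbrakk> \<Longrightarrow> gen m r \<in> B"
  using gens_B by (auto simp: gens_def)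

lemma B_H: "f \<in> B \<Longrightarrow> f \<in> carrier H" using H.submoduleD(7)[OF B_submodule] .

lemma ract_add: "\<lbrakk>f \<in> carrier H; g \<in> carrier H; r \<in> carrier R\<rbrakk> \<Longrightarrow> ract (f \<oplus>\<^bsub>H\<^esub> g) r = ract f r \<oplus>\<^bsub>H\<^esub> ract g r"
  using Hr.smult_r_distr[of r f g] by simp

lemma ract_zero: "r \<in> carrier R \<Longrightarrow> ract \<zero>\<^bsub>H\<^esub> r = \<zero>\<^bsub>H\<^esub>"
  using Hr.smult_r_null[of r] by simp

text \<open>\<open>B\<close> is generated on the left; the elements whose right multiples stay in
  \<open>B\<close> form a left submodule containing the generators, because the two actions
  commute.\<close>

lemma B_ract: "\<lbrakk>f \<in> B; r \<in> carrier R\<rbrakk> \<Longrightarrow> ract f r \<in> B"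
proof -
  note b = H.submoduleD[OF B_submodule]
  have "submodule {f \<in> carrier H. \<forall>r\<in>carrier R. ract f r \<in> B} R H"
    by (rule H.submoduleI) (use b in \<open>auto simp: H_closed ract_add ract_zero ract_smult\<close>)
  moreover have "gens \<subseteq> {f \<in> carrier H. \<forall>r\<in>carrier R. ract f r \<in> B}"
    by (auto simp: gens_def gen_closed gen_B simp flip: gen_ract)
  ultimately show "\<lbrakk>f \<in> B; r \<in> carrier R\<rbrakk> \<Longrightarrow> ract f r \<in> B" using B_least by blast
qed

lemma B_submodule_right: "submodule B (opposite R) (right_part H ract)"
  by (rule Hr.submoduleI) (use H.submoduleD[OF B_submodule] B_ract in auto)

abbreviation "BM \<equiv> H\<lparr>carrier := B\<rparr>"

lemma right_part_BM: "right_part BM ract = (right_part H ract)\<lparr>carrier := B\<rparr>"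
  by (simp add: right_part_def)

lemma BM_left: "left_module R BM"
  by (rule H.submodule_left_module[OF B_submodule])

lemma BM_right: "left_module (opposite R) (right_part BM ract)"
  unfolding right_part_BM by (rule Hr.submodule_left_module[OF B_submodule_right])

text \<open>\<open>m\<close> may range over generators of \<open>M\<close> over \<open>R\<close>,
  and \<open>r\<close> over generators of \<open>R\<close> over the centre, since central scalars
  can be moved from \<open>r\<close> to the left action.\<close>

lemma BM_fg_left: "finitely_generated R BM"
proof -
  obtain T where T: "finite T" "T \<subseteq> carrier R"
    "\<And>K. submodule K (centre R) (regular_module R) \<and> T \<subseteq> K \<Longrightarrow> K = carrier R"
    using finite_over_centre by (auto simp: finitely_generated_def)
  obtain S where S: "finite S" "S \<subseteq> carrier M" "\<And>K. submodule K R M \<and> S \<subseteq> K \<Longrightarrow> K = carrier M"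
    using fg by (auto simp: finitely_generated_def fg_module_def)
  interpret RZ: left_module "centre R" "regular_module R" by (rule centre_left_module[OF regular_left_module])
  let ?S = "(\<lambda>(m, r). gen m r) ` (S \<times> T)"
  have "N = B" if N: "submodule N R BM" "?S \<subseteq> N" for N
  proof -
    have NB: "N \<subseteq> B" using left_module.submoduleD(1)[OF BM_left N(1)] by simp
    then have NH: "submodule N R H" using H.submodule_restrict[OF B_submodule] N(1) by blast
    note n = H.submoduleD[OF NH]
    have mT: "gen m r \<in> N" if m: "m \<in> carrier M" and r: "r \<in> T" for m r
    proof -
      have rR: "r \<in> carrier R" using r T by auto
      have "{m \<in> carrier M. gen m r \<in> N} = carrier M"
        using submodule_vimage[OF M.left_module_axioms H_left gen_linear[OF rR] NH] S(2) N(2) r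
        by (intro S(3)) auto
      then show ?thesis using m by blast
    qed
    have "gen m r \<in> N" if m: "m \<in> carrier M" and r: "r \<in> carrier R" for m r
    proof -
      have "submodule {r \<in> carrier R. gen m r \<in> N} (centre R) (regular_module R)"
      proof (rule RZ.submoduleI)
        fix z x assume zx: "z \<in> carrier (centre R)" "x \<in> {r \<in> carrier R. gen m r \<in> N}"
        have "gen m (z \<otimes> x) = z \<odot>\<^bsub>H\<^esub> gen m x"
          using zx m centre_comm[OF zx(1), of x] by (simp add: gen_ract ract_central gen_closed)
        then show "z \<odot>\<^bsub>regular_module R\<^esub> x \<in> {r \<in> carrier R. gen m r \<in> N}" using zx n(4)[of z] by simp
      qed (use n m in \<open>auto simp: gen_zero_right gen_add_right\<close>)
      then have "{r \<in> carrier R. gen m r \<in> N} = carrier R" using mT[OF m] T(2) by (intro T(3)) auto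
      then show ?thesis using r by blast
    qed
    then have "B \<subseteq> N" by (intro B_least[OF NH]) (auto simp: gens_def)
    then show ?thesis using NB by blast
  qed
  moreover have "finite ?S" "?S \<subseteq> B"
    using S(1) T(1) subsetD[OF S(2)] subsetD[OF T(2)] gen_B by auto
  ultimately show ?thesis unfolding finitely_generated_def by (intro exI[of _ ?S]) auto
qed

text \<open>On the right \<open>r\<close> can be taken to be \<open>\<one>\<close>. The right action
  reaches \<open>m\<close> through central scalars, so \<open>m\<close> ranges over generators of
  \<open>M\<close> over the centre.\<close>

lemma BM_fg_right: "finitely_generated (opposite R) (right_part BM ract)"
proof -
  have "finitely_generated (centre R) M"
    using centre_finitely_generated[OF finite_over_centre M.left_module_axioms] fg
    by (simp add: fg_module_def)
  then obtain S where S: "finite S" "S \<subseteq> carrier M"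
    "\<And>K. submodule K (centre R) M \<and> S \<subseteq> K \<Longrightarrow> K = carrier M"
    by (auto simp: finitely_generated_def)
  interpret MZ: left_module "centre R" M by (rule centre_left_module[OF M.left_module_axioms])
  let ?S = "(\<lambda>m. gen m \<one>) ` S"
  have "N = B" if N: "submodule N (opposite R) (right_part BM ract)" "?S \<subseteq> N" for N
  proof -
    have NB: "N \<subseteq> B" using left_module.submoduleD(1)[OF BM_right N(1)] by simp
    then have NH: "submodule N (opposite R) (right_part H ract)"
      using Hr.submodule_restrict[OF B_submodule_right] N(1) unfolding right_part_BM by blast
    note n = Hr.submoduleD[OF NH, simplified]
    have m0: "gen \<zero>\<^bsub>M\<^esub> \<one> = \<zero>\<^bsub>H\<^esub>" using linear_map_zero[OF M.left_module_axioms H_left gen_linear[OF one_closed]] .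
    have "submodule {m \<in> carrier M. gen m \<one> \<in> N} (centre R) M"
    proof (rule MZ.submoduleI)
      fix z m assume zm: "z \<in> carrier (centre R)" "m \<in> {m \<in> carrier M. gen m \<one> \<in> N}"
      then show "z \<odot>\<^bsub>M\<^esub> m \<in> {m \<in> carrier M. gen m \<one> \<in> N}"
        using n(4)[of z] by (simp add: gen_smult ract_central gen_closed)
    qed (use n m0 in \<open>auto simp: gen_add\<close>)
    then have "{m \<in> carrier M. gen m \<one> \<in> N} = carrier M" using S(2) N(2) by (intro S(3)) auto
    then have g1: "gen m \<one> \<in> N" if "m \<in> carrier M" for m using that by blast
    have g: "gen m r \<in> N" if "m \<in> carrier M" "r \<in> carrier R" for m r
      using gen_ract[OF that(1,2) one_closed] n(4)[OF that(2) g1[OF that(1)]] that by simp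
    \<comment> \<open>\<open>N\<close> is a right submodule while \<open>B\<close> is generated on
      the left; the elements with all left multiples in \<open>N\<close> form a left submodule, to
      which the minimality of \<open>B\<close> applies.\<close>
    have "submodule {f \<in> carrier H. \<forall>r\<in>carrier R. r \<odot>\<^bsub>H\<^esub> f \<in> N} R H"
      by (rule H.submoduleI) (use n in \<open>auto simp: H.smult_r_distr simp flip: H.smult_assoc\<close>)
    moreover have "gens \<subseteq> {f \<in> carrier H. \<forall>r\<in>carrier R. r \<odot>\<^bsub>H\<^esub> f \<in> N}"
      by (auto simp: gens_def gen_closed g simp flip: gen_smult)
    ultimately have "B \<subseteq> {f \<in> carrier H. \<forall>r\<in>carrier R. r \<odot>\<^bsub>H\<^esub> f \<in> N}" by (rule B_least)
    then have "\<one> \<odot>\<^bsub>H\<^esub> f \<in> N" if "f \<in> B" for f using that by blast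
    then have "B \<subseteq> N" using B_H by auto
    then show ?thesis using NB by blast
  qed
  moreover have "finite ?S" "?S \<subseteq> B" using S(1) subsetD[OF S(2)] gen_B by auto
  ultimately show ?thesis unfolding finitely_generated_def by (intro exI[of _ ?S]) auto
qed

lemma BM_right_map:
  assumes "m \<in> carrier M" "\<phi> m \<noteq> \<zero>\<^bsub>Q\<^esub>"
  shows "has_nonzero_map (opposite R) (right_part BM ract) Q'"
proof -
  have "linear_map (opposite R) (right_part BM ract) Q' (\<lambda>f. f \<one>)"
    by (rule linear_mapI) (simp_all add: B_H H_D H_apply)
  moreover have "gen m \<one> \<one> = \<phi> m" using assms Q'.smult_one[of "\<phi> m"] by (simp add: gen_apply \<phi>D)
  ultimately show ?thesis
    unfolding has_nonzero_map_def using gen_B[OF assms(1) one_closed] assms(2)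
    by (intro exI[of _ "\<lambda>f. f \<one>"]) auto
qed

text \<open>The images of the maps that send \<open>m\<close> to \<open>gen m r\<close> together
  generate \<open>B\<close> on the left, so a map on \<open>B\<close> whose composites with all of
  them vanish is zero.\<close>

lemma BM_left_map:
  assumes "has_nonzero_map R BM N" and N: "left_module R N"
  shows "has_nonzero_map R M N"
proof (rule ccontr)
  assume no: "\<not> has_nonzero_map R M N"
  obtain h f where h: "linear_map R BM N h" "f \<in> B" "h f \<noteq> \<zero>\<^bsub>N\<^esub>"
    using assms(1) by (auto simp: has_nonzero_map_def)
  have "h (gen m r) = \<zero>\<^bsub>N\<^esub>" if "m \<in> carrier M" "r \<in> carrier R" for m r
  proof -
    have "linear_map R M BM (\<lambda>m. gen m r)"
      using gen_linear[OF that(2)] gen_B that(2) by (simp add: linear_map_def)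
    from linear_map_comp[OF this h(1)] show ?thesis using no that by (auto simp: has_nonzero_map_def)
  qed
  then have "gens \<subseteq> {f \<in> carrier BM. h f = \<zero>\<^bsub>N\<^esub>}" using gen_B by (auto simp: gens_def)
  moreover have sub: "submodule {f \<in> carrier BM. h f = \<zero>\<^bsub>N\<^esub>} R BM"
    by (rule submodule_kernel[OF BM_left N h(1)])
  then have "submodule {f \<in> carrier BM. h f = \<zero>\<^bsub>N\<^esub>} R H"
    using H.submodule_restrict[OF B_submodule, of "{f \<in> carrier BM. h f = \<zero>\<^bsub>N\<^esub>}"] by simp
  ultimately have "B \<subseteq> {f \<in> carrier BM. h f = \<zero>\<^bsub>N\<^esub>}" by (intro B_least)
  then show False using h(2,3) by blast
qed

lemma BM_annihilator:
  assumes z: "z \<in> central_annihilator R M" and f: "f \<in> B"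
  shows "z \<odot>\<^bsub>H\<^esub> f = \<zero>\<^bsub>H\<^esub>" "ract f z = \<zero>\<^bsub>H\<^esub>"
proof -
  have zZ: "z \<in> carrier (centre R)" using z by (simp add: central_annihilator_def)
  have "linear_map R H H (\<lambda>f. z \<odot>\<^bsub>H\<^esub> f)"
    by (rule linear_map_smult_fun[OF H_left H_left, of "\<lambda>f. f"])
       (use zZ centre_comm in \<open>auto intro: linear_mapI\<close>)
  from submodule_kernel[OF H_left H_left this]
  have "submodule {f \<in> carrier H. z \<odot>\<^bsub>H\<^esub> f = \<zero>\<^bsub>H\<^esub>} R H" .
  moreover have "gens \<subseteq> {f \<in> carrier H. z \<odot>\<^bsub>H\<^esub> f = \<zero>\<^bsub>H\<^esub>}"
  proof -
    have "z \<odot>\<^bsub>H\<^esub> gen m r = \<zero>\<^bsub>H\<^esub>" if "m \<in> carrier M" "r \<in> carrier R" for m r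
      using that z zZ gen_smult[of m z r] linear_map_zero[OF M.left_module_axioms H_left gen_linear[OF that(2)]]
      by (simp add: central_annihilator_def)
    then show ?thesis by (auto simp: gens_def gen_closed)
  qed
  ultimately show "z \<odot>\<^bsub>H\<^esub> f = \<zero>\<^bsub>H\<^esub>" using B_least f by blast
  then show "ract f z = \<zero>\<^bsub>H\<^esub>" using ract_central[OF zZ B_H[OF f]] by simp
qed

text \<open>Codes a set-valued function by pairs written as two-element lists, which yields the
  carrier type \<open>'a list set\<close> over which grade symmetry quantifies.\<close>

definition graph :: "('a \<Rightarrow> 'a set) \<Rightarrow> 'a list set" where
  "graph f = {[u, y] |u y. u \<in> carrier R \<and> y \<in> f u}"

lemma graph_inj: "inj_on graph (carrier H)"
proof
  fix f g assume fg: "f \<in> carrier H" "g \<in> carrier H" "graph f = graph g"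
  show "f = g"
  proof (rule H_ext[OF fg(1,2)])
    fix u assume u: "u \<in> carrier R"
    have "y \<in> h u \<longleftrightarrow> [u, y] \<in> graph h" for h y using u by (auto simp: graph_def)
    then show "f u = g u" using fg(3) by blast
  qed
qed

lemma graph_inj_B: "inj_on graph B"
  using graph_inj B_H by (auto intro: inj_on_subset)

theorem has_nonzero_map_of_grade_symmetric:
  assumes sym: "grade_symmetric R"
    and xs: "regular_sequence R xs" "set xs \<subseteq> central_annihilator R M" "J = span_list R xs"
    and m: "m \<in> carrier M" "\<phi> m \<noteq> \<zero>\<^bsub>Q\<^esub>"
  shows "has_nonzero_map R M Q"
proof -
  interpret op: centrally_finite_ring "opposite R" by (rule opposite_centrally_finite)
  define N where "N = transport_module graph BM"
  define ra where "ra x r = graph (ract (inv_into B graph x) r)" for x r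
  have inj: "inj_on graph (carrier BM)" using graph_inj_B by simp
  have inj': "inj_on graph (carrier (right_part BM ract))" using graph_inj_B by simp
  have Nr: "right_part N ra = transport_module graph (right_part BM ract)"
    by (simp add: N_def ra_def transport_module_def right_part_def)
  note simps = transport_simps[OF BM_left inj, folded N_def, simplified]
  have inv: "inv_into B graph (graph f) = f" if "f \<in> B" for f using graph_inj_B that by simp
  have ra: "ra (graph f) r = graph (ract f r)" if "f \<in> B" for f r using inv[OF that] by (simp add: ra_def)
  have NL: "left_module R N" unfolding N_def by (rule transport_left_module[OF BM_left inj])
  have NR: "left_module (opposite R) (right_part N ra)"
    unfolding Nr by (rule transport_left_module[OF BM_right inj'])
  have fgL: "finitely_generated R N"
    unfolding N_def by (rule transport_finitely_generated[OF BM_left inj BM_fg_left])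
  have fgR: "finitely_generated (opposite R) (right_part N ra)"
    unfolding Nr by (rule transport_finitely_generated[OF BM_right inj' BM_fg_right])
  have "central_bimodule R N ra"
    unfolding central_bimodule_def
  proof (intro conjI ballI)
    fix r s x assume rs: "r \<in> carrier R" "s \<in> carrier R" "x \<in> carrier N"
    then obtain f where f: "f \<in> B" "x = graph f" by (auto simp: simps)
    show "ra (r \<odot>\<^bsub>N\<^esub> x) s = r \<odot>\<^bsub>N\<^esub> ra x s"
      using rs f H.submoduleD(4)[OF B_submodule rs(1) f(1)] B_ract[OF f(1) rs(2)] B_H[OF f(1)]
      by (simp add: simps ra ract_smult)
  next
    fix z x assume zx: "z \<in> carrier (centre R)" "x \<in> carrier N"
    then obtain f where f: "f \<in> B" "x = graph f" by (auto simp: simps)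
    show "z \<odot>\<^bsub>N\<^esub> x = ra x z" using zx f B_H[OF f(1)] by (simp add: simps ra ract_central)
  qed (rule NL NR)+
  then have eq: "grade R N = grade (opposite R) (right_part N ra)"
    using sym fgL fgR unfolding grade_symmetric_def by blast
  have annL: "set xs \<subseteq> central_annihilator R N"
    using xs(2) BM_annihilator(1) by (auto simp: central_annihilator_def simps subset_iff)
  have annR: "set xs \<subseteq> central_annihilator (opposite R) (right_part N ra)"
    using xs(2) BM_annihilator(2) by (auto simp: central_annihilator_def simps subset_iff ra)
  have sp: "span_list (opposite R) xs = J"
    using span_list_opposite[OF regular_sequence_centre[OF xs(1)]] xs(3) by simp
  have "has_nonzero_map (opposite R) (right_part N ra) Q'"
    unfolding Nr
    by (rule has_nonzero_map_comp[OF transport_inv_linear[OF BM_right inj'] _ BM_right_map[OF m]])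
       (use inj' in \<open>simp add: transport_simps[OF BM_right inj'] image_image\<close>)
  \<comment> \<open>The entries of \<open>xs\<close> annihilate the bimodule from both sides and
    remain a regular sequence over the opposite ring, so the same sequence measures both
    grades.\<close>
  then have "grade (opposite R) (right_part N ra) = enat (length xs)"
    using op.grade_regular_sequence(2)[of "right_part N ra" xs] NR fgR annR xs(1)
    by (simp add: fg_module_def regular_sequence_opposite sp)
  then have "has_nonzero_map R N Q"
    using grade_regular_sequence(2)[of N xs] NL fgL annL xs(1,3) eq by (simp add: fg_module_def)
  then have "has_nonzero_map R BM Q"
    by (rule has_nonzero_map_comp[OF transport_linear[OF BM_left inj, folded N_def], rotated]) (simp add: simps)
  then show ?thesis by (rule BM_left_map[OF _ Q])
qed

end

section \<open>The grade as a dimension function\<close>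

lemma linear_map_factor:
  assumes M: "left_module R M" and L: "left_module R L" and N: "submodule N R M"
    and h: "linear_map R M L h" "\<And>x. x \<in> N \<Longrightarrow> h x = \<zero>\<^bsub>L\<^esub>"
  obtains h' where "linear_map R (quotient_module M N) L h'" "\<And>x. x \<in> carrier M \<Longrightarrow> h' (N +>\<^bsub>M\<^esub> x) = h x"
proof -
  interpret M: left_module R M by (rule M)
  interpret L: left_module R L by (rule L)
  define h' where "h' C = h (SOME x. x \<in> carrier M \<and> C = N +>\<^bsub>M\<^esub> x)" for C
  have h': "h' (N +>\<^bsub>M\<^esub> x) = h x" if x: "x \<in> carrier M" for x
  proof -
    define y where "y = (SOME y. y \<in> carrier M \<and> N +>\<^bsub>M\<^esub> x = N +>\<^bsub>M\<^esub> y)"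
    have y: "y \<in> carrier M \<and> N +>\<^bsub>M\<^esub> x = N +>\<^bsub>M\<^esub> y"
      unfolding y_def by (rule someI_ex) (use x in blast)
    then have "h (x \<ominus>\<^bsub>M\<^esub> y) = \<zero>\<^bsub>L\<^esub>" using h(2) x coset_eq_iff[OF M N, of x y] by simp
    then have "h x = h y"
      using x y linear_map_diff[OF M L h(1), of x y] linear_mapD(1)[OF h(1)] by simp
    then show ?thesis by (simp add: h'_def y_def)
  qed
  have "linear_map R (quotient_module M N) L h'"
    by (rule linear_mapI)
       (auto simp: quotient_simps[OF M N] coset_add[OF M N] quotient_smult[OF M N] h' linear_mapD[OF h(1)])
  then show thesis using h' that by blast
qed

lemma nonzero_module_iff:
  assumes "left_module R M"
  shows "carrier M \<noteq> {\<zero>\<^bsub>M\<^esub>} \<longleftrightarrow> (\<exists>x\<in>carrier M. x \<noteq> \<zero>\<^bsub>M\<^esub>)"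
proof -
  interpret left_module R M by fact
  show ?thesis using M.zero_closed by blast
qed

context centrally_finite_ring
begin

text \<open>Choose \<open>N\<close> maximal among the \<open>Z(R)\<close>-submodules such that \<open>M/N\<close> does not vanish at the prime
  \<open>\<aa>\<close> and \<open>v \<notin> N\<close>. Then \<open>v\<close> is torsion free modulo \<open>N\<close> and \<open>s M \<subseteq> N + Z(R) v\<close> for some \<open>s \<notin> \<aa>\<close>;
  the map sends \<open>m\<close> with \<open>s m \<equiv> z v\<close> to \<open>z r + J\<close>.\<close>

lemma exists_central_linear_map:
  fixes M :: "('a, 'm) module"
  assumes fg: "fg_module R M" and J: "ideal J R" and r: "r \<in> carrier R"
    and prime: "primeideal (central_colon R J r) (centre R)"
    and ann: "central_annihilator R M \<subseteq> central_colon R J r"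
  obtains \<phi> m where "linear_map (centre R) M (cyclic_quotient R J) \<phi>" "m \<in> carrier M"
    "\<phi> m \<noteq> \<zero>\<^bsub>cyclic_quotient R J\<^esub>"
proof -
  have M: "left_module R M" using fg by (simp add: fg_module_def)
  interpret M0: left_module R M by (rule M)
  interpret M: comm_left_module "centre R" M by (rule centre_comm_left_module[OF M])
  interpret J: ideal J R by (rule J)
  interpret RR: left_module R "regular_module R" by (rule regular_left_module)
  let ?Z = "carrier (centre R)" and ?a = "central_colon R J r" and ?Q = "cyclic_quotient R J"
  interpret a: primeideal ?a "centre R" by (rule prime)
  have Jsub: "submodule J R (regular_module R)" by (rule J.submodule_regular)
  let ?A = "{N. submodule N (centre R) M \<and> (\<forall>s\<in>?Z - ?a. \<exists>m\<in>carrier M. s \<odot>\<^bsub>M\<^esub> m \<notin> N)}"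
  have sub: "submodule N (centre R) M \<and> N \<subseteq> carrier M" if "N \<in> ?A" for N
    using that M.submoduleD(1)[of N] by simp
  have mem: "{\<zero>\<^bsub>M\<^esub>} \<in> ?A"
    using ann M.zero_submodule by (auto simp: central_annihilator_def)
  obtain N where N: "N \<in> ?A" "{\<zero>\<^bsub>M\<^esub>} \<subseteq> N" "\<And>N'. \<lbrakk>N' \<in> ?A; N \<subseteq> N'\<rbrakk> \<Longrightarrow> N' = N"
    by (rule noetherian_in_maximal[OF fg_noetherian_over_centre[OF fg] mem sub]) (assumption, rule that)
  have Ns: "submodule N (centre R) M" and Nbig: "\<And>s. s \<in> ?Z - ?a \<Longrightarrow> \<exists>m\<in>carrier M. s \<odot>\<^bsub>M\<^esub> m \<notin> N"
    using N(1) by auto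
  note n = M.submoduleD[OF Ns]
  have one: "\<one> \<in> ?Z - ?a" using a.prime_one M.R.one_closed by simp
  obtain m where "m \<in> carrier M" "\<one> \<odot>\<^bsub>M\<^esub> m \<notin> N" using Nbig[OF one] by blast
  then obtain v where v: "v \<in> carrier M" "v \<notin> N" using M0.smult_closed[OF one_closed] by blast
  let ?C = "(\<lambda>z. z \<odot>\<^bsub>M\<^esub> v) ` ?Z"
  have C: "submodule ?C (centre R) M" by (rule M.cyclic_submodule[OF v(1)])
  have NC: "N \<subseteq> N <+>\<^bsub>M\<^esub> ?C" "?C \<subseteq> N <+>\<^bsub>M\<^esub> ?C" using M.submodule_le_set_add[OF Ns C] .
  have "v \<in> ?C" using v(1) M.R.one_closed by (intro image_eqI[of _ _ \<one>]) (auto simp: M0.smult_one)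
  then have "N <+>\<^bsub>M\<^esub> ?C \<noteq> N" using NC v(2) by blast
  then have "N <+>\<^bsub>M\<^esub> ?C \<notin> ?A" using N(3)[OF _ NC(1)] by blast
  then obtain s where s: "s \<in> ?Z" "s \<notin> ?a" "\<And>m. m \<in> carrier M \<Longrightarrow> s \<odot>\<^bsub>M\<^esub> m \<in> N <+>\<^bsub>M\<^esub> ?C"
    using M.submodule_set_add[OF Ns C] by blast
  \<comment> \<open>Otherwise z s, still outside the prime, would map all of \<open>M\<close> into
    \<open>N\<close>, against the choice of \<open>N\<close>.\<close>
  have torsion_free: "z \<in> ?a" if z: "z \<in> ?Z" "z \<odot>\<^bsub>M\<^esub> v \<in> N" for z
  proof (rule ccontr)
    assume za: "z \<notin> ?a"
    have zs: "z \<otimes>\<^bsub>centre R\<^esub> s \<in> ?Z - ?a"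
      using a.prime_mult_notin[OF z(1) s(1) za s(2)] M.R.m_closed[OF z(1) s(1)] by simp
    have "(z \<otimes>\<^bsub>centre R\<^esub> s) \<odot>\<^bsub>M\<^esub> m \<in> N" if m: "m \<in> carrier M" for m
    proof -
      obtain k w where kw: "k \<in> N" "w \<in> ?Z" "s \<odot>\<^bsub>M\<^esub> m = k \<oplus>\<^bsub>M\<^esub> w \<odot>\<^bsub>M\<^esub> v"
        using s(3)[OF m] unfolding set_add_def' by blast
      have "(z \<otimes>\<^bsub>centre R\<^esub> s) \<odot>\<^bsub>M\<^esub> m = z \<odot>\<^bsub>M\<^esub> k \<oplus>\<^bsub>M\<^esub> z \<odot>\<^bsub>M\<^esub> (w \<odot>\<^bsub>M\<^esub> v)"
        using M.smult_assoc[OF z(1) s(1) m] kw n(7) z(1) v(1) by (simp add: M.smult_r_distr)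
      also have "z \<odot>\<^bsub>M\<^esub> (w \<odot>\<^bsub>M\<^esub> v) = w \<odot>\<^bsub>M\<^esub> (z \<odot>\<^bsub>M\<^esub> v)"
        using M.smult_assoc[OF z(1) kw(2) v(1)] M.smult_assoc[OF kw(2) z(1) v(1)] M.m_comm[OF z(1) kw(2)] by simp
      finally show ?thesis using n(3)[OF n(4)[OF z(1) kw(1)] n(4)[OF kw(2) z(2)]] by simp
    qed
    then show False using Nbig[OF zs] by blast
  qed
  \<comment> \<open>The scalar \<open>z\<close> is determined by \<open>m\<close> modulo the colon
    ideal, which takes \<open>r\<close> into \<open>J\<close>; this makes z r + J well
    defined.\<close>
  define rel where "rel m z \<longleftrightarrow> z \<in> ?Z \<and> s \<odot>\<^bsub>M\<^esub> m \<ominus>\<^bsub>M\<^esub> z \<odot>\<^bsub>M\<^esub> v \<in> N" for m z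
  have rel_ex: "\<exists>z. rel m z" if m: "m \<in> carrier M" for m
  proof -
    obtain k w where kw: "k \<in> N" "w \<in> ?Z" "s \<odot>\<^bsub>M\<^esub> m = k \<oplus>\<^bsub>M\<^esub> w \<odot>\<^bsub>M\<^esub> v"
      using s(3)[OF m] unfolding set_add_def' by blast
    then have "s \<odot>\<^bsub>M\<^esub> m \<ominus>\<^bsub>M\<^esub> w \<odot>\<^bsub>M\<^esub> v = k"
      using n(7) v(1) s(1) m by (subst M0.M.diff_eq_iff) auto
    then show ?thesis using kw(1,2) by (auto simp: rel_def)
  qed
  have colonD: "x \<otimes> r \<in> J" if "x \<in> ?a" for x using that unfolding module_colon_def regular_simps by blast
  have rel_unique: "J +>\<^bsub>R\<^esub> (z \<otimes> r) = J +>\<^bsub>R\<^esub> (z' \<otimes> r)"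
    if m: "m \<in> carrier M" and zz: "rel m z" "rel m z'" for m z z'
  proof -
    have zZ: "z \<in> ?Z" "z' \<in> ?Z" using zz by (auto simp: rel_def)
    have "(z \<ominus>\<^bsub>centre R\<^esub> z') \<odot>\<^bsub>M\<^esub> v = (s \<odot>\<^bsub>M\<^esub> m \<ominus>\<^bsub>M\<^esub> z' \<odot>\<^bsub>M\<^esub> v) \<ominus>\<^bsub>M\<^esub> (s \<odot>\<^bsub>M\<^esub> m \<ominus>\<^bsub>M\<^esub> z \<odot>\<^bsub>M\<^esub> v)"
      using zZ v(1) s(1) m by (simp add: M.smult_l_diff M0.M.abel_simps)
    also have "\<dots> \<in> N" using zz n(6) unfolding rel_def by blast
    finally have "z \<ominus>\<^bsub>centre R\<^esub> z' \<in> ?a" by (rule torsion_free[OF M.R.minus_closed[OF zZ]])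
    then have "(z \<ominus>\<^bsub>centre R\<^esub> z') \<otimes> r \<in> J" by (rule colonD)
    \<comment> \<open>Negatives are defined relative to the carrier, so subtraction in the centre
      has to be identified with subtraction in \<open>R\<close>.\<close>
    moreover have "z \<ominus>\<^bsub>centre R\<^esub> z' = z \<ominus> z'"
    proof -
      have "z = (z \<ominus>\<^bsub>centre R\<^esub> z') \<oplus> z'"
        using M.R.diff_eq_iff[of z z' "z \<ominus>\<^bsub>centre R\<^esub> z'"] zZ by simp
      then show ?thesis using zZ M.R.minus_closed[OF zZ] by (metis centre_closed diff_eq_iff)
    qed
    ultimately have "z \<otimes> r \<ominus> z' \<otimes> r \<in> J" using zZ r by (simp add: minus_eq l_distr l_minus)
    then show ?thesis using coset_eq_iff[OF regular_left_module Jsub, of "z \<otimes> r" "z' \<otimes> r"] zZ r by simp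
  qed
  define \<phi> where "\<phi> m = J +>\<^bsub>R\<^esub> ((SOME z. rel m z) \<otimes> r)" for m
  have \<phi>: "\<phi> m = J +>\<^bsub>R\<^esub> (z \<otimes> r)" if "m \<in> carrier M" "rel m z" for m z
    unfolding \<phi>_def by (rule rel_unique[OF that(1) someI that(2)]) (rule that)
  have "linear_map (centre R) M ?Q \<phi>"
  proof (rule linear_mapI)
    fix m assume m: "m \<in> carrier M"
    obtain z where z: "rel m z" using rel_ex[OF m] by blast
    then have zZ: "z \<in> ?Z" by (simp add: rel_def)
    show "\<phi> m \<in> carrier ?Q"
      using \<phi>[OF m z] zZ r by (simp add: quotient_simps[OF regular_left_module Jsub])
    fix m' assume m': "m' \<in> carrier M"
    obtain z' where z': "rel m' z'" using rel_ex[OF m'] by blast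
    then have z'Z: "z' \<in> ?Z" by (simp add: rel_def)
    have "s \<odot>\<^bsub>M\<^esub> (m \<oplus>\<^bsub>M\<^esub> m') \<ominus>\<^bsub>M\<^esub> (z \<oplus>\<^bsub>centre R\<^esub> z') \<odot>\<^bsub>M\<^esub> v =
        (s \<odot>\<^bsub>M\<^esub> m \<ominus>\<^bsub>M\<^esub> z \<odot>\<^bsub>M\<^esub> v) \<oplus>\<^bsub>M\<^esub> (s \<odot>\<^bsub>M\<^esub> m' \<ominus>\<^bsub>M\<^esub> z' \<odot>\<^bsub>M\<^esub> v)"
      using m m' s(1) zZ z'Z v(1)
      by (simp del: centre_simps add: M.smult_r_distr M.smult_l_distr M0.M.abel_simps)
    then have "rel (m \<oplus>\<^bsub>M\<^esub> m') (z \<oplus>\<^bsub>centre R\<^esub> z')"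
      using z z' n(3) M.R.a_closed[OF zZ z'Z] by (simp del: centre_simps add: rel_def)
    then have "\<phi> (m \<oplus>\<^bsub>M\<^esub> m') = J +>\<^bsub>R\<^esub> ((z \<oplus> z') \<otimes> r)" using \<phi> m m' by simp
    then show "\<phi> (m \<oplus>\<^bsub>M\<^esub> m') = \<phi> m \<oplus>\<^bsub>?Q\<^esub> \<phi> m'"
      using \<phi>[OF m z] \<phi>[OF m' z'] zZ z'Z r coset_add[OF regular_left_module Jsub, of "z \<otimes> r" "z' \<otimes> r"]
      by (simp add: l_distr quotient_simps[OF regular_left_module Jsub])
  next
    fix w m assume w: "w \<in> ?Z" and m: "m \<in> carrier M"
    obtain z where z: "rel m z" using rel_ex[OF m] by blast
    then have zZ: "z \<in> ?Z" by (simp add: rel_def)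
    have "s \<odot>\<^bsub>M\<^esub> (w \<odot>\<^bsub>M\<^esub> m) = w \<odot>\<^bsub>M\<^esub> (s \<odot>\<^bsub>M\<^esub> m)"
      using M.smult_assoc[OF w s(1) m] M.smult_assoc[OF s(1) w m] M.m_comm[OF w s(1)] by simp
    then have "s \<odot>\<^bsub>M\<^esub> (w \<odot>\<^bsub>M\<^esub> m) \<ominus>\<^bsub>M\<^esub> (w \<otimes>\<^bsub>centre R\<^esub> z) \<odot>\<^bsub>M\<^esub> v = w \<odot>\<^bsub>M\<^esub> (s \<odot>\<^bsub>M\<^esub> m \<ominus>\<^bsub>M\<^esub> z \<odot>\<^bsub>M\<^esub> v)"
      using m w s(1) zZ v(1) by (simp del: centre_simps add: M.smult_r_diff M.smult_assoc)
    then have "rel (w \<odot>\<^bsub>M\<^esub> m) (w \<otimes>\<^bsub>centre R\<^esub> z)"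
      using z w n(4) M.R.m_closed[OF w zZ] by (simp del: centre_simps add: rel_def)
    then have "\<phi> (w \<odot>\<^bsub>M\<^esub> m) = J +>\<^bsub>R\<^esub> ((w \<otimes> z) \<otimes> r)" using \<phi> m w by simp
    then show "\<phi> (w \<odot>\<^bsub>M\<^esub> m) = w \<odot>\<^bsub>?Q\<^esub> \<phi> m"
      using \<phi>[OF m z] zZ w r quotient_smult[OF regular_left_module Jsub, of w "z \<otimes> r"] by (simp add: m_assoc)
  qed
  moreover have "\<phi> v \<noteq> \<zero>\<^bsub>?Q\<^esub>"
  proof -
    have "s \<odot>\<^bsub>M\<^esub> v \<ominus>\<^bsub>M\<^esub> s \<odot>\<^bsub>M\<^esub> v = \<zero>\<^bsub>M\<^esub>"
      using M.smult_closed[OF s(1) v(1)] by (simp add: M0.M.minus_eq M0.M.r_neg)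
    then have "rel v s" using s(1) n(2) by (simp add: rel_def)
    then have "\<phi> v = J +>\<^bsub>R\<^esub> (s \<otimes> r)" using \<phi> v(1) by simp
    moreover have "s \<otimes> r \<notin> J" using s(1,2) unfolding module_colon_def regular_simps by blast
    ultimately show ?thesis
      using coset_eq_zero_iff[OF regular_left_module Jsub, of "s \<otimes> r"] s(1) r
      by (simp add: quotient_simps[OF regular_left_module Jsub])
  qed
  ultimately show thesis using v(1) that by blast
qed

lemma central_annihilator_ideal:
  assumes M: "left_module R M"
  shows "ideal (central_annihilator R M) (centre R)"
proof -
  interpret M: left_module R M by (rule M)
  interpret Z: cring "centre R" by (rule centre_cring)
  have mult: "x \<otimes>\<^bsub>centre R\<^esub> a \<in> central_annihilator R M"
    if "a \<in> central_annihilator R M" "x \<in> carrier (centre R)" for a x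
    using that Z.m_closed[of x a] by (auto simp: central_annihilator_def M.smult_assoc)
  show ?thesis
  proof (rule idealI)
    show "ring (centre R)" by (rule Z.ring_axioms)
    show "subgroup (central_annihilator R M) (add_monoid (centre R))"
    proof (rule Z.add.subgroupI)
      show "central_annihilator R M \<subseteq> carrier (centre R)" by (auto simp: central_annihilator_def)
      have "\<zero>\<^bsub>centre R\<^esub> \<in> central_annihilator R M" using Z.zero_closed by (simp add: central_annihilator_def)
      then show "central_annihilator R M \<noteq> {}" by blast
      fix a b assume a: "a \<in> central_annihilator R M"
      then have aZ: "a \<in> carrier (centre R)" by (simp add: central_annihilator_def)
      show "\<ominus>\<^bsub>centre R\<^esub> a \<in> central_annihilator R M"
        using mult[OF a, of "\<ominus>\<^bsub>centre R\<^esub> \<one>\<^bsub>centre R\<^esub>"] aZ by (simp del: centre_simps add: Z.l_minus)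
      assume "b \<in> central_annihilator R M"
      then show "a \<oplus>\<^bsub>centre R\<^esub> b \<in> central_annihilator R M"
        using a Z.a_closed[of a b] by (auto simp: central_annihilator_def M.smult_l_distr)
    qed
    show "x \<otimes>\<^bsub>centre R\<^esub> a \<in> central_annihilator R M"
      if "a \<in> central_annihilator R M" "x \<in> carrier (centre R)" for a x using mult that .
    show "a \<otimes>\<^bsub>centre R\<^esub> x \<in> central_annihilator R M"
      if "a \<in> central_annihilator R M" "x \<in> carrier (centre R)" for a x
      using mult[OF that] Z.m_comm[of a x] that by (simp add: central_annihilator_def)
  qed
qed

lemma span_list_annihilates:
  assumes M: "left_module R M"
  shows "\<lbrakk>set xs \<subseteq> central_annihilator R M; j \<in> span_list R xs; m \<in> carrier M\<rbrakk> \<Longrightarrow> j \<odot>\<^bsub>M\<^esub> m = \<zero>\<^bsub>M\<^esub>"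
proof (induction xs arbitrary: j m rule: rev_induct)
  interpret M: left_module R M by (rule M)
  case Nil
  then show ?case by (simp add: span_list_Nil)
next
  interpret M: left_module R M by (rule M)
  case (snoc y xs)
  have Z: "set xs \<subseteq> carrier (centre R)" "y \<in> carrier (centre R)" "set xs \<subseteq> central_annihilator R M"
    "\<And>m. m \<in> carrier M \<Longrightarrow> y \<odot>\<^bsub>M\<^esub> m = \<zero>\<^bsub>M\<^esub>"
    using snoc.prems(1) by (auto simp: central_annihilator_def)
  then have R: "set xs \<subseteq> carrier R" "y \<in> carrier R" by auto
  obtain i c where ic: "i \<in> span_list R xs" "c \<in> carrier R" "j = i \<oplus> y \<otimes> c"
    using snoc.prems(2) unfolding span_list_snoc[OF R] set_add_def' by blast
  have iR: "i \<in> carrier R" using ideal.Icarr[OF span_list_ideal[OF Z(1)] ic(1)] .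
  show ?case
    using snoc.IH[OF Z(3) ic(1) snoc.prems(3)] ic R iR snoc.prems(3) Z(4)
    by (simp add: M.smult_l_distr M.smult_assoc)
qed

section \<open>The grade as the length of a maximal regular sequence\<close>

definition maximal_regular_sequence_in :: "'a set \<Rightarrow> 'a list \<Rightarrow> bool" where
  "maximal_regular_sequence_in I xs \<longleftrightarrow> regular_sequence R xs \<and> set xs \<subseteq> I \<and>
     (\<forall>y\<in>I. \<not> regular_sequence R (xs @ [y]))"

lemma maximal_regular_sequence_exists:
  assumes M: "left_module R M" and nz: "x \<in> carrier M" "x \<noteq> \<zero>\<^bsub>M\<^esub>"
  obtains xs where "maximal_regular_sequence_in (central_annihilator R M) xs"
proof -
  interpret M: left_module R M by (rule M)
  have central: "central_sequence R xs" if "regular_sequence R xs" "set xs \<subseteq> central_annihilator R M" for xs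
  proof -
    have "\<one> \<notin> span_list R xs" using span_list_annihilates[OF M that(2), of \<one> x] nz by auto
    then show ?thesis using that(1) one_closed by (auto simp: central_sequence_iff)
  qed
  have "central_annihilator R M \<subseteq> carrier (centre R)" by (auto simp: central_annihilator_def)
  then obtain ys where ys: "maximal_central_sequence_in R (central_annihilator R M) ([] @ ys)"
    by (rule maximal_central_sequence_exists[OF central[OF regular_sequence_Nil], rotated 2]) auto
  then have "\<not> regular_sequence R (ys @ [y])" if "y \<in> central_annihilator R M" for y
    using that central[of "ys @ [y]"] by (auto simp: maximal_central_sequence_in_def)
  then show thesis
    using ys that by (auto simp: maximal_regular_sequence_in_def maximal_central_sequence_in_def central_sequence_iff)
qed

text \<open>Maximality makes every element of \<open>I\<close> a zero divisor modulo the
  span.\<close>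

lemma maximal_regular_sequence_colon:
  assumes I: "ideal I (centre R)" and xs: "maximal_regular_sequence_in I xs"
  obtains a where "a \<in> maximal_colons (centre R) (regular_module R) (span_list R xs)" "I \<subseteq> a"
proof -
  interpret RZ: comm_left_module "centre R" "regular_module R" by (rule regular_over_centre)
  have reg: "regular_sequence R xs" using xs by (simp add: maximal_regular_sequence_in_def)
  note J = span_submodule_centre[OF regular_sequence_centre[OF reg]]
  have noeth: "noetherian_in (centre R) (regular_module R) (carrier (regular_module R))"
    using regular_noetherian by simp
  have "\<exists>u\<in>carrier (regular_module R) - span_list R xs. z \<odot>\<^bsub>regular_module R\<^esub> u \<in> span_list R xs"
    if z: "z \<in> I" for z
  proof -
    have "\<not> regular_sequence R (xs @ [z])" using xs z by (simp add: maximal_regular_sequence_in_def)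
    then show ?thesis
      unfolding regular_sequence_snoc using reg ideal.Icarr[OF I z] by auto
  qed
  then show thesis
    using RZ.zero_divisors_in_maximal_colon[OF J noetherian_centre noeth I] that by blast
qed

lemma maximal_colonE:
  assumes xs: "regular_sequence R xs"
    and a: "a \<in> maximal_colons (centre R) (regular_module R) (span_list R xs)"
  obtains r where "r \<in> carrier R" "r \<notin> span_list R xs" "a = central_colon R (span_list R xs) r"
    "primeideal a (centre R)"
proof -
  interpret RZ: comm_left_module "centre R" "regular_module R" by (rule regular_over_centre)
  have "primeideal a (centre R)"
    by (rule RZ.maximal_colon_prime[OF span_submodule_centre[OF regular_sequence_centre[OF xs]] a])
  then show thesis using a that by (auto simp: maximal_colons_def)
qed

lemma unmixedD:
  assumes "unmixed R" "regular_sequence R xs"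
    and a: "a \<in> maximal_colons (centre R) (regular_module R) (span_list R xs)"
    and p: "primeideal p (centre R)" "set xs \<subseteq> p" "p \<subseteq> a"
  shows "p = a"
proof -
  obtain r where "r \<in> carrier R" "r \<notin> span_list R xs" "a = central_colon R (span_list R xs) r"
    "primeideal a (centre R)"
    by (rule maximal_colonE[OF assms(2) a])
  then show ?thesis using assms unfolding unmixed_def by blast
qed

lemma grade_eq_length:
  fixes M :: "('a, 'm) module"
  assumes sym: "grade_symmetric R" and fg: "fg_module R M"
    and xs: "maximal_regular_sequence_in (central_annihilator R M) xs"
  shows "grade R M = enat (length xs)"
    and "has_nonzero_map R M (cyclic_quotient R (span_list R xs))"
proof -
  have M: "left_module R M" using fg by (simp add: fg_module_def)
  have reg: "regular_sequence R xs" "set xs \<subseteq> central_annihilator R M"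
    using xs by (auto simp: maximal_regular_sequence_in_def)
  obtain a where a: "a \<in> maximal_colons (centre R) (regular_module R) (span_list R xs)"
    "central_annihilator R M \<subseteq> a"
    by (rule maximal_regular_sequence_colon[OF central_annihilator_ideal[OF M] xs])
  obtain r where r: "r \<in> carrier R" "a = central_colon R (span_list R xs) r" "primeideal a (centre R)"
    by (rule maximal_colonE[OF reg(1) a(1)]) (rule that)
  have J: "ideal (span_list R xs) R" by (rule span_list_ideal[OF regular_sequence_centre[OF reg(1)]])
  obtain \<phi> m where \<phi>m: "linear_map (centre R) M (cyclic_quotient R (span_list R xs)) \<phi>" "m \<in> carrier M"
    "\<phi> m \<noteq> \<zero>\<^bsub>cyclic_quotient R (span_list R xs)\<^esub>"
    using exists_central_linear_map[OF fg J r(1)] r(2,3) a(2) by blast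
  interpret bimodule_of_map R M "span_list R xs" \<phi>
    by (intro bimodule_of_map.intro bimodule_of_map_axioms.intro centrally_finite_ring_axioms fg J \<phi>m(1))
  show "has_nonzero_map R M (cyclic_quotient R (span_list R xs))"
    by (rule has_nonzero_map_of_grade_symmetric[OF sym reg refl \<phi>m(2,3)])
  then show "grade R M = enat (length xs)" using grade_regular_sequence(2)[OF fg reg] by simp
qed

text \<open>A maximal sequence for \<open>M\<close> annihilates \<open>N\<close> and M/N too and
  bounds both grades from below. The nonzero map on \<open>M\<close> is either nonzero on
  \<open>N\<close> or factors through M/N, so one of the bounds is attained.\<close>

lemma grade_exact:
  fixes M :: "('a, 'm) module"
  assumes sym: "grade_symmetric R" and fg: "fg_module R M" and N: "submodule N R M"
  shows "grade R M = min (grade R (M\<lparr>carrier := N\<rparr>)) (grade R (quotient_module M N))"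
proof -
  have M: "left_module R M" using fg by (simp add: fg_module_def)
  interpret M: left_module R M by (rule M)
  note fgN = fg_submodule[OF fg N] and fgQ = fg_quotient[OF fg N]
  show ?thesis
  proof (cases "carrier M = {\<zero>\<^bsub>M\<^esub>}")
    case True
    have "carrier (quotient_module M N) = {\<zero>\<^bsub>quotient_module M N\<^esub>}"
      using coset_eq_zero_iff[OF M N, of "\<zero>\<^bsub>M\<^esub>"] M.submoduleD(2)[OF N]
      by (simp add: quotient_simps[OF M N] True)
    moreover have "N = {\<zero>\<^bsub>M\<^esub>}" using M.submoduleD(1,2)[OF N] True by blast
    ultimately show ?thesis
      using grade_zero_module[OF fg True] grade_zero_module[OF fgN] grade_zero_module[OF fgQ] by simp
  next
    case False
    then obtain x where x: "x \<in> carrier M" "x \<noteq> \<zero>\<^bsub>M\<^esub>" using nonzero_module_iff[OF M] by blast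
    obtain xs where xs: "maximal_regular_sequence_in (central_annihilator R M) xs"
      by (rule maximal_regular_sequence_exists[OF M x])
    then have reg: "regular_sequence R xs" "set xs \<subseteq> central_annihilator R M"
      by (auto simp: maximal_regular_sequence_in_def)
    have annN: "set xs \<subseteq> central_annihilator R (M\<lparr>carrier := N\<rparr>)"
      using reg(2) M.submoduleD(7)[OF N] by (auto simp: central_annihilator_def)
    have annQ: "set xs \<subseteq> central_annihilator R (quotient_module M N)"
    proof
      fix z assume "z \<in> set xs"
      then have z: "z \<in> carrier (centre R)" "\<And>m. m \<in> carrier M \<Longrightarrow> z \<odot>\<^bsub>M\<^esub> m = \<zero>\<^bsub>M\<^esub>"
        using reg(2) by (auto simp: central_annihilator_def)
      then show "z \<in> central_annihilator R (quotient_module M N)"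
        using M.submoduleD(1,2)[OF N]
        by (auto simp: central_annihilator_def quotient_simps[OF M N] quotient_smult[OF M N] coset_eq_zero_iff[OF M N])
    qed
    note gN = grade_regular_sequence[OF fgN reg(1) annN] and gQ = grade_regular_sequence[OF fgQ reg(1) annQ]
    have Q: "left_module R (cyclic_quotient R (span_list R xs))"
      by (rule quotient_left_module[OF regular_left_module span_list_submodule[OF regular_sequence_centre[OF reg(1)]]])
    obtain h y where h: "linear_map R M (cyclic_quotient R (span_list R xs)) h" "y \<in> carrier M"
      "h y \<noteq> \<zero>\<^bsub>cyclic_quotient R (span_list R xs)\<^esub>"
      using grade_eq_length(2)[OF sym fg xs] by (auto simp: has_nonzero_map_def)
    have "grade R (M\<lparr>carrier := N\<rparr>) = enat (length xs) \<or> grade R (quotient_module M N) = enat (length xs)"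
    proof (cases "\<exists>x\<in>N. h x \<noteq> \<zero>\<^bsub>cyclic_quotient R (span_list R xs)\<^esub>")
      case True
      have "linear_map R (M\<lparr>carrier := N\<rparr>) (cyclic_quotient R (span_list R xs)) h"
        using h(1) M.submoduleD(7)[OF N] by (auto simp: linear_map_def)
      then have "has_nonzero_map R (M\<lparr>carrier := N\<rparr>) (cyclic_quotient R (span_list R xs))"
        using True by (auto simp: has_nonzero_map_def)
      then show ?thesis using gN(2) by simp
    next
      case False
      have zero: "h x = \<zero>\<^bsub>cyclic_quotient R (span_list R xs)\<^esub>" if "x \<in> N" for x
        using False that by blast
      obtain h' where h': "linear_map R (quotient_module M N) (cyclic_quotient R (span_list R xs)) h'"
        "\<And>x. x \<in> carrier M \<Longrightarrow> h' (N +>\<^bsub>M\<^esub> x) = h x"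
        using linear_map_factor[OF M Q N h(1) zero] by metis
      have "N +>\<^bsub>M\<^esub> y \<in> carrier (quotient_module M N)" using h(2) by (simp add: quotient_simps[OF M N])
      then have "has_nonzero_map R (quotient_module M N) (cyclic_quotient R (span_list R xs))"
        unfolding has_nonzero_map_def using h'(1) h'(2)[OF h(2)] h(3)
        by (intro exI[of _ h'] conjI bexI[of _ "N +>\<^bsub>M\<^esub> y"]) simp_all
      then show ?thesis using gQ(2) by simp
    qed
    then show ?thesis
      using grade_eq_length(1)[OF sym fg xs] gN(1) gQ(1) by (auto simp: min_def)
  qed
qed

subsection \<open>Torsion modules\<close>

text \<open>\<open>prime_ideal\<close> tests two-sided ideals, so from z w in \<open>P\<close> two
  of them are built: \<open>A\<close>, the elements that \<open>z\<close> takes into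
  \<open>P\<close>, contains \<open>w\<close>; \<open>B\<close>, the elements that take
  \<open>A\<close> into \<open>P\<close> from the right, contains \<open>z\<close> by
  centrality.\<close>

lemma prime_ideal_centre:
  assumes P: "prime_ideal R P"
  shows "primeideal (P \<inter> carrier (centre R)) (centre R)"
proof -
  interpret P: ideal P R using P by (simp add: prime_ideal_def)
  interpret Z: cring "centre R" by (rule centre_cring)
  have one: "\<one> \<notin> P" using P P.one_imp_carrier by (auto simp: prime_ideal_def)
  have mult: "x \<otimes>\<^bsub>centre R\<^esub> a \<in> P \<inter> carrier (centre R)"
    if "a \<in> P \<inter> carrier (centre R)" "x \<in> carrier (centre R)" for a x
    using that Z.m_closed[of x a] P.I_l_closed[of a x] by simp
  show ?thesis
  proof (intro primeidealI idealI)
    show "ring (centre R)" "cring (centre R)" by (rule Z.ring_axioms, rule Z.cring_axioms)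
    show "subgroup (P \<inter> carrier (centre R)) (add_monoid (centre R))"
    proof (rule Z.add.subgroupI)
      have "\<zero>\<^bsub>centre R\<^esub> \<in> P \<inter> carrier (centre R)"
        using additive_subgroup.zero_closed[OF P.is_additive_subgroup] Z.zero_closed by simp
      then show "P \<inter> carrier (centre R) \<noteq> {}" by blast
      fix a b assume a: "a \<in> P \<inter> carrier (centre R)"
      show "\<ominus>\<^bsub>centre R\<^esub> a \<in> P \<inter> carrier (centre R)"
        using mult[OF a, of "\<ominus>\<^bsub>centre R\<^esub> \<one>\<^bsub>centre R\<^esub>"] a by (simp del: centre_simps add: Z.l_minus)
      assume "b \<in> P \<inter> carrier (centre R)"
      then show "a \<oplus>\<^bsub>centre R\<^esub> b \<in> P \<inter> carrier (centre R)" using a Z.a_closed[of a b] by simp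
    qed simp
    fix a x assume "a \<in> P \<inter> carrier (centre R)" "x \<in> carrier (centre R)"
    then show "x \<otimes>\<^bsub>centre R\<^esub> a \<in> P \<inter> carrier (centre R)" "a \<otimes>\<^bsub>centre R\<^esub> x \<in> P \<inter> carrier (centre R)"
      using mult[of a x] Z.m_comm[of a x] by simp_all
  next
    show "carrier (centre R) \<noteq> P \<inter> carrier (centre R)" using one Z.one_closed by auto
    fix z w assume zw: "z \<in> carrier (centre R)" "w \<in> carrier (centre R)" "z \<otimes>\<^bsub>centre R\<^esub> w \<in> P \<inter> carrier (centre R)"
    have zwR: "z \<in> carrier R" "w \<in> carrier R" "z \<otimes> w \<in> P" using zw by simp_all
    define A where "A = {a \<in> carrier R. z \<otimes> a \<in> P}"
    define B where "B = {b \<in> carrier R. \<forall>a\<in>A. a \<otimes> b \<in> P}"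
    have A: "ideal A R"
    proof (rule idealI)
      show "ring R" by (rule ring_axioms)
      show "subgroup A (add_monoid R)"
      proof (rule add.subgroupI)
        show "A \<noteq> {}" using zwR by (auto simp: A_def)
      qed (use zwR in \<open>auto simp: A_def r_distr r_minus\<close>)
      fix a x assume a: "a \<in> A" and x: "x \<in> carrier R"
      have "z \<otimes> (x \<otimes> a) = x \<otimes> (z \<otimes> a)"
        using a x zwR centre_comm[OF zw(1) x] by (simp add: A_def flip: m_assoc)
      then show "x \<otimes> a \<in> A" using a x P.I_l_closed[of "z \<otimes> a" x] by (simp add: A_def)
      show "a \<otimes> x \<in> A" using a x P.I_r_closed[of "z \<otimes> a" x] zwR by (simp add: A_def m_assoc)
    qed
    note A_carr = ideal.Icarr[OF A] and A_r = ideal.I_r_closed[OF A]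
    have B: "ideal B R"
    proof (rule idealI)
      show "ring R" by (rule ring_axioms)
      show "subgroup B (add_monoid R)"
      proof (rule add.subgroupI)
        have "\<zero> \<in> B" using additive_subgroup.zero_closed[OF P.is_additive_subgroup] A_carr by (simp add: B_def)
        then show "B \<noteq> {}" by blast
      qed (use A_carr in \<open>auto simp: B_def r_distr r_minus\<close>)
      fix b x assume b: "b \<in> B" and x: "x \<in> carrier R"
      have "a \<otimes> (x \<otimes> b) \<in> P" if "a \<in> A" for a
        using b x A_r[OF that x] A_carr[OF that] by (simp add: B_def flip: m_assoc)
      then show "x \<otimes> b \<in> B" using b x by (simp add: B_def)
      have "a \<otimes> (b \<otimes> x) \<in> P" if "a \<in> A" for a
        using b x P.I_r_closed[of "a \<otimes> b" x] A_carr[OF that] that by (simp add: B_def flip: m_assoc)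
      then show "b \<otimes> x \<in> B" using b x by (simp add: B_def)
    qed
    have "z \<in> B"
    proof -
      have "a \<otimes> z \<in> P" if "a \<in> A" for a
      proof -
        have a: "a \<in> carrier R" "z \<otimes> a \<in> P" using that unfolding A_def by blast+
        from centre_comm[OF zw(1) a(1)] a(2) show ?thesis by (rule subst)
      qed
      then show ?thesis using zwR by (simp add: B_def)
    qed
    moreover have "w \<in> A" using zwR by (simp add: A_def)
    moreover have "A \<subseteq> P \<or> B \<subseteq> P"
      using P A B unfolding prime_ideal_def by (simp add: B_def)
    ultimately show "z \<in> P \<inter> carrier (centre R) \<or> w \<in> P \<inter> carrier (centre R)" using zw by blast
  qed
qed

text \<open>\<open>c\<close> is integral over \<open>Z(R)\<close> modulo \<open>P\<close>; an equation of minimal degree has nonzero constant term.\<close>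

lemma regular_element_central_multiple:
  assumes P: "prime_ideal R P" and c: "c \<in> carrier R" and reg: "P +>\<^bsub>R\<^esub> c \<in> regular_elements (R Quot P)"
  obtains z u where "z \<in> carrier (centre R)" "z \<notin> P" "u \<in> carrier R" "z \<ominus> u \<otimes> c \<in> P"
proof -
  interpret P: ideal P R using P by (simp add: prime_ideal_def)
  interpret Z: cring "centre R" by (rule centre_cring)
  interpret RZ: comm_left_module "centre R" "regular_module R" by (rule regular_over_centre)
  have one: "\<one> \<notin> P" using P P.one_imp_carrier by (auto simp: prime_ideal_def)
  have cancel: "x \<in> P" if x: "x \<in> carrier R" "x \<otimes> c \<in> P" for x
  proof -
    have "(P +> x) \<otimes>\<^bsub>R Quot P\<^esub> (P +> c) = \<zero>\<^bsub>R Quot P\<^esub>"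
      using P.rcoset_mult_add[OF x(1) c] coset_eq_zero_iff[OF regular_left_module P.submodule_regular, of "x \<otimes> c"] x c
      by (simp add: FactRing_def)
    moreover have "P +> x \<in> carrier (R Quot P)" using x(1) by (auto simp: FactRing_def A_RCOSETS_def')
    ultimately have "P +> x = \<zero>\<^bsub>R Quot P\<^esub>" using reg unfolding regular_elements_def by blast
    then show ?thesis
      using coset_eq_zero_iff[OF regular_left_module P.submodule_regular, of x] x(1) by (simp add: FactRing_def)
  qed
  \<comment> \<open>Horner form: \<open>N k\<close> consists of the polynomial expressions in
    \<open>c\<close> of degree less than \<open>k\<close> with central coefficients, modulo
    \<open>P\<close>. The factor \<open>n\<close> stands on the left of \<open>c\<close>, to match
    cancellation of \<open>c\<close> on the right.\<close>
  define N where "N = rec_nat P (\<lambda>_ K. {z \<oplus> n \<otimes> c \<oplus> p |z n p. z \<in> carrier (centre R) \<and> n \<in> K \<and> p \<in> P})"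
  have N0: "N 0 = P" and N_Suc: "N (Suc k) = {z \<oplus> n \<otimes> c \<oplus> p |z n p. z \<in> carrier (centre R) \<and> n \<in> N k \<and> p \<in> P}" for k
    by (simp_all add: N_def)
  have PZ: "submodule P (centre R) (regular_module R)" by (rule centre_submodule[OF P.submodule_regular])
  have P0: "\<zero> \<in> P" by (rule additive_subgroup.zero_closed[OF P.is_additive_subgroup])
  have sub: "submodule (N k) (centre R) (regular_module R)" for k
  proof (induction k)
    case 0
    then show ?case using PZ by (simp add: N0)
  next
    case (Suc k)
    note n = RZ.submoduleD[OF Suc, simplified]
    show ?case
    proof (rule RZ.submoduleI)
      show "N (Suc k) \<subseteq> carrier (regular_module R)" using n(7) c P.Icarr by (auto simp: N_Suc)
      show "\<zero>\<^bsub>regular_module R\<^esub> \<in> N (Suc k)"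
      proof -
        have "\<zero>\<^bsub>centre R\<^esub> \<oplus> \<zero> \<otimes> c \<oplus> \<zero> \<in> N (Suc k)"
          unfolding N_Suc using Z.zero_closed n(2) P0 by blast
        then show ?thesis using c by simp
      qed
      fix a b assume b: "b \<in> N (Suc k)"
      then obtain z' n' p' where b': "z' \<in> carrier (centre R)" "n' \<in> N k" "p' \<in> P" "b = z' \<oplus> n' \<otimes> c \<oplus> p'"
        unfolding N_Suc by blast
      note cl' = centre_closed[OF b'(1)] n(7)[OF b'(2)] P.Icarr[OF b'(3)]
      show "a \<oplus>\<^bsub>regular_module R\<^esub> b \<in> N (Suc k)" if a: "a \<in> N (Suc k)"
      proof -
        obtain z n1 p where a': "z \<in> carrier (centre R)" "n1 \<in> N k" "p \<in> P" "a = z \<oplus> n1 \<otimes> c \<oplus> p"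
          using a unfolding N_Suc by blast
        note cl = centre_closed[OF a'(1)] n(7)[OF a'(2)] P.Icarr[OF a'(3)]
        have "a \<oplus> b = (z \<oplus> z') \<oplus> (n1 \<oplus> n') \<otimes> c \<oplus> (p \<oplus> p')"
          using cl cl' c by (simp add: a'(4) b'(4) l_distr a_ac)
        moreover have "z \<oplus> z' \<in> carrier (centre R)" using Z.a_closed[OF a'(1) b'(1)] by simp
        moreover have "n1 \<oplus> n' \<in> N k" "p \<oplus> p' \<in> P" using n(3) a' b' by simp_all
        ultimately show ?thesis unfolding N_Suc by auto
      qed
      show "a \<odot>\<^bsub>regular_module R\<^esub> b \<in> N (Suc k)" if a: "a \<in> carrier (centre R)"
      proof -
        have "a \<otimes> b = (a \<otimes> z') \<oplus> (a \<otimes> n') \<otimes> c \<oplus> a \<otimes> p'"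
          using cl' c centre_closed[OF a] by (simp add: b'(4) r_distr m_assoc)
        moreover have "a \<otimes> z' \<in> carrier (centre R)" using Z.m_closed[OF a b'(1)] by simp
        moreover have "a \<otimes> n' \<in> N k" using n(4)[OF a b'(2)] .
        moreover have "a \<otimes> p' \<in> P" using P.I_l_closed[OF b'(3) centre_closed[OF a]] .
        ultimately show ?thesis unfolding N_Suc by auto
      qed
    qed
  qed
  have NR: "n \<in> carrier R" if "n \<in> N k" for n k using RZ.submoduleD(7)[OF sub that] by simp
  have P_N: "P \<subseteq> N k" for k
  proof (cases k)
    case (Suc j)
    have "\<zero> \<oplus> \<zero> \<otimes> c \<oplus> p \<in> N k" if "p \<in> P" for p
      using that Z.zero_closed RZ.submoduleD(2)[OF sub[of j]] unfolding Suc N_Suc by auto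
    then show ?thesis using P.Icarr c by auto
  qed (simp add: N0)
  have mono: "N k \<subseteq> N (Suc k)" for k
  proof (induction k)
    case 0
    then show ?case using P_N by (simp add: N0)
  next
    case (Suc k)
    then show ?case unfolding N_Suc[of "Suc k"] N_Suc[of k] by blast
  qed
  have pow: "c [^] k \<in> N (Suc k)" for k :: nat
  proof (induction k)
    case 0
    have "\<zero> \<in> N 0" using P0 by (simp add: N0)
    moreover have "\<one> \<in> carrier (centre R)" using Z.one_closed by simp
    ultimately have "\<one> \<oplus> \<zero> \<otimes> c \<oplus> \<zero> \<in> N (Suc 0)"
      using P0 unfolding N_Suc by blast
    then show ?case using c by simp
  next
    case (Suc j)
    have "\<zero> \<in> carrier (centre R)" using Z.zero_closed by simp
    then have "\<zero> \<oplus> c [^] j \<otimes> c \<oplus> \<zero> \<in> N (Suc (Suc j))"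
      using P0 Suc unfolding N_Suc[of "Suc j"] by blast
    then show ?case using c by simp
  qed
  obtain k where k: "\<And>i. i \<ge> k \<Longrightarrow> N i = N k"
    by (rule noetherian_inD[where N = N, OF regular_noetherian sub _ mono]) (use NR that in auto)
  \<comment> \<open>Stationarity makes \<open>c\<close> integral modulo \<open>P\<close>: a power of
    \<open>c\<close> is an expression of lower degree.\<close>
  have "c [^] k \<in> N k" using pow[of k] k[of "Suc k"] by simp
  then have "\<exists>z u. z \<in> carrier (centre R) \<and> z \<notin> P \<and> u \<in> carrier R \<and> z \<ominus> u \<otimes> c \<in> P"
  proof (induction k)
    case 0
    then show ?case using one by (simp add: N0)
  next
    case (Suc k)
    obtain z n p where z: "z \<in> carrier (centre R)" "n \<in> N k" "p \<in> P" "c [^] Suc k = z \<oplus> n \<otimes> c \<oplus> p"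
      using Suc.prems unfolding N_Suc by blast
    note cl = centre_closed[OF z(1)] NR[OF z(2)] P.Icarr[OF z(3)]
    have ck: "c [^] k \<in> carrier R" using c by simp
    have diff: "(c [^] k \<ominus> n) \<otimes> c = z \<oplus> p"
    proof -
      have "(c [^] k \<ominus> n) \<otimes> c = c [^] Suc k \<ominus> n \<otimes> c"
        using ck cl c by (simp add: minus_eq l_distr l_minus)
      also have "\<dots> = z \<oplus> p" unfolding z(4) using cl c by (simp add: diff_eq_iff a_ac)
      finally show ?thesis .
    qed
    \<comment> \<open>\<open>z\<close> is the constant term. If it lies in \<open>P\<close>,
      regularity cancels one factor \<open>c\<close> and lowers the degree; if not,
      \<open>c [^] k \<ominus> n\<close> times \<open>c\<close> is \<open>z\<close> modulo
      \<open>P\<close>.\<close>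
    show ?case
    proof (cases "z \<in> P")
      case True
      then have "c [^] k \<ominus> n \<in> P" using cancel[of "c [^] k \<ominus> n"] diff z(3) ck cl by simp
      then have "(c [^] k \<ominus> n) \<oplus> n \<in> N k" using P_N z(2) RZ.submoduleD(3)[OF sub[of k]] by auto
      moreover have "(c [^] k \<ominus> n) \<oplus> n = c [^] k" using ck cl by (simp add: minus_eq a_assoc l_neg)
      ultimately show ?thesis using Suc.IH by simp
    next
      case False
      have "z \<ominus> (c [^] k \<ominus> n) \<otimes> c = \<ominus> p"
        unfolding diff using cl by (simp add: abel_simps)
      then show ?thesis using False z(1,3) ck cl by (intro exI[of _ z] exI[of _ "c [^] k \<ominus> n"]) simp
    qed
  qed
  then show thesis using that by blast
qed

text \<open>Each generator is killed by a central element outside \<open>P\<close>; centrality lets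
  the product of these act as zero on all of \<open>M\<close>.\<close>

lemma torsion_annihilator:
  fixes M :: "('a, 'm) module"
  assumes fg: "fg_module R M" and P: "prime_ideal R P" and tors: "torsion_over_quotient R P M"
  obtains z where "z \<in> central_annihilator R M" "z \<notin> P"
proof -
  have M: "left_module R M" using fg by (simp add: fg_module_def)
  interpret M: left_module R M by (rule M)
  interpret P: ideal P R using P by (simp add: prime_ideal_def)
  interpret p: primeideal "P \<inter> carrier (centre R)" "centre R" by (rule prime_ideal_centre[OF P])
  have each: "\<exists>z\<in>carrier (centre R) - P. z \<odot>\<^bsub>M\<^esub> x = \<zero>\<^bsub>M\<^esub>" if x: "x \<in> carrier M" for x
  proof -
    obtain c where c: "c \<in> carrier R" "P +>\<^bsub>R\<^esub> c \<in> regular_elements (R Quot P)" "c \<odot>\<^bsub>M\<^esub> x = \<zero>\<^bsub>M\<^esub>"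
      using tors x unfolding torsion_over_quotient_def by blast
    obtain z u where z: "z \<in> carrier (centre R)" "z \<notin> P" "u \<in> carrier R" "z \<ominus> u \<otimes> c \<in> P"
      by (rule regular_element_central_multiple[OF P c(1,2)])
    have "(z \<ominus> u \<otimes> c) \<odot>\<^bsub>M\<^esub> x = \<zero>\<^bsub>M\<^esub>" using tors z(4) x unfolding torsion_over_quotient_def by blast
    then have "z \<odot>\<^bsub>M\<^esub> x = \<zero>\<^bsub>M\<^esub>" using z c x by (simp add: M.smult_l_diff M.smult_assoc)
    then show ?thesis using z by blast
  qed
  obtain S where S: "finite S" "S \<subseteq> carrier M" "\<And>K. submodule K R M \<and> S \<subseteq> K \<Longrightarrow> K = carrier M"
    using fg by (auto simp: finitely_generated_def fg_module_def)
  have "\<exists>z\<in>carrier (centre R) - P. \<forall>x\<in>S. z \<odot>\<^bsub>M\<^esub> x = \<zero>\<^bsub>M\<^esub>"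
    using S(1,2)
  proof (induction S rule: finite_induct)
    case empty
    then show ?case using p.prime_one p.one_closed by auto
  next
    case (insert x S)
    then obtain z where z: "z \<in> carrier (centre R)" "z \<notin> P" "\<forall>x\<in>S. z \<odot>\<^bsub>M\<^esub> x = \<zero>\<^bsub>M\<^esub>" by auto
    obtain w where w: "w \<in> carrier (centre R)" "w \<notin> P" "w \<odot>\<^bsub>M\<^esub> x = \<zero>\<^bsub>M\<^esub>" using each insert.prems by blast
    have "z \<otimes> w \<in> carrier (centre R)" using p.m_closed[OF z(1) w(1)] by simp
    moreover have "z \<otimes> w \<notin> P" using p.prime_mult_notin[OF z(1) w(1)] z w calculation by auto
    moreover have "(z \<otimes> w) \<odot>\<^bsub>M\<^esub> y = \<zero>\<^bsub>M\<^esub>" if y: "y \<in> insert x S" for y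
    proof -
      have yM: "y \<in> carrier M" using y insert.prems by auto
      show ?thesis
      proof (cases "y = x")
        case True
        then show ?thesis using z w yM by (simp add: M.smult_assoc)
      next
        case False
        then have "(w \<otimes> z) \<odot>\<^bsub>M\<^esub> y = \<zero>\<^bsub>M\<^esub>" using y z w yM by (simp add: M.smult_assoc)
        then show ?thesis using centre_comm[OF z(1), of w] w(1) by simp
      qed
    qed
    ultimately show ?case by blast
  qed
  then obtain z where z: "z \<in> carrier (centre R)" "z \<notin> P" "\<forall>x\<in>S. z \<odot>\<^bsub>M\<^esub> x = \<zero>\<^bsub>M\<^esub>" by blast
  have "linear_map R M M (\<lambda>x. z \<odot>\<^bsub>M\<^esub> x)"
    by (rule linear_map_smult_fun[OF M M, of "\<lambda>x. x"]) (use z(1) centre_comm in \<open>auto intro: linear_mapI\<close>)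
  from submodule_kernel[OF M M this] have "{x \<in> carrier M. z \<odot>\<^bsub>M\<^esub> x = \<zero>\<^bsub>M\<^esub>} = carrier M"
    using z(3) S(2) by (intro S(3)) auto
  then have "z \<in> central_annihilator R M" using z(1) by (auto simp: central_annihilator_def)
  then show thesis using z(2) that by blast
qed

lemma grade_torsion:
  fixes M :: "('a, 'm) module"
  assumes sym: "grade_symmetric R" and unm: "unmixed R"
    and fg: "fg_module R M" and P: "prime_ideal R P" and tors: "torsion_over_quotient R P M"
  obtains g where "grade R (cyclic_quotient R P) = enat g" "enat (Suc g) \<le> grade R M"
proof -
  have M: "left_module R M" using fg by (simp add: fg_module_def)
  interpret M: left_module R M by (rule M)
  interpret P: ideal P R using P by (simp add: prime_ideal_def)
  let ?p = "P \<inter> carrier (centre R)"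
  interpret p: primeideal ?p "centre R" by (rule prime_ideal_centre[OF P])
  have one: "\<one> \<notin> P" using P P.one_imp_carrier by (auto simp: prime_ideal_def)
  note sub = P.submodule_regular
  note qs = quotient_simps[OF regular_left_module sub] and qm = quotient_smult[OF regular_left_module sub]
  have fgP: "fg_module R (cyclic_quotient R P)" by (rule fg_quotient[OF fg_regular sub])
  have annP: "central_annihilator R (cyclic_quotient R P) = ?p"
  proof (intro equalityI subsetI)
    fix z assume "z \<in> central_annihilator R (cyclic_quotient R P)"
    then have z: "z \<in> carrier (centre R)" "z \<odot>\<^bsub>cyclic_quotient R P\<^esub> (P +> \<one>) = P"
      by (auto simp: central_annihilator_def qs)
    then show "z \<in> ?p"
      using qm[of z \<one>] coset_eq_zero_iff[OF regular_left_module sub, of z] by simp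
  next
    fix z assume z: "z \<in> ?p"
    have "z \<otimes> x \<in> P" if "x \<in> carrier R" for x using P.I_r_closed[of z x] z that by simp
    then show "z \<in> central_annihilator R (cyclic_quotient R P)"
      using z qm[of z] coset_eq_zero_iff[OF regular_left_module sub] by (auto simp: central_annihilator_def qs)
  qed
  have nz: "P +> \<one> \<in> carrier (cyclic_quotient R P)" "P +> \<one> \<noteq> \<zero>\<^bsub>cyclic_quotient R P\<^esub>"
    using one coset_eq_zero_iff[OF regular_left_module sub, of \<one>] by (auto simp: qs)
  obtain xs where xs: "maximal_regular_sequence_in (central_annihilator R (cyclic_quotient R P)) xs"
    by (rule maximal_regular_sequence_exists[OF quotient_left_module[OF regular_left_module sub] nz])
  then have reg: "regular_sequence R xs" "set xs \<subseteq> ?p"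
    by (auto simp: maximal_regular_sequence_in_def annP)
  have "?p \<subseteq> central_annihilator R M"
    using tors by (auto simp: central_annihilator_def torsion_over_quotient_def)
  then have ann: "set xs \<subseteq> central_annihilator R M" using reg(2) by blast
  obtain z where z: "z \<in> central_annihilator R M" "z \<notin> P" by (rule torsion_annihilator[OF fg P tors])
  \<comment> \<open>If \<open>xs\<close> were already maximal in the annihilator of
    \<open>M\<close>, this annihilator would lie in an associated prime of the quotient, which
    unmixedness identifies with the contraction of \<open>P\<close>; but \<open>z\<close> is
    outside.\<close>
  have "\<exists>y\<in>central_annihilator R M. regular_sequence R (xs @ [y])"
  proof (rule ccontr)
    assume "\<not> ?thesis"
    then have "maximal_regular_sequence_in (central_annihilator R M) xs"
      using reg(1) ann by (auto simp: maximal_regular_sequence_in_def)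
    then obtain a where a: "a \<in> maximal_colons (centre R) (regular_module R) (span_list R xs)"
      "central_annihilator R M \<subseteq> a"
      by (rule maximal_regular_sequence_colon[OF central_annihilator_ideal[OF M]])
    have "?p = a"
      by (rule unmixedD[OF unm reg(1) a(1) p.primeideal reg(2)]) (use \<open>?p \<subseteq> central_annihilator R M\<close> a(2) in blast)
    then show False using z a(2) by blast
  qed
  then obtain y where "y \<in> central_annihilator R M" "regular_sequence R (xs @ [y])" by blast
  then have "enat (length (xs @ [y])) \<le> grade R M"
    using ann by (intro grade_regular_sequence(1)[OF fg]) auto
  then show thesis using grade_eq_length(1)[OF sym fgP xs] that by simp
qed

end

subsection \<open>Finite partitivity\<close>

text \<open>Says that C/D does not vanish after localization at \<open>S\<close>.\<close>

definition big_step :: "('a, 'm) module \<Rightarrow> 'a set \<Rightarrow> 'm set \<Rightarrow> 'm set \<Rightarrow> bool" where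
  "big_step M S C D \<longleftrightarrow> (\<exists>c\<in>C. \<forall>s\<in>S. s \<odot>\<^bsub>M\<^esub> c \<notin> D)"

text \<open>A finite bound on the length of the localization of B/A at \<open>S\<close>, phrased by
  counting the steps that survive. Chains need only be weakly decreasing, since intersecting with or
  adding a submodule can make terms coincide.\<close>

definition big_steps_bounded ::
    "('a, 'b) ring_scheme \<Rightarrow> ('a, 'm) module \<Rightarrow> 'a set \<Rightarrow> 'm set \<Rightarrow> 'm set \<Rightarrow> bool" where
  "big_steps_bounded R M S A B \<longleftrightarrow> (\<exists>n. \<forall>m C.
     (\<forall>i\<le>m. submodule (C i) R M \<and> A \<subseteq> C i \<and> C i \<subseteq> B) \<and> (\<forall>i<m. C (Suc i) \<subseteq> C i) \<longrightarrow>
     card {i. i < m \<and> big_step M S (C i) (C (Suc i))} \<le> n)"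

context comm_left_module
begin

text \<open>If both the trace on \<open>E\<close> and the image modulo \<open>E\<close> of C/D
  vanish locally, then s x = u + w with \<open>u\<close> in \<open>D\<close> and \<open>w\<close> in
  C \<inter> E, and a second denominator moves \<open>w\<close> into \<open>D\<close>.\<close>

lemma big_step_modular:
  assumes S: "multiplicative R S" and sub: "submodule C R M" "submodule D R M" "submodule E R M" "D \<subseteq> C"
    and big: "big_step M S C D"
  shows "big_step M S (C \<inter> E) (D \<inter> E) \<or> big_step M S (C <+>\<^bsub>M\<^esub> E) (D <+>\<^bsub>M\<^esub> E)"
proof (rule ccontr)
  assume no: "\<not> ?thesis"
  note c = submoduleD[OF sub(1)] and d = submoduleD[OF sub(2)] and e = submoduleD[OF sub(3)]
  have SR: "s \<in> carrier R" if "s \<in> S" for s using S that by (auto simp: multiplicative_def)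
  have mul: "s \<otimes> t \<in> S" if "s \<in> S" "t \<in> S" for s t using S that by (auto simp: multiplicative_def)
  have "\<exists>s\<in>S. s \<odot>\<^bsub>M\<^esub> x \<in> D" if x: "x \<in> C" for x
  proof -
    have xM: "x \<in> carrier M" using c(7)[OF x] .
    have "x \<in> C <+>\<^bsub>M\<^esub> E" using submodule_le_set_add(1)[OF sub(1,3)] x by blast
    then obtain s where s: "s \<in> S" "s \<odot>\<^bsub>M\<^esub> x \<in> D <+>\<^bsub>M\<^esub> E" using no unfolding big_step_def by blast
    obtain u w where uw: "u \<in> D" "w \<in> E" "s \<odot>\<^bsub>M\<^esub> x = u \<oplus>\<^bsub>M\<^esub> w" using s(2) unfolding set_add_def' by blast
    have uwM: "u \<in> carrier M" "w \<in> carrier M" using uw d(7) e(7) by auto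
    have "s \<odot>\<^bsub>M\<^esub> x \<ominus>\<^bsub>M\<^esub> u = w" using uw(3) uwM by (simp add: M.diff_eq_iff M.a_comm)
    moreover have "s \<odot>\<^bsub>M\<^esub> x \<in> C" "u \<in> C" using c(4)[OF SR[OF s(1)] x] uw(1) sub(4) by auto
    ultimately have "w \<in> C \<inter> E" using c(6)[of "s \<odot>\<^bsub>M\<^esub> x" u] uw(2) by simp
    then obtain t where t: "t \<in> S" "t \<odot>\<^bsub>M\<^esub> w \<in> D" using no unfolding big_step_def by blast
    have "(t \<otimes> s) \<odot>\<^bsub>M\<^esub> x = t \<odot>\<^bsub>M\<^esub> u \<oplus>\<^bsub>M\<^esub> t \<odot>\<^bsub>M\<^esub> w"
      using SR s(1) t(1) xM uwM by (simp add: smult_assoc uw(3) smult_r_distr)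
    also have "\<dots> \<in> D" using d(3)[OF d(4)[OF SR[OF t(1)] uw(1)] t(2)] .
    finally show ?thesis using mul[OF t(1) s(1)] by blast
  qed
  then show False using big unfolding big_step_def by blast
qed

lemma big_steps_bounded_trans:
  assumes S: "multiplicative R S" and sub: "submodule E R M" "A \<subseteq> E" "E \<subseteq> B"
    and B: "submodule B R M"
    and bd: "big_steps_bounded R M S A E" "big_steps_bounded R M S E B"
  shows "big_steps_bounded R M S A B"
proof -
  obtain n1 where n1: "\<And>m C. \<lbrakk>\<forall>i\<le>m. submodule (C i) R M \<and> A \<subseteq> C i \<and> C i \<subseteq> E; \<forall>i<m. C (Suc i) \<subseteq> C i\<rbrakk> \<Longrightarrow>
      card {i. i < m \<and> big_step M S (C i) (C (Suc i))} \<le> n1"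
    using bd(1) unfolding big_steps_bounded_def by blast
  obtain n2 where n2: "\<And>m C. \<lbrakk>\<forall>i\<le>m. submodule (C i) R M \<and> E \<subseteq> C i \<and> C i \<subseteq> B; \<forall>i<m. C (Suc i) \<subseteq> C i\<rbrakk> \<Longrightarrow>
      card {i. i < m \<and> big_step M S (C i) (C (Suc i))} \<le> n2"
    using bd(2) unfolding big_steps_bounded_def by blast
  show ?thesis
    unfolding big_steps_bounded_def
  proof (intro exI[of _ "n1 + n2"] allI impI, elim conjE)
    fix m C
    assume C: "\<forall>i\<le>m. submodule (C i) R M \<and> A \<subseteq> C i \<and> C i \<subseteq> B" and dec: "\<forall>i<m. C (Suc i) \<subseteq> C i"
    let ?C1 = "\<lambda>i. C i \<inter> E" and ?C2 = "\<lambda>i. C i <+>\<^bsub>M\<^esub> E"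
    have "card {i. i < m \<and> big_step M S (?C1 i) (?C1 (Suc i))} \<le> n1"
    proof (rule n1)
      show "\<forall>i\<le>m. submodule (?C1 i) R M \<and> A \<subseteq> ?C1 i \<and> ?C1 i \<subseteq> E"
        using C sub submodule_Int by auto
      show "\<forall>i<m. ?C1 (Suc i) \<subseteq> ?C1 i" using dec by auto
    qed
    moreover have "card {i. i < m \<and> big_step M S (?C2 i) (?C2 (Suc i))} \<le> n2"
    proof (rule n2)
      have "?C2 i \<subseteq> B" if "i \<le> m" for i
        using C sub(3) that submoduleD(3)[OF B] unfolding set_add_def' by blast
      then show "\<forall>i\<le>m. submodule (?C2 i) R M \<and> E \<subseteq> ?C2 i \<and> ?C2 i \<subseteq> B"
        using C sub(1) submodule_set_add submodule_le_set_add(2) by simp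
      show "\<forall>i<m. ?C2 (Suc i) \<subseteq> ?C2 i" using dec unfolding set_add_def' by blast
    qed
    moreover have "{i. i < m \<and> big_step M S (C i) (C (Suc i))} \<subseteq>
        {i. i < m \<and> big_step M S (?C1 i) (?C1 (Suc i))} \<union> {i. i < m \<and> big_step M S (?C2 i) (?C2 (Suc i))}"
    proof
      fix i assume i: "i \<in> {i. i < m \<and> big_step M S (C i) (C (Suc i))}"
      then have "submodule (C i) R M" "submodule (C (Suc i)) R M" "C (Suc i) \<subseteq> C i" using C dec by auto
      then show "i \<in> {i. i < m \<and> big_step M S (?C1 i) (?C1 (Suc i))} \<union> {i. i < m \<and> big_step M S (?C2 i) (?C2 (Suc i))}"
        using big_step_modular[OF S _ _ sub(1), of "C i" "C (Suc i)"] i by simp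
    qed
    then have "card {i. i < m \<and> big_step M S (C i) (C (Suc i))} \<le>
        card {i. i < m \<and> big_step M S (?C1 i) (?C1 (Suc i))} + card {i. i < m \<and> big_step M S (?C2 i) (?C2 (Suc i))}"
      by (intro order.trans[OF card_mono card_Un_le]) auto
    ultimately show "card {i. i < m \<and> big_step M S (C i) (C (Suc i))} \<le> n1 + n2" by linarith
  qed
qed

text \<open>(A + R v)/A is the cyclic module with annihilator \<open>q\<close>. Localized at
  \<open>a\<close> it is zero, or the residue field if q = a, so a submodule \<open>D\<close>
  reaching beyond \<open>A\<close> contains a multiple s v with \<open>s\<close> outside
  \<open>a\<close> and leaves nothing for a big step.\<close>

lemma big_step_cyclic:
  assumes a: "primeideal a R" and A: "submodule A R M" and v: "v \<in> carrier M"
    and q: "q = module_colon R M A v" "q \<subseteq> a \<longrightarrow> q = a"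
    and D: "submodule D R M" "A \<subseteq> D" and C: "C \<subseteq> A <+>\<^bsub>M\<^esub> (\<lambda>z. z \<odot>\<^bsub>M\<^esub> v) ` carrier R"
    and big: "big_step M (carrier R - a) C D"
  shows "D \<subseteq> A \<or> \<not> D \<subseteq> A <+>\<^bsub>M\<^esub> (\<lambda>z. z \<odot>\<^bsub>M\<^esub> v) ` carrier R"
proof (rule ccontr)
  assume "\<not> ?thesis"
  then obtain d where d: "d \<in> D" "d \<notin> A" "d \<in> A <+>\<^bsub>M\<^esub> (\<lambda>z. z \<odot>\<^bsub>M\<^esub> v) ` carrier R" by blast
  note aD = submoduleD[OF A] and dD = submoduleD[OF D(1)]
  have kill: "\<exists>s\<in>carrier R - a. s \<odot>\<^bsub>M\<^esub> v \<in> D"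
  proof (cases "q \<subseteq> a")
    case False
    then obtain s where "s \<in> q" "s \<notin> a" by blast
    then show ?thesis using D(2) unfolding q(1) module_colon_def by blast
  next
    case True
    obtain k z where kz: "k \<in> A" "z \<in> carrier R" "d = k \<oplus>\<^bsub>M\<^esub> z \<odot>\<^bsub>M\<^esub> v" using d(3) unfolding set_add_def' by blast
    have kM: "k \<in> carrier M" using aD(7)[OF kz(1)] .
    have "z \<odot>\<^bsub>M\<^esub> v \<notin> A" using d(2) kz aD(3) by blast
    then have "z \<notin> a" using True q kz(2) by (auto simp: module_colon_def)
    have "d \<ominus>\<^bsub>M\<^esub> k = z \<odot>\<^bsub>M\<^esub> v" using kz kM v by (simp add: M.diff_eq_iff M.a_comm)
    then have "z \<odot>\<^bsub>M\<^esub> v \<in> D" using dD(6)[OF d(1), of k] kz(1) D(2) by auto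
    then show ?thesis using \<open>z \<notin> a\<close> kz(2) by blast
  qed
  then obtain s where s: "s \<in> carrier R" "s \<notin> a" "s \<odot>\<^bsub>M\<^esub> v \<in> D" by blast
  obtain c where c: "c \<in> C" "\<And>s. \<lbrakk>s \<in> carrier R; s \<notin> a\<rbrakk> \<Longrightarrow> s \<odot>\<^bsub>M\<^esub> c \<notin> D"
    using big unfolding big_step_def by blast
  obtain k z where kz: "k \<in> A" "z \<in> carrier R" "c = k \<oplus>\<^bsub>M\<^esub> z \<odot>\<^bsub>M\<^esub> v" using c(1) C unfolding set_add_def' by blast
  have kM: "k \<in> carrier M" using aD(7)[OF kz(1)] .
  have "s \<odot>\<^bsub>M\<^esub> c = s \<odot>\<^bsub>M\<^esub> k \<oplus>\<^bsub>M\<^esub> z \<odot>\<^bsub>M\<^esub> (s \<odot>\<^bsub>M\<^esub> v)"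
    using s(1) kz(2,3) kM v m_comm[of s z] by (simp add: smult_r_distr flip: smult_assoc)
  also have "\<dots> \<in> D" using dD(3)[OF _ dD(4)[OF kz(2) s(3)]] aD(4)[OF s(1) kz(1)] D(2) by blast
  finally show False using c(2)[OF s(1,2)] by blast
qed

text \<open>The bound 1 is the length of a residue field: after a big step the chain lies inside
  \<open>A\<close>, its lower end.\<close>

lemma big_steps_bounded_cyclic:
  assumes a: "primeideal a R" and A: "submodule A R M" and v: "v \<in> carrier M"
    and q: "q = module_colon R M A v" "q \<subseteq> a \<longrightarrow> q = a"
  shows "big_steps_bounded R M (carrier R - a) A (A <+>\<^bsub>M\<^esub> (\<lambda>z. z \<odot>\<^bsub>M\<^esub> v) ` carrier R)"
  unfolding big_steps_bounded_def
proof (intro exI[of _ 1] allI impI, elim conjE)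
  interpret a: primeideal a R by (rule a)
  let ?E = "A <+>\<^bsub>M\<^esub> (\<lambda>z. z \<odot>\<^bsub>M\<^esub> v) ` carrier R" and ?S = "carrier R - a"
  fix m C
  assume C: "\<forall>i\<le>m. submodule (C i) R M \<and> A \<subseteq> C i \<and> C i \<subseteq> ?E" and dec: "\<forall>i<m. C (Suc i) \<subseteq> C i"
  let ?I = "{i. i < m \<and> big_step M ?S (C i) (C (Suc i))}"
  have mono: "C j \<subseteq> C i" if "i \<le> j" "j \<le> m" for i j
    using that
  proof (induction j rule: dec_induct)
    case (step n)
    then show ?case using dec[rule_format, of n] by auto
  qed simp
  have eq: "i = j" if ij: "i \<in> ?I" "j \<in> ?I" "i \<le> j" for i j
  proof (rule ccontr)
    assume "i \<noteq> j"
    then have lt: "Suc i \<le> j" "j < m" using ij by auto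
    have "C (Suc i) \<subseteq> A"
      using big_step_cyclic[OF a A v q, of "C (Suc i)" "C i"] C ij(1) by auto
    then have Cj: "C j \<subseteq> A" using mono[of "Suc i" j] lt by auto
    have "\<one> \<odot>\<^bsub>M\<^esub> c \<in> C (Suc j)" if "c \<in> C j" for c
    proof -
      have c: "c \<in> A" using that Cj by blast
      have "A \<subseteq> C (Suc j)" using C lt(2) by (simp add: Suc_le_eq)
      then show ?thesis using c smult_one[OF submoduleD(7)[OF A c]] by auto
    qed
    moreover have "\<one> \<in> ?S" using a.prime_one by simp
    ultimately have "\<not> big_step M ?S (C j) (C (Suc j))" unfolding big_step_def by blast
    then show False using ij(2) by simp
  qed
  show "card ?I \<le> 1"
  proof (rule ccontr)
    assume "\<not> card ?I \<le> 1"
    moreover have "finite ?I" by simp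
    ultimately obtain i j where "i \<in> ?I" "j \<in> ?I" "i \<noteq> j"
      using card_le_Suc0_iff_eq[of ?I] by auto
    then show False using eq[of i j] eq[of j i] by (cases "i \<le> j") auto
  qed
qed

text \<open>Noetherian induction on the lower end \<open>A\<close>, adding one cyclic piece with
  prime annihilator \<open>q\<close> at a time. Such a \<open>q\<close> contains the annihilator of
  \<open>M\<close>, so by minimality of \<open>a\<close> it equals \<open>a\<close> or is not
  contained in it.\<close>

lemma big_steps_bounded_module:
  assumes Z: "noetherian_ring R" and noeth: "noetherian_in R M (carrier M)" and a: "primeideal a R"
    and min: "\<And>q. \<lbrakk>primeideal q R; {z \<in> carrier R. \<forall>x\<in>carrier M. z \<odot>\<^bsub>M\<^esub> x = \<zero>\<^bsub>M\<^esub>} \<subseteq> q; q \<subseteq> a\<rbrakk> \<Longrightarrow> q = a"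
  shows "big_steps_bounded R M (carrier R - a) {\<zero>\<^bsub>M\<^esub>} (carrier M)"
proof (rule ccontr)
  interpret a: primeideal a R by (rule a)
  let ?S = "carrier R - a"
  note S = a.multiplicative_complement
  assume unb: "\<not> ?thesis"
  let ?A = "{A. submodule A R M \<and> \<not> big_steps_bounded R M ?S A (carrier M)}"
  have mem: "{\<zero>\<^bsub>M\<^esub>} \<in> ?A" using unb zero_submodule by simp
  have sub: "submodule N R M \<and> N \<subseteq> carrier M" if "N \<in> ?A" for N
    using that submoduleD(1)[of N] by simp
  obtain A where A: "A \<in> ?A" "{\<zero>\<^bsub>M\<^esub>} \<subseteq> A" "\<And>N. \<lbrakk>N \<in> ?A; A \<subseteq> N\<rbrakk> \<Longrightarrow> N = A"
    by (rule noetherian_in_maximal[OF noeth mem sub]) (assumption, rule that)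
  have As: "submodule A R M" and Au: "\<not> big_steps_bounded R M ?S A (carrier M)" using A(1) by auto
  have "A \<noteq> carrier M"
  proof
    assume AM: "A = carrier M"
    have "big_steps_bounded R M ?S A (carrier M)"
      unfolding big_steps_bounded_def
    proof (intro exI[of _ 0] allI impI, elim conjE)
      fix m :: nat and C :: "nat \<Rightarrow> 'm set"
      assume C: "\<forall>i\<le>m. submodule (C i) R M \<and> A \<subseteq> C i \<and> C i \<subseteq> carrier M"
      then have "C i = carrier M" if "i \<le> m" for i using that AM by blast
      moreover have "\<not> big_step M ?S (carrier M) (carrier M)"
        using a.prime_one unfolding big_step_def by (auto intro!: bexI[of _ \<one>])
      ultimately have "{i. i < m \<and> big_step M ?S (C i) (C (Suc i))} = {}" by auto
      then show "card {i. i < m \<and> big_step M ?S (C i) (C (Suc i))} \<le> 0" by simp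
    qed
    then show False using Au by blast
  qed
  then obtain u where u: "u \<in> carrier M" "u \<notin> A" using submoduleD(1)[OF As] by blast
  obtain q where "q \<in> maximal_colons R M A" by (rule maximal_colon_exists[OF As Z u])
  then have q: "primeideal q R" and "\<exists>v. v \<in> carrier M \<and> v \<notin> A \<and> q = module_colon R M A v"
    using maximal_colon_prime[OF As] by (auto simp: maximal_colons_def)
  then obtain v where v: "v \<in> carrier M" "v \<notin> A" "q = module_colon R M A v" by blast
  let ?C = "(\<lambda>z. z \<odot>\<^bsub>M\<^esub> v) ` carrier R"
  have C: "submodule ?C R M" by (rule cyclic_submodule[OF v(1)])
  have E: "submodule (A <+>\<^bsub>M\<^esub> ?C) R M" by (rule submodule_set_add[OF As C])
  have AE: "A \<subseteq> A <+>\<^bsub>M\<^esub> ?C" by (rule submodule_le_set_add(1)[OF As C])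
  have "v \<in> ?C" using v(1) by (intro image_eqI[of _ _ \<one>]) auto
  then have "A <+>\<^bsub>M\<^esub> ?C \<noteq> A" using submodule_le_set_add(2)[OF As C] v(2) by blast
  then have "A <+>\<^bsub>M\<^esub> ?C \<notin> ?A" using A(3)[OF _ AE] by blast
  then have top: "big_steps_bounded R M ?S (A <+>\<^bsub>M\<^esub> ?C) (carrier M)" using E by blast
  have "{z \<in> carrier R. \<forall>x\<in>carrier M. z \<odot>\<^bsub>M\<^esub> x = \<zero>\<^bsub>M\<^esub>} \<subseteq> q"
    using v submoduleD(2)[OF As] by (auto simp: module_colon_def)
  then have "q \<subseteq> a \<longrightarrow> q = a" using min[OF q] by blast
  then have "big_steps_bounded R M ?S A (A <+>\<^bsub>M\<^esub> ?C)"
    by (rule big_steps_bounded_cyclic[OF a As v(1,3)])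
  then have "big_steps_bounded R M ?S A (carrier M)"
    by (rule big_steps_bounded_trans[OF S E AE submoduleD(1)[OF E] carrier_submodule _ top])
  then show False using Au by blast
qed

end

context centrally_finite_ring
begin

text \<open>A nonzero value r + J of the map has its central annihilator in some maximal colon
  \<open>a\<close>. A central element outside \<open>a\<close> that moved the preimage
  \<open>c\<close> into \<open>N'\<close> would annihilate this value.\<close>

lemma nonzero_map_big_step:
  assumes M: "left_module R M" and N: "submodule N R M" "submodule N' R M" "N' \<subseteq> N"
    and xs: "regular_sequence R xs"
    and map: "has_nonzero_map R (quotient_module (M\<lparr>carrier := N\<rparr>) N') (cyclic_quotient R (span_list R xs))"
  obtains a where "a \<in> maximal_colons (centre R) (regular_module R) (span_list R xs)"
    "big_step M (carrier (centre R) - a) N N'"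
proof -
  interpret M: left_module R M by (rule M)
  interpret RZ: comm_left_module "centre R" "regular_module R" by (rule regular_over_centre)
  let ?J = "span_list R xs" and ?MN = "M\<lparr>carrier := N\<rparr>"
  note Z = regular_sequence_centre[OF xs]
  have MN: "left_module R ?MN" by (rule M.submodule_left_module[OF N(1)])
  have N': "submodule N' R ?MN" using M.submodule_restrict[OF N(1,3)] N(2) by blast
  note J = span_list_submodule[OF Z]
  note qs = quotient_simps[OF MN N'] and js = quotient_simps[OF regular_left_module J]
  have L: "left_module R (quotient_module ?MN N')" by (rule quotient_left_module[OF MN N'])
  have Q: "left_module R (cyclic_quotient R ?J)" by (rule quotient_left_module[OF regular_left_module J])
  obtain h c where h: "linear_map R (quotient_module ?MN N') (cyclic_quotient R ?J) h" "c \<in> N"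
    "h (N' +>\<^bsub>?MN\<^esub> c) \<noteq> ?J"
    using map by (auto simp: has_nonzero_map_def qs js)
  have "h (N' +>\<^bsub>?MN\<^esub> c) \<in> carrier (cyclic_quotient R ?J)"
    by (rule linear_mapD(1)[OF h(1)]) (use h(2) in \<open>simp add: qs\<close>)
  then obtain r where r: "r \<in> carrier R" "h (N' +>\<^bsub>?MN\<^esub> c) = ?J +>\<^bsub>R\<^esub> r" by (auto simp: js)
  have rJ: "r \<notin> ?J" using h(3) r coset_eq_zero_iff[OF regular_left_module J, of r] by simp
  obtain a where a: "a \<in> maximal_colons (centre R) (regular_module R) ?J" "central_colon R ?J r \<subseteq> a"
    by (rule RZ.maximal_colon_exists[OF span_submodule_centre[OF Z] noetherian_centre, of r]) (use r(1) rJ in auto)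
  have "s \<odot>\<^bsub>M\<^esub> c \<notin> N'" if s: "s \<in> carrier (centre R) - a" for s
  proof
    assume sc: "s \<odot>\<^bsub>M\<^esub> c \<in> N'"
    have sR: "s \<in> carrier R" using s by simp
    have sN: "s \<odot>\<^bsub>M\<^esub> c \<in> N" using M.submoduleD(4)[OF N(1) sR h(2)] .
    have "s \<odot>\<^bsub>quotient_module ?MN N'\<^esub> (N' +>\<^bsub>?MN\<^esub> c) = \<zero>\<^bsub>quotient_module ?MN N'\<^esub>"
      using quotient_smult[OF MN N' sR, of c] h(2) coset_eq_zero_iff[OF MN N', of "s \<odot>\<^bsub>M\<^esub> c"] sN sc
      by (simp add: qs)
    then have "s \<odot>\<^bsub>cyclic_quotient R ?J\<^esub> (?J +>\<^bsub>R\<^esub> r) = ?J"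
      using linear_mapD(3)[OF h(1) sR, of "N' +>\<^bsub>?MN\<^esub> c"] h(2) linear_map_zero[OF L Q h(1)] r(2)
      by (simp add: qs js)
    then have "s \<otimes> r \<in> ?J"
      using quotient_smult[OF regular_left_module J sR, of r] r(1) sR
        coset_eq_zero_iff[OF regular_left_module J, of "s \<otimes> r"] by simp
    then have "s \<in> central_colon R ?J r" using s by (simp add: module_colon_def)
    then show False using a(2) s by blast
  qed
  then have "big_step M (carrier (centre R) - a) N N'" using h(2) unfolding big_step_def by blast
  then show thesis using a(1) that by blast
qed

lemma grade_partitive:
  fixes M :: "('a, 'm) module"
  assumes sym: "grade_symmetric R" and unm: "unmixed R" and fg: "fg_module R M"
  shows "\<exists>n. \<forall>m (N :: nat \<Rightarrow> 'm set).
    N 0 = carrier M \<and> (\<forall>i\<le>m. submodule (N i) R M) \<and>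
    (\<forall>i<m. N (Suc i) \<subset> N i \<and>
       grade R (quotient_module (M\<lparr>carrier := N i\<rparr>) (N (Suc i))) = grade R M) \<longrightarrow> m \<le> n"
proof (cases "carrier M = {\<zero>\<^bsub>M\<^esub>}")
  case True
  interpret M: left_module R M using fg by (simp add: fg_module_def)
  show ?thesis
  \<comment> \<open>All grades are infinite here, but a submodule contains zero, so no step can be
    strict.\<close>
  proof (intro exI[of _ 0] allI impI, elim conjE)
    fix m :: nat and N :: "nat \<Rightarrow> 'm set"
    assume N: "N 0 = carrier M" "\<forall>i\<le>m. submodule (N i) R M"
      "\<forall>i<m. N (Suc i) \<subset> N i \<and> grade R (quotient_module (M\<lparr>carrier := N i\<rparr>) (N (Suc i))) = grade R M"
    show "m \<le> 0"
    proof (rule ccontr)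
      assume "\<not> m \<le> 0"
      then have "N (Suc 0) \<subset> {\<zero>\<^bsub>M\<^esub>}" "submodule (N (Suc 0)) R M" using N True by auto
      then show False using M.submoduleD(2)[of "N (Suc 0)"] by blast
    qed
  qed
next
  case False
  have M: "left_module R M" using fg by (simp add: fg_module_def)
  interpret M: left_module R M by (rule M)
  interpret MZ: comm_left_module "centre R" M by (rule centre_comm_left_module[OF M])
  interpret RZ: comm_left_module "centre R" "regular_module R" by (rule regular_over_centre)
  obtain x where x: "x \<in> carrier M" "x \<noteq> \<zero>\<^bsub>M\<^esub>" using False nonzero_module_iff[OF M] by blast
  obtain xs where xs: "maximal_regular_sequence_in (central_annihilator R M) xs"
    by (rule maximal_regular_sequence_exists[OF M x])
  then have reg: "regular_sequence R xs" "set xs \<subseteq> central_annihilator R M"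
    by (auto simp: maximal_regular_sequence_in_def)
  have g: "grade R M = enat (length xs)" by (rule grade_eq_length(1)[OF sym fg xs])
  define \<A> where "\<A> = maximal_colons (centre R) (regular_module R) (span_list R xs)"
  have fin: "finite \<A>"
    unfolding \<A>_def
    by (rule RZ.finite_maximal_colons[OF span_submodule_centre[OF regular_sequence_centre[OF reg(1)]]])
       (use regular_noetherian in simp)
  \<comment> \<open>A prime of the centre between the annihilator of \<open>M\<close> and
    \<open>a\<close> contains \<open>xs\<close>, so unmixedness makes \<open>a\<close> minimal over
    the annihilator and the local length of \<open>M\<close> at \<open>a\<close> finite.\<close>
  have "big_steps_bounded (centre R) M (carrier (centre R) - a) {\<zero>\<^bsub>M\<^esub>} (carrier M)" if a: "a \<in> \<A>" for a
  proof (rule MZ.big_steps_bounded_module[OF noetherian_centre fg_noetherian_over_centre[OF fg]])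
    have a': "a \<in> maximal_colons (centre R) (regular_module R) (span_list R xs)" using a by (simp add: \<A>_def)
    show "primeideal a (centre R)" using maximal_colonE[OF reg(1) a'] by blast
    fix q assume q: "primeideal q (centre R)"
      "{z \<in> carrier (centre R). \<forall>x\<in>carrier M. z \<odot>\<^bsub>M\<^esub> x = \<zero>\<^bsub>M\<^esub>} \<subseteq> q" "q \<subseteq> a"
    then have "set xs \<subseteq> q" using reg(2) unfolding central_annihilator_def by blast
    then show "q = a" by (rule unmixedD[OF unm reg(1) a' q(1) _ q(3)])
  qed
  then have "\<forall>a\<in>\<A>. \<exists>n. \<forall>m C. (\<forall>i\<le>m. submodule (C i) (centre R) M \<and> {\<zero>\<^bsub>M\<^esub>} \<subseteq> C i \<and> C i \<subseteq> carrier M) \<and>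
      (\<forall>i<m. C (Suc i) \<subseteq> C i) \<longrightarrow> card {i. i < m \<and> big_step M (carrier (centre R) - a) (C i) (C (Suc i))} \<le> n"
    unfolding big_steps_bounded_def by blast
  from bchoice[OF this] obtain n where n': "\<forall>a\<in>\<A>. \<forall>m C.
      (\<forall>i\<le>m. submodule (C i) (centre R) M \<and> {\<zero>\<^bsub>M\<^esub>} \<subseteq> C i \<and> C i \<subseteq> carrier M) \<and>
      (\<forall>i<m. C (Suc i) \<subseteq> C i) \<longrightarrow> card {i. i < m \<and> big_step M (carrier (centre R) - a) (C i) (C (Suc i))} \<le> n a" ..
  have n: "card {i. i < m \<and> big_step M (carrier (centre R) - a) (C i) (C (Suc i))} \<le> n a"
    if "a \<in> \<A>" "\<forall>i\<le>m. submodule (C i) (centre R) M \<and> {\<zero>\<^bsub>M\<^esub>} \<subseteq> C i \<and> C i \<subseteq> carrier M" "\<forall>i<m. C (Suc i) \<subseteq> C i"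
    for a m C
    by (rule mp[OF spec[OF spec[OF bspec[OF n' that(1)]]] conjI[OF that(2,3)]])
  show ?thesis
  \<comment> \<open>Each step of the chain is big at one or more of the finitely many primes, so the
    local bounds add up to a global one.\<close>
  proof (intro exI[of _ "\<Sum>a\<in>\<A>. n a"] allI impI, elim conjE)
    fix m :: nat and N :: "nat \<Rightarrow> 'm set"
    assume N: "N 0 = carrier M" "\<forall>i\<le>m. submodule (N i) R M"
      "\<forall>i<m. N (Suc i) \<subset> N i \<and> grade R (quotient_module (M\<lparr>carrier := N i\<rparr>) (N (Suc i))) = grade R M"
    let ?I = "\<lambda>a. {i. i < m \<and> big_step M (carrier (centre R) - a) (N i) (N (Suc i))}"
    have "\<exists>a\<in>\<A>. i \<in> ?I a" if i: "i < m" for i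
    proof -
      have Ni: "submodule (N i) R M" "submodule (N (Suc i)) R M" "N (Suc i) \<subseteq> N i" using N i by auto
      note fgi = fg_submodule[OF fg Ni(1)]
      have sub: "submodule (N (Suc i)) R (M\<lparr>carrier := N i\<rparr>)"
        using M.submodule_restrict[OF Ni(1,3)] Ni(2) by blast
      have MN: "left_module R (M\<lparr>carrier := N i\<rparr>)" using fgi by (simp add: fg_module_def)
      let ?L = "quotient_module (M\<lparr>carrier := N i\<rparr>) (N (Suc i))"
      have fgL: "fg_module R ?L" by (rule fg_quotient[OF fgi sub])
      have "set xs \<subseteq> central_annihilator R ?L"
      proof
        fix z assume "z \<in> set xs"
        then have z: "z \<in> carrier (centre R)" "\<And>m. m \<in> carrier M \<Longrightarrow> z \<odot>\<^bsub>M\<^esub> m = \<zero>\<^bsub>M\<^esub>"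
          using reg(2) by (auto simp: central_annihilator_def)
        then show "z \<in> central_annihilator R ?L"
          using M.submoduleD(7)[OF Ni(1)] M.submoduleD(2)[OF Ni(2)] M.submoduleD(2)[OF Ni(1)]
          by (auto simp: central_annihilator_def quotient_simps[OF MN sub] quotient_smult[OF MN sub]
              coset_eq_zero_iff[OF MN sub])
      qed
      then have "has_nonzero_map R ?L (cyclic_quotient R (span_list R xs))"
        using grade_regular_sequence(2)[OF fgL reg(1)] N(3) i g by simp
      then obtain a where "a \<in> \<A>" "big_step M (carrier (centre R) - a) (N i) (N (Suc i))"
        unfolding \<A>_def by (rule nonzero_map_big_step[OF M Ni reg(1)])
      then show ?thesis using i by blast
    qed
    then have "{..<m} \<subseteq> (\<Union>a\<in>\<A>. ?I a)" by blast
    then have "card {..<m} \<le> card (\<Union>a\<in>\<A>. ?I a)" by (intro card_mono finite_UN_I fin) auto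
    also have "\<dots> \<le> (\<Sum>a\<in>\<A>. card (?I a))" by (rule card_UN_le[OF fin])
    also have "\<dots> \<le> (\<Sum>a\<in>\<A>. n a)"
    proof (rule sum_mono)
      fix a assume a: "a \<in> \<A>"
      show "card (?I a) \<le> n a"
      proof (rule n[OF a])
        show "\<forall>i\<le>m. submodule (N i) (centre R) M \<and> {\<zero>\<^bsub>M\<^esub>} \<subseteq> N i \<and> N i \<subseteq> carrier M"
          using N(2) centre_submodule M.submoduleD(1,2) by blast
        show "\<forall>i<m. N (Suc i) \<subseteq> N i" using N(3) by auto
      qed
    qed
    finally show "m \<le> (\<Sum>a\<in>\<A>. n a)" by simp
  qed
qed

section \<open>Translation from grades to the dimension function t - j\<close>

lemma cograde_exact_dimension_function:
  assumes sym: "grade_symmetric R" and unm: "unmixed R"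
  shows "exact_dimension_function R (cograde t R :: ('a, 'm) module \<Rightarrow> ereal) (cograde t R) (cograde t R)"
  unfolding exact_dimension_function_def
proof (intro conjI allI impI; elim conjE)
  fix M :: "('a, 'm) module"
  assume fg: "fg_module R M"
  show "cograde t R M = -\<infinity>" if "carrier M = {\<zero>\<^bsub>M\<^esub>}"
    using grade_zero_module[OF fg that] by (simp add: cograde_def)
  show "cograde t R M = max (cograde t R (M\<lparr>carrier := N\<rparr>)) (cograde t R (quotient_module M N))"
    if N: "submodule N R M" for N
    unfolding cograde_def grade_exact[OF sym fg N] min_def max_def
    by (cases "grade R (M\<lparr>carrier := N\<rparr>)"; cases "grade R (quotient_module M N)") auto
  show "cograde t R M \<le> cograde t R (cyclic_quotient R P) - 1"
    if P: "prime_ideal R P" "torsion_over_quotient R P M" for P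
  proof -
    obtain g where g: "grade R (cyclic_quotient R P) = enat g" "enat (Suc g) \<le> grade R M"
      by (rule grade_torsion[OF sym unm fg P])
    then show ?thesis by (cases "grade R M") (auto simp: cograde_def one_ereal_def)
  qed
qed

lemma cograde_finitely_partitive:
  assumes sym: "grade_symmetric R" and unm: "unmixed R"
  shows "finitely_partitive R (cograde t R :: ('a, 'm) module \<Rightarrow> ereal) (cograde t R)"
proof -
  have eq: "cograde t R L = cograde t R M \<longleftrightarrow> grade R L = grade R M"
    for L :: "('a, 'x) module" and M :: "('a, 'y) module"
    by (cases "grade R L"; cases "grade R M") (auto simp: cograde_def)
  show ?thesis
    unfolding finitely_partitive_def eq using grade_partitive[OF sym unm] by blast
qed

end

theorem corollary4p12:
  fixes R :: "('a, 'b) ring_scheme" and t :: nat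
  assumes "ring R"
    and "noetherian_ring (centre R)"
    and "finitely_generated (centre R) (regular_module R)"
    and "grade_symmetric R"
    and "centrally_Macaulay R"
    and "Kdim R = ereal (real t)"
  shows "exact_dimension_function R
           (cograde t R :: ('a, 'm) module \<Rightarrow> ereal) (cograde t R) (cograde t R)
    \<and> finitely_partitive R
           (cograde t R :: ('a, 'm) module \<Rightarrow> ereal) (cograde t R)
    \<and> exact_dimension_function (opposite R)
           (cograde t (opposite R) :: ('a, 'm) module \<Rightarrow> ereal)
           (cograde t (opposite R)) (cograde t (opposite R))
    \<and> finitely_partitive (opposite R)
           (cograde t (opposite R) :: ('a, 'm) module \<Rightarrow> ereal) (cograde t (opposite R))"
proof -
  interpret R: ring R by fact
  \<comment> \<open>Over the zero ring \<open>Kdim\<close> would be -\<infinity>, which is not a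
    natural number.\<close>
  have "\<one>\<^bsub>R\<^esub> \<noteq> \<zero>\<^bsub>R\<^esub>"
  proof
    assume "\<one>\<^bsub>R\<^esub> = \<zero>\<^bsub>R\<^esub>"
    then have "carrier R = {\<zero>\<^bsub>R\<^esub>}" by (rule R.one_zeroD)
    then show False using assms(6) by (simp add: Kdim_def Kdim_module_def)
  qed
  then interpret centrally_finite_ring R
    using assms(1-3) by (intro centrally_finite_ring.intro centrally_finite_ring_axioms.intro)
  \<comment> \<open>Right modules over \<open>R\<close> are left modules over the opposite ring, and
    the properties used pass to it.\<close>
  interpret op: centrally_finite_ring "opposite R" by (rule opposite_centrally_finite)
  have unm: "unmixed R" by (rule centrally_Macaulay_unmixed[OF assms(5)])
  note sym' = grade_symmetric_opposite[OF assms(4)] and unm' = unmixed_opposite[OF unm]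
  show ?thesis
    using cograde_exact_dimension_function[OF assms(4) unm] cograde_finitely_partitive[OF assms(4) unm]
      op.cograde_exact_dimension_function[OF sym' unm'] op.cograde_finitely_partitive[OF sym' unm']
    by blast
qed

end
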